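(* With the setting and notation of the context, the variation of the total cocycle $\Omega[f]=2\pi\sqrt{-1}(\omega_i,\theta_{ij},-\Theta_{ijk},-m_{ijkl})$ under a vertical variation of $f$ (with $h$ fixed) is given, up to a total coboundary in the Deligne complex, by the 2-form $$a_i(f,\boldsymbol\delta f)=-2\bigl(\bar\partial h_i-\mathcal D_h\mu_i\bigr)\frac{\boldsymbol\delta f_i}{\partial f_i}\,dz_i\wedge d\bar z_i ,$$ which is a well-defined global 2-form $a(f,\boldsymbol\delta f)$ on $X$; that is, $\boldsymbol\delta\Omega=2\pi\sqrt{-1}\,(a_i,0,0,0)+D(\cdot)$. The variation of the action functional $S[f]$ is $$\boldsymbol\delta S[f]=2\pi\sqrt{-1}\int_X a(f,\boldsymbol\delta f),$$ giving the Euler–Lagrange equation $$\mathcal D_h\mu-\bar\partial h=0 .$$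
   Context: Notation: $\mathbb Z(p)=(2\pi i)^p\mathbb Z$; $A^p_X$ is the sheaf of smooth complex $p$-forms on $X$. Smooth Deligne complex: $\mathbb Z(3)^\bullet_{\mathcal D}:\ \mathbb Z(3)_X\hookrightarrow A^0_X\xrightarrow{d}A^1_X\xrightarrow{d}A^2_X$, with $\mathbb Z(3)_X$ in degree $0$ and $A^r_X$ in degree $r+1$, zero after degree $3$. Double complex $\mathcal C^{p,q}=\check C^q(\mathcal U_X,\mathbb Z(3)^p_{\mathcal D})$ with total differential $D=d+(-1)^p\check\delta$. Setting: $X$ is a compact Riemann surface of genus $g>1$; $f:X\to\tilde X$ is an orientation-preserving diffeomorphism onto a Riemann surface $\tilde X$. $\mathcal U_X=\{U_i\}_{i\in I}$ ($I$ totally ordered) is a good open cover of $X$ (all nonempty finite intersections are contractible), with holomorphic coordinates $z_i:U_i\to\mathbb C$ and transition functions $z_i=z_{ij}\circ z_j$. $V_i=f(U_i)$ are the sets of the corresponding good cover of $\tilde X$, with holomorphic coordinates $w_i$ and $w_i=w_{ij}\circ w_j$. Put $f_i=w_i\circ f\circ z_i^{-1}$, so $f_i\circ z_{ij}=w_{ij}\circ f_j$; $\partial=\partial/\partial z_i$, $\bar\partial=\partial/\partial\bar z_i$; $\mu_i=\bar\partial f_i/\partial f_i$. Čech convention: the component $\phi_{i_0\dots i_{q-1}}$ of a cochain is expressed in the coordinate $z_{i_{q-1}}$ of the last index, and $\check\delta\phi_{i_0\dots i_q}=\sum_{k=0}^{q-1}(-1)^k\phi_{i_0\dots\hat{i_k}\dots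 i_q}+(-1)^q (z_{i_{q-1}i_q})^*\phi_{i_0\dots i_{q-1}}$. On multiple intersections functions are evaluated in the last coordinate; $\log w'_{jk}$ stands for $\log w'_{jk}\circ f_k$. Smooth projective connection: $h=\{h_i\}$, smooth functions with $h_j-h_i\circ z_{ij}(z'_{ij})^2=\{z_i,z_j\}$, where $\{z_i,z_j\}=\frac{z_{ij}'''}{z_{ij}'}-\frac32\bigl(\frac{z_{ij}''}{z_{ij}'}\bigr)^2$. The operator $\mathcal D_h=\partial^3+2h\,\partial+\partial h$ maps tensors of weight $(-1,l)$ to tensors of weight $(2,l)$. Logarithms: fix branches of $\log z'_{ij}$, $\log w'_{ij}$, $\log\partial f_i$ and set $c_{ijk}=(\check\delta\log z'_{\cdot\cdot})_{ijk}$, $\tilde c_{ijk}=(\check\delta\log w'_{\cdot\cdot}\circ f_\cdot)_{ijk}$, in $\mathbb Z(1)$. Trivialization of the tame symbols: fix holomorphic $1$-forms $\tau_{ij}$, holomorphic functions $\phi_{ijk}$ and $n_{ijkl}\in\mathbb Z(2)$ with $$-\log z'_{ij}\,d\log z'_{jk}=(\check\delta\tau)_{ijk}+d\phi_{ijk},\quad c_{ijk}\log z'_{kl}=-(\check\delta\phi)_{ijkl}+n_{ijkl},\quad c_{ijk}c_{klm}=(\check\delta n)_{ijklm}$$ (these exist), and a triple $(\tilde\tau_{ij},\tilde\phi_{ijk},\tilde n_{ijkl})$ satisfying the analogous relations on $\tilde X$. Lagrangian cocycle components: $$\omega_i=\frac{\partial^2 f_i}{\partial f_i}\,\partial\mu_i\,dz_i\wedge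 d\bar z_i+2\mu_i h_i\,dz_i\wedge d\bar z_i,$$ $$\theta_{ij}=2\mu_j\frac{z''_{ij}}{z'_{ij}}d\bar z_j-\bigl(\log(w'_{ij}\circ f_j)+\log z'_{ij}\bigr)d\log\partial f_j+\log(w'_{ij}\circ f_j)\,d\log z'_{ij}-f^*(\tilde\tau_{ij})+\tau_{ij},$$ $$\Theta_{ijk}=f^*(\tilde\phi_{ijk})-\phi_{ijk}-(\tilde c_{ijk}+c_{ijk})\log\partial f_k-\log z'_{ij}\log w'_{jk}+\tilde c_{ijk}\log z'_{ik},\qquad m=\check\delta\Theta\in\mathbb Z(2).$$ Fundamental class: choose smooth singular chains $\sigma_i$ ($2$-chains in $U_i$), $\sigma_{ij}$ ($1$-chains in $U_i\cap U_j$, $i\le j$), $\sigma_{ijk}$ ($0$-chains in $U_i\cap U_j\cap U_k$, $i\le j\le k$) and form $\Sigma_0=\sum_i\sigma_i\cdot\Delta_i$, $\Sigma_1=\sum\sigma_{ij}\cdot\Delta_{ij}$, $\Sigma_2=\sum\sigma_{ijk}\cdot\Delta_{ijk}$, where $\sum_i\sigma_i$ represents $[X]$ and $\partial'\Sigma_0=\partial''\Sigma_1$, $\partial'\Sigma_1=\partial''\Sigma_2$; here $\Delta_{i_0\dots i_q}$ is a symbol for $U_{i_0}\cap\dots\cap U_{i_q}$, $\partial'$ is the singular boundary, $\partial''\Delta_{i_0\dots i_q}=\sum_j(-1)^j\Delta_{i_0\dots\hat{i_j}\dots i_q}$. Action: $$S[f]=2\pi\sqrt{-1}\Bigl(\sum_i\int_{\sigma_i}\omega_i-\sum_{i\le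 j}\int_{\sigma_{ij}}\theta_{ij}+\sum_{i\le j\le k}\int_{\sigma_{ijk}}\Theta_{ijk}\Bigr)\in\mathbb C/\mathbb Z(3).$$ Variations: $\boldsymbol\delta$ denotes the differential with respect to the field $f$. A variation of $f$ has Kodaira–Spencer cocycle $\kappa_{ij}=\boldsymbol\delta w_{ij}/w'_{ij}$, satisfying $\frac{\kappa_{ij}\circ f_j}{\partial f_j}=\frac{\boldsymbol\delta f_i}{\partial f_i}\circ z_{ij}\cdot(z'_{ij})^{-1}-\frac{\boldsymbol\delta f_j}{\partial f_j}$. It is vertical if $[\kappa]=0$ in $H^1(\tilde X,\tilde\Theta)$ ($\tilde\Theta$ the holomorphic tangent sheaf), i.e. the complex structure of $\tilde X$ is not deformed (these are the vertical tangent directions of the Earle–Eells fibration of the unit ball of Beltrami differentials over Teichmüller space). One then normalizes, by redefining by a holomorphic coboundary, so that $\kappa_{ij}=0$; then $\boldsymbol\delta f_i/\partial f_i$ is a smooth $(1,0)$-vector field on $X$, $\boldsymbol\delta\mu=\bar\partial_\mu(\boldsymbol\delta f/\partial f)$ with $\bar\partial_\mu=\bar\partial-\mu\partial+\partial\mu$ on weight $(-1,0)$, and $z_{ij}$, $w_{ij}$, the logarithm branches and the trivializing cochains (on $X$ and on $\tilde X$) are held fixed. *)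

theory Defs
  imports "HOL-Analysis.Analysis" "HOL-Homology.Homology"
begin

text \<open>Only used for open \<open>S\<close>: derivatives are taken in the ambient space.\<close>

primrec Ck_on :: "nat \<Rightarrow> 'v::euclidean_space set \<Rightarrow> ('v \<Rightarrow> 'w::real_normed_vector) \<Rightarrow> bool" where
  "Ck_on 0 S f \<longleftrightarrow> continuous_on S f"
| "Ck_on (Suc k) S f \<longleftrightarrow> (\<forall>x\<in>S. f differentiable (at x)) \<and>
     (\<forall>b\<in>Basis. Ck_on k S (\<lambda>x. frechet_derivative f (at x) b))"

definition smooth_on :: "'v::euclidean_space set \<Rightarrow> ('v \<Rightarrow> 'w::real_normed_vector) \<Rightarrow> bool" where
  "smooth_on S f \<longleftrightarrow> (\<forall>k. Ck_on k S f)"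

text \<open>\<open>pd\<close> is \<open>\<partial>/\<partial>z\<close> and \<open>pdb\<close> is \<open>\<partial>/\<partial>zbar\<close>.\<close>

definition pd :: "(complex \<Rightarrow> complex) \<Rightarrow> complex \<Rightarrow> complex" where
  "pd f z = (frechet_derivative f (at z) 1 - \<i> * frechet_derivative f (at z) \<i>) / 2"

definition pdb :: "(complex \<Rightarrow> complex) \<Rightarrow> complex \<Rightarrow> complex" where
  "pdb f z = (frechet_derivative f (at z) 1 + \<i> * frechet_derivative f (at z) \<i>) / 2"

text \<open>
  Differential forms on open subsets of the complex plane are given by their coefficient functions:
  \<open>A dz + B dzbar\<close> is \<open>\<lambda>z. (A z, B z)\<close>, and \<open>C dz \<and> dzbar\<close> is \<open>C\<close>.
\<close>

type_synonym form0 = "complex \<Rightarrow> complex"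
type_synonym form1 = "complex \<Rightarrow> complex \<times> complex"
type_synonym form2 = "complex \<Rightarrow> complex"

definition d0 :: "form0 \<Rightarrow> form1" where
  "d0 f z = (pd f z, pdb f z)"

definition d1 :: "form1 \<Rightarrow> form2" where
  "d1 \<theta> z = pd (\<lambda>y. snd (\<theta> y)) z - pdb (\<lambda>y. fst (\<theta> y)) z"

definition cscale :: "complex \<Rightarrow> complex \<times> complex \<Rightarrow> complex \<times> complex" where
  "cscale c p = (c * fst p, c * snd p)"

text \<open>Pullbacks along a smooth, not necessarily holomorphic, map \<open>g\<close>.\<close>

definition pull0 :: "(complex \<Rightarrow> complex) \<Rightarrow> form0 \<Rightarrow> form0" where
  "pull0 g \<phi> z = \<phi> (g z)"

definition pull1 :: "(complex \<Rightarrow> complex) \<Rightarrow> form1 \<Rightarrow> form1" where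
  "pull1 g \<theta> z =
     (fst (\<theta> (g z)) * pd g z + snd (\<theta> (g z)) * cnj (pdb g z),
      fst (\<theta> (g z)) * pdb g z + snd (\<theta> (g z)) * cnj (pd g z))"

definition pull2 :: "(complex \<Rightarrow> complex) \<Rightarrow> form2 \<Rightarrow> form2" where
  "pull2 g \<omega> z = \<omega> (g z) * (pd g z * cnj (pd g z) - pdb g z * cnj (pdb g z))"

definition Zp :: "nat \<Rightarrow> complex set" where
  "Zp p = {(2 * of_real pi * \<i>) ^ p * of_int k | k. True}"

definition log_branch :: "complex set \<Rightarrow> (complex \<Rightarrow> complex) \<Rightarrow> (complex \<Rightarrow> complex) \<Rightarrow> bool" where
  "log_branch S g L \<longleftrightarrow> continuous_on S L \<and> (\<forall>z\<in>S. exp (L z) = g z)"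

text \<open>
  The complex structure is the one for which the coordinates \<open>coord i\<close> on the sets \<open>patch i\<close> of the
  cover form a holomorphic atlas. The record also carries the branches of the logarithms of the
  derivatives of the transition functions and the cochains trivializing the tame symbols.
  Cochains are indexed by lists of indices; the 1-form \<open>tau K\<close> is \<open>tau K dz\<close>.
\<close>

record ('a, 'i) surface =
  surf :: "'a topology"
  idx :: "'i set"
  patch :: "'i \<Rightarrow> 'a set"
  coord :: "'i \<Rightarrow> 'a \<Rightarrow> complex"
  logtr :: "'i list \<Rightarrow> complex \<Rightarrow> complex"
  tau :: "'i list \<Rightarrow> complex \<Rightarrow> complex"
  phi :: "'i list \<Rightarrow> complex \<Rightarrow> complex"
  nn :: "'i list \<Rightarrow> complex"

definition coord_inv :: "('a, 'i) surface \<Rightarrow> 'i \<Rightarrow> complex \<Rightarrow> 'a" where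
  "coord_inv X i = inv_into (patch X i) (coord X i)"

definition trans_fun :: "('a, 'i) surface \<Rightarrow> 'i \<Rightarrow> 'i \<Rightarrow> complex \<Rightarrow> complex" where
  "trans_fun X i j \<zeta> = coord X i (coord_inv X j \<zeta>)"

definition tuples :: "('a, 'i) surface \<Rightarrow> nat \<Rightarrow> 'i list set" where
  "tuples X q = {K. length K = Suc q \<and> set K \<subseteq> idx X}"

definition overlap :: "('a, 'i) surface \<Rightarrow> 'i list \<Rightarrow> 'a set" where
  "overlap X K = (\<Inter>i\<in>set K. patch X i)"

text \<open>Functions on an intersection are expressed in the coordinate of the last index.\<close>

definition dom_of :: "('a, 'i) surface \<Rightarrow> 'i list \<Rightarrow> complex set" where
  "dom_of X K = coord X (last K) ` overlap X K"

definition riemann_surface :: "('a, 'i) surface \<Rightarrow> bool" where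
  "riemann_surface X \<longleftrightarrow>
     topspace (surf X) \<noteq> {} \<and> Hausdorff_space (surf X) \<and> second_countable (surf X) \<and>
     connected_space (surf X) \<and>
     (\<Union>i\<in>idx X. patch X i) = topspace (surf X) \<and>
     (\<forall>i\<in>idx X. openin (surf X) (patch X i) \<and> open (coord X i ` patch X i) \<and>
        homeomorphic_map (subtopology (surf X) (patch X i))
          (top_of_set (coord X i ` patch X i)) (coord X i)) \<and>
     (\<forall>i\<in>idx X. \<forall>j\<in>idx X. trans_fun X i j holomorphic_on dom_of X [i, j])"

definition good_cover :: "('a, 'i) surface \<Rightarrow> bool" where
  "good_cover X \<longleftrightarrow> (\<forall>K. K \<noteq> [] \<longrightarrow> set K \<subseteq> idx X \<longrightarrow> overlap X K \<noteq> {} \<longrightarrow>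
     contractible_space (subtopology (surf X) (overlap X K)))"

definition has_genus :: "('a, 'i) surface \<Rightarrow> nat \<Rightarrow> bool" where
  "has_genus X g \<longleftrightarrow> homology_group 1 (surf X) \<cong> free_Abelian_group {..<2 * g}"

definition del_nth :: "nat \<Rightarrow> 'i list \<Rightarrow> 'i list" where
  "del_nth k K = take k K @ drop (Suc k) K"

text \<open>The first argument is the pullback operation for the coefficients; \<open>length K = Suc q\<close>.\<close>

definition cech :: "((complex \<Rightarrow> complex) \<Rightarrow> (complex \<Rightarrow> 'v) \<Rightarrow> (complex \<Rightarrow> 'v)) \<Rightarrow>
    ('a, 'i) surface \<Rightarrow> ('i list \<Rightarrow> complex \<Rightarrow> 'v::real_vector) \<Rightarrow> 'i list \<Rightarrow> complex \<Rightarrow> 'v" where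
  "cech pull X \<phi> K z = (let q = length K - 1 in
     (\<Sum>k<q. (-1) ^ k *\<^sub>R \<phi> (del_nth k K) z) +
     (-1) ^ q *\<^sub>R pull (trans_fun X (K ! (q - 1)) (K ! q)) (\<phi> (butlast K)) z)"

definition smooth_cochain ::
    "('a, 'i) surface \<Rightarrow> nat \<Rightarrow> ('i list \<Rightarrow> complex \<Rightarrow> 'v::real_normed_vector) \<Rightarrow> bool" where
  "smooth_cochain X q \<phi> \<longleftrightarrow> (\<forall>K\<in>tuples X q. smooth_on (dom_of X K) (\<phi> K))"

text \<open>
  Cochains of total degree 2 and 3; the field \<open>cpq\<close> is the component in Cech degree \<open>q\<close> with values
  in the degree \<open>p\<close> term of \<open>\<int>(3) \<hookrightarrow> A\<^sup>0 \<rightarrow> A\<^sup>1 \<rightarrow> A\<^sup>2\<close> (so \<open>p = 1\<close> means functions). Locally constant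
  functions with values in \<open>\<int>(3)\<close> are represented as complex functions.
\<close>

record 'i cochain2 =
  c20 :: "'i list \<Rightarrow> form1"
  c11 :: "'i list \<Rightarrow> form0"
  c02 :: "'i list \<Rightarrow> form0"

record 'i cochain3 =
  c30 :: "'i list \<Rightarrow> form2"
  c21 :: "'i list \<Rightarrow> form1"
  c12 :: "'i list \<Rightarrow> form0"
  c03 :: "'i list \<Rightarrow> form0"

definition deligne_cochain2 :: "('a, 'i) surface \<Rightarrow> 'i cochain2 \<Rightarrow> bool" where
  "deligne_cochain2 X \<xi> \<longleftrightarrow> smooth_cochain X 0 (c20 \<xi>) \<and> smooth_cochain X 1 (c11 \<xi>) \<and>
     (\<forall>K\<in>tuples X 2. continuous_on (dom_of X K) (c02 \<xi> K) \<and> c02 \<xi> K ` dom_of X K \<subseteq> Zp 3)"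

text \<open>\<open>D = d + (-1)\<^sup>p \<delta>\<close>, where \<open>d\<close> in degree 0 is the inclusion of \<open>\<int>(3)\<close> into \<open>A\<^sup>0\<close>.\<close>

definition total_D :: "('a, 'i) surface \<Rightarrow> 'i cochain2 \<Rightarrow> 'i cochain3" where
  "total_D X \<xi> = \<lparr>
     c30 = (\<lambda>K. d1 (c20 \<xi> K)),
     c21 = (\<lambda>K z. d0 (c11 \<xi> K) z + cech pull1 X (c20 \<xi>) K z),
     c12 = (\<lambda>K z. c02 \<xi> K z - cech pull0 X (c11 \<xi>) K z),
     c03 = cech pull0 X (c02 \<xi>)\<rparr>"

text \<open>The sum of a cochain \<open>(a, 0, 0, 0)\<close> and a cochain \<open>c\<close>.\<close>

definition add_top :: "('i list \<Rightarrow> form2) \<Rightarrow> 'i cochain3 \<Rightarrow> 'i cochain3" where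
  "add_top a c = c\<lparr>c30 := (\<lambda>K z. a K z + c30 c K z)\<rparr>"

text \<open>\<open>c'\<close> is the derivative at \<open>t = 0\<close> of the family of cochains \<open>c t\<close>.\<close>

definition has_cochain_derivative ::
    "('a, 'i) surface \<Rightarrow> (real \<Rightarrow> 'i cochain3) \<Rightarrow> 'i cochain3 \<Rightarrow> bool" where
  "has_cochain_derivative X c c' \<longleftrightarrow>
     (\<forall>K\<in>tuples X 0. \<forall>z\<in>dom_of X K. ((\<lambda>t. c30 (c t) K z) has_vector_derivative c30 c' K z) (at 0)) \<and>
     (\<forall>K\<in>tuples X 1. \<forall>z\<in>dom_of X K. ((\<lambda>t. c21 (c t) K z) has_vector_derivative c21 c' K z) (at 0)) \<and>
     (\<forall>K\<in>tuples X 2. \<forall>z\<in>dom_of X K. ((\<lambda>t. c12 (c t) K z) has_vector_derivative c12 c' K z) (at 0)) \<and>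
     (\<forall>K\<in>tuples X 3. \<forall>z\<in>dom_of X K. ((\<lambda>t. c03 (c t) K z) has_vector_derivative c03 c' K z) (at 0))"

definition global_2form :: "('a, 'i) surface \<Rightarrow> ('i list \<Rightarrow> form2) \<Rightarrow> bool" where
  "global_2form X a \<longleftrightarrow> smooth_cochain X 0 a \<and>
     (\<forall>K\<in>tuples X 1. \<forall>z\<in>dom_of X K. cech pull2 X a K z = 0)"

definition log_branches :: "('a, 'i) surface \<Rightarrow> bool" where
  "log_branches X \<longleftrightarrow> (\<forall>i\<in>idx X. \<forall>j\<in>idx X.
     log_branch (dom_of X [i, j]) (deriv (trans_fun X i j)) (logtr X [i, j]))"

text \<open>\<open>cc X [i, j, k]\<close> is the function, constant on connected triple intersections, \<open>c\<^sub>i\<^sub>j\<^sub>k\<close>.\<close>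

definition cc :: "('a, 'i) surface \<Rightarrow> 'i list \<Rightarrow> complex \<Rightarrow> complex" where
  "cc X = cech pull0 X (logtr X)"

definition tau_form :: "('a, 'i) surface \<Rightarrow> 'i list \<Rightarrow> form1" where
  "tau_form X K z = (tau X K z, 0)"

definition tame_trivialization :: "('a, 'i) surface \<Rightarrow> bool" where
  "tame_trivialization X \<longleftrightarrow>
     (\<forall>K\<in>tuples X 1. tau X K holomorphic_on dom_of X K) \<and>
     (\<forall>K\<in>tuples X 2. phi X K holomorphic_on dom_of X K) \<and>
     (\<forall>K\<in>tuples X 3. overlap X K \<noteq> {} \<longrightarrow> nn X K \<in> Zp 2) \<and>
     (\<forall>i\<in>idx X. \<forall>j\<in>idx X. \<forall>k\<in>idx X. \<forall>z\<in>dom_of X [i, j, k].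
        cscale (- logtr X [i, j] (trans_fun X j k z)) (d0 (logtr X [j, k]) z)
        = cech pull1 X (tau_form X) [i, j, k] z + d0 (phi X [i, j, k]) z) \<and>
     (\<forall>i\<in>idx X. \<forall>j\<in>idx X. \<forall>k\<in>idx X. \<forall>l\<in>idx X. \<forall>z\<in>dom_of X [i, j, k, l].
        cc X [i, j, k] (trans_fun X k l z) * logtr X [k, l] z
        = - cech pull0 X (phi X) [i, j, k, l] z + nn X [i, j, k, l]) \<and>
     (\<forall>i\<in>idx X. \<forall>j\<in>idx X. \<forall>k\<in>idx X. \<forall>l\<in>idx X. \<forall>m\<in>idx X. \<forall>z\<in>dom_of X [i, j, k, l, m].
        cc X [i, j, k] (trans_fun X k m z) * cc X [k, l, m] z
        = cech pull0 X (\<lambda>K z. nn X K) [i, j, k, l, m] z)"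

definition schwarzian :: "(complex \<Rightarrow> complex) \<Rightarrow> complex \<Rightarrow> complex" where
  "schwarzian g z = (deriv ^^ 3) g z / deriv g z - 3 / 2 * ((deriv ^^ 2) g z / deriv g z)\<^sup>2"

definition projective_connection :: "('a, 'i) surface \<Rightarrow> ('i \<Rightarrow> complex \<Rightarrow> complex) \<Rightarrow> bool" where
  "projective_connection X h \<longleftrightarrow>
     (\<forall>i\<in>idx X. smooth_on (dom_of X [i]) (h i)) \<and>
     (\<forall>i\<in>idx X. \<forall>j\<in>idx X. \<forall>z\<in>dom_of X [i, j].
        h j z - h i (trans_fun X i j z) * (deriv (trans_fun X i j) z)\<^sup>2
        = schwarzian (trans_fun X i j) z)"

definition D_op :: "(complex \<Rightarrow> complex) \<Rightarrow> (complex \<Rightarrow> complex) \<Rightarrow> complex \<Rightarrow> complex" where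
  "D_op h \<mu> z = pd (pd (pd \<mu>)) z + 2 * h z * pd \<mu> z + pd h z * \<mu> z"

definition local_rep :: "('a, 'i) surface \<Rightarrow> ('b, 'i) surface \<Rightarrow> ('a \<Rightarrow> 'b) \<Rightarrow> 'i \<Rightarrow> complex \<Rightarrow> complex" where
  "local_rep X Y f i \<zeta> = coord Y i (f (coord_inv X i \<zeta>))"

definition beltrami :: "(complex \<Rightarrow> complex) \<Rightarrow> complex \<Rightarrow> complex" where
  "beltrami g z = pdb g z / pd g z"

definition smooth_map :: "('a, 'i) surface \<Rightarrow> ('b, 'i) surface \<Rightarrow> ('a \<Rightarrow> 'b) \<Rightarrow> bool" where
  "smooth_map X Y g \<longleftrightarrow> continuous_map (surf X) (surf Y) g \<and>
     (\<forall>i\<in>idx X. \<forall>j\<in>idx Y. smooth_on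
        {\<zeta> \<in> dom_of X [i]. g (coord_inv X i \<zeta>) \<in> patch Y j} (\<lambda>\<zeta>. coord Y j (g (coord_inv X i \<zeta>))))"

text \<open>The Jacobian of a map with derivatives \<open>pd\<close>, \<open>pdb\<close> is \<open>|pd|\<^sup>2 - |pdb|\<^sup>2\<close>.\<close>

definition oriented_diffeo :: "('a, 'i) surface \<Rightarrow> ('b, 'i) surface \<Rightarrow> ('a \<Rightarrow> 'b) \<Rightarrow> bool" where
  "oriented_diffeo X Y g \<longleftrightarrow>
     bij_betw g (topspace (surf X)) (topspace (surf Y)) \<and> smooth_map X Y g \<and>
     smooth_map Y X (inv_into (topspace (surf X)) g) \<and>
     (\<forall>i\<in>idx X. \<forall>j\<in>idx Y. \<forall>\<zeta>\<in>dom_of X [i]. g (coord_inv X i \<zeta>) \<in> patch Y j \<longrightarrow>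
        cmod (pdb (\<lambda>\<zeta>. coord Y j (g (coord_inv X i \<zeta>))) \<zeta>)
        < cmod (pd (\<lambda>\<zeta>. coord Y j (g (coord_inv X i \<zeta>))) \<zeta>))"

text \<open>
  A vertical variation of \<open>f\<close>, normalized so that its Kodaira-Spencer cocycle vanishes: a smooth
  one-parameter family of diffeomorphisms onto the Riemann surface \<open>Y\<close>, whose complex structure,
  coordinates and transition functions do not vary. Since \<open>patch Y i\<close> is kept equal to \<open>f ` patch X i\<close>,
  the local representative of \<open>F t\<close> in the coordinates with index \<open>i\<close> is meaningful only where
  \<open>F t\<close> takes values in \<open>patch Y i\<close>; on compact subsets of \<open>patch X i\<close> this holds for all small \<open>t\<close>.
\<close>

definition vertical_variation ::
    "('a, 'i) surface \<Rightarrow> ('b, 'i) surface \<Rightarrow> ('a \<Rightarrow> 'b) \<Rightarrow> (real \<Rightarrow> 'a \<Rightarrow> 'b) \<Rightarrow> bool" where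
  "vertical_variation X Y f F \<longleftrightarrow>
     (\<forall>x\<in>topspace (surf X). F 0 x = f x) \<and>
     (\<exists>\<epsilon>>0.
        (\<forall>t. \<bar>t\<bar> < \<epsilon> \<longrightarrow> oriented_diffeo X Y (F t)) \<and>
        continuous_map (prod_topology (top_of_set {-\<epsilon><..<\<epsilon>}) (surf X)) (surf Y) (\<lambda>(t, x). F t x) \<and>
        (\<forall>i\<in>idx X. \<forall>j\<in>idx Y. smooth_on
           {(t, \<zeta>). \<bar>t\<bar> < \<epsilon> \<and> \<zeta> \<in> dom_of X [i] \<and> F t (coord_inv X i \<zeta>) \<in> patch Y j}
           (\<lambda>(t, \<zeta>). coord Y j (F t (coord_inv X i \<zeta>)))))"

definition delta_rep ::
    "('a, 'i) surface \<Rightarrow> ('b, 'i) surface \<Rightarrow> (real \<Rightarrow> 'a \<Rightarrow> 'b) \<Rightarrow> 'i \<Rightarrow> complex \<Rightarrow> complex" where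
  "delta_rep X Y F i z = vector_derivative (\<lambda>t. local_rep X Y (F t) i z) (at 0)"

text \<open>
  Continuation of the branch \<open>L i\<close> of the logarithm of \<open>\<partial>f\<^sub>i\<close> to a nearby map \<open>g\<close>: the quotient under
  the principal logarithm is close to 1.
\<close>

definition continue_log :: "('a, 'i) surface \<Rightarrow> ('b, 'i) surface \<Rightarrow> ('a \<Rightarrow> 'b) \<Rightarrow>
    ('i \<Rightarrow> complex \<Rightarrow> complex) \<Rightarrow> ('a \<Rightarrow> 'b) \<Rightarrow> 'i \<Rightarrow> complex \<Rightarrow> complex" where
  "continue_log X Y f L g i z =
     L i z + Ln (pd (local_rep X Y g i) z / pd (local_rep X Y f i) z)"

text \<open>Throughout, \<open>L i\<close> is a branch of the logarithm of \<open>\<partial>g\<^sub>i\<close>.\<close>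

definition lag_omega :: "('a, 'i) surface \<Rightarrow> ('b, 'i) surface \<Rightarrow> ('i \<Rightarrow> complex \<Rightarrow> complex) \<Rightarrow>
    ('a \<Rightarrow> 'b) \<Rightarrow> 'i list \<Rightarrow> form2" where
  "lag_omega X Y h g K z = (let i = K ! 0; gi = local_rep X Y g i; \<mu> = beltrami gi in
     pd (pd gi) z / pd gi z * pd \<mu> z + 2 * \<mu> z * h i z)"

definition lag_theta :: "('a, 'i) surface \<Rightarrow> ('b, 'i) surface \<Rightarrow> ('a \<Rightarrow> 'b) \<Rightarrow>
    ('i \<Rightarrow> complex \<Rightarrow> complex) \<Rightarrow> 'i list \<Rightarrow> form1" where
  "lag_theta X Y g L K z = (let i = K ! 0; j = K ! 1; gj = local_rep X Y g j;
       \<mu> = beltrami gj; zij = trans_fun X i j in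
     (0, 2 * \<mu> z * (deriv (deriv zij) z / deriv zij z))
     - cscale (logtr Y [i, j] (gj z) + logtr X [i, j] z) (d0 (L j) z)
     + cscale (logtr Y [i, j] (gj z)) (d0 (logtr X [i, j]) z)
     - pull1 gj (tau_form Y [i, j]) z
     + tau_form X [i, j] z)"

definition lag_Theta :: "('a, 'i) surface \<Rightarrow> ('b, 'i) surface \<Rightarrow> ('a \<Rightarrow> 'b) \<Rightarrow>
    ('i \<Rightarrow> complex \<Rightarrow> complex) \<Rightarrow> 'i list \<Rightarrow> form0" where
  "lag_Theta X Y g L K z = (let i = K ! 0; j = K ! 1; k = K ! 2; gk = local_rep X Y g k in
     phi Y [i, j, k] (gk z) - phi X [i, j, k] z
     - (cc Y [i, j, k] (gk z) + cc X [i, j, k] z) * L k z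
     - logtr X [i, j] (trans_fun X j k z) * logtr Y [j, k] (gk z)
     + cc Y [i, j, k] (gk z) * logtr X [i, k] z)"

definition lag_m :: "('a, 'i) surface \<Rightarrow> ('b, 'i) surface \<Rightarrow> ('a \<Rightarrow> 'b) \<Rightarrow>
    ('i \<Rightarrow> complex \<Rightarrow> complex) \<Rightarrow> 'i list \<Rightarrow> form0" where
  "lag_m X Y g L = cech pull0 X (lag_Theta X Y g L)"

definition lag_Omega :: "('a, 'i) surface \<Rightarrow> ('b, 'i) surface \<Rightarrow> ('i \<Rightarrow> complex \<Rightarrow> complex) \<Rightarrow>
    ('a \<Rightarrow> 'b) \<Rightarrow> ('i \<Rightarrow> complex \<Rightarrow> complex) \<Rightarrow> 'i cochain3" where
  "lag_Omega X Y h g L = \<lparr>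
     c30 = (\<lambda>K z. 2 * of_real pi * \<i> * lag_omega X Y h g K z),
     c21 = (\<lambda>K z. cscale (2 * of_real pi * \<i>) (lag_theta X Y g L K z)),
     c12 = (\<lambda>K z. - (2 * of_real pi * \<i> * lag_Theta X Y g L K z)),
     c03 = (\<lambda>K z. - (2 * of_real pi * \<i> * lag_m X Y g L K z))\<rparr>"

definition form_a :: "('a, 'i) surface \<Rightarrow> ('b, 'i) surface \<Rightarrow> ('i \<Rightarrow> complex \<Rightarrow> complex) \<Rightarrow>
    ('a \<Rightarrow> 'b) \<Rightarrow> (real \<Rightarrow> 'a \<Rightarrow> 'b) \<Rightarrow> 'i list \<Rightarrow> form2" where
  "form_a X Y h f F K z = (let i = K ! 0; fi = local_rep X Y f i in
     - 2 * (pdb (h i) z - D_op (h i) (beltrami fi) z) * (delta_rep X Y F i z / pd fi z))"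

text \<open>
  Smoothness on the closed simplex is existence of local smooth extensions. The coordinates
  \<open>x 1, x 2, x 3\<close> determine a point of \<open>standard_simplex p\<close> only for \<open>p \<le> 3\<close>, so this is meant
  for \<open>p \<le> 3\<close>.
\<close>

definition smooth_simplex :: "('a, 'i) surface \<Rightarrow> nat \<Rightarrow> ((nat \<Rightarrow> real) \<Rightarrow> 'a) \<Rightarrow> bool" where
  "smooth_simplex X p \<sigma> \<longleftrightarrow> singular_simplex p (surf X) \<sigma> \<and>
     (\<forall>x\<in>standard_simplex p. \<forall>i\<in>idx X. \<sigma> x \<in> patch X i \<longrightarrow>
        (\<exists>W (G :: real \<times> real \<times> real \<Rightarrow> complex).
           open W \<and> (x 1, x 2, x 3) \<in> W \<and> smooth_on W G \<and>
           (\<forall>y\<in>standard_simplex p. (y 1, y 2, y 3) \<in> W \<longrightarrow>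
              \<sigma> y \<in> patch X i \<and> coord X i (\<sigma> y) = G (y 1, y 2, y 3))))"

definition smooth_chain :: "('a, 'i) surface \<Rightarrow> nat \<Rightarrow> 'a chain \<Rightarrow> bool" where
  "smooth_chain X p c \<longleftrightarrow> (\<forall>\<sigma>\<in>Poly_Mapping.keys c. smooth_simplex X p \<sigma>)"

definition chart_triangle ::
    "('a, 'i) surface \<Rightarrow> 'i \<Rightarrow> complex \<Rightarrow> complex \<Rightarrow> complex \<Rightarrow> (nat \<Rightarrow> real) \<Rightarrow> 'a" where
  "chart_triangle X i a b c = restrict
     (\<lambda>x. coord_inv X i (of_real (x 0) * a + of_real (x 1) * b + of_real (x 2) * c)) (standard_simplex 2)"

text \<open>
  A smooth 2-cycle represents the fundamental class iff for every point \<open>x\<close> it is homologous,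
  relative to the complement of \<open>x\<close>, to a triangle around \<open>x\<close> that is positively oriented in a
  holomorphic coordinate, i.e. iff it restricts to the local orientation in \<open>H\<^sub>2(X, X - x)\<close>.
  The homology is that of smooth singular chains.
\<close>

definition fundamental_cycle :: "('a, 'i) surface \<Rightarrow> 'a chain \<Rightarrow> bool" where
  "fundamental_cycle X s \<longleftrightarrow> smooth_chain X 2 s \<and> chain_boundary 2 s = 0 \<and>
     (\<forall>x\<in>topspace (surf X). \<exists>i\<in>idx X. \<exists>a b c.
        x \<in> patch X i \<and> convex hull {a, b, c} \<subseteq> dom_of X [i] \<and>
        coord X i x \<in> interior (convex hull {a, b, c}) \<and> Im (cnj (b - a) * (c - a)) > 0 \<and>
        (\<exists>B E. smooth_chain X 3 B \<and> smooth_chain X 2 E \<and>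
           (\<forall>\<sigma>\<in>Poly_Mapping.keys E. x \<notin> \<sigma> ` standard_simplex 2) \<and>
           s - frag_of (chart_triangle X i a b c) = chain_boundary 3 B + E))"

text \<open>
  Chains \<open>\<Sum> \<sigma>\<^sub>K \<cdot> \<Delta>\<^sub>K\<close> are finitely supported maps from index lists \<open>K\<close> to singular chains
  \<open>\<sigma>\<^sub>K\<close>; \<open>bd_sing\<close> is \<open>\<partial>'\<close> and \<open>bd_cech\<close> is \<open>\<partial>''\<close>.
\<close>

definition bd_sing :: "nat \<Rightarrow> ('i list \<Rightarrow>\<^sub>0 'a chain) \<Rightarrow> ('i list \<Rightarrow>\<^sub>0 'a chain)" where
  "bd_sing p S = Poly_Mapping.map (chain_boundary p) S"

definition bd_cech :: "('i list \<Rightarrow>\<^sub>0 'a chain) \<Rightarrow> ('i list \<Rightarrow>\<^sub>0 'a chain)" where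
  "bd_cech S = (\<Sum>K\<in>Poly_Mapping.keys S. \<Sum>j<length K.
     Poly_Mapping.single (del_nth j K) (frag_cmul ((-1) ^ j) (Poly_Mapping.lookup S K)))"

definition cover_chain ::
    "('a, 'i::linorder) surface \<Rightarrow> nat \<Rightarrow> nat \<Rightarrow> ('i list \<Rightarrow>\<^sub>0 'a chain) \<Rightarrow> bool" where
  "cover_chain X q p S \<longleftrightarrow> (\<forall>K\<in>Poly_Mapping.keys S. K \<in> tuples X q \<and> sorted K \<and>
     smooth_chain X p (Poly_Mapping.lookup S K) \<and>
     singular_chain p (subtopology (surf X) (overlap X K)) (Poly_Mapping.lookup S K))"

definition fundamental_chains :: "('a, 'i::linorder) surface \<Rightarrow> ('i list \<Rightarrow>\<^sub>0 'a chain) \<Rightarrow>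
    ('i list \<Rightarrow>\<^sub>0 'a chain) \<Rightarrow> ('i list \<Rightarrow>\<^sub>0 'a chain) \<Rightarrow> bool" where
  "fundamental_chains X S0 S1 S2 \<longleftrightarrow>
     cover_chain X 0 2 S0 \<and> cover_chain X 1 1 S1 \<and> cover_chain X 2 0 S2 \<and>
     fundamental_cycle X (\<Sum>K\<in>Poly_Mapping.keys S0. Poly_Mapping.lookup S0 K) \<and>
     bd_sing 2 S0 = bd_cech S1 \<and> bd_sing 1 S1 = bd_cech S2"

definition bary :: "real \<Rightarrow> real \<Rightarrow> nat \<Rightarrow> real" where
  "bary s t n = (if n = 0 then 1 - s - t else if n = 1 then s else if n = 2 then t else 0)"

definition triangle :: "(real \<times> real) set" where
  "triangle = {(s, t). 0 \<le> s \<and> 0 \<le> t \<and> s + t \<le> 1}"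

text \<open>Integrals over a simplex contained in \<open>patch X i\<close> of forms given in the coordinate \<open>coord X i\<close>.\<close>

definition simplex_int2 :: "('a, 'i) surface \<Rightarrow> 'i \<Rightarrow> form2 \<Rightarrow> ((nat \<Rightarrow> real) \<Rightarrow> 'a) \<Rightarrow> complex" where
  "simplex_int2 X i \<omega> \<sigma> = (let u = (\<lambda>(s, t). coord X i (\<sigma> (bary s t))) in
     integral triangle (\<lambda>x. let D = frechet_derivative u (at x within triangle) in
       \<omega> (u x) * (D (1, 0) * cnj (D (0, 1)) - D (0, 1) * cnj (D (1, 0)))))"

definition simplex_int1 :: "('a, 'i) surface \<Rightarrow> 'i \<Rightarrow> form1 \<Rightarrow> ((nat \<Rightarrow> real) \<Rightarrow> 'a) \<Rightarrow> complex" where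
  "simplex_int1 X i \<theta> \<sigma> = (let u = (\<lambda>s. coord X i (\<sigma> (bary s 0))) in
     integral {0..1} (\<lambda>s. let D = vector_derivative u (at s within {0..1}) in
       fst (\<theta> (u s)) * D + snd (\<theta> (u s)) * cnj D))"

definition simplex_int0 :: "('a, 'i) surface \<Rightarrow> 'i \<Rightarrow> form0 \<Rightarrow> ((nat \<Rightarrow> real) \<Rightarrow> 'a) \<Rightarrow> complex" where
  "simplex_int0 X i \<phi> \<sigma> = \<phi> (coord X i (\<sigma> (bary 0 0)))"

definition chain_int :: "('i \<Rightarrow> (complex \<Rightarrow> 'v) \<Rightarrow> ((nat \<Rightarrow> real) \<Rightarrow> 'a) \<Rightarrow> complex) \<Rightarrow>
    ('i list \<Rightarrow> complex \<Rightarrow> 'v) \<Rightarrow> ('i list \<Rightarrow>\<^sub>0 'a chain) \<Rightarrow> complex" where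
  "chain_int simplex_int \<phi> S = (\<Sum>K\<in>Poly_Mapping.keys S.
     \<Sum>\<sigma>\<in>Poly_Mapping.keys (Poly_Mapping.lookup S K).
       of_int (Poly_Mapping.lookup (Poly_Mapping.lookup S K) \<sigma>) * simplex_int (last K) (\<phi> K) \<sigma>)"

definition mod_Z3 :: "complex \<Rightarrow> complex set" where
  "mod_Z3 s = {s + k | k. k \<in> Zp 3}"

definition action :: "('a, 'i) surface \<Rightarrow> ('b, 'i) surface \<Rightarrow> ('i \<Rightarrow> complex \<Rightarrow> complex) \<Rightarrow>
    ('i list \<Rightarrow>\<^sub>0 'a chain) \<Rightarrow> ('i list \<Rightarrow>\<^sub>0 'a chain) \<Rightarrow> ('i list \<Rightarrow>\<^sub>0 'a chain) \<Rightarrow>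
    ('a \<Rightarrow> 'b) \<Rightarrow> ('i \<Rightarrow> complex \<Rightarrow> complex) \<Rightarrow> complex set" where
  "action X Y h S0 S1 S2 g L = mod_Z3 (2 * of_real pi * \<i> *
     (chain_int (simplex_int2 X) (lag_omega X Y h g) S0
      - chain_int (simplex_int1 X) (lag_theta X Y g L) S1
      + chain_int (simplex_int0 X) (lag_Theta X Y g L) S2))"

text \<open>
  Derivative at \<open>t = 0\<close> of a curve in \<open>\<complex>/\<int>(3)\<close>. It is unique, because two lifts that are
  continuous at 0 differ by a constant near 0.
\<close>

definition has_derivative_mod_Z3 :: "(real \<Rightarrow> complex set) \<Rightarrow> complex \<Rightarrow> bool" where
  "has_derivative_mod_Z3 A d \<longleftrightarrow> (\<exists>s. (\<forall>\<^sub>F t in nhds 0. A t = mod_Z3 (s t)) \<and>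
     (s has_vector_derivative d) (at 0))"

definition partition_of_unity :: "('a, 'i) surface \<Rightarrow> ('i \<Rightarrow> 'a \<Rightarrow> real) \<Rightarrow> bool" where
  "partition_of_unity X \<rho> \<longleftrightarrow>
     finite {i \<in> idx X. \<exists>x\<in>topspace (surf X). \<rho> i x \<noteq> 0} \<and>
     (\<forall>i\<in>idx X. \<forall>x\<in>topspace (surf X). 0 \<le> \<rho> i x) \<and>
     (\<forall>i\<in>idx X. surf X closure_of {x \<in> topspace (surf X). \<rho> i x \<noteq> 0} \<subseteq> patch X i) \<and>
     (\<forall>i\<in>idx X. \<forall>j\<in>idx X. smooth_on (dom_of X [j]) (\<lambda>\<zeta>. \<rho> i (coord_inv X j \<zeta>))) \<and>
     (\<forall>x\<in>topspace (surf X).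
        (\<Sum>i | i \<in> idx X \<and> (\<exists>y\<in>topspace (surf X). \<rho> i y \<noteq> 0). \<rho> i x) = 1)"

text \<open>
  The integral of a global 2-form over the compact surface; it does not depend on the partition of
  unity. The factor comes from \<open>dz \<and> dzbar = -2\<i> dx \<and> dy\<close>.
\<close>

definition surface_integral :: "('a, 'i) surface \<Rightarrow> ('i list \<Rightarrow> form2) \<Rightarrow> complex" where
  "surface_integral X \<alpha> = (let \<rho> = (SOME \<rho>. partition_of_unity X \<rho>) in
     \<Sum>i | i \<in> idx X \<and> (\<exists>x\<in>topspace (surf X). \<rho> i x \<noteq> 0).
       integral (dom_of X [i]) (\<lambda>\<zeta>. - 2 * \<i> * of_real (\<rho> i (coord_inv X i \<zeta>)) * \<alpha> [i] \<zeta>))"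

end

theory Submission
  imports Defs "HOL-Complex_Analysis.Complex_Analysis"
begin

text \<open>
  With \<open>v = \<delta>f / \<partial>f\<close>, a direct computation on one chart gives \<open>\<delta>\<omega> = a + d A\<close> for an explicit 1-form
  \<open>A\<close>, determined up to an exact form. For a suitable choice of the exact term the Cech coboundary of \<open>A\<close>
  and \<open>\<delta>\<theta>\<close> differ by the differential of an explicit function on double overlaps, whose Cech
  coboundary is in turn \<open>\<delta>\<Theta>\<close> up to sign; so the primitive is a Deligne cochain without integral part.

  Differentiating the action under the integral and applying Stokes' theorem to the simplices, the relations
  \<open>\<partial>'\<Sigma>\<^sub>0 = \<partial>''\<Sigma>\<^sub>1\<close>, \<open>\<partial>'\<Sigma>\<^sub>1 = \<partial>''\<Sigma>\<^sub>2\<close> cancel everything but the integral of \<open>a\<close> over the smooth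
  2-cycle. By a partition of unity this is an integral of forms supported near a point \<open>x\<close>, for which the
  local homology condition at \<open>x\<close> and Stokes' theorem on 3-simplices replace the cycle by a small triangle
  in a chart.

  If the Euler-Lagrange expression does not vanish at some point, composing \<open>f\<close> with the maps
  \<open>w + t c b(w)\<close> for a bump function \<open>b\<close> in a chart of the target is a vertical variation for which the
  integrand has nonnegative, not identically zero real part when the phase of \<open>c\<close> is chosen well.
\<close>

section \<open>Calculus of smooth functions\<close>

text \<open>The choice of variables makes the computation finite: with
  \<open>N = \<partial> log \<partial>f\<close>, \<open>\<mu>\<close> and \<open>v\<close>, the
  Beltrami equation expresses the antiholomorphic derivatives of \<open>\<partial>f\<close> and
  \<open>N\<close> by holomorphic derivatives of \<open>\<mu>\<close> and \<open>N\<close>. Each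
  identity of forms then becomes a polynomial identity between jets at one point. The obstacle is
  that \<open>F t\<close> does not preserve the patches, so its local representative is meaningful
  only on a part of the chart that depends on \<open>t\<close>. Every varying quantity is therefore
  a function on an open set of pairs \<open>(t, z)\<close> containing the slice
  \<open>t = 0\<close>. Time and coordinate derivatives commute there, and the cochains agree with
  these functions for \<open>t\<close> near 0: at a fixed point for the cocycle, uniformly along a
  compact simplex for the action. The simplices in the local homology condition need not lie in a
  chart, so global 2-forms are integrated through a chart chosen point by point. Passing from
  critical points back to the equation also uses that \<open>\<int>(3)\<close> is discrete, which
  makes derivatives in the quotient unique.\<close>

abbreviation dird :: "('v::real_normed_vector \<Rightarrow> 'w::real_normed_vector) \<Rightarrow> 'v \<Rightarrow> 'v \<Rightarrow> 'w" where
  "dird f b x \<equiv> frechet_derivative f (at x) b"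

text \<open>The congruence property is a premise because the induction that proves
  \<open>Ck_on_cong\<close> applies this rule with its induction hypothesis in that place.\<close>

lemma Ck_on_SucI:
  fixes f :: "'v::euclidean_space \<Rightarrow> 'w::real_normed_vector"
  assumes "open S" and der: "\<And>x. x \<in> S \<Longrightarrow> (f has_derivative f' x) (at x)"
    and ck: "\<And>b. b \<in> Basis \<Longrightarrow> Ck_on k S (\<lambda>x. f' x b)"
    and cong: "\<And>f g :: 'v \<Rightarrow> 'w. (\<And>x. x \<in> S \<Longrightarrow> f x = g x) \<Longrightarrow> Ck_on k S f \<Longrightarrow> Ck_on k S g"
  shows "Ck_on (Suc k) S f"
proof -
  have "frechet_derivative f (at x) = f' x" if "x \<in> S" for x
    using der[OF that] frechet_derivative_at by metis
  then show ?thesis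
    using der ck cong[of "\<lambda>x. f' x b" "dird f b" for b] by (auto simp: differentiable_def)
qed

lemma Ck_on_cong:
  assumes "open S" "\<And>x. x \<in> S \<Longrightarrow> f x = g x" "Ck_on k S f"
  shows "Ck_on k S g"
  using assms(2,3)
proof (induction k arbitrary: f g)
  case 0 then show ?case using continuous_on_eq by fastforce
next
  case (Suc k)
  have der: "(g has_derivative frechet_derivative f (at x)) (at x)" if "x \<in> S" for x
    using Suc.prems that assms(1)
    by (intro has_derivative_transform_within_open[of f _ x UNIV S g])
       (auto simp: frechet_derivative_works[symmetric])
  show ?case
    by (rule Ck_on_SucI[OF assms(1) der]) (use Suc in auto)
qed

lemma Ck_on_SucI':
  assumes "open S" and "\<And>x. x \<in> S \<Longrightarrow> (f has_derivative f' x) (at x)"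
    and "\<And>b. b \<in> Basis \<Longrightarrow> Ck_on k S (\<lambda>x. f' x b)"
  shows "Ck_on (Suc k) S f"
  using Ck_on_SucI[OF assms] Ck_on_cong[OF assms(1)] by blast

lemma Ck_on_SucD:
  assumes "Ck_on (Suc k) S f" "x \<in> S"
  shows "(f has_derivative frechet_derivative f (at x)) (at x)"
  using assms by (auto simp: frechet_derivative_works[symmetric])

lemma Ck_on_SucD2: "Ck_on (Suc k) S f \<Longrightarrow> b \<in> Basis \<Longrightarrow> Ck_on k S (dird f b)"
  by auto

lemma Ck_on_mono: "Ck_on (Suc k) S f \<Longrightarrow> Ck_on k S f"
proof (induction k arbitrary: f)
  case 0 then show ?case
    by (auto intro!: continuous_at_imp_continuous_on differentiable_imp_continuous_within)
next
  case (Suc k)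
  have "\<forall>b\<in>Basis. Ck_on k S (dird f b)"
    using Suc.IH Suc.prems unfolding Ck_on.simps(2)[of "Suc k"] by blast
  then show ?case using Suc.prems unfolding Ck_on.simps(2) by blast
qed

lemma Ck_on_subset: "Ck_on k S f \<Longrightarrow> T \<subseteq> S \<Longrightarrow> Ck_on k T f"
proof (induction k arbitrary: f)
  case 0 then show ?case using continuous_on_subset by auto
qed (simp, blast)

lemma Ck_on_local:
  assumes "\<And>x. x \<in> S \<Longrightarrow> \<exists>T. open T \<and> x \<in> T \<and> Ck_on k T f"
  shows "Ck_on k S f"
  using assms
proof (induction k arbitrary: f)
  case 0
  show ?case unfolding Ck_on.simps
  proof (rule continuous_at_imp_continuous_on, rule ballI)
    fix x assume "x \<in> S"
    then obtain T where "open T" "x \<in> T" "continuous_on T f"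
      using 0[of x] unfolding Ck_on.simps by blast
    then show "isCont f x" by (simp add: continuous_on_eq_continuous_at)
  qed
next
  case (Suc k)
  have "f differentiable at x" if "x \<in> S" for x
    using Suc.prems[OF that] unfolding Ck_on.simps by blast
  moreover have "Ck_on k S (dird f b)" if "b \<in> Basis" for b
  proof (rule Suc.IH)
    fix x assume "x \<in> S"
    then show "\<exists>T. open T \<and> x \<in> T \<and> Ck_on k T (dird f b)"
      using Suc.prems[of x] that unfolding Ck_on.simps by blast
  qed
  ultimately show ?case by simp
qed

lemma Ck_on_const: "Ck_on k S (\<lambda>x. c)"
  by (induction k arbitrary: c) (auto simp: frechet_derivative_const)

lemma Ck_on_linear:
  assumes "bounded_linear f" shows "Ck_on k S f"
proof (cases k)
  case 0 then show ?thesis using assms linear_continuous_on by auto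
next
  case (Suc n)
  have "frechet_derivative f (at x) = f" for x
    using frechet_derivative_at[OF bounded_linear_imp_has_derivative[OF assms], of x] by simp
  then show ?thesis using Suc assms Ck_on_const bounded_linear_imp_differentiable by auto
qed

lemma Ck_on_bounded_linear:
  assumes "bounded_linear L" "open S" "Ck_on k S f"
  shows "Ck_on k S (\<lambda>x. L (f x))"
  using assms(3)
proof (induction k arbitrary: f)
  case 0 then show ?case
    using assms(1) by (simp add: bounded_linear.continuous_on)
next
  case (Suc k)
  show ?case
  proof (rule Ck_on_SucI'[OF assms(2)])
    show "((\<lambda>x. L (f x)) has_derivative (\<lambda>b. L (dird f b x))) (at x)" if "x \<in> S" for x
      using Ck_on_SucD[OF Suc.prems that] bounded_linear.has_derivative[OF assms(1)] by blast
    show "Ck_on k S (\<lambda>x. L (dird f b x))" if "b \<in> Basis" for b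
      using Suc that by auto
  qed
qed

lemma Ck_on_add:
  assumes "open S" "Ck_on k S f" "Ck_on k S g"
  shows "Ck_on k S (\<lambda>x. f x + g x)"
  using assms(2,3)
proof (induction k arbitrary: f g)
  case 0 then show ?case by (simp add: continuous_on_add)
next
  case (Suc k)
  show ?case
  proof (rule Ck_on_SucI'[OF assms(1)])
    show "((\<lambda>x. f x + g x) has_derivative (\<lambda>b. dird f b x + dird g b x)) (at x)" if "x \<in> S" for x
      using Ck_on_SucD[OF Suc.prems(1) that] Ck_on_SucD[OF Suc.prems(2) that] by (rule has_derivative_add)
    show "Ck_on k S (\<lambda>x. dird f b x + dird g b x)" if "b \<in> Basis" for b
      using Suc that by auto
  qed
qed

lemma Ck_on_sum:
  assumes "open S" "\<And>i. i \<in> I \<Longrightarrow> Ck_on k S (f i)"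
  shows "Ck_on k S (\<lambda>x. \<Sum>i\<in>I. f i x)"
  using assms(2)
  by (induction I rule: infinite_finite_induct) (simp_all add: Ck_on_const Ck_on_add assms(1))

lemma Ck_on_bilinear:
  assumes B: "bounded_bilinear B" and "open S" "Ck_on k S f" "Ck_on k S g"
  shows "Ck_on k S (\<lambda>x. B (f x) (g x))"
  using assms(3,4)
proof (induction k arbitrary: f g)
  case 0 then show ?case using bounded_bilinear.continuous_on[OF B] by auto
next
  case (Suc k)
  show ?case
  proof (rule Ck_on_SucI'[OF assms(2)])
    show "((\<lambda>x. B (f x) (g x)) has_derivative (\<lambda>b. B (f x) (dird g b x) + B (dird f b x) (g x))) (at x)"
      if "x \<in> S" for x
      using bounded_bilinear.FDERIV[OF B Ck_on_SucD[OF Suc.prems(1) that] Ck_on_SucD[OF Suc.prems(2) that]] .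
    show "Ck_on k S (\<lambda>x. B (f x) (dird g b x) + B (dird f b x) (g x))" if "b \<in> Basis" for b
      using that Ck_on_mono[OF Suc.prems(1)] Ck_on_mono[OF Suc.prems(2)]
        Ck_on_SucD2[OF Suc.prems(1)] Ck_on_SucD2[OF Suc.prems(2)]
      by (intro Ck_on_add assms(2) Suc.IH)
  qed
qed

text \<open>Expanding the chain rule in a basis of the intermediate space leaves \<open>g\<close>
  only through its partial derivatives composed with \<open>f\<close>. The induction hypothesis
  applies to these, since \<open>f\<close> is also of the lower class.\<close>

lemma Ck_on_compose:
  fixes f :: "'v::euclidean_space \<Rightarrow> 'u::euclidean_space" and g :: "'u \<Rightarrow> 'w::real_normed_vector"
  assumes "open S" "Ck_on k T g" "Ck_on k S f" "\<And>x. x \<in> S \<Longrightarrow> f x \<in> T"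
  shows "Ck_on k S (\<lambda>x. g (f x))"
  using assms(2,3)
proof (induction k arbitrary: g)
  case 0 then show ?case
    using assms(4) by (auto intro: continuous_on_compose2)
next
  case (Suc k)
  let ?f' = "\<lambda>x h. \<Sum>c\<in>Basis. (dird f h x \<bullet> c) *\<^sub>R dird g c (f x)"
  show ?case
  proof (rule Ck_on_SucI'[OF assms(1)])
    fix x assume x: "x \<in> S"
    have g: "(g has_derivative frechet_derivative g (at (f x))) (at (f x))"
      using Ck_on_SucD[OF Suc.prems(1)] assms(4) x by blast
    have lin: "linear (frechet_derivative g (at (f x)))"
      using g has_derivative_linear by blast
    have "((\<lambda>x. g (f x)) has_derivative (\<lambda>h. dird g (dird f h x) (f x))) (at x)"
      using has_derivative_compose[OF Ck_on_SucD[OF Suc.prems(2) x] g] .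
    moreover have "dird g (dird f h x) (f x) = ?f' x h" for h
      using linear_sum[OF lin, of "\<lambda>c. (dird f h x \<bullet> c) *\<^sub>R c" Basis]
      by (simp add: linear_scale[OF lin] euclidean_representation)
    ultimately show "((\<lambda>x. g (f x)) has_derivative ?f' x) (at x)" by simp
  next
    fix b :: 'v assume b: "b \<in> Basis"
    show "Ck_on k S (\<lambda>x. ?f' x b)"
    proof (rule Ck_on_sum[OF assms(1)])
      fix c :: 'u assume c: "c \<in> Basis"
      have "Ck_on k S (\<lambda>x. dird f b x \<bullet> c)"
        by (rule Ck_on_bounded_linear[OF bounded_linear_inner_left assms(1)]) (use Suc.prems b in auto)
      moreover have "Ck_on k S (\<lambda>x. dird g c (f x))"
        by (rule Suc.IH[OF Ck_on_SucD2[OF Suc.prems(1) c] Ck_on_mono[OF Suc.prems(2)]])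
      ultimately show "Ck_on k S (\<lambda>x. (dird f b x \<bullet> c) *\<^sub>R dird g c (f x))"
        by (rule Ck_on_bilinear[OF bounded_bilinear_scaleR assms(1)])
    qed
  qed
qed

section \<open>Closure properties of smooth functions\<close>

lemma smooth_on_cong: "open S \<Longrightarrow> (\<And>x. x \<in> S \<Longrightarrow> f x = g x) \<Longrightarrow> smooth_on S f \<Longrightarrow> smooth_on S g"
  by (auto simp: smooth_on_def intro: Ck_on_cong[of S f g])

lemma smooth_on_subset: "smooth_on S f \<Longrightarrow> T \<subseteq> S \<Longrightarrow> smooth_on T f"
  by (auto simp: smooth_on_def intro: Ck_on_subset[of _ S f T])

lemma smooth_on_local:
  assumes "\<And>x. x \<in> S \<Longrightarrow> \<exists>T. open T \<and> x \<in> T \<and> smooth_on T f"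
  shows "smooth_on S f"
  unfolding smooth_on_def
proof (rule allI, rule Ck_on_local)
  fix k x assume "x \<in> S"
  then show "\<exists>T. open T \<and> x \<in> T \<and> Ck_on k T f" using assms[of x] by (auto simp: smooth_on_def)
qed

lemma smooth_on_const: "smooth_on S (\<lambda>x. c)"
  unfolding smooth_on_def by (intro allI Ck_on_const)

lemma smooth_on_linear: "bounded_linear f \<Longrightarrow> smooth_on S f"
  unfolding smooth_on_def by (intro allI Ck_on_linear)

lemma smooth_on_ident: "smooth_on S (\<lambda>x. x)"
  using smooth_on_linear[OF bounded_linear_ident] .

lemma smooth_on_bounded_linear:
  "bounded_linear L \<Longrightarrow> open S \<Longrightarrow> smooth_on S f \<Longrightarrow> smooth_on S (\<lambda>x. L (f x))"
  using Ck_on_bounded_linear[of L S _ f] by (auto simp: smooth_on_def)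

lemma smooth_on_add: "open S \<Longrightarrow> smooth_on S f \<Longrightarrow> smooth_on S g \<Longrightarrow> smooth_on S (\<lambda>x. f x + g x)"
  using Ck_on_add[of S _ f g] by (auto simp: smooth_on_def)

lemma smooth_on_minus: "open S \<Longrightarrow> smooth_on S f \<Longrightarrow> smooth_on S (\<lambda>x. - f x)"
  using smooth_on_bounded_linear[OF bounded_linear_minus[OF bounded_linear_ident]] .

lemma smooth_on_diff: "open S \<Longrightarrow> smooth_on S f \<Longrightarrow> smooth_on S g \<Longrightarrow> smooth_on S (\<lambda>x. f x - g x)"
  using smooth_on_add[of S f "\<lambda>x. - g x"] smooth_on_minus[of S g] by simp

lemma smooth_on_sum:
  "open S \<Longrightarrow> (\<And>i. i \<in> I \<Longrightarrow> smooth_on S (f i)) \<Longrightarrow> smooth_on S (\<lambda>x. \<Sum>i\<in>I. f i x)"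
  by (auto simp: smooth_on_def intro!: Ck_on_sum)

lemma smooth_on_mult:
  fixes f g :: "'v::euclidean_space \<Rightarrow> 'w::real_normed_algebra"
  shows "open S \<Longrightarrow> smooth_on S f \<Longrightarrow> smooth_on S g \<Longrightarrow> smooth_on S (\<lambda>x. f x * g x)"
  using Ck_on_bilinear[OF bounded_bilinear_mult, of S _ f g] by (auto simp: smooth_on_def)

lemma smooth_on_power2:
  fixes f :: "'v::euclidean_space \<Rightarrow> 'w::real_normed_algebra_1"
  shows "open S \<Longrightarrow> smooth_on S f \<Longrightarrow> smooth_on S (\<lambda>x. (f x)\<^sup>2)"
  unfolding power2_eq_square by (rule smooth_on_mult)

lemma smooth_on_scaleR:
  "open S \<Longrightarrow> smooth_on S f \<Longrightarrow> smooth_on S g \<Longrightarrow> smooth_on S (\<lambda>x. f x *\<^sub>R g x)"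
  using Ck_on_bilinear[OF bounded_bilinear_scaleR, of S _ f g] by (auto simp: smooth_on_def)

lemma smooth_on_compose:
  fixes f :: "'v::euclidean_space \<Rightarrow> 'u::euclidean_space" and g :: "'u \<Rightarrow> 'w::real_normed_vector"
  shows "open S \<Longrightarrow> smooth_on T g \<Longrightarrow> smooth_on S f \<Longrightarrow> (\<And>x. x \<in> S \<Longrightarrow> f x \<in> T) \<Longrightarrow>
    smooth_on S (\<lambda>x. g (f x))"
  by (auto simp: smooth_on_def intro!: Ck_on_compose[of S _ T g f])

lemma smooth_on_fst: "open S \<Longrightarrow> smooth_on S f \<Longrightarrow> smooth_on S (\<lambda>x. fst (f x))"
  by (rule smooth_on_bounded_linear[OF bounded_linear_fst])

lemma smooth_on_snd: "open S \<Longrightarrow> smooth_on S f \<Longrightarrow> smooth_on S (\<lambda>x. snd (f x))"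
  by (rule smooth_on_bounded_linear[OF bounded_linear_snd])

lemma smooth_on_cnj: "open S \<Longrightarrow> smooth_on S f \<Longrightarrow> smooth_on S (\<lambda>x. cnj (f x))"
  by (rule smooth_on_bounded_linear[OF bounded_linear_cnj])

lemma smooth_on_of_real: "open S \<Longrightarrow> smooth_on S f \<Longrightarrow> smooth_on S (\<lambda>x. of_real (f x) :: complex)"
  by (rule smooth_on_bounded_linear[OF bounded_linear_of_real])

lemma smooth_on_Pair:
  assumes "open S" "smooth_on S f" "smooth_on S g" shows "smooth_on S (\<lambda>x. (f x, g x))"
proof -
  have "bounded_linear (\<lambda>x. (x, 0))" "bounded_linear (\<lambda>x. (0, x))"
    by (auto intro!: bounded_linear_Pair bounded_linear_ident bounded_linear_zero)
  then have "smooth_on S (\<lambda>x. (f x, 0) + (0, g x))"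
    using assms by (intro smooth_on_add smooth_on_bounded_linear[of "\<lambda>x. (x, 0)"]
        smooth_on_bounded_linear[of "\<lambda>x. (0, x)"]) auto
  then show ?thesis by simp
qed

lemma smooth_on_differentiable: "smooth_on S f \<Longrightarrow> x \<in> S \<Longrightarrow> f differentiable (at x)"
  unfolding smooth_on_def by (metis Ck_on.simps(2))

lemma smooth_on_has_derivative:
  "smooth_on S f \<Longrightarrow> x \<in> S \<Longrightarrow> (f has_derivative frechet_derivative f (at x)) (at x)"
  using smooth_on_differentiable frechet_derivative_works by blast

lemma smooth_on_continuous: "smooth_on S f \<Longrightarrow> continuous_on S f"
  unfolding smooth_on_def by (metis Ck_on.simps(1))

lemma smooth_on_dird:
  assumes "open S" "smooth_on S f" shows "smooth_on S (dird f v)"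
proof -
  have "smooth_on S (dird f b)" if "b \<in> Basis" for b
    using assms(2) that unfolding smooth_on_def by (metis Ck_on.simps(2))
  then have "smooth_on S (\<lambda>x. \<Sum>b\<in>Basis. (v \<bullet> b) *\<^sub>R dird f b x)"
    by (intro smooth_on_sum smooth_on_scaleR smooth_on_const assms) auto
  moreover have "(\<Sum>b\<in>Basis. (v \<bullet> b) *\<^sub>R dird f b x) = dird f v x" if "x \<in> S" for x
  proof -
    have lin: "linear (frechet_derivative f (at x))"
      using smooth_on_has_derivative[OF assms(2) that] has_derivative_linear by blast
    show ?thesis
      using linear_sum[OF lin, of "\<lambda>c. (v \<bullet> c) *\<^sub>R c" Basis]
      by (simp add: linear_scale[OF lin] euclidean_representation)
  qed
  ultimately show ?thesis by (rule smooth_on_cong[OF assms(1), rotated])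
qed

text \<open>Induction on the order: the derivative in direction \<open>b\<close> is
  \<open>deriv f * b\<close>, which is again holomorphic.\<close>

lemma smooth_on_holomorphic:
  assumes "open S" "f holomorphic_on S" shows "smooth_on S f"
proof -
  have "Ck_on k S f" for k
    using assms(2)
  proof (induction k arbitrary: f)
    case 0 then show ?case by (simp add: holomorphic_on_imp_continuous_on)
  next
    case (Suc k)
    show ?case
    proof (rule Ck_on_SucI'[OF assms(1)])
      show "(f has_derivative (\<lambda>h. deriv f x * h)) (at x)" if "x \<in> S" for x
        using holomorphic_derivI[OF Suc.prems assms(1) that] by (simp add: has_field_derivative_def)
      show "Ck_on k S (\<lambda>x. deriv f x * b)" for b
        by (intro Suc.IH holomorphic_intros holomorphic_deriv Suc.prems assms(1))
    qed
  qed
  then show ?thesis by (simp add: smooth_on_def)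
qed

lemma smooth_on_inverse:
  fixes f :: "'v::euclidean_space \<Rightarrow> complex"
  assumes "open S" "smooth_on S f" "\<And>x. x \<in> S \<Longrightarrow> f x \<noteq> 0"
  shows "smooth_on S (\<lambda>x. inverse (f x))"
  by (rule smooth_on_compose[where T = "- {0}"])
     (use assms in \<open>auto intro!: smooth_on_holomorphic holomorphic_intros\<close>)

lemma smooth_on_divide:
  fixes f :: "'v::euclidean_space \<Rightarrow> complex"
  assumes "open S" "smooth_on S f" "smooth_on S g" "\<And>x. x \<in> S \<Longrightarrow> g x \<noteq> 0"
  shows "smooth_on S (\<lambda>x. f x / g x)"
  unfolding divide_inverse by (intro smooth_on_mult smooth_on_inverse assms)

lemmas smooth_intros = smooth_on_const smooth_on_ident smooth_on_add smooth_on_minus smooth_on_diff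
  smooth_on_mult smooth_on_power2 smooth_on_scaleR smooth_on_fst smooth_on_snd smooth_on_cnj
  smooth_on_of_real smooth_on_Pair smooth_on_sum smooth_on_divide

text \<open>The second difference over a small square is close to the mixed second derivative, and it is
  symmetric in the two directions.\<close>

lemma second_difference_bound:
  fixes g :: "'v::euclidean_space \<Rightarrow> real"
  assumes "open S" "smooth_on S g" "x \<in> S" "0 < e"
  shows "\<exists>d>0. \<forall>h. 0 < h \<and> h < d \<longrightarrow>
    \<bar>(g (x + h *\<^sub>R a + h *\<^sub>R b) - g (x + h *\<^sub>R a) - g (x + h *\<^sub>R b) + g x) / h\<^sup>2
      - dird (dird g a) b x\<bar> < e"
proof -
  have sm: "smooth_on S (dird g a)" "smooth_on S (dird (dird g a) b)"
    using assms(1,2) smooth_on_dird by blast+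
  have "isCont (dird (dird g a) b) x"
    using smooth_on_continuous[OF sm(2)] assms(1,3) continuous_on_eq_continuous_at by blast
  then obtain d1 where d1: "d1 > 0" "\<And>y. dist y x < d1 \<Longrightarrow>
      \<bar>dird (dird g a) b y - dird (dird g a) b x\<bar> < e"
    using assms(4) unfolding continuous_at_eps_delta by (auto simp: dist_norm)
  obtain d2 where d2: "d2 > 0" "ball x d2 \<subseteq> S" using assms(1,3) open_contains_ball by blast
  \<comment> \<open>Every point of the parallelogram with sides \<open>h a\<close> and
    \<open>h b\<close>, \<open>h < d\<close>, lies within \<open>min d1 d2\<close> of
    \<open>x\<close>; the summand 1 keeps the denominator positive.\<close>
  define d where "d = min d1 d2 / (norm a + norm b + 1)"
  have pos: "norm a + norm b + 1 > 0" by (simp add: add_nonneg_pos)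
  have d: "d > 0" using d1(1) d2(1) pos by (simp add: d_def)
  have near: "dist (x + s *\<^sub>R a + t *\<^sub>R b) x < min d1 d2"
    if "0 \<le> s" "s \<le> h" "0 \<le> t" "t \<le> h" "h < d" for s t h
  proof -
    have "norm (s *\<^sub>R a + t *\<^sub>R b) \<le> s * norm a + t * norm b"
      using norm_triangle_ineq[of "s *\<^sub>R a" "t *\<^sub>R b"] that by simp
    also have "\<dots> \<le> h * (norm a + norm b)"
      using that by (simp add: distrib_left add_mono mult_right_mono)
    also have "\<dots> \<le> h * (norm a + norm b + 1)" using that by (simp add: mult_left_mono)
    also have "\<dots> < d * (norm a + norm b + 1)" using that pos by (simp add: mult_strict_right_mono)
    finally show ?thesis using pos by (simp add: d_def dist_norm add.assoc)
  qed
  have inS: "x + s *\<^sub>R a + t *\<^sub>R b \<in> S"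
    if "0 \<le> s" "s \<le> h" "0 \<le> t" "t \<le> h" "h < d" for s t h
    using near[OF that] d2(2) by (auto simp: dist_commute subset_iff)
  have along: "((\<lambda>s. f (p + s *\<^sub>R c)) has_real_derivative dird f c (p + s *\<^sub>R c)) (at s)"
    if "smooth_on S f" "p + s *\<^sub>R c \<in> S" for f :: "'v \<Rightarrow> real" and p c s
  proof -
    have f: "(f has_derivative frechet_derivative f (at (p + s *\<^sub>R c))) (at (p + s *\<^sub>R c))"
      using smooth_on_has_derivative[OF that] .
    have "((\<lambda>s. p + s *\<^sub>R c) has_derivative (\<lambda>s. s *\<^sub>R c)) (at s)"
      by (auto intro!: derivative_eq_intros)
    from has_derivative_compose[OF this f]
    have "((\<lambda>s. f (p + s *\<^sub>R c)) has_derivative (\<lambda>h. dird f (h *\<^sub>R c) (p + s *\<^sub>R c))) (at s)" .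
    moreover have "(\<lambda>h. dird f (h *\<^sub>R c) (p + s *\<^sub>R c)) = (*) (dird f c (p + s *\<^sub>R c))"
      by (rule ext) (simp add: linear_scale[OF has_derivative_linear[OF f]])
    ultimately show ?thesis unfolding has_field_derivative_def by simp
  qed
  show ?thesis
  proof (intro exI[of _ d] conjI allI impI d)
    fix h assume h: "0 < h \<and> h < d"
    \<comment> \<open>The second difference is \<open>u h - u 0\<close>; the mean value theorem is
      applied to \<open>u\<close> along \<open>a\<close> and then to the resulting first derivative
      along \<open>b\<close>.\<close>
    define u where "u s = g (x + h *\<^sub>R b + s *\<^sub>R a) - g (x + s *\<^sub>R a)" for s
    have "\<exists>s. 0 < s \<and> s < h \<and> u h - u 0
        = (h - 0) * (dird g a (x + h *\<^sub>R b + s *\<^sub>R a) - dird g a (x + s *\<^sub>R a))"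
    proof (rule MVT2)
      fix s assume s: "0 \<le> s" "s \<le> h"
      show "(u has_real_derivative
          dird g a (x + h *\<^sub>R b + s *\<^sub>R a) - dird g a (x + s *\<^sub>R a)) (at s)"
        unfolding u_def
        by (intro DERIV_diff along assms(2))
           (use inS[of s h h] inS[of s h 0] s h in \<open>auto simp: algebra_simps\<close>)
    qed (use h in auto)
    then obtain s where s: "0 < s" "s < h" and us: "u h - u 0
        = h * (dird g a (x + h *\<^sub>R b + s *\<^sub>R a) - dird g a (x + s *\<^sub>R a))" by auto
    have "\<exists>t. 0 < t \<and> t < h \<and> dird g a (x + s *\<^sub>R a + h *\<^sub>R b) - dird g a (x + s *\<^sub>R a + 0 *\<^sub>R b)
       = (h - 0) * dird (dird g a) b (x + s *\<^sub>R a + t *\<^sub>R b)"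
      by (rule MVT2) (use h s inS[of s h] in \<open>auto intro!: along sm\<close>)
    then obtain t where t: "0 < t" "t < h" and
      ut: "dird g a (x + s *\<^sub>R a + h *\<^sub>R b) - dird g a (x + s *\<^sub>R a)
       = h * dird (dird g a) b (x + s *\<^sub>R a + t *\<^sub>R b)" by auto
    have "u h - u 0 = h * (h * dird (dird g a) b (x + s *\<^sub>R a + t *\<^sub>R b))"
      using us ut by (simp add: ac_simps)
    then have "(u h - u 0) / h\<^sup>2 = dird (dird g a) b (x + s *\<^sub>R a + t *\<^sub>R b)"
      using h by (simp add: power2_eq_square)
    moreover have "u h - u 0 = g (x + h *\<^sub>R a + h *\<^sub>R b) - g (x + h *\<^sub>R a) - g (x + h *\<^sub>R b) + g x"
      by (simp add: u_def algebra_simps)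
    ultimately show "\<bar>(g (x + h *\<^sub>R a + h *\<^sub>R b) - g (x + h *\<^sub>R a) - g (x + h *\<^sub>R b) + g x) / h\<^sup>2
      - dird (dird g a) b x\<bar> < e"
      using d1(2) near[of s h t] s t h by simp
  qed
qed

lemma dird_commute_real:
  fixes g :: "'v::euclidean_space \<Rightarrow> real"
  assumes "open S" "smooth_on S g" "x \<in> S"
  shows "dird (dird g a) b x = dird (dird g b) a x"
proof (rule ccontr)
  define e where "e = \<bar>dird (dird g a) b x - dird (dird g b) a x\<bar> / 2"
  assume "\<not> ?thesis"
  then have e: "e > 0" by (simp add: e_def)
  obtain d1 where d1: "d1 > 0" "\<And>h. 0 < h \<and> h < d1 \<Longrightarrow>
    \<bar>(g (x + h *\<^sub>R a + h *\<^sub>R b) - g (x + h *\<^sub>R a) - g (x + h *\<^sub>R b) + g x) / h\<^sup>2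
      - dird (dird g a) b x\<bar> < e"
    using second_difference_bound[OF assms e, of a b] by blast
  obtain d2 where d2: "d2 > 0" "\<And>h. 0 < h \<and> h < d2 \<Longrightarrow>
    \<bar>(g (x + h *\<^sub>R b + h *\<^sub>R a) - g (x + h *\<^sub>R b) - g (x + h *\<^sub>R a) + g x) / h\<^sup>2
      - dird (dird g b) a x\<bar> < e"
    using second_difference_bound[OF assms e, of b a] by blast
  define h where "h = min d1 d2 / 2"
  have h: "0 < h \<and> h < d1" "0 < h \<and> h < d2" using d1(1) d2(1) by (auto simp: h_def)
  have "g (x + h *\<^sub>R b + h *\<^sub>R a) - g (x + h *\<^sub>R b) - g (x + h *\<^sub>R a) + g x
      = g (x + h *\<^sub>R a + h *\<^sub>R b) - g (x + h *\<^sub>R a) - g (x + h *\<^sub>R b) + g x"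
    by (simp add: algebra_simps)
  then show False using d1(2)[OF h(1)] d2(2)[OF h(2)] unfolding e_def by (simp add: field_simps) argo
qed

lemma dird_bounded_linear:
  assumes "open S" "smooth_on S f" "bounded_linear L" "x \<in> S"
  shows "dird (\<lambda>x. L (f x)) b x = L (dird f b x)"
  using frechet_derivative_at[OF bounded_linear.has_derivative[OF assms(3)
      smooth_on_has_derivative[OF assms(2,4)]]] by metis

lemma dird_cong:
  assumes "open S" "\<And>x. x \<in> S \<Longrightarrow> f x = g x" "f differentiable (at x)" "x \<in> S"
  shows "dird f b x = dird g b x"
  using frechet_derivative_transform_within_open[of f x S g] assms by simp

text \<open>The mean value argument is for real functions, so the identity is tested on real and
  imaginary parts.\<close>

lemma dird_commute:
  fixes g :: "'v::euclidean_space \<Rightarrow> complex"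
  assumes "open S" "smooth_on S g" "x \<in> S"
  shows "dird (dird g a) b x = dird (dird g b) a x"
proof -
  have *: "dird (dird (\<lambda>x. L (g x)) a) b x = L (dird (dird g a) b x)"
    if "bounded_linear L" for L :: "complex \<Rightarrow> real" and a b
  proof -
    have sm: "smooth_on S (\<lambda>x. L (g x))" using smooth_on_bounded_linear[OF that assms(1,2)] .
    have "dird (dird (\<lambda>x. L (g x)) a) b x = dird (\<lambda>x. L (dird g a x)) b x"
      by (rule dird_cong[OF assms(1) dird_bounded_linear[OF assms(1,2) that]
          smooth_on_differentiable[OF smooth_on_dird[OF assms(1) sm] assms(3)] assms(3)])
    then show ?thesis using dird_bounded_linear[OF assms(1) smooth_on_dird[OF assms(1,2)] that assms(3)]
      by simp
  qed
  have "L (dird (dird g a) b x) = L (dird (dird g b) a x)"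
    if "bounded_linear L" for L :: "complex \<Rightarrow> real"
    using *[OF that] dird_commute_real[OF assms(1) smooth_on_bounded_linear[OF that assms(1,2)] assms(3)]
    by metis
  from this[OF bounded_linear_Re] this[OF bounded_linear_Im] show ?thesis
    by (simp add: complex_eq_iff)
qed

section \<open>Wirtinger derivatives\<close>

text \<open>Differentiability bundled with both Wirtinger coefficients: one derivative rule then
  computes \<open>pd\<close> and \<open>pdb\<close> together, without separate differentiability
  conditions.\<close>

definition has_wirt :: "(complex \<Rightarrow> complex) \<Rightarrow> complex \<Rightarrow> complex \<Rightarrow> complex \<Rightarrow> bool" where
  "has_wirt f p q z \<longleftrightarrow> (f has_derivative (\<lambda>h. p * h + q * cnj h)) (at z)"

lemma has_wirt_unique:
  assumes "has_wirt f p q z" shows "pd f z = p" "pdb f z = q"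
proof -
  have "frechet_derivative f (at z) = (\<lambda>h. p * h + q * cnj h)"
    using assms frechet_derivative_at unfolding has_wirt_def by metis
  then show "pd f z = p" "pdb f z = q" by (simp_all add: pd_def pdb_def algebra_simps)
qed

text \<open>A real-linear map of the plane is the sum of a complex-linear and an antilinear one,
  both read off from its values at \<open>1\<close> and \<open>\<i>\<close>.\<close>

lemma linear_wirt:
  assumes "linear D"
  shows "D h = (D 1 - \<i> * D \<i>) / 2 * h + (D 1 + \<i> * D \<i>) / 2 * cnj h"
proof -
  have "Re h *\<^sub>R 1 + Im h *\<^sub>R \<i> = h" by (simp add: complex_eq_iff)
  then have "D h = D (Re h *\<^sub>R 1 + Im h *\<^sub>R \<i>)" by simp
  also have "\<dots> = of_real (Re h) * D 1 + of_real (Im h) * D \<i>"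
    unfolding linear_add[OF assms] linear_scale[OF assms] by (simp add: scaleR_conv_of_real)
  also have "\<dots> = (D 1 - \<i> * D \<i>) / 2 * h + (D 1 + \<i> * D \<i>) / 2 * cnj h"
    by (simp add: complex_eq_iff field_simps)
  finally show ?thesis .
qed

lemma has_wirt_pd:
  assumes "f differentiable (at z)" shows "has_wirt f (pd f z) (pdb f z) z"
proof -
  have f: "(f has_derivative frechet_derivative f (at z)) (at z)"
    using assms frechet_derivative_works by blast
  have "frechet_derivative f (at z) = (\<lambda>h. pd f z * h + pdb f z * cnj h)"
    using linear_wirt[OF has_derivative_linear[OF f]] unfolding pd_def pdb_def by blast
  then show ?thesis using f unfolding has_wirt_def by simp
qed

lemma has_wirt_cong:
  assumes "has_wirt f p q z" "open S" "z \<in> S" "\<And>y. y \<in> S \<Longrightarrow> f y = g y"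
  shows "has_wirt g p q z"
  using has_derivative_transform_within_open[of f _ z UNIV S g] assms unfolding has_wirt_def by simp

lemma has_wirt_eq: "has_wirt f p q z \<Longrightarrow> p = p' \<Longrightarrow> q = q' \<Longrightarrow> has_wirt f p' q' z"
  by simp

lemma has_wirt_const: "has_wirt (\<lambda>z. c) 0 0 z"
  by (simp add: has_wirt_def)

lemma has_wirt_ident: "has_wirt (\<lambda>z. z) 1 0 z"
  by (simp add: has_wirt_def)

lemma has_wirt_add: "has_wirt f p q z \<Longrightarrow> has_wirt g p' q' z \<Longrightarrow> has_wirt (\<lambda>z. f z + g z) (p + p') (q + q') z"
  unfolding has_wirt_def by (auto intro!: derivative_eq_intros simp: algebra_simps)

lemma has_wirt_minus: "has_wirt f p q z \<Longrightarrow> has_wirt (\<lambda>z. - f z) (- p) (- q) z"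
  unfolding has_wirt_def by (auto intro!: derivative_eq_intros simp: algebra_simps)

lemma has_wirt_diff: "has_wirt f p q z \<Longrightarrow> has_wirt g p' q' z \<Longrightarrow> has_wirt (\<lambda>z. f z - g z) (p - p') (q - q') z"
  unfolding has_wirt_def by (auto intro!: derivative_eq_intros simp: algebra_simps)

lemma has_wirt_mult: "has_wirt f p q z \<Longrightarrow> has_wirt g p' q' z \<Longrightarrow>
    has_wirt (\<lambda>z. f z * g z) (p * g z + f z * p') (q * g z + f z * q') z"
  unfolding has_wirt_def by (auto intro!: derivative_eq_intros simp: algebra_simps)

lemma has_wirt_cnj: "has_wirt f p q z \<Longrightarrow> has_wirt (\<lambda>z. cnj (f z)) (cnj q) (cnj p) z"
  unfolding has_wirt_def by (auto intro!: derivative_eq_intros simp: algebra_simps)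

lemma has_wirt_compose: "has_wirt f p q (g z) \<Longrightarrow> has_wirt g p' q' z \<Longrightarrow>
    has_wirt (\<lambda>z. f (g z)) (p * p' + q * cnj q') (p * q' + q * cnj p') z"
  unfolding has_wirt_def
  by (drule (1) has_derivative_compose) (simp add: algebra_simps)

lemma has_wirt_field: "(f has_field_derivative f') (at z) \<Longrightarrow> has_wirt f f' 0 z"
  by (simp add: has_wirt_def has_field_derivative_def)

lemma has_wirt_compose_field: "(f has_field_derivative f') (at (g z)) \<Longrightarrow> has_wirt g p q z \<Longrightarrow>
    has_wirt (\<lambda>z. f (g z)) (f' * p) (f' * q) z"
  using has_wirt_compose[OF has_wirt_field] by fastforce

lemma has_wirt_holomorphic: "f holomorphic_on S \<Longrightarrow> open S \<Longrightarrow> z \<in> S \<Longrightarrow> has_wirt f (deriv f z) 0 z"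
  using holomorphic_derivI has_wirt_field by blast

lemma has_wirt_compose_holomorphic:
  "f holomorphic_on S \<Longrightarrow> open S \<Longrightarrow> g z \<in> S \<Longrightarrow> has_wirt g p q z \<Longrightarrow>
    has_wirt (\<lambda>z. f (g z)) (deriv f (g z) * p) (deriv f (g z) * q) z"
  using holomorphic_derivI has_wirt_compose_field by blast

lemma has_wirt_inverse:
  assumes "has_wirt f p q z" "f z \<noteq> 0"
  shows "has_wirt (\<lambda>z. inverse (f z)) (- (p / (f z)\<^sup>2)) (- (q / (f z)\<^sup>2)) z"
proof -
  have "(inverse has_field_derivative - (inverse (f z) ^ Suc (Suc 0))) (at (f z))"
    by (rule DERIV_inverse[OF assms(2)])
  from has_wirt_compose_field[OF this assms(1)] show ?thesis
    by (rule has_wirt_eq) (auto simp: field_simps power2_eq_square)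
qed

lemma has_wirt_divide:
  assumes "has_wirt f p q z" "has_wirt g p' q' z" "g z \<noteq> 0"
  shows "has_wirt (\<lambda>z. f z / g z) ((p - f z / g z * p') / g z) ((q - f z / g z * q') / g z) z"
proof -
  have "has_wirt (\<lambda>z. f z * inverse (g z)) ((p - f z / g z * p') / g z) ((q - f z / g z * q') / g z) z"
    by (rule has_wirt_eq[OF has_wirt_mult[OF assms(1) has_wirt_inverse[OF assms(2,3)]]])
       (use assms(3) in \<open>auto simp: field_simps power2_eq_square\<close>)
  then show ?thesis by (simp add: divide_inverse)
qed

lemma smooth_on_has_wirt: "smooth_on S f \<Longrightarrow> z \<in> S \<Longrightarrow> has_wirt f (pd f z) (pdb f z) z"
  using has_wirt_pd smooth_on_differentiable by blast

lemma smooth_on_pd: "open S \<Longrightarrow> smooth_on S f \<Longrightarrow> smooth_on S (pd f)"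
  and smooth_on_pdb: "open S \<Longrightarrow> smooth_on S f \<Longrightarrow> smooth_on S (pdb f)"
  unfolding pd_def[abs_def] pdb_def[abs_def]
  by (intro smooth_intros smooth_on_dird; simp)+

lemma pd_cong:
  assumes "open S" "\<And>x. x \<in> S \<Longrightarrow> f x = g x" "smooth_on S f" "z \<in> S"
  shows "pd g z = pd f z" "pdb g z = pdb f z"
  using has_wirt_unique[OF has_wirt_cong[OF smooth_on_has_wirt[OF assms(3,4)] assms(1,4,2)]] by auto

text \<open>Both sides are a quarter of the Laplacian once the mixed derivatives in the directions
  \<open>1\<close> and \<open>\<i>\<close> agree.\<close>

lemma pd_pdb_commute:
  assumes "open S" "smooth_on S f" "z \<in> S"
  shows "pdb (pd f) z = pd (pdb f) z"
proof -
  have w: "has_wirt (\<lambda>z. dird f b z) (pd (dird f b) z) (pdb (dird f b) z) z" for b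
    using smooth_on_has_wirt[OF smooth_on_dird[OF assms(1,2)] assms(3)] .
  have c2: "(2::complex) \<noteq> 0" by simp
  have 1: "pdb (pd f) z = (pdb (dird f 1) z - \<i> * pdb (dird f \<i>) z) / 2"
    unfolding pd_def[abs_def]
    using has_wirt_unique(2)[OF has_wirt_divide[OF has_wirt_diff[OF w[of 1]
        has_wirt_mult[OF has_wirt_const[of \<i>] w[of \<i>]]] has_wirt_const c2]] by simp
  have 2: "pd (pdb f) z = (pd (dird f 1) z + \<i> * pd (dird f \<i>) z) / 2"
    unfolding pdb_def[abs_def]
    using has_wirt_unique(1)[OF has_wirt_divide[OF has_wirt_add[OF w[of 1]
        has_wirt_mult[OF has_wirt_const[of \<i>] w[of \<i>]]] has_wirt_const c2]] by simp
  show ?thesis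
    unfolding 1 2 unfolding pd_def pdb_def
    using dird_commute[OF assms, of 1 \<i>] by (simp add: field_simps)
qed

section \<open>Charts, logarithms and families\<close>

locale rsurface =
  fixes X :: "('a, 'i) surface"
  assumes rs: "riemann_surface X"
begin

lemma patch_open: "i \<in> idx X \<Longrightarrow> openin (surf X) (patch X i)"
  using rs by (auto simp: riemann_surface_def)

lemma patch_subset: "i \<in> idx X \<Longrightarrow> patch X i \<subseteq> topspace (surf X)"
  using patch_open openin_subset by blast

lemma topspace_covered: "x \<in> topspace (surf X) \<Longrightarrow> \<exists>i\<in>idx X. x \<in> patch X i"
  using rs unfolding riemann_surface_def by blast

lemma dom_single: "dom_of X [i] = coord X i ` patch X i"
  by (simp add: dom_of_def overlap_def)

lemma chart_homeo: "i \<in> idx X \<Longrightarrow> homeomorphic_map (subtopology (surf X) (patch X i))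
    (top_of_set (dom_of X [i])) (coord X i)"
  using rs by (auto simp: riemann_surface_def dom_single)

lemma open_dom_single: "i \<in> idx X \<Longrightarrow> open (dom_of X [i])"
  using rs by (auto simp: riemann_surface_def dom_single)

lemma coord_inj: "i \<in> idx X \<Longrightarrow> inj_on (coord X i) (patch X i)"
  using homeomorphic_imp_injective_map[OF chart_homeo] patch_subset
  by (metis topspace_subtopology inf.absorb2)

lemma coord_inv_coord [simp]: "i \<in> idx X \<Longrightarrow> x \<in> patch X i \<Longrightarrow> coord_inv X i (coord X i x) = x"
  unfolding coord_inv_def using coord_inj inv_into_f_f by fast

lemma coord_coord_inv [simp]: "z \<in> dom_of X [i] \<Longrightarrow> coord X i (coord_inv X i z) = z"
  unfolding coord_inv_def dom_single by (rule f_inv_into_f)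

lemma coord_inv_patch [simp]: "z \<in> dom_of X [i] \<Longrightarrow> coord_inv X i z \<in> patch X i"
  unfolding coord_inv_def dom_single by (rule inv_into_into)

lemma coord_dom [simp]: "x \<in> patch X i \<Longrightarrow> coord X i x \<in> dom_of X [i]"
  by (simp add: dom_single)

lemma coord_inv_topspace: "i \<in> idx X \<Longrightarrow> z \<in> dom_of X [i] \<Longrightarrow> coord_inv X i z \<in> topspace (surf X)"
  using patch_subset coord_inv_patch by blast

text \<open>Replaces membership in the image of an intersection by conditions on the inverse chart,
  the form in which overlaps are handled from here on.\<close>

lemma dom_of_iff:
  assumes "K \<noteq> []" "set K \<subseteq> idx X"
  shows "z \<in> dom_of X K \<longleftrightarrow> z \<in> dom_of X [last K] \<and> (\<forall>k\<in>set K. coord_inv X (last K) z \<in> patch X k)"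
proof
  assume "z \<in> dom_of X K"
  then obtain x where x: "z = coord X (last K) x" "x \<in> overlap X K" by (auto simp: dom_of_def)
  have "x \<in> patch X (last K)" "last K \<in> idx X" using assms x(2) by (auto simp: overlap_def)
  then show "z \<in> dom_of X [last K] \<and> (\<forall>k\<in>set K. coord_inv X (last K) z \<in> patch X k)"
    using x by (auto simp: overlap_def)
next
  assume "z \<in> dom_of X [last K] \<and> (\<forall>k\<in>set K. coord_inv X (last K) z \<in> patch X k)"
  then show "z \<in> dom_of X K"
    unfolding dom_of_def[of X K] overlap_def
    by (intro image_eqI[of _ _ "coord_inv X (last K) z"]) auto
qed

lemma dom_of2: "i \<in> idx X \<Longrightarrow> j \<in> idx X \<Longrightarrow>
    z \<in> dom_of X [i, j] \<longleftrightarrow> z \<in> dom_of X [j] \<and> coord_inv X j z \<in> patch X i"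
  by (subst dom_of_iff) auto

lemma dom_of3: "i \<in> idx X \<Longrightarrow> j \<in> idx X \<Longrightarrow> k \<in> idx X \<Longrightarrow>
    z \<in> dom_of X [i, j, k] \<longleftrightarrow> z \<in> dom_of X [k] \<and> coord_inv X k z \<in> patch X i \<and> coord_inv X k z \<in> patch X j"
  by (subst dom_of_iff) auto

lemma dom_of4: "i \<in> idx X \<Longrightarrow> j \<in> idx X \<Longrightarrow> k \<in> idx X \<Longrightarrow> l \<in> idx X \<Longrightarrow>
    z \<in> dom_of X [i, j, k, l] \<longleftrightarrow> z \<in> dom_of X [l] \<and> coord_inv X l z \<in> patch X i \<and>
      coord_inv X l z \<in> patch X j \<and> coord_inv X l z \<in> patch X k"
  by (subst dom_of_iff) auto

lemma open_chart_preimage: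
  assumes "i \<in> idx X" "openin (surf X) U"
  shows "open {z \<in> dom_of X [i]. coord_inv X i z \<in> U}"
proof -
  have "openin (subtopology (surf X) (patch X i)) (patch X i \<inter> U)"
    using assms openin_subtopology_Int2 by blast
  moreover have "open_map (subtopology (surf X) (patch X i)) (top_of_set (dom_of X [i])) (coord X i)"
    using homeomorphic_imp_open_map[OF chart_homeo[OF assms(1)]] .
  ultimately have "openin (top_of_set (dom_of X [i])) (coord X i ` (patch X i \<inter> U))"
    unfolding open_map_def by blast
  then have "open (coord X i ` (patch X i \<inter> U))"
    using open_dom_single[OF assms(1)] openin_open_trans by blast
  moreover have "coord X i ` (patch X i \<inter> U) = {z \<in> dom_of X [i]. coord_inv X i z \<in> U}"
    using assms(1) by (auto simp: dom_single)
  ultimately show ?thesis by simp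
qed

text \<open>Joint continuity in time and point, read in a chart. The sets of pairs obtained in this
  way are the domains on which moving maps are differentiated.\<close>

lemma open_family_preimage:
  assumes c: "continuous_map (prod_topology (top_of_set I) (surf X)) Z (\<lambda>(t, x). F t x)" and I: "open I"
    and i: "i \<in> idx X" and U: "openin Z U"
  shows "open {(t::real, \<zeta>). t \<in> I \<and> \<zeta> \<in> dom_of X [i] \<and> F t (coord_inv X i \<zeta>) \<in> U}"
proof (subst open_subopen, rule ballI)
  let ?P = "prod_topology (top_of_set I) (surf X)"
  have o: "openin ?P {p \<in> topspace ?P. (\<lambda>(t, x). F t x) p \<in> U}"
    by (rule openin_continuous_map_preimage[OF c U])
  fix p assume "p \<in> {(t, \<zeta>). t \<in> I \<and> \<zeta> \<in> dom_of X [i] \<and> F t (coord_inv X i \<zeta>) \<in> U}"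
  then obtain t z where p: "p = (t, z)" "t \<in> I" "z \<in> dom_of X [i]" "F t (coord_inv X i z) \<in> U" by auto
  then have "(t, coord_inv X i z) \<in> {p \<in> topspace ?P. (\<lambda>(t, x). F t x) p \<in> U}"
    using coord_inv_topspace[OF i p(3)] by auto
  then obtain A B where AB: "openin (top_of_set I) A" "openin (surf X) B" "t \<in> A" "coord_inv X i z \<in> B"
    "A \<times> B \<subseteq> {p \<in> topspace ?P. (\<lambda>(t, x). F t x) p \<in> U}"
    using o unfolding openin_prod_topology_alt by meson
  have oA: "open A" using AB(1) openin_open_trans I by blast
  have oB: "open {\<zeta> \<in> dom_of X [i]. coord_inv X i \<zeta> \<in> B}" by (rule open_chart_preimage[OF i AB(2)])
  have "A \<times> {\<zeta> \<in> dom_of X [i]. coord_inv X i \<zeta> \<in> B} \<subseteq>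
      {(t, \<zeta>). t \<in> I \<and> \<zeta> \<in> dom_of X [i] \<and> F t (coord_inv X i \<zeta>) \<in> U}"
  proof clarify
    fix t \<zeta> assume "t \<in> A" "\<zeta> \<in> dom_of X [i]" "coord_inv X i \<zeta> \<in> B"
    then have "(t, coord_inv X i \<zeta>) \<in> {p \<in> topspace ?P. (\<lambda>(t, x). F t x) p \<in> U}" using AB(5) by blast
    then show "t \<in> I \<and> \<zeta> \<in> dom_of X [i] \<and> F t (coord_inv X i \<zeta>) \<in> U"
      using \<open>\<zeta> \<in> dom_of X [i]\<close> by auto
  qed
  moreover have "p \<in> A \<times> {\<zeta> \<in> dom_of X [i]. coord_inv X i \<zeta> \<in> B}" using p AB by simp
  moreover have "open (A \<times> {\<zeta> \<in> dom_of X [i]. coord_inv X i \<zeta> \<in> B})" by (rule open_Times[OF oA oB])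
  ultimately show "\<exists>T. open T \<and> p \<in> T \<and> T \<subseteq> {(t, \<zeta>). t \<in> I \<and> \<zeta> \<in> dom_of X [i] \<and> F t (coord_inv X i \<zeta>) \<in> U}"
    by blast
qed

lemma openin_chart:
  assumes "i \<in> idx X" "open V"
  shows "openin (surf X) {x \<in> patch X i. coord X i x \<in> V}"
proof -
  have "continuous_map (subtopology (surf X) (patch X i)) (top_of_set (dom_of X [i])) (coord X i)"
    using homeomorphic_imp_continuous_map[OF chart_homeo[OF assms(1)]] .
  moreover have "openin (top_of_set (dom_of X [i])) (dom_of X [i] \<inter> V)"
    using assms(2) openin_open by blast
  ultimately have "openin (subtopology (surf X) (patch X i))
      {x \<in> topspace (subtopology (surf X) (patch X i)). coord X i x \<in> dom_of X [i] \<inter> V}"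
    by (rule openin_continuous_map_preimage)
  then have "openin (surf X) {x \<in> topspace (subtopology (surf X) (patch X i)). coord X i x \<in> dom_of X [i] \<inter> V}"
    using patch_open[OF assms(1)] openin_trans_full by blast
  moreover have "{x \<in> topspace (subtopology (surf X) (patch X i)). coord X i x \<in> dom_of X [i] \<inter> V}
     = {x \<in> patch X i. coord X i x \<in> V}"
    using patch_subset[OF assms(1)] by auto
  ultimately show ?thesis by simp
qed

lemma open_dom:
  assumes "K \<noteq> []" "set K \<subseteq> idx X"
  shows "open (dom_of X K)"
proof -
  have *: "openin (surf X) (overlap X K)"
    unfolding overlap_def using assms patch_open by (intro openin_INT2) auto
  have "dom_of X K = {z \<in> dom_of X [last K]. coord_inv X (last K) z \<in> overlap X K}"
    using dom_of_iff[OF assms] by (auto simp: overlap_def)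
  moreover have "last K \<in> idx X" using assms last_in_set by blast
  ultimately show ?thesis using open_chart_preimage[OF _ *] by simp
qed

lemma open_dom2: "i \<in> idx X \<Longrightarrow> j \<in> idx X \<Longrightarrow> open (dom_of X [i, j])"
  and open_dom3: "i \<in> idx X \<Longrightarrow> j \<in> idx X \<Longrightarrow> k \<in> idx X \<Longrightarrow> open (dom_of X [i, j, k])"
  by (rule open_dom; simp)+

lemma trans_holo: "i \<in> idx X \<Longrightarrow> j \<in> idx X \<Longrightarrow> trans_fun X i j holomorphic_on dom_of X [i, j]"
  using rs by (auto simp: riemann_surface_def)

lemma trans_mem:
  assumes "i \<in> idx X" "j \<in> idx X" "z \<in> dom_of X [j]" "coord_inv X j z \<in> patch X i"
  shows "trans_fun X i j z \<in> dom_of X [i]" "coord_inv X i (trans_fun X i j z) = coord_inv X j z"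
  using assms by (simp_all add: trans_fun_def)

lemma trans_comp:
  assumes "i \<in> idx X" "j \<in> idx X" "k \<in> idx X" "z \<in> dom_of X [k]" "coord_inv X k z \<in> patch X j"
  shows "trans_fun X i j (trans_fun X j k z) = trans_fun X i k z"
  using assms trans_mem(2)[of j k z] by (simp add: trans_fun_def)

lemma trans_self: "z \<in> dom_of X [i] \<Longrightarrow> trans_fun X i i z = z"
  by (simp add: trans_fun_def)

lemma trans_deriv:
  assumes "i \<in> idx X" "j \<in> idx X" "z \<in> dom_of X [j]" "coord_inv X j z \<in> patch X i"
  shows "(trans_fun X i j has_field_derivative deriv (trans_fun X i j) z) (at z)"
  using holomorphic_derivI[OF trans_holo[OF assms(1,2)] open_dom2[OF assms(1,2)]] dom_of2 assms by blast

lemma trans_deriv_comp: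
  assumes "i \<in> idx X" "j \<in> idx X" "k \<in> idx X" "z \<in> dom_of X [k]"
    "coord_inv X k z \<in> patch X i" "coord_inv X k z \<in> patch X j"
  shows "deriv (trans_fun X i k) z = deriv (trans_fun X i j) (trans_fun X j k z) * deriv (trans_fun X j k) z"
proof -
  note m = trans_mem[OF assms(2,3,4,6)]
  have "((\<lambda>z. trans_fun X i j (trans_fun X j k z)) has_field_derivative
      deriv (trans_fun X i j) (trans_fun X j k z) * deriv (trans_fun X j k) z) (at z)"
    by (rule DERIV_chain2[OF trans_deriv trans_deriv]) (use assms m in auto)
  then have "(trans_fun X i k has_field_derivative
      deriv (trans_fun X i j) (trans_fun X j k z) * deriv (trans_fun X j k) z) (at z)"
    by (rule has_field_derivative_transform_within_open[OF _ open_dom3[OF assms(1-3)]])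
       (use assms dom_of3 trans_comp in auto)
  then show ?thesis by (rule DERIV_imp_deriv)
qed

text \<open>The transition functions in the two directions are mutually inverse, so by the chain
  rule the product of their derivatives is the derivative 1 of the identity.\<close>

lemma trans_deriv_nz:
  assumes "i \<in> idx X" "j \<in> idx X" "z \<in> dom_of X [j]" "coord_inv X j z \<in> patch X i"
  shows "deriv (trans_fun X i j) z \<noteq> 0"
proof -
  have "((\<lambda>z. z) has_field_derivative 1) (at z)" by simp
  then have "(trans_fun X j j has_field_derivative 1) (at z)"
    by (rule has_field_derivative_transform_within_open[OF _ open_dom_single[OF assms(2)] assms(3)])
       (simp add: trans_self)
  then have "deriv (trans_fun X j j) z = 1" by (rule DERIV_imp_deriv)
  then show ?thesis
    using trans_deriv_comp[OF assms(2,1,2,3)] assms by auto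
qed

lemma trans_smooth: "i \<in> idx X \<Longrightarrow> j \<in> idx X \<Longrightarrow> smooth_on (dom_of X [i, j]) (trans_fun X i j)"
  using smooth_on_holomorphic[OF open_dom2 trans_holo] by blast

lemma deriv_trans_holo: "i \<in> idx X \<Longrightarrow> j \<in> idx X \<Longrightarrow> deriv (trans_fun X i j) holomorphic_on dom_of X [i, j]"
  using holomorphic_deriv[OF trans_holo open_dom2] by blast

end

section \<open>Continuous branches of the logarithm\<close>

lemma log_branch_local:
  fixes L g :: "'v::metric_space \<Rightarrow> complex"
  assumes "open S" "continuous_on S L" "\<And>z. z \<in> S \<Longrightarrow> exp (L z) = g z" "z0 \<in> S"
  shows "\<exists>T. open T \<and> z0 \<in> T \<and> T \<subseteq> S \<and>
    (\<forall>z\<in>T. g z / g z0 \<notin> \<real>\<^sub>\<le>\<^sub>0 \<and> L z = L z0 + Ln (g z / g z0))"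
proof -
  \<comment> \<open>Radius 1 is below pi/2: a number whose imaginary part is smaller than pi/2 in
    modulus is recovered by \<open>Ln\<close> from its exponential, and that exponential has
    positive real part, hence avoids the cut.\<close>
  let ?T = "S \<inter> L -` ball (L z0) 1"
  have "open ?T" using assms(1,2) continuous_open_preimage by blast
  moreover have "g z / g z0 \<notin> \<real>\<^sub>\<le>\<^sub>0 \<and> L z = L z0 + Ln (g z / g z0)" if "z \<in> ?T" for z
  proof -
    let ?d = "L z - L z0"
    have "norm ?d < 1" using that by (simp add: dist_norm norm_minus_commute)
    then have im: "\<bar>Im ?d\<bar> < 1" using abs_Im_le_cmod[of ?d] by linarith
    have e: "exp ?d = g z / g z0" using assms(3,4) that by (simp add: exp_diff)
    have pi: "pi > 1" using pi_gt3 by simp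
    have ln: "Ln (exp ?d) = ?d" using im pi by (intro Ln_exp) auto
    have "exp ?d \<notin> \<real>\<^sub>\<le>\<^sub>0"
    proof
      assume "exp ?d \<in> \<real>\<^sub>\<le>\<^sub>0"
      then have "Re (exp ?d) \<le> 0" by (simp add: complex_nonpos_Reals_iff)
      moreover have "cos (Im ?d) > 0" using im pi_half_gt_zero pi_gt3 by (intro cos_gt_zero_pi) linarith+
      ultimately show False by (simp add: Re_exp mult_le_0_iff not_le)
    qed
    then show ?thesis using e ln by simp
  qed
  moreover have "z0 \<in> ?T" using assms(4) by simp
  ultimately show ?thesis by blast
qed

text \<open>Continuity of the branch is enough to make it, locally, a constant plus
  \<open>Ln\<close> of a quotient of values of \<open>g\<close>.\<close>

lemma smooth_on_log:
  fixes L g :: "'v::euclidean_space \<Rightarrow> complex"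
  assumes "open S" "continuous_on S L" "\<And>z. z \<in> S \<Longrightarrow> exp (L z) = g z" "smooth_on S g"
  shows "smooth_on S L"
proof (rule smooth_on_local)
  fix z0 assume z0: "z0 \<in> S"
  obtain T where T: "open T" "z0 \<in> T" "T \<subseteq> S"
    and eq: "\<And>z. z \<in> T \<Longrightarrow> g z / g z0 \<notin> \<real>\<^sub>\<le>\<^sub>0 \<and> L z = L z0 + Ln (g z / g z0)"
    using log_branch_local[OF assms(1-3) z0] by blast
  have nz: "g z0 \<noteq> 0" using assms(3)[OF z0] by (metis exp_not_eq_zero)
  have "smooth_on T (\<lambda>z. Ln (g z / g z0))"
  proof (rule smooth_on_compose[OF T(1), where T = "- \<real>\<^sub>\<le>\<^sub>0" and g = Ln])
    show "smooth_on (- \<real>\<^sub>\<le>\<^sub>0) Ln"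
      by (rule smooth_on_holomorphic) (auto intro!: holomorphic_intros open_Compl)
    show "smooth_on T (\<lambda>z. g z / g z0)"
      by (rule smooth_on_divide[OF T(1) smooth_on_subset[OF assms(4) T(3)] smooth_on_const nz])
  qed (use eq in auto)
  then have "smooth_on T (\<lambda>z. L z0 + Ln (g z / g z0))"
    by (rule smooth_on_add[OF T(1) smooth_on_const])
  then have "smooth_on T L" by (rule smooth_on_cong[OF T(1), rotated]) (use eq in auto)
  then show "\<exists>T. open T \<and> z0 \<in> T \<and> smooth_on T L" using T by blast
qed

lemma has_wirt_log:
  assumes "open S" "continuous_on S L" "\<And>z. z \<in> S \<Longrightarrow> exp (L z) = g z" "z0 \<in> S" "has_wirt g p q z0"
  shows "has_wirt L (p / g z0) (q / g z0) z0"
proof -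
  obtain T where T: "open T" "z0 \<in> T" "T \<subseteq> S"
    and eq: "\<And>z. z \<in> T \<Longrightarrow> g z / g z0 \<notin> \<real>\<^sub>\<le>\<^sub>0 \<and> L z = L z0 + Ln (g z / g z0)"
    using log_branch_local[OF assms(1-4)] by blast
  have nz: "g z0 \<noteq> 0" using assms(3,4) by (metis exp_not_eq_zero)
  have 1: "has_wirt (\<lambda>z. g z / g z0) (p / g z0) (q / g z0) z0"
    by (rule has_wirt_eq[OF has_wirt_divide[OF assms(5) has_wirt_const nz]]) auto
  have "(Ln has_field_derivative inverse (g z0 / g z0)) (at (g z0 / g z0))"
    using nz by (intro has_field_derivative_Ln) auto
  from has_wirt_compose_field[OF this 1]
  have "has_wirt (\<lambda>z. L z0 + Ln (g z / g z0)) (p / g z0) (q / g z0) z0"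
    using has_wirt_add[OF has_wirt_const[of "L z0"]] nz by fastforce
  then show ?thesis by (rule has_wirt_cong[OF _ T(1,2)]) (use eq in auto)
qed

lemma holomorphic_on_log:
  assumes "open S" "continuous_on S L" "\<And>z. z \<in> S \<Longrightarrow> exp (L z) = g z" "g holomorphic_on S"
  shows "L holomorphic_on S" and "z \<in> S \<Longrightarrow> deriv L z = deriv g z / g z"
proof -
  have *: "(L has_field_derivative deriv g z / g z) (at z)" if "z \<in> S" for z
    using has_wirt_log[OF assms(1-3) that has_wirt_holomorphic[OF assms(4,1) that]]
    unfolding has_wirt_def has_field_derivative_def by (rule has_derivative_eq_rhs) auto
  show "L holomorphic_on S"
    unfolding holomorphic_on_open[OF assms(1)] using * by blast
  show "z \<in> S \<Longrightarrow> deriv L z = deriv g z / g z" using DERIV_imp_deriv[OF *] .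
qed

section \<open>Functions of the deformation parameter and the coordinate\<close>

definition dt :: "(real \<times> complex \<Rightarrow> complex) \<Rightarrow> real \<times> complex \<Rightarrow> complex" where
  "dt G p = dird G (1, 0) p"

definition dz :: "(real \<times> complex \<Rightarrow> complex) \<Rightarrow> real \<times> complex \<Rightarrow> complex" where
  "dz G p = (dird G (0, 1) p - \<i> * dird G (0, \<i>) p) / 2"

definition dzb :: "(real \<times> complex \<Rightarrow> complex) \<Rightarrow> real \<times> complex \<Rightarrow> complex" where
  "dzb G p = (dird G (0, 1) p + \<i> * dird G (0, \<i>) p) / 2"

lemma smooth_on_dt: "open W \<Longrightarrow> smooth_on W G \<Longrightarrow> smooth_on W (dt G)"
  and smooth_on_dz: "open W \<Longrightarrow> smooth_on W G \<Longrightarrow> smooth_on W (dz G)"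
  and smooth_on_dzb: "open W \<Longrightarrow> smooth_on W G \<Longrightarrow> smooth_on W (dzb G)"
  unfolding dt_def[abs_def] dz_def[abs_def] dzb_def[abs_def]
  by (intro smooth_intros smooth_on_dird; simp)+

lemma slice_has_wirt:
  assumes "smooth_on W G" "(t, z) \<in> W"
  shows "has_wirt (\<lambda>\<zeta>. G (t, \<zeta>)) (dz G (t, z)) (dzb G (t, z)) z"
proof -
  have G: "(G has_derivative frechet_derivative G (at (t, z))) (at (t, z))"
    using smooth_on_has_derivative[OF assms] .
  have "((\<lambda>\<zeta>. (t, \<zeta>)) has_derivative (\<lambda>h. (0, h))) (at z)"
    by (auto intro!: derivative_eq_intros)
  from has_derivative_compose[OF this G]
  have d: "((\<lambda>\<zeta>. G (t, \<zeta>)) has_derivative (\<lambda>h. dird G (0, h) (t, z))) (at z)" .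
  have "(\<lambda>h. dird G (0, h) (t, z)) = (\<lambda>h. dz G (t, z) * h + dzb G (t, z) * cnj h)"
    unfolding dz_def dzb_def by (rule ext) (rule linear_wirt[OF has_derivative_linear[OF d]])
  then show ?thesis using d unfolding has_wirt_def by simp
qed

lemma slice_has_vector_derivative:
  assumes "smooth_on W G" "(t, z) \<in> W"
  shows "((\<lambda>t. G (t, z)) has_vector_derivative dt G (t, z)) (at t)"
proof -
  have G: "(G has_derivative frechet_derivative G (at (t, z))) (at (t, z))"
    using smooth_on_has_derivative[OF assms] .
  have "((\<lambda>t. (t, z)) has_derivative (\<lambda>h. (h, 0))) (at t)"
    by (auto intro!: derivative_eq_intros)
  from has_derivative_compose[OF this G]
  have d: "((\<lambda>t. G (t, z)) has_derivative (\<lambda>h. dird G (h, 0) (t, z))) (at t)" .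
  have "dird G (h, 0) (t, z) = h *\<^sub>R dt G (t, z)" for h
    using linear_scale[OF has_derivative_linear[OF G], of h "(1, 0)"] by (simp add: dt_def)
  then show ?thesis using d by (simp add: has_vector_derivative_def)
qed

lemma slice_pd:
  assumes "smooth_on W G" "(t, z) \<in> W"
  shows "pd (\<lambda>\<zeta>. G (t, \<zeta>)) z = dz G (t, z)" "pdb (\<lambda>\<zeta>. G (t, \<zeta>)) z = dzb G (t, z)"
  using has_wirt_unique[OF slice_has_wirt[OF assms]] by auto

lemma open_slice:
  fixes W :: "(real \<times> complex) set"
  assumes "open W" shows "open {\<zeta>. (t, \<zeta>) \<in> W}"
proof -
  have "continuous_on UNIV (\<lambda>\<zeta>::complex. (t, \<zeta>))" by (intro continuous_intros)
  from open_vimage[OF assms this] show ?thesis by (simp add: vimage_def)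
qed

lemma smooth_slice:
  fixes G :: "real \<times> complex \<Rightarrow> complex"
  assumes "open W" "smooth_on W G" shows "smooth_on {\<zeta>. (t, \<zeta>) \<in> W} (\<lambda>\<zeta>. G (t, \<zeta>))"
  by (rule smooth_on_compose[OF open_slice[OF assms(1)] assms(2)])
     (auto intro!: smooth_on_Pair open_slice assms smooth_on_const smooth_on_ident)

lemma eventually_slice:
  fixes W :: "(real \<times> complex) set"
  assumes "open W" "(t0, z) \<in> W" shows "\<forall>\<^sub>F t in nhds t0. (t, z) \<in> W"
proof -
  have "open ((\<lambda>t. (t, z)) -` W)" by (intro open_vimage assms(1) continuous_intros)
  then show ?thesis using assms(2) eventually_nhds_in_open[of "(\<lambda>t. (t, z)) -` W" t0] by simp
qed

text \<open>Viewing a family as one function on an open set of \<open>real \<times> complex\<close>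
  turns the interchange of variation and coordinate derivative into the symmetry of second
  derivatives.\<close>

lemma dt_dz:
  assumes "open W" "smooth_on W G" "p \<in> W"
  shows "dt (dz G) p = dz (dt G) p" "dt (dzb G) p = dzb (dt G) p"
proof -
  obtain t z where p: "p = (t, z)" by fastforce
  have d: "((\<lambda>t. dird G b (t, z)) has_vector_derivative dt (dird G b) (t, z)) (at t)" for b
    using slice_has_vector_derivative[OF smooth_on_dird[OF assms(1,2)]] assms(3) p by blast
  have u: "dt H (t, z) = d" if "((\<lambda>t. H (t, z)) has_vector_derivative d) (at t)" "smooth_on W H" for H d
    using slice_has_vector_derivative[OF that(2)] that(1) vector_derivative_unique_at assms(3) p by blast
  have 1: "dt (dz G) (t, z) = (dt (dird G (0, 1)) (t, z) - \<i> * dt (dird G (0, \<i>)) (t, z)) / 2"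
    by (rule u[OF _ smooth_on_dz[OF assms(1,2)]], unfold dz_def)
       (intro has_vector_derivative_divide has_vector_derivative_diff has_vector_derivative_mult_right d)
  have 2: "dt (dzb G) (t, z) = (dt (dird G (0, 1)) (t, z) + \<i> * dt (dird G (0, \<i>)) (t, z)) / 2"
    by (rule u[OF _ smooth_on_dzb[OF assms(1,2)]], unfold dzb_def)
       (intro has_vector_derivative_divide has_vector_derivative_add has_vector_derivative_mult_right d)
  have c: "dt (dird G b) (t, z) = dird (dt G) b (t, z)" for b
    unfolding dt_def[abs_def] using dird_commute[OF assms(1,2), of "(t, z)"] assms(3) p by simp
  show "dt (dz G) p = dz (dt G) p" "dt (dzb G) p = dzb (dt G) p"
    unfolding p 1 2 c by (simp_all add: dz_def dzb_def)
qed

lemma slice_pd_fun: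
  assumes "open W" "smooth_on W G" "(t, z) \<in> W"
  shows "pd (pd (\<lambda>\<zeta>. G (t, \<zeta>))) z = dz (dz G) (t, z)"
    "pdb (pd (\<lambda>\<zeta>. G (t, \<zeta>))) z = dzb (dz G) (t, z)"
    "pd (pdb (\<lambda>\<zeta>. G (t, \<zeta>))) z = dz (dzb G) (t, z)"
proof -
  let ?S = "{\<zeta>. (t, \<zeta>) \<in> W}"
  have s: "open ?S" "z \<in> ?S" using open_slice assms by auto
  have 1: "\<And>y. y \<in> ?S \<Longrightarrow> dz G (t, y) = pd (\<lambda>\<zeta>. G (t, \<zeta>)) y"
    "\<And>y. y \<in> ?S \<Longrightarrow> dzb G (t, y) = pdb (\<lambda>\<zeta>. G (t, \<zeta>)) y"
    using slice_pd[OF assms(2)] by auto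
  note sm = smooth_on_dz[OF assms(1,2)] smooth_on_dzb[OF assms(1,2)]
  show "pd (pd (\<lambda>\<zeta>. G (t, \<zeta>))) z = dz (dz G) (t, z)"
    "pdb (pd (\<lambda>\<zeta>. G (t, \<zeta>))) z = dzb (dz G) (t, z)"
    using has_wirt_unique[OF has_wirt_cong[OF slice_has_wirt[OF sm(1) assms(3)] s 1(1)]] by auto
  show "pd (pdb (\<lambda>\<zeta>. G (t, \<zeta>))) z = dz (dzb G) (t, z)"
    using has_wirt_unique[OF has_wirt_cong[OF slice_has_wirt[OF sm(2) assms(3)] s 1(2)]] by auto
qed

section \<open>The local variational identity\<close>

definition vfield :: "(complex \<Rightarrow> complex) \<Rightarrow> (complex \<Rightarrow> complex) \<Rightarrow> complex \<Rightarrow> complex" where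
  "vfield f u z = u z / pd f z"

text \<open>The pre-Schwarzian \<open>\<partial> log \<partial>f\<close>; unlike
  \<open>log \<partial>f\<close> it involves no branch.\<close>

definition prelog :: "(complex \<Rightarrow> complex) \<Rightarrow> complex \<Rightarrow> complex" where
  "prelog f z = pd (pd f) z / pd f z"

text \<open>If \<open>u\<close> is the variation of \<open>f\<close>, these are the variations of \<open>log \<partial>f\<close> and of \<open>\<mu>\<close>.\<close>

definition var_log :: "(complex \<Rightarrow> complex) \<Rightarrow> (complex \<Rightarrow> complex) \<Rightarrow> complex \<Rightarrow> complex" where
  "var_log f u z = pd (vfield f u) z + vfield f u z * prelog f z"

definition var_mu :: "(complex \<Rightarrow> complex) \<Rightarrow> (complex \<Rightarrow> complex) \<Rightarrow> complex \<Rightarrow> complex" where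
  "var_mu f u z = pdb (vfield f u) z + vfield f u z * pd (beltrami f) z - beltrami f z * pd (vfield f u) z"

text \<open>Boundary terms of an integration by parts: with \<open>p = var_log\<close>,
  \<open>m = var_mu\<close> and \<open>N = prelog\<close>, all derivatives in
  \<open>pd p * pd \<mu> + N * pd m + 2 * h * m\<close> are moved off \<open>v\<close>. What stands
  under \<open>pdb\<close> is \<open>- prim_A\<close>, what stands under \<open>pd\<close> is
  \<open>prim_B\<close>, in line with the sign in \<open>d1\<close>.\<close>

definition prim_A :: "(complex \<Rightarrow> complex) \<Rightarrow> (complex \<Rightarrow> complex) \<Rightarrow> (complex \<Rightarrow> complex) \<Rightarrow> complex \<Rightarrow> complex" where
  "prim_A f u h z = vfield f u z * pd (prelog f) z - 2 * h z * vfield f u z"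

definition prim_B :: "(complex \<Rightarrow> complex) \<Rightarrow> (complex \<Rightarrow> complex) \<Rightarrow> (complex \<Rightarrow> complex) \<Rightarrow> complex \<Rightarrow> complex" where
  "prim_B f u h z = prelog f z * var_mu f u z + var_log f u z * pd (beltrami f) z
     - 2 * h z * beltrami f z * vfield f u z - vfield f u z * pd (pd (beltrami f)) z
     + vfield f u z * beltrami f z * pd (prelog f) z"

text \<open>The Cech coboundary of the boundary terms \<open>prim_A\<close>, \<open>prim_B\<close>
  contains second derivatives of the logarithms of the transition derivatives, which the variation
  of \<open>\<theta>\<close> lacks. The coboundary of this function is
  \<open>v * (\<partial> log (w' \<circ> f) + \<partial> log z')\<close>, and its differential
  cancels them.\<close>

definition prim_chi :: "(complex \<Rightarrow> complex) \<Rightarrow> (complex \<Rightarrow> complex) \<Rightarrow> complex \<Rightarrow> complex" where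
  "prim_chi f u z = - (vfield f u z * prelog f z + 2 * pd (vfield f u) z)"

text \<open>The exact term \<open>d\<chi>\<close> does not matter on one chart; it makes the Cech coboundary of the
  primitive cancel against the variation of \<open>\<theta>\<close>.\<close>

definition prim :: "(complex \<Rightarrow> complex) \<Rightarrow> (complex \<Rightarrow> complex) \<Rightarrow> (complex \<Rightarrow> complex) \<Rightarrow> form1" where
  "prim f u h z = (prim_A f u h z + pd (prim_chi f u) z, prim_B f u h z + pdb (prim_chi f u) z)"

definition el_form :: "(complex \<Rightarrow> complex) \<Rightarrow> (complex \<Rightarrow> complex) \<Rightarrow> (complex \<Rightarrow> complex) \<Rightarrow> complex \<Rightarrow> complex" where
  "el_form f u h z = - 2 * (pdb h z - D_op h (beltrami f) z) * vfield f u z"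

text \<open>The situation in one chart, with \<open>u\<close> an arbitrary smooth function; the
  comparison of two charts is left to the locale \<open>transition\<close>.\<close>

locale deformation =
  fixes D :: "complex set" and f u h :: "complex \<Rightarrow> complex"
  assumes open_D: "open D"
    and smooth_f: "smooth_on D f" and smooth_u: "smooth_on D u" and smooth_h: "smooth_on D h"
    and pd_nz: "z \<in> D \<Longrightarrow> pd f z \<noteq> 0"
begin

abbreviation "v \<equiv> vfield f u"
abbreviation "N \<equiv> prelog f"
abbreviation "\<mu> \<equiv> beltrami f"
abbreviation "p \<equiv> var_log f u"
abbreviation "m \<equiv> var_mu f u"
abbreviation "B \<equiv> pd f"

lemma smooth_B: "smooth_on D B" by (rule smooth_on_pd[OF open_D smooth_f])

lemma smooth_v: "smooth_on D v"
  unfolding vfield_def[abs_def] by (rule smooth_on_divide[OF open_D smooth_u smooth_B pd_nz])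

lemma smooth_N: "smooth_on D N"
  unfolding prelog_def[abs_def] by (rule smooth_on_divide[OF open_D smooth_on_pd[OF open_D smooth_B] smooth_B pd_nz])

lemma smooth_mu: "smooth_on D \<mu>"
  unfolding beltrami_def[abs_def] by (rule smooth_on_divide[OF open_D smooth_on_pdb[OF open_D smooth_f] smooth_B pd_nz])

lemmas smooth_v1 = smooth_on_pd[OF open_D smooth_v]
lemmas smooth_vb = smooth_on_pdb[OF open_D smooth_v]
lemmas smooth_N1 = smooth_on_pd[OF open_D smooth_N]
lemmas smooth_mu1 = smooth_on_pd[OF open_D smooth_mu]
lemmas smooth_mu2 = smooth_on_pd[OF open_D smooth_mu1]

lemma smooth_p: "smooth_on D p"
  unfolding var_log_def[abs_def] by (intro smooth_on_add smooth_on_mult open_D smooth_v1 smooth_v smooth_N)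

lemma smooth_m: "smooth_on D m"
  unfolding var_mu_def[abs_def]
  by (intro smooth_on_add smooth_on_diff smooth_on_mult open_D smooth_vb smooth_v1 smooth_v smooth_mu smooth_mu1)

lemma smooth_chi: "smooth_on D (prim_chi f u)"
  unfolding prim_chi_def[abs_def]
  by (intro smooth_on_minus smooth_on_add smooth_on_mult smooth_on_const open_D smooth_v1 smooth_v smooth_N)

lemma smooth_A: "smooth_on D (prim_A f u h)"
  unfolding prim_A_def[abs_def]
  by (intro smooth_on_diff smooth_on_mult smooth_on_const open_D smooth_v smooth_N1 smooth_h)

lemma smooth_PB: "smooth_on D (prim_B f u h)"
  unfolding prim_B_def[abs_def]
  by (intro smooth_on_diff smooth_on_add smooth_on_mult smooth_on_const open_D smooth_v smooth_N1 smooth_h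
      smooth_N smooth_m smooth_p smooth_mu smooth_mu1 smooth_mu2)

lemma smooth_prim: "smooth_on D (prim f u h)"
  unfolding prim_def[abs_def]
  by (intro smooth_on_Pair smooth_on_add smooth_A smooth_PB open_D smooth_on_pd smooth_on_pdb smooth_chi)

lemma smooth_el: "smooth_on D (el_form f u h)"
  unfolding el_form_def[abs_def] D_op_def[abs_def]
  by (intro smooth_on_mult smooth_on_diff smooth_on_add smooth_on_const smooth_on_pd smooth_on_pdb
      open_D smooth_h smooth_v smooth_mu1 smooth_mu)

lemmas w_f = smooth_on_has_wirt[OF smooth_f]
lemmas w_u = smooth_on_has_wirt[OF smooth_u]
lemmas w_v = smooth_on_has_wirt[OF smooth_v]
lemmas w_v1 = smooth_on_has_wirt[OF smooth_v1]
lemmas w_vb = smooth_on_has_wirt[OF smooth_vb]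
lemmas w_mu = smooth_on_has_wirt[OF smooth_mu]
lemmas w_mu1 = smooth_on_has_wirt[OF smooth_mu1]
lemmas w_mu2 = smooth_on_has_wirt[OF smooth_mu2]
lemmas w_N1 = smooth_on_has_wirt[OF smooth_N1]
lemmas w_h = smooth_on_has_wirt[OF smooth_h]
lemmas w_p = smooth_on_has_wirt[OF smooth_p]
lemmas w_m = smooth_on_has_wirt[OF smooth_m]

lemma u_eq: "z \<in> D \<Longrightarrow> u z = v z * B z"
  using pd_nz by (simp add: vfield_def)

lemma pdb_f: "z \<in> D \<Longrightarrow> pdb f z = \<mu> z * B z"
  using pd_nz by (simp add: beltrami_def)

lemma pd_B: "z \<in> D \<Longrightarrow> pd B z = N z * B z"
  using pd_nz by (simp add: prelog_def)

text \<open>The Beltrami equation \<open>pdb f = \<mu> * B\<close>, differentiated by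
  \<open>pd\<close>. Together with \<open>pdb_N\<close> and \<open>pdb_pd_N\<close> it eliminates
  antiholomorphic derivatives of \<open>B\<close> and \<open>N\<close>, so that
  \<open>d1_prim\<close> becomes polynomial algebra.\<close>

lemma pdb_B:
  assumes "z \<in> D" shows "pdb B z = B z * (pd \<mu> z + \<mu> z * N z)"
proof -
  have "has_wirt (\<lambda>z. \<mu> z * B z) (pd \<mu> z * B z + \<mu> z * pd B z) (pdb \<mu> z * B z + \<mu> z * pdb B z) z"
    by (rule has_wirt_mult[OF w_mu[OF assms] smooth_on_has_wirt[OF smooth_B assms]])
  then have "has_wirt (pdb f) (pd \<mu> z * B z + \<mu> z * pd B z) (pdb \<mu> z * B z + \<mu> z * pdb B z) z"
    by (rule has_wirt_cong[OF _ open_D assms]) (simp add: pdb_f)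
  then have "pd (pdb f) z = pd \<mu> z * B z + \<mu> z * pd B z" by (rule has_wirt_unique)
  then show ?thesis
    using pd_pdb_commute[OF open_D smooth_f assms] pd_B[OF assms] by (simp add: algebra_simps)
qed

lemma w_B: "z \<in> D \<Longrightarrow> has_wirt B (N z * B z) (B z * (pd \<mu> z + \<mu> z * N z)) z"
  using smooth_on_has_wirt[OF smooth_B] pd_B pdb_B by simp

text \<open>Equality of \<open>pdb (pd B)\<close> and \<open>pd (pdb B)\<close> divided by
  \<open>B\<close>, in other words \<open>pdb N = pd (pd \<mu> + \<mu> * N)\<close>, the
  integrability condition for \<open>log \<partial>f\<close>.\<close>

lemma pdb_N:
  assumes "z \<in> D" shows "pdb N z = pd (pd \<mu>) z + pd \<mu> z * N z + \<mu> z * pd N z"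
proof -
  note wN = smooth_on_has_wirt[OF smooth_N assms]
  have 1: "has_wirt (\<lambda>z. N z * B z) (pd N z * B z + N z * (N z * B z))
      (pdb N z * B z + N z * (B z * (pd \<mu> z + \<mu> z * N z))) z"
    by (rule has_wirt_mult[OF wN w_B[OF assms]])
  have 2: "pdb (pd B) z = pdb N z * B z + N z * (B z * (pd \<mu> z + \<mu> z * N z))"
    by (rule has_wirt_unique(2)[OF has_wirt_cong[OF 1 open_D assms]]) (simp add: pd_B)
  have 3: "has_wirt (\<lambda>z. B z * (pd \<mu> z + \<mu> z * N z))
     (N z * B z * (pd \<mu> z + \<mu> z * N z) + B z * (pd (pd \<mu>) z + (pd \<mu> z * N z + \<mu> z * pd N z)))
     (B z * (pd \<mu> z + \<mu> z * N z) * (pd \<mu> z + \<mu> z * N z) + B z * (pdb (pd \<mu>) z + (pdb \<mu> z * N z + \<mu> z * pdb N z))) z"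
    by (rule has_wirt_mult[OF w_B[OF assms] has_wirt_add[OF w_mu1[OF assms] has_wirt_mult[OF w_mu[OF assms] wN]]])
  have 4: "pd (pdb B) z = N z * B z * (pd \<mu> z + \<mu> z * N z) + B z * (pd (pd \<mu>) z + (pd \<mu> z * N z + \<mu> z * pd N z))"
    by (rule has_wirt_unique(1)[OF has_wirt_cong[OF 3 open_D assms]]) (simp add: pdb_B)
  have "B z * pdb N z = B z * (pd (pd \<mu>) z + pd \<mu> z * N z + \<mu> z * pd N z)"
    using pd_pdb_commute[OF open_D smooth_B assms] 2 4 by (simp add: algebra_simps)
  then show ?thesis using pd_nz[OF assms] by simp
qed

lemma w_N: "z \<in> D \<Longrightarrow> has_wirt N (pd N z) (pd (pd \<mu>) z + pd \<mu> z * N z + \<mu> z * pd N z) z"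
  using smooth_on_has_wirt[OF smooth_N] pdb_N by metis

lemma pdb_pd_N:
  assumes "z \<in> D"
  shows "pdb (pd N) z = pd (pd (pd \<mu>)) z + pd (pd \<mu>) z * N z + 2 * pd \<mu> z * pd N z + \<mu> z * pd (pd N) z"
proof -
  have "has_wirt (\<lambda>z. pd (pd \<mu>) z + pd \<mu> z * N z + \<mu> z * pd N z)
    (pd (pd (pd \<mu>)) z + (pd (pd \<mu>) z * N z + pd \<mu> z * pd N z) + (pd \<mu> z * pd N z + \<mu> z * pd (pd N) z))
    (pdb (pd (pd \<mu>)) z + (pdb (pd \<mu>) z * N z + pd \<mu> z * (pd (pd \<mu>) z + pd \<mu> z * N z + \<mu> z * pd N z)) + (pdb \<mu> z * pd N z + \<mu> z * pdb (pd N) z)) z"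
    by (rule has_wirt_add[OF has_wirt_add[OF w_mu2[OF assms] has_wirt_mult[OF w_mu1[OF assms] w_N[OF assms]]]
          has_wirt_mult[OF w_mu[OF assms] w_N1[OF assms]]])
  then have "has_wirt (pdb N)
    (pd (pd (pd \<mu>)) z + (pd (pd \<mu>) z * N z + pd \<mu> z * pd N z) + (pd \<mu> z * pd N z + \<mu> z * pd (pd N) z))
    (pdb (pd (pd \<mu>)) z + (pdb (pd \<mu>) z * N z + pd \<mu> z * (pd (pd \<mu>) z + pd \<mu> z * N z + \<mu> z * pd N z)) + (pdb \<mu> z * pd N z + \<mu> z * pdb (pd N) z)) z"
    by (rule has_wirt_cong[OF _ open_D assms]) (simp add: pdb_N)
  from has_wirt_unique(1)[OF this] show ?thesis
    using pd_pdb_commute[OF open_D smooth_N assms] by (simp add: algebra_simps)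
qed

lemma w_p': "z \<in> D \<Longrightarrow> pd p z = pd (pd v) z + pd v z * N z + v z * pd N z"
  unfolding var_log_def[abs_def]
  by (subst has_wirt_unique(1)[OF has_wirt_add[OF w_v1 has_wirt_mult[OF w_v w_N]]]) (auto simp: algebra_simps)

lemma pd_m:
  assumes "z \<in> D"
  shows "pd m z = pdb (pd v) z + v z * pd (pd \<mu>) z - \<mu> z * pd (pd v) z"
proof -
  note w = has_wirt_diff[OF has_wirt_add[OF w_vb[OF assms] has_wirt_mult[OF w_v[OF assms] w_mu1[OF assms]]]
    has_wirt_mult[OF w_mu[OF assms] w_v1[OF assms]]]
  show ?thesis
    unfolding var_mu_def[abs_def] has_wirt_unique(1)[OF w]
    using pd_pdb_commute[OF open_D smooth_v assms] by (simp add: algebra_simps)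
qed

text \<open>The left side is the variation of \<open>N * pd \<mu> + 2 * \<mu> * h\<close>. After
  moving all derivatives off \<open>v\<close>, the third derivative of \<open>\<mu>\<close> occurs
  twice in the coefficient of \<open>v\<close>: once from the term with \<open>p\<close>, once
  through \<open>pdb_pd_N\<close>. The terms in \<open>N\<close> cancel, and \<open>h\<close>
  supplies the rest of \<open>D_op\<close> and \<open>pdb h\<close>. The exact part
  \<open>prim_chi\<close> drops out because mixed derivatives commute.\<close>

lemma d1_prim:
  assumes "z \<in> D"
  shows "pd p z * pd \<mu> z + N z * pd m z + 2 * h z * m z = el_form f u h z + d1 (prim f u h) z"
proof -
  note wA = has_wirt_diff[OF has_wirt_mult[OF w_v[OF assms] w_N1[OF assms]]
      has_wirt_mult[OF has_wirt_mult[OF has_wirt_const[of 2] w_h[OF assms]] w_v[OF assms]]]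
  note wB = has_wirt_add[OF has_wirt_diff[OF has_wirt_diff[OF has_wirt_add[OF
      has_wirt_mult[OF w_N[OF assms] w_m[OF assms]] has_wirt_mult[OF w_p[OF assms] w_mu1[OF assms]]]
      has_wirt_mult[OF has_wirt_mult[OF has_wirt_mult[OF has_wirt_const[of 2] w_h[OF assms]] w_mu[OF assms]] w_v[OF assms]]]
      has_wirt_mult[OF w_v[OF assms] w_mu2[OF assms]]]
      has_wirt_mult[OF has_wirt_mult[OF w_v[OF assms] w_mu[OF assms]] w_N1[OF assms]]]
  have wc: "has_wirt (pd (prim_chi f u)) (pd (pd (prim_chi f u)) z) (pdb (pd (prim_chi f u)) z) z"
    "has_wirt (pdb (prim_chi f u)) (pd (pdb (prim_chi f u)) z) (pdb (pdb (prim_chi f u)) z) z"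
    using smooth_on_has_wirt assms smooth_on_pd[OF open_D smooth_chi] smooth_on_pdb[OF open_D smooth_chi] by blast+
  have d1: "d1 (prim f u h) z = pd (\<lambda>y. prim_B f u h y + pdb (prim_chi f u) y) z
      - pdb (\<lambda>y. prim_A f u h y + pd (prim_chi f u) y) z"
    by (simp add: d1_def prim_def)
  note wB' = has_wirt_unique(1)[OF has_wirt_add[OF wB wc(2)], folded prim_B_def]
  note wA' = has_wirt_unique(2)[OF has_wirt_add[OF wA wc(1)], folded prim_A_def]
  show ?thesis
    unfolding d1 wA' wB' el_form_def D_op_def w_p'[OF assms] pd_m[OF assms] pdb_pd_N[OF assms]
      pd_pdb_commute[OF open_D smooth_chi assms]
    unfolding var_log_def var_mu_def
    by (simp add: algebra_simps)
qed

end

section \<open>Change of coordinates\<close>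

text \<open>\<open>\<phi>\<close> and \<open>w\<close> stand for the transition functions of the
  source and of the target, \<open>D\<close> for the overlap in the second coordinate. The law
  \<open>u_tr\<close> is the vanishing of the Kodaira-Spencer cocycle.\<close>

locale transition = i: deformation Di fi ui hi + j: deformation Dj f u h
  for Di fi ui hi Dj f u h +
  fixes \<phi> w :: "complex \<Rightarrow> complex" and D E :: "complex set"
  assumes open_D': "open D" and sub: "D \<subseteq> Dj" and phi_D: "z \<in> D \<Longrightarrow> \<phi> z \<in> Di"
    and phi_holo: "\<phi> holomorphic_on D" and phi_nz: "z \<in> D \<Longrightarrow> deriv \<phi> z \<noteq> 0"
    and open_E: "open E" and w_holo: "w holomorphic_on E" and f_E: "z \<in> D \<Longrightarrow> f z \<in> E"
    and w_nz: "y \<in> E \<Longrightarrow> deriv w y \<noteq> 0"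
    and f_eq: "z \<in> D \<Longrightarrow> fi (\<phi> z) = w (f z)"
    and u_tr: "z \<in> D \<Longrightarrow> ui (\<phi> z) = deriv w (f z) * u z"
    and h_eq: "z \<in> D \<Longrightarrow> h z - hi (\<phi> z) * (deriv \<phi> z)\<^sup>2 = schwarzian \<phi> z"
begin

abbreviation "P \<equiv> deriv \<phi>"

definition lam :: "complex \<Rightarrow> complex" where
  "lam z = deriv (deriv \<phi>) z / deriv \<phi> z"

definition rho :: "complex \<Rightarrow> complex" where
  "rho y = deriv (deriv w) y / deriv w y"

text \<open>The \<open>\<partial>\<close>-derivative of \<open>log (deriv w \<circ> f)\<close>, the
  counterpart of \<open>lam\<close> for the target.\<close>

definition R :: "complex \<Rightarrow> complex" where
  "R z = rho (f z) * pd f z"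

lemma inDj: "z \<in> D \<Longrightarrow> z \<in> Dj" using sub by blast

lemma P_holo: "P holomorphic_on D" by (rule holomorphic_deriv[OF phi_holo open_D'])

lemma lam_holo: "lam holomorphic_on D"
  unfolding lam_def[abs_def] by (intro holomorphic_on_divide holomorphic_deriv P_holo open_D' phi_nz)

lemma lam1_holo: "deriv lam holomorphic_on D" by (rule holomorphic_deriv[OF lam_holo open_D'])

lemma rho_holo: "rho holomorphic_on E"
  unfolding rho_def[abs_def] by (intro holomorphic_on_divide holomorphic_deriv w_holo open_E w_nz)

lemma w_phi: "z \<in> D \<Longrightarrow> has_wirt \<phi> (P z) 0 z"
  by (rule has_wirt_holomorphic[OF phi_holo open_D'])

lemma w_P: "z \<in> D \<Longrightarrow> has_wirt P (lam z * P z) 0 z"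
  using has_wirt_holomorphic[OF P_holo open_D'] phi_nz by (simp add: lam_def)

lemma w_lam: "z \<in> D \<Longrightarrow> has_wirt lam (deriv lam z) 0 z"
  by (rule has_wirt_holomorphic[OF lam_holo open_D'])

lemma w_lam1: "z \<in> D \<Longrightarrow> has_wirt (deriv lam) (deriv (deriv lam) z) 0 z"
  by (rule has_wirt_holomorphic[OF lam1_holo open_D'])

lemma w_Pb: "z \<in> D \<Longrightarrow> has_wirt (\<lambda>z. cnj (P z)) 0 (cnj (lam z * P z)) z"
  using has_wirt_cnj[OF w_P] by simp

lemma Pb_nz: "z \<in> D \<Longrightarrow> cnj (P z) \<noteq> 0" using phi_nz by simp

lemma schwarz: assumes "z \<in> D" shows "schwarzian \<phi> z = deriv lam z - (lam z)\<^sup>2 / 2"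
proof -
  have "((\<lambda>z. lam z * P z) has_field_derivative deriv lam z * P z + deriv P z * lam z) (at z)"
    by (rule DERIV_mult[OF holomorphic_derivI[OF lam_holo open_D' assms] holomorphic_derivI[OF P_holo open_D' assms]])
  then have "(deriv P has_field_derivative deriv lam z * P z + deriv P z * lam z) (at z)"
    by (rule has_field_derivative_transform_within_open[OF _ open_D' assms])
       (use phi_nz in \<open>auto simp: lam_def\<close>)
  then have 3: "deriv (deriv P) z = deriv lam z * P z + deriv P z * lam z" by (rule DERIV_imp_deriv)
  have 2: "deriv P z = lam z * P z" using phi_nz[OF assms] by (simp add: lam_def)
  show ?thesis
    unfolding schwarzian_def using 2 3 phi_nz[OF assms]
    by (simp add: numeral_3_eq_3 numeral_2_eq_2 power2_eq_square) (simp add: field_simps)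
qed

text \<open>For holomorphic \<open>\<phi>\<close> the Wirtinger derivatives of
  \<open>g \<circ> \<phi>\<close> are those of \<open>g\<close> times \<open>P\<close> and
  \<open>cnj P\<close>. Solving for the latter turns a transformation law into the laws for the
  derivatives; the laws up to the third derivative of \<open>\<mu>\<close> arise by
  iteration.\<close>

lemma pull_wirt:
  assumes "smooth_on Di g" "\<And>z. z \<in> D \<Longrightarrow> g (\<phi> z) = e z" "z \<in> D" "has_wirt e a b z"
  shows "pd g (\<phi> z) = a / P z" "pdb g (\<phi> z) = b / cnj (P z)"
proof -
  have "has_wirt (\<lambda>z. g (\<phi> z)) (pd g (\<phi> z) * P z) (pdb g (\<phi> z) * cnj (P z)) z"
    by (rule has_wirt_eq[OF has_wirt_compose[OF smooth_on_has_wirt[OF assms(1) phi_D[OF assms(3)]] w_phi[OF assms(3)]]])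
       auto
  then have 1: "has_wirt e (pd g (\<phi> z) * P z) (pdb g (\<phi> z) * cnj (P z)) z"
    by (rule has_wirt_cong[OF _ open_D' assms(3,2)])
  show "pd g (\<phi> z) = a / P z" "pdb g (\<phi> z) = b / cnj (P z)"
    using has_wirt_unique[OF 1] has_wirt_unique[OF assms(4)] phi_nz[OF assms(3)]
    by (auto simp: field_simps)
qed

lemma w_wf:
  assumes "z \<in> D"
  shows "has_wirt (\<lambda>z. w (f z)) (deriv w (f z) * j.B z) (deriv w (f z) * (j.\<mu> z * j.B z)) z"
  using has_wirt_compose_holomorphic[OF w_holo open_E f_E[OF assms] j.w_f[OF inDj[OF assms]]]
    j.pdb_f[OF inDj[OF assms]] by simp

lemma w_w1f:
  assumes "z \<in> D"
  shows "has_wirt (\<lambda>z. deriv w (f z)) (deriv w (f z) * R z) (deriv w (f z) * (j.\<mu> z * R z)) z"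
proof -
  have "deriv (deriv w) (f z) = deriv w (f z) * rho (f z)"
    using w_nz[OF f_E[OF assms]] by (simp add: rho_def)
  then show ?thesis
    using has_wirt_compose_holomorphic[OF holomorphic_deriv[OF w_holo open_E] open_E f_E[OF assms] j.w_f[OF inDj[OF assms]]]
      j.pdb_f[OF inDj[OF assms]] by (simp add: R_def mult_ac)
qed

text \<open>The function \<open>log (deriv w \<circ> f)\<close> is annihilated by
  \<open>pdb - \<mu> * pd\<close>, so its \<open>pd\<close>-derivative satisfies
  \<open>pdb R = pd (\<mu> * R)\<close>.\<close>

lemma w_R:
  assumes "z \<in> D"
  shows "has_wirt R (pd R z) (j.\<mu> z * pd R z + R z * pd j.\<mu> z) z"
proof -
  let ?r = "deriv rho (f z)"
  have 1: "has_wirt (\<lambda>z. rho (f z)) (?r * j.B z) (?r * (j.\<mu> z * j.B z)) z"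
    using has_wirt_compose_holomorphic[OF rho_holo open_E f_E[OF assms] j.w_f[OF inDj[OF assms]]]
      j.pdb_f[OF inDj[OF assms]] by simp
  have 2: "has_wirt R (?r * j.B z * j.B z + rho (f z) * (j.N z * j.B z))
    (?r * (j.\<mu> z * j.B z) * j.B z + rho (f z) * (j.B z * (pd j.\<mu> z + j.\<mu> z * j.N z))) z"
    unfolding R_def[abs_def] by (rule has_wirt_mult[OF 1 j.w_B[OF inDj[OF assms]]])
  show ?thesis
    using 2 unfolding has_wirt_unique(1)[OF 2] by (rule has_wirt_eq) (auto simp: R_def algebra_simps)
qed

lemma B_eq: assumes "z \<in> D" shows "i.B (\<phi> z) = deriv w (f z) * j.B z / P z"
  using pull_wirt(1)[OF i.smooth_f f_eq assms w_wf[OF assms]] .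

lemma pdbf_eq: assumes "z \<in> D" shows "pdb fi (\<phi> z) = deriv w (f z) * (j.\<mu> z * j.B z) / cnj (P z)"
  using pull_wirt(2)[OF i.smooth_f f_eq assms w_wf[OF assms]] .

lemma v_eq: assumes "z \<in> D" shows "i.v (\<phi> z) = j.v z * P z"
  unfolding vfield_def B_eq[OF assms] u_tr[OF assms]
  using w_nz[OF f_E[OF assms]] phi_nz[OF assms] j.pd_nz[OF inDj[OF assms]] by (simp add: field_simps)

lemma mu_eq: assumes "z \<in> D" shows "i.\<mu> (\<phi> z) = j.\<mu> z * P z / cnj (P z)"
proof -
  have "i.\<mu> (\<phi> z) = pdb fi (\<phi> z) / i.B (\<phi> z)" by (rule beltrami_def)
  then show ?thesis unfolding B_eq[OF assms] pdbf_eq[OF assms]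
    using w_nz[OF f_E[OF assms]] phi_nz[OF assms] j.pd_nz[OF inDj[OF assms]] by (simp add: field_simps)
qed

lemma N_eq: assumes "z \<in> D" shows "i.N (\<phi> z) = (j.N z + R z - lam z) / P z"
proof -
  note w = has_wirt_divide[OF has_wirt_mult[OF w_w1f[OF assms] j.w_B[OF inDj[OF assms]]] w_P[OF assms] phi_nz[OF assms]]
  have pdB: "pd i.B (\<phi> z) = (deriv w (f z) * R z * j.B z + deriv w (f z) * (j.N z * j.B z)
      - deriv w (f z) * j.B z / P z * (lam z * P z)) / P z / P z"
    by (rule pull_wirt(1)[OF i.smooth_B B_eq assms w])
  show ?thesis unfolding prelog_def[of fi] pdB B_eq[OF assms]
    using w_nz[OF f_E[OF assms]] phi_nz[OF assms] j.pd_nz[OF inDj[OF assms]] by (simp add: field_simps)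
qed

lemma h_tr: assumes "z \<in> D" shows "hi (\<phi> z) = (h z - deriv lam z + lam z * lam z / 2) / (P z * P z)"
  using h_eq[OF assms] schwarz[OF assms] phi_nz[OF assms] by (simp add: field_simps power2_eq_square)

lemma v1_eq: assumes "z \<in> D"
  shows "pd i.v (\<phi> z) = pd j.v z + j.v z * lam z" "pdb i.v (\<phi> z) = pdb j.v z * P z / cnj (P z)"
proof -
  note w = has_wirt_mult[OF j.w_v[OF inDj[OF assms]] w_P[OF assms]]
  show "pd i.v (\<phi> z) = pd j.v z + j.v z * lam z"
    using pull_wirt(1)[OF i.smooth_v v_eq assms w] phi_nz[OF assms] by (simp only:) (simp add: field_simps)
  show "pdb i.v (\<phi> z) = pdb j.v z * P z / cnj (P z)"
    using pull_wirt(2)[OF i.smooth_v v_eq assms w] phi_nz[OF assms] by (simp only:) (simp add: field_simps)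
qed

lemma mu1_eq: assumes "z \<in> D"
  shows "pd i.\<mu> (\<phi> z) = (pd j.\<mu> z + j.\<mu> z * lam z) / cnj (P z)"
  using pull_wirt(1)[OF i.smooth_mu mu_eq assms has_wirt_divide[OF has_wirt_mult[OF j.w_mu[OF inDj[OF assms]] w_P[OF assms]]
     w_Pb[OF assms] Pb_nz[OF assms]]] phi_nz[OF assms] by (simp only:) (simp add: field_simps)

lemma mu2_eq: assumes "z \<in> D"
  shows "pd (pd i.\<mu>) (\<phi> z) = (pd (pd j.\<mu>) z + pd j.\<mu> z * lam z + j.\<mu> z * deriv lam z) / (cnj (P z) * P z)"
  using pull_wirt(1)[OF i.smooth_mu1 mu1_eq assms has_wirt_divide[OF has_wirt_add[OF j.w_mu1[OF inDj[OF assms]]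
     has_wirt_mult[OF j.w_mu[OF inDj[OF assms]] w_lam[OF assms]]] w_Pb[OF assms] Pb_nz[OF assms]]] phi_nz[OF assms] by (simp only:) (simp add: field_simps)

lemma mu3_eq: assumes "z \<in> D"
  shows "pd (pd (pd i.\<mu>)) (\<phi> z) = (pd (pd (pd j.\<mu>)) z + pd j.\<mu> z * deriv lam z + j.\<mu> z * deriv (deriv lam) z
     + pd j.\<mu> z * deriv lam z
     - pd j.\<mu> z * lam z * lam z - j.\<mu> z * deriv lam z * lam z) / (cnj (P z) * P z * P z)"
proof -
  note j = inDj[OF assms]
  have nz: "cnj (P z) * P z \<noteq> 0" using phi_nz[OF assms] by simp
  note w = has_wirt_divide[OF has_wirt_add[OF has_wirt_add[OF j.w_mu2[OF j] has_wirt_mult[OF j.w_mu1[OF j] w_lam[OF assms]]]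
     has_wirt_mult[OF j.w_mu[OF j] w_lam1[OF assms]]] has_wirt_mult[OF w_Pb[OF assms] w_P[OF assms]] nz]
  show ?thesis
    using pull_wirt(1)[OF i.smooth_mu2 mu2_eq assms w] phi_nz[OF assms] by (simp only:) (simp add: field_simps)
qed

lemma N1_eq: assumes "z \<in> D"
  shows "pd i.N (\<phi> z) = (pd j.N z + pd R z - deriv lam z - (j.N z + R z - lam z) * lam z) / (P z * P z)"
  using pull_wirt(1)[OF i.smooth_N N_eq assms has_wirt_divide[OF has_wirt_diff[OF has_wirt_add[OF j.w_N[OF inDj[OF assms]]
     w_R[OF assms]] w_lam[OF assms]] w_P[OF assms] phi_nz[OF assms]]] phi_nz[OF assms] by (simp only:) (simp add: field_simps)

lemma h1_eq: assumes "z \<in> D"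
  shows "pd hi (\<phi> z) = (pd h z - deriv (deriv lam) z + lam z * deriv lam z
       - 2 * lam z * (h z - deriv lam z + lam z * lam z / 2)) / (P z * P z * P z)"
    "pdb hi (\<phi> z) = pdb h z / (P z * P z * cnj (P z))"
proof -
  have nz: "P z * P z \<noteq> 0" using phi_nz[OF assms] by simp
  note w = has_wirt_divide[OF has_wirt_add[OF has_wirt_diff[OF j.w_h[OF inDj[OF assms]] w_lam1[OF assms]]
    has_wirt_divide[OF has_wirt_mult[OF w_lam[OF assms] w_lam[OF assms]] has_wirt_const[of 2] numeral_neq_zero]]
    has_wirt_mult[OF w_P[OF assms] w_P[OF assms]] nz]
  show "pd hi (\<phi> z) = (pd h z - deriv (deriv lam) z + lam z * deriv lam z
       - 2 * lam z * (h z - deriv lam z + lam z * lam z / 2)) / (P z * P z * P z)"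
    using pull_wirt(1)[OF i.smooth_h h_tr assms w] phi_nz[OF assms] by (simp only:) (simp add: field_simps)
  show "pdb hi (\<phi> z) = pdb h z / (P z * P z * cnj (P z))"
    using pull_wirt(2)[OF i.smooth_h h_tr assms w] phi_nz[OF assms] by (simp only:) (simp add: field_simps)
qed

lemma p_eq: assumes "z \<in> D" shows "i.p (\<phi> z) = j.p z + R z * j.v z"
  unfolding var_log_def v1_eq[OF assms] v_eq[OF assms] N_eq[OF assms]
  using phi_nz[OF assms] by (simp add: field_simps)

lemma m_eq: assumes "z \<in> D" shows "i.m (\<phi> z) = j.m z * P z / cnj (P z)"
  unfolding var_mu_def v1_eq[OF assms] v_eq[OF assms] mu1_eq[OF assms] mu_eq[OF assms]
  using phi_nz[OF assms] by (simp add: field_simps)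

text \<open>\<open>v\<close> has weight (-1, 0) and the bracket has weight (2, 1). The anomalous
  terms in the third derivative of \<open>\<mu>\<close> are cancelled by the Schwarzian in the law
  of \<open>h\<close>; in \<open>pdb h\<close> the Schwarzian is invisible because it is
  holomorphic.\<close>

lemma el_eq: assumes "z \<in> D"
  shows "el_form f u h z = el_form fi ui hi (\<phi> z) * (P z * cnj (P z))"
  unfolding el_form_def D_op_def v_eq[OF assms] mu1_eq[OF assms] mu_eq[OF assms] mu3_eq[OF assms]
    h1_eq[OF assms] h_tr[OF assms]
  using phi_nz[OF assms] by (simp add: field_simps)

lemma chi_eq: assumes "z \<in> D"
  shows "prim_chi fi ui (\<phi> z) = - (j.v z * (j.N z + R z - lam z) + 2 * (pd j.v z + j.v z * lam z))"
  unfolding prim_chi_def v1_eq[OF assms] v_eq[OF assms] N_eq[OF assms]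
  using phi_nz[OF assms] by (simp add: field_simps)

lemma chi1_eq: assumes z: "z \<in> D"
  shows "pd (prim_chi f u) z - pd (prim_chi fi ui) (\<phi> z) * P z
       = pd j.v z * (R z + lam z) + j.v z * (pd R z + deriv lam z)"
    "pdb (prim_chi f u) z - pdb (prim_chi fi ui) (\<phi> z) * cnj (P z)
       = pdb j.v z * (R z + lam z) + j.v z * (j.\<mu> z * pd R z + R z * pd j.\<mu> z)"
proof -
  note j = inDj[OF z]
  note w1 = has_wirt_minus[OF has_wirt_add[OF has_wirt_mult[OF j.w_v[OF j] has_wirt_diff[OF has_wirt_add[OF j.w_N[OF j] w_R[OF z]] w_lam[OF z]]]
     has_wirt_mult[OF has_wirt_const[of 2] has_wirt_add[OF j.w_v1[OF j] has_wirt_mult[OF j.w_v[OF j] w_lam[OF z]]]]]]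
  note w2 = has_wirt_unique[OF has_wirt_minus[OF has_wirt_add[OF has_wirt_mult[OF j.w_v[OF j] j.w_N[OF j]]
     has_wirt_mult[OF has_wirt_const[of 2] j.w_v1[OF j]]]], folded prim_chi_def]
  have c1: "pd (prim_chi fi ui) (\<phi> z) = - (pd j.v z * (j.N z + R z - lam z) + j.v z * (pd j.N z + pd R z - deriv lam z)
     + 2 * (pd (pd j.v) z + pd j.v z * lam z + j.v z * deriv lam z)) / P z"
    using pull_wirt(1)[OF i.smooth_chi chi_eq z w1] by (simp only:) (simp add: algebra_simps)
  have c2: "pdb (prim_chi fi ui) (\<phi> z) = - (pdb j.v z * (j.N z + R z - lam z)
     + j.v z * (pd (pd j.\<mu>) z + pd j.\<mu> z * j.N z + j.\<mu> z * pd j.N z + j.\<mu> z * pd R z + R z * pd j.\<mu> z)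
     + 2 * (pdb (pd j.v) z + pdb j.v z * lam z)) / cnj (P z)"
    using pull_wirt(2)[OF i.smooth_chi chi_eq z w1] by (simp only:) (simp add: algebra_simps)
  show "pd (prim_chi f u) z - pd (prim_chi fi ui) (\<phi> z) * P z
       = pd j.v z * (R z + lam z) + j.v z * (pd R z + deriv lam z)"
    unfolding c1 w2 using phi_nz[OF z] by (simp del: minus_add_distrib) (simp add: algebra_simps)
  show "pdb (prim_chi f u) z - pdb (prim_chi fi ui) (\<phi> z) * cnj (P z)
       = pdb j.v z * (R z + lam z) + j.v z * (j.\<mu> z * pd R z + R z * pd j.\<mu> z)"
    unfolding c2 w2 using phi_nz[OF z] by (simp del: minus_add_distrib) (simp add: algebra_simps)
qed

text \<open>The terms in \<open>pd R\<close> and \<open>deriv lam\<close> have cancelled against the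
  coboundary of \<open>prim_chi\<close>. What is left is matched with the variation of
  \<open>\<theta>\<close> in \<open>dt_Th\<close>.\<close>

lemma cech_prim: assumes z: "z \<in> D"
  shows "fst (prim f u h z) - fst (prim fi ui hi (\<phi> z)) * P z
       = R z * pd j.v z + lam z * (R z * j.v z + j.p z)"
    "snd (prim f u h z) - snd (prim fi ui hi (\<phi> z)) * cnj (P z)
       = 2 * j.m z * lam z + R z * (j.\<mu> z * pd j.v z - j.v z * pd j.\<mu> z)"
proof -
  have X: "prim_A f u h z - prim_A fi ui hi (\<phi> z) * P z
     = - j.v z * pd R z - j.v z * deriv lam z + j.v z * (j.N z + R z) * lam z"
    unfolding prim_A_def v_eq[OF z] N1_eq[OF z] h_tr[OF z] using phi_nz[OF z]
    by (simp add: field_simps)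
  have "fst (prim f u h z) - fst (prim fi ui hi (\<phi> z)) * P z = (prim_A f u h z - prim_A fi ui hi (\<phi> z) * P z)
      + (pd (prim_chi f u) z - pd (prim_chi fi ui) (\<phi> z) * P z)"
    by (simp add: prim_def algebra_simps)
  then show "fst (prim f u h z) - fst (prim fi ui hi (\<phi> z)) * P z
       = R z * pd j.v z + lam z * (R z * j.v z + j.p z)"
    unfolding X chi1_eq(1)[OF z] var_log_def by (simp add: algebra_simps)
  have Y: "prim_B f u h z - prim_B fi ui hi (\<phi> z) * cnj (P z)
     = - (R z - lam z) * j.m z - pd j.v z * j.\<mu> z * lam z - R z * j.v z * pd j.\<mu> z + j.v z * pd j.\<mu> z * lam z
       - j.v z * j.\<mu> z * pd R z"
    unfolding prim_B_def v_eq[OF z] N1_eq[OF z] h_tr[OF z] N_eq[OF z] m_eq[OF z] p_eq[OF z]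
      mu1_eq[OF z] mu2_eq[OF z] mu_eq[OF z]
    unfolding var_log_def using phi_nz[OF z]
    by (simp add: field_simps)
  \<comment> \<open>Eliminating \<open>pdb v\<close> in favour of \<open>m\<close> brings out
    \<open>2 * m * lam\<close>, the variation of the term \<open>2 \<mu> z''/z' dzbar\<close> of
    \<open>\<theta>\<close>.\<close>
  have e: "pdb j.v z = j.m z - j.v z * pd j.\<mu> z + j.\<mu> z * pd j.v z"
    by (simp add: var_mu_def)
  have "snd (prim f u h z) - snd (prim fi ui hi (\<phi> z)) * cnj (P z) = (prim_B f u h z - prim_B fi ui hi (\<phi> z) * cnj (P z))
      + (pdb (prim_chi f u) z - pdb (prim_chi fi ui) (\<phi> z) * cnj (P z))"
    by (simp add: prim_def algebra_simps)
  then show "snd (prim f u h z) - snd (prim fi ui hi (\<phi> z)) * cnj (P z)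
       = 2 * j.m z * lam z + R z * (j.\<mu> z * pd j.v z - j.v z * pd j.\<mu> z)"
    unfolding Y chi1_eq(2)[OF z] e by (simp add: algebra_simps)
qed

end

section \<open>Integration over simplices\<close>

text \<open>Bridge between the gauge integral of the definitions and the Lebesgue integral, in which
  Fubini and the change of variables are carried out.\<close>

lemma compact_integral:
  fixes f :: "'a::euclidean_space \<Rightarrow> 'b::euclidean_space"
  assumes "compact S" "continuous_on S f"
  shows "set_integrable lborel S f" "f integrable_on S"
    "integral S f = (\<integral>x. indicator S x *\<^sub>R f x \<partial>lborel)"
    "f absolutely_integrable_on S"
proof -
  have i: "integrable lborel (\<lambda>x. indicator S x *\<^sub>R f x)" by (rule borel_integrable_compact[OF assms])
  then show s: "set_integrable lborel S f" unfolding set_integrable_def .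
  show "f integrable_on S" using set_borel_integral_eq_integral(1)[OF s] .
  show "integral S f = (\<integral>x. indicator S x *\<^sub>R f x \<partial>lborel)"
    using set_borel_integral_eq_integral(2)[OF s] unfolding set_lebesgue_integral_def by simp
  show "f absolutely_integrable_on S"
    unfolding set_integrable_def using i integrable_completion[OF borel_measurable_integrable[OF i]] by blast
qed

text \<open>Boxes pull back to boxes with the same side lengths. This serves both to permute
  coordinates and to pass between \<open>real \<times> real\<close>, \<open>real^2\<close> and
  \<open>complex\<close>.\<close>

lemma lborel_basis_bij:
  fixes e :: "'a::euclidean_space \<Rightarrow> 'b::euclidean_space"
  assumes e: "linear e" and bij: "bij_betw e Basis Basis"
    and inner: "\<And>x b. b \<in> Basis \<Longrightarrow> e x \<bullet> e b = x \<bullet> b"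
  shows "lborel = distr lborel borel e"
proof (rule lborel_eqI)
  have m: "e \<in> borel_measurable lborel"
    using linear_continuous_on[of e UNIV] e by (simp add: linear_linear borel_measurable_continuous_onI)
  fix l u :: 'b assume le: "\<And>b. b \<in> Basis \<Longrightarrow> l \<bullet> b \<le> u \<bullet> b"
  define l' where "l' = (\<Sum>b\<in>Basis. (l \<bullet> e b) *\<^sub>R b)"
  define u' where "u' = (\<Sum>b\<in>Basis. (u \<bullet> e b) *\<^sub>R b)"
  have l': "l' \<bullet> b = l \<bullet> e b" "u' \<bullet> b = u \<bullet> e b" if "b \<in> Basis" for b
    unfolding l'_def u'_def using that by simp_all
  have im: "Basis = e ` Basis" using bij by (simp add: bij_betw_def)
  have "e -` box l u = {x. \<forall>b\<in>e ` Basis. l \<bullet> b < e x \<bullet> b \<and> e x \<bullet> b < u \<bullet> b}"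
    using im by (auto simp: box_def)
  also have "\<dots> = box l' u'"
    using inner l' by (auto simp: box_def)
  finally have "emeasure (distr lborel borel e) (box l u) = emeasure lborel (box l' u')"
    using m by (simp add: emeasure_distr)
  also have "\<dots> = (\<Prod>b\<in>Basis. (u' - l') \<bullet> b)"
  proof (rule emeasure_lborel_box)
    fix b :: 'a assume b: "b \<in> Basis"
    then have "e b \<in> Basis" using im by blast
    then show "l' \<bullet> b \<le> u' \<bullet> b" using le l' b by simp
  qed
  also have "(\<Prod>b\<in>Basis. (u' - l') \<bullet> b) = (\<Prod>b\<in>Basis. (u - l) \<bullet> e b)"
    by (intro prod.cong refl) (simp add: inner_diff_left l')
  also have "\<dots> = (\<Prod>b\<in>Basis. (u - l) \<bullet> b)"
    by (rule prod.reindex_bij_betw[OF bij])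
  finally show "emeasure (distr lborel borel e) (box l u) = (\<Prod>b\<in>Basis. (u - l) \<bullet> b)" .
qed simp

lemma integral_basis_bij:
  fixes e :: "'a::euclidean_space \<Rightarrow> 'b::euclidean_space" and f :: "'b \<Rightarrow> 'c::euclidean_space"
  assumes e: "linear e" "bij_betw e Basis Basis" "\<And>x b. b \<in> Basis \<Longrightarrow> e x \<bullet> e b = x \<bullet> b"
    and S: "compact S" "e ` S = T" "\<And>x. e x \<in> T \<Longrightarrow> x \<in> S" and f: "continuous_on T f"
  shows "integral T f = integral S (\<lambda>x. f (e x))"
proof -
  have ce: "continuous_on A e" for A
    using linear_continuous_on[of e A] e(1) by (simp add: linear_linear)
  have T: "compact T" using S(1,2) ce compact_continuous_image by blast
  have fe: "continuous_on S (\<lambda>x. f (e x))"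
    by (rule continuous_on_compose2[OF f ce]) (use S in auto)
  have m: "e \<in> measurable lborel borel" using ce by (simp add: borel_measurable_continuous_onI)
  have mf: "(\<lambda>x. indicator T x *\<^sub>R f x) \<in> borel_measurable borel"
    using borel_measurable_integrable[OF borel_integrable_compact[OF T f]] by simp
  have "(\<integral>x. indicator T x *\<^sub>R f x \<partial>lborel) = (\<integral>x. indicator T x *\<^sub>R f x \<partial>distr lborel borel e)"
    using lborel_basis_bij[OF e] by simp
  also have "\<dots> = (\<integral>x. indicator T (e x) *\<^sub>R f (e x) \<partial>lborel)"
    using integral_distr[OF m mf] .
  also have "\<dots> = (\<integral>x. indicator S x *\<^sub>R f (e x) \<partial>lborel)"
    using S(2,3) by (intro Bochner_Integration.integral_cong) (auto simp: indicator_def)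
  finally show ?thesis using compact_integral(3)[OF T f] compact_integral(3)[OF S(1) fe] by simp
qed

text \<open>Fubini for the region under the graph of \<open>lam\<close>, followed by the fundamental
  theorem on each fibre.\<close>

lemma region_ftc:
  fixes B :: "'b::euclidean_space set" and lam :: "'b \<Rightarrow> real" and \<phi> \<psi> :: "real \<times> 'b \<Rightarrow> complex"
  defines "R \<equiv> {(r, y). y \<in> B \<and> 0 \<le> r \<and> r \<le> lam y}"
  assumes B: "compact B" and R: "compact R" and lam: "continuous_on B lam" "\<And>y. y \<in> B \<Longrightarrow> 0 \<le> lam y"
    and c: "continuous_on R \<phi>" "continuous_on R \<psi>"
    and d: "\<And>r y. y \<in> B \<Longrightarrow> 0 \<le> r \<Longrightarrow> r \<le> lam y \<Longrightarrow>
      ((\<lambda>r. \<phi> (r, y)) has_vector_derivative \<psi> (r, y)) (at r within {0..lam y})"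
  shows "integral R \<psi> = integral B (\<lambda>y. \<phi> (lam y, y) - \<phi> (0, y))"
proof -
  have cB: "continuous_on B (\<lambda>y. \<phi> (lam y, y) - \<phi> (0, y))"
    by (intro continuous_intros continuous_on_compose2[OF c(1)] lam(1)) (auto simp: R_def lam(2))
  have i: "integrable (lborel \<Otimes>\<^sub>M lborel) (\<lambda>(r, y). indicator R (r, y) *\<^sub>R \<psi> (r, y))"
    using borel_integrable_compact[OF R c(2)] by (simp add: lborel_prod case_prod_unfold)
  have "integral R \<psi> = integral\<^sup>L (lborel \<Otimes>\<^sub>M lborel) (\<lambda>(r, y). indicator R (r, y) *\<^sub>R \<psi> (r, y))"
    using compact_integral(3)[OF R c(2)] by (simp add: lborel_prod case_prod_unfold)
  also have "\<dots> = (\<integral>y. (\<integral>r. indicator R (r, y) *\<^sub>R \<psi> (r, y) \<partial>lborel) \<partial>lborel)"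
    using lborel_pair.integral_snd[OF i] by simp
  also have "\<dots> = (\<integral>y. indicator B y *\<^sub>R (\<phi> (lam y, y) - \<phi> (0, y)) \<partial>lborel)"
  proof (intro Bochner_Integration.integral_cong refl)
    fix y
    show "(\<integral>r. indicator R (r, y) *\<^sub>R \<psi> (r, y) \<partial>lborel) = indicator B y *\<^sub>R (\<phi> (lam y, y) - \<phi> (0, y))"
    proof (cases "y \<in> B")
      case True
      have "(\<integral>r. indicator R (r, y) *\<^sub>R \<psi> (r, y) \<partial>lborel)
          = (\<integral>r. indicator {0..lam y} r *\<^sub>R \<psi> (r, y) \<partial>lborel)"
        using True by (intro Bochner_Integration.integral_cong refl) (auto simp: R_def indicator_def)
      also have "\<dots> = \<phi> (lam y, y) - \<phi> (0, y)"
      proof (rule integral_FTC_atLeastAtMost[OF lam(2)[OF True] d[OF True]])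
        show "continuous_on {0..lam y} (\<lambda>r. \<psi> (r, y))"
          by (intro continuous_on_compose2[OF c(2)] continuous_intros) (auto simp: R_def True)
      qed
      finally show ?thesis using True by simp
    next
      case False
      then have "indicator R (r, y) = (0::real)" for r by (simp add: R_def)
      then show ?thesis using False by simp
    qed
  qed
  also have "\<dots> = integral B (\<lambda>y. \<phi> (lam y, y) - \<phi> (0, y))"
    using compact_integral(3)[OF B cB] by simp
  finally show ?thesis .
qed

section \<open>Triangle and tetrahedron\<close>

definition tetra :: "(real \<times> real \<times> real) set" where
  "tetra = {(r, s, t). 0 \<le> r \<and> 0 \<le> s \<and> 0 \<le> t \<and> r + s + t \<le> 1}"

lemma compact_triangle: "compact triangle"
proof -
  have "triangle = {p. 0 \<le> fst p} \<inter> {p. 0 \<le> snd p} \<inter> {p. fst p + snd p \<le> 1}"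
    by (auto simp: triangle_def)
  moreover have "closed \<dots>" by (intro closed_Int closed_Collect_le continuous_intros)
  moreover have "triangle \<subseteq> cbox (0, 0) (1, 1)" by (auto simp: triangle_def cbox_Pair_eq)
  ultimately show ?thesis using bounded_subset[OF bounded_cbox] compact_eq_bounded_closed by metis
qed

lemma compact_tetra: "compact tetra"
proof -
  have "tetra = {p. 0 \<le> fst p} \<inter> {p. 0 \<le> fst (snd p)} \<inter> {p. 0 \<le> snd (snd p)} \<inter> {p. fst p + fst (snd p) + snd (snd p) \<le> 1}"
    by (auto simp: tetra_def)
  moreover have "closed \<dots>" by (intro closed_Int closed_Collect_le continuous_intros)
  moreover have "tetra \<subseteq> cbox (0, 0, 0) (1, 1, 1)" by (auto simp: tetra_def cbox_Pair_eq)
  ultimately show ?thesis using bounded_subset[OF bounded_cbox] compact_eq_bounded_closed by metis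
qed

lemma integral_triangle_swap:
  fixes f :: "real \<times> real \<Rightarrow> complex"
  assumes "continuous_on triangle f"
  shows "integral triangle f = integral triangle (\<lambda>(s, t). f (t, s))"
proof -
  let ?e = "\<lambda>p::real \<times> real. (snd p, fst p)"
  have "integral triangle f = integral triangle (\<lambda>p. f (?e p))"
  proof (rule integral_basis_bij[OF _ _ _ compact_triangle _ _ assms])
    show "linear ?e" by (auto intro!: linearI)
    show "bij_betw ?e Basis Basis"
      by (rule bij_betw_byWitness[where f' = ?e]) (auto simp: Basis_prod_def)
    show "\<And>x b. ?e x \<bullet> ?e b = x \<bullet> b" by (simp add: inner_prod_def)
    show "?e ` triangle = triangle" by (force simp: triangle_def image_iff)
  qed (auto simp: triangle_def)
  then show ?thesis by (simp add: case_prod_unfold)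
qed

lemma triangle_ftc1:
  fixes \<phi> \<psi> :: "real \<times> real \<Rightarrow> complex"
  assumes "continuous_on triangle \<phi>" "continuous_on triangle \<psi>"
    and "\<And>s t. (s, t) \<in> triangle \<Longrightarrow>
      ((\<lambda>s. \<phi> (s, t)) has_vector_derivative \<psi> (s, t)) (at s within {0..1 - t})"
  shows "integral triangle \<psi> = integral {0..1} (\<lambda>t. \<phi> (1 - t, t) - \<phi> (0, t))"
proof -
  have T: "triangle = {(s, t). t \<in> {0..1} \<and> 0 \<le> s \<and> s \<le> 1 - t}" by (auto simp: triangle_def)
  have m: "(s, t) \<in> triangle" if "t \<in> {0..1}" "0 \<le> s" "s \<le> 1 - t" for s t
    using that by (auto simp: triangle_def)
  show ?thesis
    unfolding T
    by (rule region_ftc[where lam = "\<lambda>t. 1 - t", OF _ compact_triangle[unfolded T] _ _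
          assms(1)[unfolded T] assms(2)[unfolded T]])
       (use assms(3) m in \<open>auto intro!: continuous_intros\<close>)
qed

lemma triangle_ftc2:
  fixes \<phi> \<psi> :: "real \<times> real \<Rightarrow> complex"
  assumes "continuous_on triangle \<phi>" "continuous_on triangle \<psi>"
    and "\<And>s t. (s, t) \<in> triangle \<Longrightarrow>
      ((\<lambda>t. \<phi> (s, t)) has_vector_derivative \<psi> (s, t)) (at t within {0..1 - s})"
  shows "integral triangle \<psi> = integral {0..1} (\<lambda>s. \<phi> (s, 1 - s) - \<phi> (s, 0))"
proof -
  have sw: "continuous_on triangle (\<lambda>(s, t). f (t, s))" if "continuous_on triangle f"
    for f :: "real \<times> real \<Rightarrow> complex"
    unfolding case_prod_unfold
    by (intro continuous_on_compose2[OF that] continuous_intros) (auto simp: triangle_def)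
  have d: "((\<lambda>s. (\<lambda>(s, t). \<phi> (t, s)) (s, t)) has_vector_derivative (\<lambda>(s, t). \<psi> (t, s)) (s, t))
      (at s within {0..1 - t})" if "(s, t) \<in> triangle" for s t
    using assms(3)[of t s] that by (auto simp: triangle_def)
  show ?thesis
    using integral_triangle_swap[OF assms(2)] triangle_ftc1[OF sw[OF assms(1)] sw[OF assms(2)] d] by simp
qed

text \<open>The substitution \<open>s -> 1 - s - t\<close> on every horizontal line. It reconciles
  different parametrizations of the slanted face in Stokes' theorem for the tetrahedron.\<close>

lemma integral_triangle_reflect:
  fixes f :: "real \<times> real \<Rightarrow> complex"
  assumes f: "continuous_on triangle f"
  shows "integral triangle (\<lambda>(s, t). f (1 - s - t, t)) = integral triangle f"
proof -
  let ?g = "\<lambda>p. f (1 - fst p - snd p, snd p)"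
  have g: "continuous_on triangle ?g"
    by (intro continuous_on_compose2[OF f] continuous_intros) (auto simp: triangle_def)
  have fub: "integral triangle h = (\<integral>t. (\<integral>s. indicator triangle (s, t) *\<^sub>R h (s, t) \<partial>lborel) \<partial>lborel)"
    if "continuous_on triangle h" for h :: "real \<times> real \<Rightarrow> complex"
  proof -
    have i: "integrable (lborel \<Otimes>\<^sub>M lborel) (\<lambda>(s, t). indicator triangle (s, t) *\<^sub>R h (s, t))"
      using borel_integrable_compact[OF compact_triangle that] by (simp add: lborel_prod case_prod_unfold)
    show ?thesis
      using lborel_pair.integral_snd[OF i] compact_integral(3)[OF compact_triangle that]
      by (simp add: lborel_prod case_prod_unfold)
  qed
  have "(\<integral>s. indicator triangle (s, t) *\<^sub>R ?g (s, t) \<partial>lborel) = (\<integral>s. indicator triangle (s, t) *\<^sub>R f (s, t) \<partial>lborel)" for t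
  proof -
    have "(\<integral>s. indicator triangle (s, t) *\<^sub>R f (s, t) \<partial>lborel)
        = \<bar>-1\<bar> *\<^sub>R (\<integral>s. indicator triangle ((1 - t) + (-1) * s, t) *\<^sub>R f ((1 - t) + (-1) * s, t) \<partial>lborel)"
      by (rule lborel_integral_real_affine) simp
    also have "\<dots> = (\<integral>s. indicator triangle (s, t) *\<^sub>R ?g (s, t) \<partial>lborel)"
      by (auto intro!: Bochner_Integration.integral_cong simp: indicator_def triangle_def algebra_simps)
    finally show ?thesis by simp
  qed
  then show ?thesis using fub[OF f] fub[OF g] by (simp add: case_prod_unfold)
qed

lemma tetra_ftc1:
  fixes \<phi> \<psi> :: "real \<times> real \<times> real \<Rightarrow> complex"
  assumes "continuous_on tetra \<phi>" "continuous_on tetra \<psi>"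
    and "\<And>r s t. (r, s, t) \<in> tetra \<Longrightarrow>
      ((\<lambda>r. \<phi> (r, s, t)) has_vector_derivative \<psi> (r, s, t)) (at r within {0..1 - s - t})"
  shows "integral tetra \<psi> = integral triangle (\<lambda>(s, t). \<phi> (1 - s - t, s, t) - \<phi> (0, s, t))"
proof -
  have T: "tetra = {(r, y). y \<in> triangle \<and> 0 \<le> r \<and> r \<le> 1 - fst y - snd y}"
    by (auto simp: tetra_def triangle_def)
  have nn: "0 \<le> 1 - fst y - snd y" if "y \<in> triangle" for y
    using that by (auto simp: triangle_def)
  have "integral {(r, y). y \<in> triangle \<and> 0 \<le> r \<and> r \<le> 1 - fst y - snd y} \<psi>
      = integral triangle (\<lambda>y. \<phi> (1 - fst y - snd y, y) - \<phi> (0, y))"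
  proof (rule region_ftc[where lam = "\<lambda>y. 1 - fst y - snd y", OF compact_triangle compact_tetra[unfolded T]
          _ _ assms(1)[unfolded T] assms(2)[unfolded T]])
    show "((\<lambda>r. \<phi> (r, y)) has_vector_derivative \<psi> (r, y)) (at r within {0..1 - fst y - snd y})"
      if "y \<in> triangle" "0 \<le> r" "r \<le> 1 - fst y - snd y" for r y
      using assms(3)[of r "fst y" "snd y"] that T by auto
  qed (use nn in \<open>auto intro!: continuous_intros\<close>)
  then show ?thesis using T by (simp add: case_prod_unfold)
qed

lemma integral_tetra_perm:
  fixes f :: "real \<times> real \<times> real \<Rightarrow> complex"
  assumes "continuous_on tetra f"
  shows "integral tetra f = integral tetra (\<lambda>(s, r, t). f (r, s, t))"
    "integral tetra f = integral tetra (\<lambda>(t, r, s). f (r, s, t))"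
proof -
  let ?e = "\<lambda>p::real \<times> real \<times> real. (fst (snd p), fst p, snd (snd p))"
  let ?e' = "\<lambda>p::real \<times> real \<times> real. (fst (snd p), snd (snd p), fst p)"
  let ?e'' = "\<lambda>p::real \<times> real \<times> real. (snd (snd p), fst p, fst (snd p))"
  have "integral tetra f = integral tetra (\<lambda>p. f (?e p))"
  proof (rule integral_basis_bij[OF _ _ _ compact_tetra _ _ assms])
    show "linear ?e" by (auto intro!: linearI)
    show "bij_betw ?e Basis Basis"
      by (rule bij_betw_byWitness[where f' = ?e]) (auto simp: Basis_prod_def zero_prod_def)
    show "\<And>x b. ?e x \<bullet> ?e b = x \<bullet> b" by (simp add: inner_prod_def)
    show "?e ` tetra = tetra" by (force simp: tetra_def image_iff)
  qed (auto simp: tetra_def)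
  then show "integral tetra f = integral tetra (\<lambda>(s, r, t). f (r, s, t))" by (simp add: case_prod_unfold)
  have "integral tetra f = integral tetra (\<lambda>p. f (?e' p))"
  proof (rule integral_basis_bij[OF _ _ _ compact_tetra _ _ assms])
    show "linear ?e'" by (auto intro!: linearI)
    show "bij_betw ?e' Basis Basis"
      by (rule bij_betw_byWitness[where f' = ?e'']) (auto simp: Basis_prod_def zero_prod_def)
    show "\<And>x b. ?e' x \<bullet> ?e' b = x \<bullet> b" by (simp add: inner_prod_def)
    show "?e' ` tetra = tetra" by (force simp: tetra_def image_iff)
  qed (auto simp: tetra_def)
  then show "integral tetra f = integral tetra (\<lambda>(t, r, s). f (r, s, t))" by (simp add: case_prod_unfold)
qed

lemma tetra_ftc2:
  fixes \<phi> \<psi> :: "real \<times> real \<times> real \<Rightarrow> complex"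
  assumes "continuous_on tetra \<phi>" "continuous_on tetra \<psi>"
    and "\<And>r s t. (r, s, t) \<in> tetra \<Longrightarrow>
      ((\<lambda>s. \<phi> (r, s, t)) has_vector_derivative \<psi> (r, s, t)) (at s within {0..1 - r - t})"
  shows "integral tetra \<psi> = integral triangle (\<lambda>(r, t). \<phi> (r, 1 - r - t, t) - \<phi> (r, 0, t))"
proof -
  have sw: "continuous_on tetra (\<lambda>(s, r, t). f (r, s, t))" if "continuous_on tetra f"
    for f :: "real \<times> real \<times> real \<Rightarrow> complex"
    unfolding case_prod_unfold
    by (intro continuous_on_compose2[OF that] continuous_intros) (auto simp: tetra_def)
  have d: "((\<lambda>s. (\<lambda>(s, r, t). \<phi> (r, s, t)) (s, r, t)) has_vector_derivative (\<lambda>(s, r, t). \<psi> (r, s, t)) (s, r, t))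
      (at s within {0..1 - r - t})" if "(s, r, t) \<in> tetra" for s r t
    using assms(3)[of r s t] that by (auto simp: tetra_def)
  show ?thesis
    using integral_tetra_perm(1)[OF assms(2)] tetra_ftc1[OF sw[OF assms(1)] sw[OF assms(2)] d]
    by (simp add: case_prod_unfold)
qed

lemma tetra_ftc3:
  fixes \<phi> \<psi> :: "real \<times> real \<times> real \<Rightarrow> complex"
  assumes "continuous_on tetra \<phi>" "continuous_on tetra \<psi>"
    and "\<And>r s t. (r, s, t) \<in> tetra \<Longrightarrow>
      ((\<lambda>t. \<phi> (r, s, t)) has_vector_derivative \<psi> (r, s, t)) (at t within {0..1 - r - s})"
  shows "integral tetra \<psi> = integral triangle (\<lambda>(r, s). \<phi> (r, s, 1 - r - s) - \<phi> (r, s, 0))"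
proof -
  have sw: "continuous_on tetra (\<lambda>(t, r, s). f (r, s, t))" if "continuous_on tetra f"
    for f :: "real \<times> real \<times> real \<Rightarrow> complex"
    unfolding case_prod_unfold
    by (intro continuous_on_compose2[OF that] continuous_intros) (auto simp: tetra_def)
  have d: "((\<lambda>t. (\<lambda>(t, r, s). \<phi> (r, s, t)) (t, r, s)) has_vector_derivative (\<lambda>(t, r, s). \<psi> (r, s, t)) (t, r, s))
      (at t within {0..1 - r - s})" if "(t, r, s) \<in> tetra" for t r s
    using assms(3)[of r s t] that by (auto simp: tetra_def)
  show ?thesis
    using integral_tetra_perm(2)[OF assms(2)] tetra_ftc1[OF sw[OF assms(1)] sw[OF assms(2)] d]
    by (simp add: case_prod_unfold)
qed

text \<open>The change of variables theorem concerns \<open>real^2\<close>; the domain, the map and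
  the values of the integrand are therefore conjugated with the coordinate isometry
  \<open>e\<close>.\<close>

lemma cov_complex:
  fixes g f :: "complex \<Rightarrow> complex"
  assumes S: "compact S"
    and g: "\<And>z. z \<in> S \<Longrightarrow> (g has_derivative (\<lambda>h. p z * h + q z * cnj h)) (at z within S)"
    and pq: "continuous_on S p" "continuous_on S q"
    and inj: "inj_on g S" and f: "continuous_on (g ` S) f"
  shows "integral S (\<lambda>z. of_real \<bar>(cmod (p z))\<^sup>2 - (cmod (q z))\<^sup>2\<bar> * f (g z)) = integral (g ` S) f"
proof -
  let ?J = "\<lambda>z. \<bar>(cmod (p z))\<^sup>2 - (cmod (q z))\<^sup>2\<bar>"
  define e :: "real^2 \<Rightarrow> complex" where "e v = Complex (v $ 1) (v $ 2)" for v
  define e' :: "complex \<Rightarrow> real^2" where "e' z = vector [Re z, Im z]" for z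
  have ee: "e (e' z) = z" "e' (e v) = v" for z v
    by (simp_all add: e_def e'_def vec_eq_iff forall_2)
  have lin: "linear e" "linear e'"
    by (auto intro!: linearI simp: e_def e'_def complex_eq_iff vec_eq_iff forall_2)
  have ble: "bounded_linear e" "bounded_linear e'" using lin by (auto simp: linear_linear)
  have cont: "continuous_on A e" "continuous_on A' e'" for A A'
    using ble linear_continuous_on by auto
  define S' where "S' = e' ` S"
  have S': "compact S'" unfolding S'_def using compact_continuous_image[OF cont(2) S] .
  have eS: "e ` S' = S" unfolding S'_def by (force simp: ee image_iff)
  define g' where "g' v = e' (g (e v))" for v
  have gS: "g' ` S' = e' ` g ` S" unfolding S'_def g'_def by (force simp: ee image_iff)
  define f' where "f' v = e' (f (e v))" for v
  define A where "A v h = e' (p (e v) * e h + q (e v) * cnj (e h))" for v h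
  have der: "(g' has_derivative A v) (at v within S')" if "v \<in> S'" for v
  proof -
    have "e v \<in> S" using that eS by blast
    then have 1: "(g has_derivative (\<lambda>h. p (e v) * h + q (e v) * cnj h)) (at (e v) within e ` S')"
      using g eS by simp
    have "((\<lambda>v. g (e v)) has_derivative (\<lambda>h. p (e v) * e h + q (e v) * cnj (e h))) (at v within S')"
      using diff_chain_within[OF bounded_linear_imp_has_derivative[OF ble(1)] 1] by (simp add: o_def)
    from bounded_linear.has_derivative[OF ble(2) this] show ?thesis
      unfolding g'_def[abs_def] A_def[abs_def] .
  qed
  \<comment> \<open>In the basis \<open>1\<close>, \<open>\<i>\<close> the determinant of
    \<open>h -> p h + q cnj h\<close> is \<open>|p|^2 - |q|^2\<close>.\<close>
  have det: "\<bar>det (matrix (A v))\<bar> = ?J (e v)" for v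
  proof -
    have "e (axis 1 1) = 1" "e (axis 2 1) = \<i>" by (auto simp: e_def axis_def complex_eq_iff)
    then have "det (matrix (A v)) = (cmod (p (e v)))\<^sup>2 - (cmod (q (e v)))\<^sup>2"
      unfolding det_2 matrix_def A_def e'_def cmod_power2
      by (simp add: power2_eq_square algebra_simps)
    then show ?thesis by simp
  qed
  have inj': "inj_on g' S'"
    using inj unfolding inj_on_def S'_def g'_def by (auto simp: ee) (metis ee(1))
  have f'c: "continuous_on (g' ` S') f'"
    unfolding f'_def gS
    by (intro continuous_on_compose2[OF cont(2)] continuous_on_compose2[OF f] cont(1)) (auto simp: ee)
  have cgS: "compact (g' ` S')"
  proof -
    have "continuous_on S' g'" using der has_derivative_continuous_on by blast
    then show ?thesis using S' compact_continuous_image by blast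
  qed
  have "f' absolutely_integrable_on (g' ` S')"
    by (rule compact_integral(4)[OF cgS f'c])
  then have cv: "(\<lambda>v. \<bar>det (matrix (A v))\<bar> *\<^sub>R f' (g' v)) absolutely_integrable_on S'"
    "integral S' (\<lambda>v. \<bar>det (matrix (A v))\<bar> *\<^sub>R f' (g' v)) = integral (g' ` S') f'"
    using has_absolute_integral_change_of_variables_compact[OF S' der inj', of f' "integral (g' ` S') f'"] by blast+
  have bas: "bij_betw e Basis Basis"
    by (rule bij_betw_byWitness[where f' = e'])
       (auto simp: Basis_vec_def Basis_complex_def ee UNIV_2 e_def e'_def axis_def vec_eq_iff forall_2 complex_eq_iff)
  have inner: "e x \<bullet> e b = x \<bullet> b" for x b
    by (simp add: e_def inner_complex_def inner_vec_def sum_2)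
  have tr: "integral (e ` U) F = e (integral U (\<lambda>v. e' (F (e v))))"
    if U: "compact U" "continuous_on (e ` U) F" for U and F :: "complex \<Rightarrow> complex"
  proof -
    have Fe: "continuous_on U (\<lambda>v. F (e v))"
      by (intro continuous_on_compose2[OF U(2) cont(1)]) auto
    have "integral U (e' \<circ> (\<lambda>v. F (e v))) = e' (integral U (\<lambda>v. F (e v)))"
      by (rule integral_linear[OF compact_integral(2)[OF U(1) Fe] ble(2)])
    moreover have "integral (e ` U) F = integral U (\<lambda>v. F (e v))"
      by (rule integral_basis_bij[OF lin(1) bas inner U(1) refl _ U(2)]) (metis ee(2) imageE)
    ultimately show ?thesis by (simp add: o_def ee)
  qed
  have e'_scale: "e' (of_real r * w) = r *\<^sub>R e' w" for r w
    by (simp add: e'_def vec_eq_iff forall_2)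
  have im: "e ` g' ` S' = g ` S" unfolding gS by (simp add: image_image ee)
  let ?F = "\<lambda>z. of_real (?J z) * f (g z)"
  have cg: "continuous_on S g" by (rule has_derivative_continuous_on[OF g])
  have cF: "continuous_on S ?F"
    by (intro continuous_intros pq continuous_on_compose2[OF f cg]) auto
  have "integral S ?F = e (integral S' (\<lambda>v. e' (?F (e v))))"
    by (rule tr[OF S', of ?F, unfolded eS, OF cF])
  also have "(\<lambda>v. e' (?F (e v))) = (\<lambda>v. \<bar>det (matrix (A v))\<bar> *\<^sub>R f' (g' v))"
    unfolding det f'_def g'_def ee e'_scale ..
  also have "e (integral S' (\<lambda>v. \<bar>det (matrix (A v))\<bar> *\<^sub>R f' (g' v))) = e (integral (g' ` S') f')"
    by (simp only: cv(2))
  also have "\<dots> = integral (e ` g' ` S') f"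
    unfolding f'_def[abs_def] using tr[OF cgS] f unfolding im by simp
  finally show ?thesis unfolding im .
qed

text \<open>On a compact set of pairs \<open>dt H\<close> is uniformly continuous, so the
  linearization error at time \<open>t\<close> is at most \<open>|t|\<close> times a small constant,
  uniformly over \<open>T\<close>. The factor \<open>k\<close> carries the part of the integrand
  that does not vary.\<close>

lemma has_vector_derivative_integral:
  fixes u k :: "'e::euclidean_space \<Rightarrow> complex"
  assumes W: "open W" and H: "smooth_on W H" and T: "compact T"
    and u: "continuous_on T u" and k: "continuous_on T k" and in_W: "\<And>x. x \<in> T \<Longrightarrow> (0, u x) \<in> W"
  shows "((\<lambda>t. integral T (\<lambda>x. H (t, u x) * k x)) has_vector_derivative
      integral T (\<lambda>x. dt H (0, u x) * k x)) (at 0)"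
proof -
  \<comment> \<open>The compact slice at time 0 has a neighbourhood of uniform width in
    \<open>W\<close>, so one time interval serves all points of \<open>T\<close>.\<close>
  define K where "K = Pair (0::real) ` u ` T"
  have K: "compact K" unfolding K_def
    by (intro compact_continuous_image T u continuous_intros)
  obtain e where e: "e > 0" "(\<Union>x\<in>K. cball x e) \<subseteq> W"
    using compact_subset_open_imp_cball_epsilon_subset[OF K W] in_W by (auto simp: K_def)
  have mem: "(t, u x) \<in> W" if "\<bar>t\<bar> \<le> e" "x \<in> T" for t x
  proof -
    have "(t, u x) \<in> cball (0, u x) e" using that by (simp add: dist_Pair_Pair dist_real_def)
    then have "(t, u x) \<in> (\<Union>x\<in>K. cball x e)"
      using that(2) by (intro UN_I[of "(0, u x)"]) (simp_all add: K_def)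
    then show ?thesis using e(2) by blast
  qed
  have c: "continuous_on W H" "continuous_on W (dt H)"
    using smooth_on_continuous H smooth_on_dt[OF W H] by auto
  have int: "(\<lambda>x. F (t, u x) * k x) integrable_on T"
    if "\<bar>t\<bar> \<le> e" "continuous_on W F" for t and F :: "real \<times> complex \<Rightarrow> complex"
    by (intro compact_integral(2)[OF T] continuous_intros k continuous_on_compose2[OF that(2)] u)
       (use mem that in auto)
  define C where "C = integral T (\<lambda>x. norm (k x))"
  have ik: "(\<lambda>x. norm (k x)) integrable_on T"
    by (intro compact_integral(2)[OF T] continuous_intros k)
  have C: "C \<ge> 0" unfolding C_def by (intro integral_nonneg ik) auto
  let ?I = "\<lambda>t. integral T (\<lambda>x. H (t, u x) * k x)"
  let ?I' = "integral T (\<lambda>x. dt H (0, u x) * k x)"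
  define Q where "Q = {-e..e} \<times> u ` T"
  have Q: "compact Q" "Q \<subseteq> W" unfolding Q_def
    using mem by (auto intro!: compact_Times compact_continuous_image T u)
  have unif: "uniformly_continuous_on Q (dt H)"
    using compact_uniformly_continuous[OF continuous_on_subset[OF c(2) Q(2)] Q(1)] .
  show ?thesis
    unfolding has_vector_derivative_def has_derivative_at_alt
  proof (intro conjI allI impI)
    show "bounded_linear (\<lambda>h. h *\<^sub>R ?I')" by (rule bounded_linear_scaleR_left)
    fix \<epsilon> :: real assume "\<epsilon> > 0"
    \<comment> \<open>The error is bounded by \<open>|t| * \<eta> * C\<close>; the summand 1 covers
      \<open>C = 0\<close>.\<close>
    define \<eta> where "\<eta> = \<epsilon> / (C + 1)"
    have \<eta>: "\<eta> > 0" using \<open>\<epsilon> > 0\<close> C by (simp add: \<eta>_def)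
    obtain d where d: "d > 0" "\<And>a b. a \<in> Q \<Longrightarrow> b \<in> Q \<Longrightarrow> dist b a < d \<Longrightarrow> dist (dt H b) (dt H a) < \<eta>"
      using unif \<eta> unfolding uniformly_continuous_on_def by blast
    have "norm (?I t - ?I 0 - (t - 0) *\<^sub>R ?I') \<le> \<epsilon> * norm (t - 0)" if "norm (t - 0) < min d e" for t
    proof -
      have te: "\<bar>t\<bar> \<le> e" "\<bar>t\<bar> < d" using that by auto
      have pt: "norm ((H (t, u x) - H (0, u x) - t *\<^sub>R dt H (0, u x)) * k x) \<le> \<bar>t\<bar> * \<eta> * norm (k x)" if x: "x \<in> T" for x
      proof -
        have seg: "\<bar>\<tau>\<bar> \<le> \<bar>t\<bar>" if "\<tau> \<in> closed_segment 0 t" for \<tau>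
          using that by (auto simp: closed_segment_eq_real_ivl split: if_splits)
        have "norm (H (t, u x) - H (0, u x) - (t - 0) *\<^sub>R dt H (0, u x)) \<le> norm (t - 0) * \<eta>"
        proof (rule vector_differentiable_bound_linearization[of "closed_segment 0 t" "\<lambda>t. H (t, u x)" "\<lambda>t. dt H (t, u x)"])
          fix \<tau> assume \<tau>: "\<tau> \<in> closed_segment 0 t"
          have m: "\<bar>\<tau>\<bar> \<le> e" "\<bar>\<tau>\<bar> < d" using seg[OF \<tau>] te by auto
          show "((\<lambda>t. H (t, u x)) has_vector_derivative dt H (\<tau>, u x)) (at \<tau> within closed_segment 0 t)"
            using slice_has_vector_derivative[OF H mem[OF m(1) x]] has_vector_derivative_at_within by blast
          have "dist (\<tau>, u x) (0, u x) < d" using m by (simp add: dist_Pair_Pair dist_real_def)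
          then have "dist (dt H (\<tau>, u x)) (dt H (0, u x)) < \<eta>"
            using m e(1) x by (intro d(2)) (auto simp: Q_def)
          then show "norm (dt H (\<tau>, u x) - dt H (0, u x)) \<le> \<eta>" by (simp add: dist_norm)
        qed auto
        then show ?thesis by (simp add: norm_mult mult_right_mono)
      qed
      note i = int[OF te(1) c(1)] int[of 0, OF _ c(1)] int[of 0, OF _ c(2)]
      have "?I t - ?I 0 - (t - 0) *\<^sub>R ?I' = integral T (\<lambda>x. (H (t, u x) - H (0, u x) - t *\<^sub>R dt H (0, u x)) * k x)"
      proof -
        have "integral T (\<lambda>x. H (t, u x) * k x - H (0, u x) * k x - t *\<^sub>R (dt H (0, u x) * k x))
            = ?I t - ?I 0 - t *\<^sub>R ?I'"
          using i e(1) by (simp add: integral_diff integrable_diff integrable_cmul)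
        then show ?thesis by (simp add: algebra_simps)
      qed
      also have "norm \<dots> \<le> integral T (\<lambda>x. \<bar>t\<bar> * \<eta> * norm (k x))"
      proof (rule integral_norm_bound_integral)
        show "(\<lambda>x. (H (t, u x) - H (0, u x) - t *\<^sub>R dt H (0, u x)) * k x) integrable_on T"
        proof -
          have "(\<lambda>x. H (t, u x) * k x - H (0, u x) * k x - t *\<^sub>R (dt H (0, u x) * k x)) integrable_on T"
            using i e(1) by (intro integrable_diff integrable_cmul) auto
          then show ?thesis by (simp add: algebra_simps)
        qed
        show "(\<lambda>x. \<bar>t\<bar> * \<eta> * norm (k x)) integrable_on T"
          using ik integrable_on_mult_right by blast
      qed (use pt in auto)
      also have "\<dots> = \<bar>t\<bar> * (\<eta> * C)" by (simp add: C_def mult.assoc)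
      also have "\<bar>t\<bar> * (\<eta> * C) \<le> \<bar>t\<bar> * \<epsilon>"
        using C \<open>\<epsilon> > 0\<close> by (intro mult_left_mono) (auto simp: \<eta>_def field_simps)
      finally show ?thesis by (simp add: mult.commute)
    qed
    then show "\<exists>d>0. \<forall>y. norm (y - 0) < d \<longrightarrow> norm (?I y - ?I 0 - (y - 0) *\<^sub>R ?I') \<le> \<epsilon> * norm (y - 0)"
      using d(1) e(1) by (intro exI[of _ "min d e"]) auto
  qed
qed

section \<open>Stokes' theorem for smooth simplices\<close>

text \<open>Geometry that makes derivatives relative to the set unique, at boundary points as
  well.\<close>

definition solid :: "'v::euclidean_space set \<Rightarrow> bool" where
  "solid T \<longleftrightarrow> convex T \<and> interior T \<noteq> {}"

text \<open>Smoothness up to the boundary through local extensions, the notion underlying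
  \<open>smooth_simplex\<close>.\<close>

definition csmooth :: "'v::euclidean_space set \<Rightarrow> ('v \<Rightarrow> 'w::real_normed_vector) \<Rightarrow> bool" where
  "csmooth T u \<longleftrightarrow> (\<forall>x\<in>T. \<exists>W g. open W \<and> x \<in> W \<and> smooth_on W g \<and> (\<forall>y\<in>T \<inter> W. u y = g y))"

abbreviation wdir :: "'v::euclidean_space set \<Rightarrow> ('v \<Rightarrow> 'w::real_normed_vector) \<Rightarrow> 'v \<Rightarrow> 'v \<Rightarrow> 'w" where
  "wdir T u b x \<equiv> frechet_derivative u (at x within T) b"

lemma has_vector_derivative_along:
  fixes f :: "'v::real_normed_vector \<Rightarrow> 'w::real_normed_vector"
  assumes "(f has_derivative A) (at (l s) within T)" "(l has_vector_derivative b) (at s within I)" "l ` I \<subseteq> T"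
  shows "((\<lambda>s. f (l s)) has_vector_derivative A b) (at s within I)"
proof -
  have "(f has_derivative A) (at (l s) within l ` I)"
    using has_derivative_subset[OF assms(1,3)] .
  from diff_chain_within[OF assms(2)[unfolded has_vector_derivative_def] this]
  have "((\<lambda>s. f (l s)) has_derivative (\<lambda>h. A (h *\<^sub>R b))) (at s within I)" by (simp add: o_def)
  then show ?thesis
    unfolding has_vector_derivative_def
    using linear_scale[OF has_derivative_linear[OF assms(1)]] by simp
qed

text \<open>Along a segment inside \<open>T\<close> both derivatives compute the same one-sided
  derivative, so they agree on \<open>y - x\<close> for all \<open>y\<close> in \<open>T\<close>.
  Differences of such vectors fill a ball around 0, because \<open>T\<close> has interior
  points.\<close>

lemma solid_derivative_unique:
  fixes f :: "'v::euclidean_space \<Rightarrow> 'w::real_normed_vector"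
  assumes "solid T" "x \<in> T" "(f has_derivative A) (at x within T)" "(f has_derivative B) (at x within T)"
  shows "A = B"
proof
  have *: "A (y - x) = B (y - x)" if "y \<in> T" for y
  proof -
    have l: "((\<lambda>r. x + r *\<^sub>R (y - x)) has_vector_derivative (y - x)) (at 0 within cbox 0 1)"
      by (auto intro!: derivative_eq_intros simp: has_vector_derivative_def)
    have im: "(\<lambda>r. x + r *\<^sub>R (y - x)) ` cbox 0 1 \<subseteq> T"
    proof safe
      fix r :: real assume "r \<in> cbox 0 1"
      then have "(1 - r) *\<^sub>R x + r *\<^sub>R y \<in> T"
        using assms(1,2) that unfolding solid_def by (auto intro!: convexD_alt)
      then show "x + r *\<^sub>R (y - x) \<in> T" by (simp add: algebra_simps)
    qed
    show ?thesis
      using has_vector_derivative_along[OF _ l im] assms(3,4)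
      by (intro vector_derivative_unique_within_closed_interval[of 0 1 0 "\<lambda>r. f (x + r *\<^sub>R (y - x))"]) auto
  qed
  have lin: "linear A" "linear B" using assms(3,4) has_derivative_linear by auto
  obtain c where "c \<in> interior T" using assms(1) solid_def by blast
  then obtain e where e: "e > 0" "cball c e \<subseteq> T" unfolding mem_interior_cball by blast
  fix v
  show "A v = B v"
  proof (cases "v = 0")
    case True then show ?thesis using lin linear_0 by metis
  next
    case False
    \<comment> \<open>Scales \<open>v\<close> so that \<open>c + d v\<close> stays in the ball
      around the interior point \<open>c\<close>.\<close>
    define d where "d = e / norm v"
    have d: "d > 0" using e(1) False by (simp add: d_def)
    have "c + d *\<^sub>R v \<in> T" "c \<in> T" using e False by (auto simp: d_def dist_norm subset_iff)
    then have "A (c + d *\<^sub>R v - x) - A (c - x) = B (c + d *\<^sub>R v - x) - B (c - x)" using * by simp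
    then have "A (d *\<^sub>R v) = B (d *\<^sub>R v)"
      by (simp add: linear_diff[OF lin(1), symmetric] linear_diff[OF lin(2), symmetric])
    then show ?thesis using d by (simp add: linear_scale[OF lin(1)] linear_scale[OF lin(2)])
  qed
qed

lemma has_derivative_local:
  assumes "open W" "x \<in> W" "(g has_derivative A) (at x)" "\<And>y. y \<in> T \<inter> W \<Longrightarrow> u y = g y" "x \<in> T"
  shows "(u has_derivative A) (at x within T)"
proof -
  obtain d where d: "d > 0" "ball x d \<subseteq> W" using assms(1,2) open_contains_ball by blast
  have g: "(g has_derivative A) (at x within T)" by (rule has_derivative_at_withinI[OF assms(3)])
  show ?thesis
  proof (rule has_derivative_transform_within[OF g d(1) assms(5)])
    fix y assume "y \<in> T" "dist y x < d"
    then have "y \<in> T \<inter> W" using d(2) by (auto simp: dist_commute subset_iff)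
    then show "g y = u y" using assms(4) by simp
  qed
qed

text \<open>By uniqueness on solid sets, derivatives within \<open>T\<close> are those of any local
  smooth extension.\<close>

lemma wdir_local:
  assumes "solid T" "open W" "smooth_on W g" "\<And>y. y \<in> T \<inter> W \<Longrightarrow> u y = g y" "x \<in> T \<inter> W"
  shows "(u has_derivative frechet_derivative g (at x)) (at x within T)"
    "frechet_derivative u (at x within T) = frechet_derivative g (at x)"
proof -
  show 1: "(u has_derivative frechet_derivative g (at x)) (at x within T)"
    by (rule has_derivative_local[OF assms(2) _ smooth_on_has_derivative[OF assms(3)] assms(4)]) (use assms(5) in auto)
  then have "(u has_derivative frechet_derivative u (at x within T)) (at x within T)"
    unfolding frechet_derivative_works[symmetric] by (rule differentiableI)
  from solid_derivative_unique[OF assms(1) _ this 1]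
  show "frechet_derivative u (at x within T) = frechet_derivative g (at x)" using assms(5) by simp
qed

lemma csmooth_local:
  "csmooth T u \<Longrightarrow> x \<in> T \<Longrightarrow> \<exists>W g. open W \<and> x \<in> W \<and> smooth_on W g \<and> (\<forall>y\<in>T \<inter> W. u y = g y)"
  unfolding csmooth_def by (rule bspec)

lemma csmooth_has_derivative:
  assumes "solid T" "csmooth T u" "x \<in> T"
  shows "(u has_derivative frechet_derivative u (at x within T)) (at x within T)"
proof -
  obtain W g where "open W \<and> x \<in> W \<and> smooth_on W g \<and> (\<forall>y\<in>T \<inter> W. u y = g y)"
    using csmooth_local[OF assms(2,3)] by (elim exE)
  then have W: "open W" "x \<in> W" "smooth_on W g" "\<And>y. y \<in> T \<inter> W \<Longrightarrow> u y = g y" by simp_all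
  show ?thesis using wdir_local[OF assms(1) W(1,3,4), of x] assms(3) W(2) by simp
qed

lemma csmooth_wdir:
  assumes "solid T" "csmooth T u" shows "csmooth T (wdir T u b)"
  unfolding csmooth_def
proof
  fix x assume x: "x \<in> T"
  obtain W g where "open W \<and> x \<in> W \<and> smooth_on W g \<and> (\<forall>y\<in>T \<inter> W. u y = g y)"
    using csmooth_local[OF assms(2) x] by (elim exE)
  then have W: "open W" "x \<in> W" "smooth_on W g" "\<And>y. y \<in> T \<inter> W \<Longrightarrow> u y = g y" by simp_all
  have "\<forall>y\<in>T \<inter> W. wdir T u b y = dird g b y"
    using wdir_local(2)[OF assms(1) W(1,3,4)] by simp
  then show "\<exists>W g. open W \<and> x \<in> W \<and> smooth_on W g \<and> (\<forall>y\<in>T \<inter> W. wdir T u b y = g y)"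
    using W smooth_on_dird[OF W(1,3)] by (intro exI[of _ W] exI[of _ "dird g b"]) auto
qed

lemma csmooth_continuous:
  assumes "csmooth T u" shows "continuous_on T u"
  unfolding continuous_on_eq_continuous_within
proof
  fix x assume x: "x \<in> T"
  obtain W g where "open W \<and> x \<in> W \<and> smooth_on W g \<and> (\<forall>y\<in>T \<inter> W. u y = g y)"
    using csmooth_local[OF assms x] by (elim exE)
  then have W: "open W" "x \<in> W" "smooth_on W g" "\<And>y. y \<in> T \<inter> W \<Longrightarrow> u y = g y" by simp_all
  have "(u has_derivative frechet_derivative g (at x)) (at x within T)"
    by (rule has_derivative_local[OF W(1,2) smooth_on_has_derivative[OF W(3,2)] W(4) x])
  then show "continuous (at x within T) u" using has_derivative_continuous by blast
qed

lemma csmooth_compose: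
  fixes u :: "'v::euclidean_space \<Rightarrow> 'u::euclidean_space" and \<phi> :: "'u \<Rightarrow> 'w::real_normed_vector"
  assumes "csmooth T u" "open V" "smooth_on V \<phi>" "\<And>x. x \<in> T \<Longrightarrow> u x \<in> V"
  shows "csmooth T (\<lambda>x. \<phi> (u x))"
  unfolding csmooth_def
proof
  fix x assume x: "x \<in> T"
  obtain W g where "open W \<and> x \<in> W \<and> smooth_on W g \<and> (\<forall>y\<in>T \<inter> W. u y = g y)"
    using csmooth_local[OF assms(1) x] by (elim exE)
  then have W: "open W" "x \<in> W" "smooth_on W g" "\<And>y. y \<in> T \<inter> W \<Longrightarrow> u y = g y" by simp_all
  have o: "open (W \<inter> g -` V)"
    using continuous_open_preimage[OF smooth_on_continuous[OF W(3)] W(1) assms(2)] .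
  have "smooth_on (W \<inter> g -` V) (\<lambda>x. \<phi> (g x))"
    by (rule smooth_on_compose[OF o assms(3) smooth_on_subset[OF W(3)]]) auto
  moreover have "x \<in> W \<inter> g -` V" using W(2) W(4)[of x] assms(4)[OF x] x by simp
  moreover have "\<forall>y\<in>T \<inter> (W \<inter> g -` V). \<phi> (u y) = \<phi> (g y)" using W(4) by simp
  ultimately show "\<exists>W g. open W \<and> x \<in> W \<and> smooth_on W g \<and> (\<forall>y\<in>T \<inter> W. \<phi> (u y) = g y)"
    using o by (intro exI[of _ "W \<inter> g -` V"] exI[of _ "\<lambda>x. \<phi> (g x)"]) blast
qed

lemma csmooth_combine:
  fixes T :: "'v::euclidean_space set"
  assumes "csmooth T u" "csmooth T v"
    and "\<And>(W :: 'v set) g h. open W \<Longrightarrow> smooth_on W g \<Longrightarrow> smooth_on W h \<Longrightarrow> smooth_on W (\<lambda>x. F (g x) (h x))"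
  shows "csmooth T (\<lambda>x. F (u x) (v x))"
  unfolding csmooth_def
proof
  fix x assume x: "x \<in> T"
  obtain W g where "open W \<and> x \<in> W \<and> smooth_on W g \<and> (\<forall>y\<in>T \<inter> W. u y = g y)"
    using csmooth_local[OF assms(1) x] by (elim exE)
  then have W: "open W" "x \<in> W" "smooth_on W g" "\<And>y. y \<in> T \<inter> W \<Longrightarrow> u y = g y" by simp_all
  obtain W' h where "open W' \<and> x \<in> W' \<and> smooth_on W' h \<and> (\<forall>y\<in>T \<inter> W'. v y = h y)"
    using csmooth_local[OF assms(2) x] by (elim exE)
  then have W': "open W'" "x \<in> W'" "smooth_on W' h" "\<And>y. y \<in> T \<inter> W' \<Longrightarrow> v y = h y" by simp_all
  have "smooth_on (W \<inter> W') (\<lambda>x. F (g x) (h x))"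
    by (rule assms(3)) (auto intro: smooth_on_subset W W')
  then show "\<exists>W g. open W \<and> x \<in> W \<and> smooth_on W g \<and> (\<forall>y\<in>T \<inter> W. F (u y) (v y) = g y)"
    using W W' by (intro exI[of _ "W \<inter> W'"] exI[of _ "\<lambda>x. F (g x) (h x)"]) auto
qed

lemma csmooth_mult:
  fixes u v :: "'v::euclidean_space \<Rightarrow> complex"
  shows "csmooth T u \<Longrightarrow> csmooth T v \<Longrightarrow> csmooth T (\<lambda>x. u x * v x)"
  by (rule csmooth_combine[where F = "(*)"]) (auto intro: smooth_on_mult)

lemma csmooth_add:
  fixes u v :: "'v::euclidean_space \<Rightarrow> complex"
  shows "csmooth T u \<Longrightarrow> csmooth T v \<Longrightarrow> csmooth T (\<lambda>x. u x + v x)"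
  by (rule csmooth_combine[where F = "(+)"]) (auto intro: smooth_on_add)

lemma csmooth_cnj:
  fixes u :: "'v::euclidean_space \<Rightarrow> complex"
  shows "csmooth T u \<Longrightarrow> csmooth T (\<lambda>x. cnj (u x))"
  by (rule csmooth_compose[where V = UNIV]) (auto intro: smooth_on_linear bounded_linear_cnj)

lemma solid_triangle: "solid triangle"
proof -
  have "convex triangle"
  proof (rule convexI)
    fix x y :: "real \<times> real" and u v :: real
    assume h: "x \<in> triangle" "y \<in> triangle" "0 \<le> u" "0 \<le> v" "u + v = 1"
    have "u * (fst x + snd x) + v * (fst y + snd y) \<le> u * 1 + v * 1"
      using h by (intro add_mono mult_left_mono) (auto simp: triangle_def)
    then show "u *\<^sub>R x + v *\<^sub>R y \<in> triangle"
      using h by (auto simp: triangle_def algebra_simps)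
  qed
  moreover have "(1/4, 1/4) \<in> interior triangle"
    by (rule interiorI[of "box (0, 0) (1/2, 1/2)"]) (auto simp: triangle_def mem_box Basis_prod_def)
  ultimately show ?thesis unfolding solid_def by blast
qed

lemma solid_tetra: "solid tetra"
proof -
  have "convex tetra"
  proof (rule convexI)
    fix x y :: "real \<times> real \<times> real" and u v :: real
    assume h: "x \<in> tetra" "y \<in> tetra" "0 \<le> u" "0 \<le> v" "u + v = 1"
    have "u * (fst x + fst (snd x) + snd (snd x)) + v * (fst y + fst (snd y) + snd (snd y)) \<le> u * 1 + v * 1"
      using h by (intro add_mono mult_left_mono) (auto simp: tetra_def)
    then show "u *\<^sub>R x + v *\<^sub>R y \<in> tetra"
      using h by (auto simp: tetra_def algebra_simps)
  qed
  moreover have "(1/8, 1/8, 1/8) \<in> interior tetra"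
    by (rule interiorI[of "box (0, 0, 0) (1/4, 1/4, 1/4)"]) (auto simp: tetra_def mem_box Basis_prod_def)
  ultimately show ?thesis unfolding solid_def by blast
qed

lemma solid_unit: "solid {0..1::real}"
proof -
  have "interior {0..1::real} = {0<..<1}" by (rule interior_atLeastAtMost_real)
  moreover have "(1/2::real) \<in> {0<..<1}" by simp
  ultimately show ?thesis unfolding solid_def by auto
qed

lemma integral_unit_reflect:
  fixes f :: "real \<Rightarrow> complex"
  assumes "continuous_on {0..1} f"
  shows "integral {0..1} (\<lambda>s. f (1 - s)) = integral {0..1} f"
proof -
  have c: "continuous_on {0..1} (\<lambda>s. f (1 - s))"
    by (intro continuous_on_compose2[OF assms] continuous_intros) auto
  have "(\<integral>s. indicator {0..1} s *\<^sub>R f s \<partial>lborel)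
      = \<bar>-1\<bar> *\<^sub>R (\<integral>s. indicator {0..1} (1 + (-1) * s) *\<^sub>R f (1 + (-1) * s) \<partial>lborel)"
    by (rule lborel_integral_real_affine) simp
  also have "\<dots> = (\<integral>s. indicator {0..1} s *\<^sub>R f (1 - s) \<partial>lborel)"
    by (auto intro!: Bochner_Integration.integral_cong simp: indicator_def)
  finally show ?thesis
    using compact_integral(3)[OF compact_Icc assms] compact_integral(3)[OF compact_Icc c] by simp
qed

section \<open>Pulled-back forms and Stokes' theorem on the model simplices\<close>

definition edge_form :: "form1 \<Rightarrow> 'v::euclidean_space set \<Rightarrow> ('v \<Rightarrow> complex) \<Rightarrow> 'v \<Rightarrow> 'v \<Rightarrow> complex" where
  "edge_form \<eta> T u b x = fst (\<eta> (u x)) * wdir T u b x + snd (\<eta> (u x)) * cnj (wdir T u b x)"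

text \<open>The pullback of \<open>\<omega> dz \<and> dzbar\<close> along \<open>u\<close>,
  evaluated on the pair \<open>b\<close>, \<open>c\<close>; \<open>edge_form\<close> is the analogue
  for 1-forms and one direction.\<close>

definition area_form :: "form2 \<Rightarrow> 'v::euclidean_space set \<Rightarrow> ('v \<Rightarrow> complex) \<Rightarrow> 'v \<Rightarrow> 'v \<Rightarrow> 'v \<Rightarrow> complex" where
  "area_form \<omega> T u b c x = \<omega> (u x) * (wdir T u b x * cnj (wdir T u c x) - wdir T u c x * cnj (wdir T u b x))"

lemma dird_compose_complex:
  assumes "smooth_on V \<phi>" "g x \<in> V" "(g has_derivative A) (at x)"
  shows "((\<lambda>x. \<phi> (g x)) has_derivative (\<lambda>h. pd \<phi> (g x) * A h + pdb \<phi> (g x) * cnj (A h))) (at x)"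
  using has_derivative_compose[OF assms(3) smooth_on_has_wirt[OF assms(1,2), unfolded has_wirt_def]] .

context
  fixes T :: "'v::euclidean_space set" and u :: "'v \<Rightarrow> complex" and V :: "complex set"
  assumes T: "solid T" and u: "csmooth T u" and V: "open V" and uV: "\<And>x. x \<in> T \<Longrightarrow> u x \<in> V"
begin

lemma csmooth_edge_form:
  assumes "smooth_on V \<eta>" shows "csmooth T (edge_form \<eta> T u b)"
  unfolding edge_form_def[abs_def]
  by (intro csmooth_add csmooth_mult csmooth_cnj csmooth_wdir T u)
     (rule csmooth_compose[OF u V _ uV, of "\<lambda>z. fst (\<eta> z)"] csmooth_compose[OF u V _ uV, of "\<lambda>z. snd (\<eta> z)"],
      use assms V in \<open>auto intro: smooth_on_fst smooth_on_snd\<close>)+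

text \<open>Exterior derivative commutes with pullback: the terms with second derivatives of the
  local extension of \<open>u\<close> cancel by symmetry, and the first-order terms assemble to
  \<open>d1 \<eta>\<close>.\<close>

lemma curl_edge_form:
  assumes \<eta>: "smooth_on V \<eta>" and x: "x \<in> T"
  shows "wdir T (edge_form \<eta> T u c) b x - wdir T (edge_form \<eta> T u b) c x = area_form (d1 \<eta>) T u b c x"
proof -
  obtain W g where "open W \<and> x \<in> W \<and> smooth_on W g \<and> (\<forall>y\<in>T \<inter> W. u y = g y)"
    using csmooth_local[OF u x] by (elim exE)
  then have W: "open W" "x \<in> W" "smooth_on W g" "\<And>y. y \<in> T \<inter> W \<Longrightarrow> u y = g y" by simp_all
  let ?W = "W \<inter> g -` V"
  have o: "open ?W" using continuous_open_preimage[OF smooth_on_continuous[OF W(3)] W(1) V] .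
  have xW: "x \<in> T \<inter> ?W" using W(2) W(4)[of x] uV[OF x] x by simp
  have sg: "smooth_on ?W g" using smooth_on_subset[OF W(3)] by blast
  let ?A = "\<lambda>z. fst (\<eta> z)" and ?B = "\<lambda>z. snd (\<eta> z)"
  have AB: "smooth_on V ?A" "smooth_on V ?B" using \<eta> V by (auto intro: smooth_on_fst smooth_on_snd)
  have gV: "g x \<in> V" using xW by simp
  have g: "(g has_derivative frechet_derivative g (at x)) (at x)"
    using smooth_on_has_derivative[OF sg] xW by blast
  have gd: "(dird g e has_derivative frechet_derivative (dird g e) (at x)) (at x)" for e
    using smooth_on_has_derivative[OF smooth_on_dird[OF o sg]] xW by blast
  have dd: "wdir T (edge_form \<eta> T u e) e' x =
      (pd ?A (g x) * dird g e' x + pdb ?A (g x) * cnj (dird g e' x)) * dird g e x + ?A (g x) * dird (dird g e) e' x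
      + ((pd ?B (g x) * dird g e' x + pdb ?B (g x) * cnj (dird g e' x)) * cnj (dird g e x) + ?B (g x) * cnj (dird (dird g e) e' x))"
    for e e'
  proof -
    let ?E = "\<lambda>y. ?A (g y) * dird g e y + ?B (g y) * cnj (dird g e y)"
    have sE: "smooth_on ?W ?E"
      by (intro smooth_on_add smooth_on_mult smooth_on_cnj smooth_on_dird o sg
          smooth_on_compose[OF o AB(1) sg] smooth_on_compose[OF o AB(2) sg]) auto
    have eq: "edge_form \<eta> T u e y = ?E y" if "y \<in> T \<inter> ?W" for y
    proof -
      have "wdir T u e y = dird g e y"
        using wdir_local(2)[OF T W(1,3,4), of y] that by auto
      then show ?thesis using W(4)[of y] that by (simp add: edge_form_def)
    qed
    have "(?E has_derivative (\<lambda>h.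
       ?A (g x) * dird (dird g e) h x + (pd ?A (g x) * dird g h x + pdb ?A (g x) * cnj (dird g h x)) * dird g e x
      + (?B (g x) * cnj (dird (dird g e) h x) + (pd ?B (g x) * dird g h x + pdb ?B (g x) * cnj (dird g h x)) * cnj (dird g e x)))) (at x)"
      by (intro has_derivative_add has_derivative_mult has_derivative_cnj gd
          dird_compose_complex[OF AB(1) gV g] dird_compose_complex[OF AB(2) gV g])
    then have "frechet_derivative ?E (at x) = (\<lambda>h.
       ?A (g x) * dird (dird g e) h x + (pd ?A (g x) * dird g h x + pdb ?A (g x) * cnj (dird g h x)) * dird g e x
      + (?B (g x) * cnj (dird (dird g e) h x) + (pd ?B (g x) * dird g h x + pdb ?B (g x) * cnj (dird g h x)) * cnj (dird g e x)))"
      by (rule frechet_derivative_at[symmetric])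
    then show ?thesis
      using wdir_local(2)[OF T o sE eq xW] by (simp add: algebra_simps)
  qed
  have wg: "wdir T u e x = dird g e x" for e using wdir_local(2)[OF T W(1,3,4), of x] xW by auto
  have sym: "dird (dird g c) b x = dird (dird g b) c x"
    using dird_commute[OF o sg, of x c b] xW by blast
  show ?thesis
    unfolding dd area_form_def d1_def wg sym using W(4)[of x] xW by (simp add: algebra_simps)
qed

end

text \<open>A 3-form on a surface is zero. The terms with first derivatives of
  \<open>\<omega>\<close> cancel because an alternating sum over three directions meets only the two
  differentials of \<open>g\<close> and its conjugate; those with second derivatives of
  \<open>g\<close> cancel by symmetry. The formula for \<open>F\<close> is a local premise, since
  one chart may cover only part of a simplex.\<close>

lemma closed_area_form:
  fixes T :: "'v::euclidean_space set" and g :: "'v \<Rightarrow> complex"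
  assumes T: "solid T" and W: "open W" and V: "open V" and g: "smooth_on W g" and \<omega>: "smooth_on V \<omega>"
    and x: "x \<in> T \<inter> W" and gx: "g x \<in> V"
    and F: "\<And>e f y. y \<in> T \<inter> W \<Longrightarrow>
      F e f y = \<omega> (g y) * (dird g e y * cnj (dird g f y) - dird g f y * cnj (dird g e y))"
  shows "wdir T (F b c) a x - wdir T (F a c) b x + wdir T (F a b) c x = 0"
proof -
  let ?W = "W \<inter> g -` V"
  have o: "open ?W" using continuous_open_preimage[OF smooth_on_continuous[OF g] W V] .
  have xW: "x \<in> T \<inter> ?W" using x gx by simp
  have sg: "smooth_on ?W g" using smooth_on_subset[OF g] by blast
  have dg: "(g has_derivative frechet_derivative g (at x)) (at x)"
    using smooth_on_has_derivative[OF sg] xW by blast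
  have gd: "(dird g e has_derivative frechet_derivative (dird g e) (at x)) (at x)" for e
    using smooth_on_has_derivative[OF smooth_on_dird[OF o sg]] xW by blast
  have dd: "wdir T (F e f) h x =
      (pd \<omega> (g x) * dird g h x + pdb \<omega> (g x) * cnj (dird g h x)) * (dird g e x * cnj (dird g f x) - dird g f x * cnj (dird g e x))
      + \<omega> (g x) * (dird (dird g e) h x * cnj (dird g f x) + dird g e x * cnj (dird (dird g f) h x)
         - (dird (dird g f) h x * cnj (dird g e x) + dird g f x * cnj (dird (dird g e) h x)))"
    for e f h
  proof -
    let ?E = "\<lambda>y. \<omega> (g y) * (dird g e y * cnj (dird g f y) - dird g f y * cnj (dird g e y))"
    have sE: "smooth_on ?W ?E"
      by (intro smooth_on_diff smooth_on_mult smooth_on_cnj smooth_on_dird o sg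
          smooth_on_compose[OF o \<omega> sg]) auto
    have eq: "F e f y = ?E y" if "y \<in> T \<inter> ?W" for y using F[of y e f] that by simp
    have "(?E has_derivative (\<lambda>h.
       \<omega> (g x) * (dird g e x * cnj (dird (dird g f) h x) + dird (dird g e) h x * cnj (dird g f x)
         - (dird g f x * cnj (dird (dird g e) h x) + dird (dird g f) h x * cnj (dird g e x)))
       + (pd \<omega> (g x) * dird g h x + pdb \<omega> (g x) * cnj (dird g h x)) *
         (dird g e x * cnj (dird g f x) - dird g f x * cnj (dird g e x)))) (at x)"
      by (intro has_derivative_diff has_derivative_mult has_derivative_cnj gd
          dird_compose_complex[OF \<omega> gx dg])
    then have "frechet_derivative ?E (at x) = (\<lambda>h.
       \<omega> (g x) * (dird g e x * cnj (dird (dird g f) h x) + dird (dird g e) h x * cnj (dird g f x)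
         - (dird g f x * cnj (dird (dird g e) h x) + dird (dird g f) h x * cnj (dird g e x)))
       + (pd \<omega> (g x) * dird g h x + pdb \<omega> (g x) * cnj (dird g h x)) *
         (dird g e x * cnj (dird g f x) - dird g f x * cnj (dird g e x)))"
      by (rule frechet_derivative_at[symmetric])
    then show ?thesis
      using wdir_local(2)[OF T o sE eq xW] by (simp add: algebra_simps)
  qed
  have "x \<in> ?W" using xW by blast
  note sym = dird_commute[OF o sg this, of c a] dird_commute[OF o sg this, of b a] dird_commute[OF o sg this, of c b]
  show ?thesis unfolding dd sym by (simp add: algebra_simps)
qed

lemma csmooth_along:
  fixes f :: "'v::euclidean_space \<Rightarrow> 'w::real_normed_vector"
  assumes "solid T" "csmooth T f" "(l has_vector_derivative b) (at s within I)" "l ` I \<subseteq> T" "l s \<in> T"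
  shows "((\<lambda>s. f (l s)) has_vector_derivative wdir T f b (l s)) (at s within I)"
  using has_vector_derivative_along[OF csmooth_has_derivative[OF assms(1,2,5)] assms(3,4)] .

text \<open>Fubini in each coordinate, applied to the two terms of \<open>curl_edge_form\<close>;
  the hypotenuse receives the difference of both components.\<close>

lemma stokes_triangle:
  assumes u: "csmooth triangle u" and V: "open V" "\<And>x. x \<in> triangle \<Longrightarrow> u x \<in> V" and \<eta>: "smooth_on V \<eta>"
  shows "integral triangle (area_form (d1 \<eta>) triangle u (1, 0) (0, 1)) =
    integral {0..1} (\<lambda>s. edge_form \<eta> triangle u (0, 1) (1 - s, s) - edge_form \<eta> triangle u (1, 0) (1 - s, s))
    - integral {0..1} (\<lambda>s. edge_form \<eta> triangle u (0, 1) (0, s))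
    + integral {0..1} (\<lambda>s. edge_form \<eta> triangle u (1, 0) (s, 0))"
proof -
  let ?P = "edge_form \<eta> triangle u (1, 0)" and ?Q = "edge_form \<eta> triangle u (0, 1)"
  have cs: "csmooth triangle (edge_form \<eta> triangle u b)" for b
    by (rule csmooth_edge_form[OF solid_triangle u V(1) _ \<eta>]) (rule V(2))
  note cc = csmooth_continuous[OF cs] csmooth_continuous[OF csmooth_wdir[OF solid_triangle cs]]
  have 1: "integral triangle (wdir triangle ?Q (1, 0)) = integral {0..1} (\<lambda>t. ?Q (1 - t, t) - ?Q (0, t))"
  proof (rule triangle_ftc1[OF cc])
    fix s t :: real assume st: "(s, t) \<in> triangle"
    have d: "((\<lambda>s. (s, t)) has_vector_derivative (1, 0)) (at s within {0..1 - t})"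
      by (auto intro!: derivative_eq_intros simp: has_vector_derivative_def)
    have im: "(\<lambda>s. (s, t)) ` {0..1 - t} \<subseteq> triangle" using st by (auto simp: triangle_def)
    show "((\<lambda>s. ?Q (s, t)) has_vector_derivative wdir triangle ?Q (1, 0) (s, t)) (at s within {0..1 - t})"
      using csmooth_along[where l = "\<lambda>s. (s, t)", OF solid_triangle cs d im] st by simp
  qed
  have 2: "integral triangle (wdir triangle ?P (0, 1)) = integral {0..1} (\<lambda>s. ?P (s, 1 - s) - ?P (s, 0))"
  proof (rule triangle_ftc2[OF cc])
    fix s t :: real assume st: "(s, t) \<in> triangle"
    have d: "((\<lambda>t. (s, t)) has_vector_derivative (0, 1)) (at t within {0..1 - s})"
      by (auto intro!: derivative_eq_intros simp: has_vector_derivative_def)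
    have im: "(\<lambda>t. (s, t)) ` {0..1 - s} \<subseteq> triangle" using st by (auto simp: triangle_def)
    show "((\<lambda>t. ?P (s, t)) has_vector_derivative wdir triangle ?P (0, 1) (s, t)) (at t within {0..1 - s})"
      using csmooth_along[where l = "\<lambda>t. (s, t)", OF solid_triangle cs d im] st by simp
  qed
  have line: "continuous_on {0..1} (\<lambda>s. edge_form \<eta> triangle u b (l s))"
    if "continuous_on {0..1} l" "l ` {0..1} \<subseteq> triangle" for b l
    using continuous_on_compose2[OF cc(1) that] .
  have l: "continuous_on {0..1} (\<lambda>s. edge_form \<eta> triangle u b (1 - s, s))"
    "continuous_on {0..1} (\<lambda>s. edge_form \<eta> triangle u b (s, 1 - s))"
    "continuous_on {0..1} (\<lambda>s. edge_form \<eta> triangle u b (0, s))"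
    "continuous_on {0..1} (\<lambda>s. edge_form \<eta> triangle u b (s, 0))" for b
    by (intro line continuous_intros; force simp: triangle_def)+
  note i = compact_integral(2)[OF compact_Icc l(1)] compact_integral(2)[OF compact_Icc l(2)]
    compact_integral(2)[OF compact_Icc l(3)] compact_integral(2)[OF compact_Icc l(4)]
  \<comment> \<open>Integration along \<open>t\<close> yields the hypotenuse as
    \<open>(s, 1 - s)\<close>; reversal brings it to the parametrization \<open>(1 - s, s)\<close>
    of the other term.\<close>
  have refl: "integral {0..1} (\<lambda>s. ?P (s, 1 - s)) = integral {0..1} (\<lambda>s. ?P (1 - s, s))"
    using integral_unit_reflect[OF l(1)[of "(1, 0)"]] by simp
  have "integral triangle (area_form (d1 \<eta>) triangle u (1, 0) (0, 1))
     = integral triangle (\<lambda>x. wdir triangle ?Q (1, 0) x - wdir triangle ?P (0, 1) x)"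
    by (intro integral_cong curl_edge_form[OF solid_triangle u V(1) _ \<eta>, symmetric]) (rule V(2))
  also have "\<dots> = integral triangle (wdir triangle ?Q (1, 0)) - integral triangle (wdir triangle ?P (0, 1))"
    by (intro integral_diff compact_integral(2)[OF compact_triangle cc(2)])
  finally show ?thesis
    unfolding 1 2 using i refl by (simp add: integral_diff)
qed

section \<open>Forms along smooth chains\<close>

lemma wdir_eq:
  assumes "solid T" "x \<in> T" "(u has_derivative A) (at x within T)"
  shows "wdir T u b x = A b"
proof -
  have "(u has_derivative frechet_derivative u (at x within T)) (at x within T)"
    using assms(3) unfolding frechet_derivative_works[symmetric] by (rule differentiableI)
  from solid_derivative_unique[OF assms(1,2) this assms(3)] show ?thesis by simp
qed

text \<open>\<open>a12\<close>, \<open>a13\<close> and \<open>a23\<close> are the components of a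
  closed 2-form. Each derivative integrated over \<open>tetra\<close> yields one coordinate face and
  one copy of the slanted face.\<close>

lemma stokes_tetra:
  fixes a12 a13 a23 :: "real \<times> real \<times> real \<Rightarrow> complex"
  assumes cs: "csmooth tetra a12" "csmooth tetra a13" "csmooth tetra a23"
    and closed: "\<And>x. x \<in> tetra \<Longrightarrow>
      wdir tetra a23 (1, 0, 0) x - wdir tetra a13 (0, 1, 0) x + wdir tetra a12 (0, 0, 1) x = 0"
  shows "integral triangle (\<lambda>(s, t). a12 (1 - s - t, s, t) - a13 (1 - s - t, s, t) + a23 (1 - s - t, s, t))
    - integral triangle (\<lambda>(s, t). a23 (0, s, t)) + integral triangle (\<lambda>(s, t). a13 (s, 0, t))
    - integral triangle (\<lambda>(s, t). a12 (s, t, 0)) = 0"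
proof -
  note cw = csmooth_wdir[OF solid_tetra]
  note cc = csmooth_continuous[OF cs(1)] csmooth_continuous[OF cs(2)] csmooth_continuous[OF cs(3)]
  note cd = csmooth_continuous[OF cw[OF cs(1)]] csmooth_continuous[OF cw[OF cs(2)]] csmooth_continuous[OF cw[OF cs(3)]]
  note iw = compact_integral(2)[OF compact_tetra cd(1)] compact_integral(2)[OF compact_tetra cd(2)]
    compact_integral(2)[OF compact_tetra cd(3)]
  have 1: "integral tetra (wdir tetra a23 (1, 0, 0)) = integral triangle (\<lambda>(s, t). a23 (1 - s - t, s, t) - a23 (0, s, t))"
  proof (rule tetra_ftc1[OF cc(3) cd(3)])
    fix r s t :: real assume x: "(r, s, t) \<in> tetra"
    have d: "((\<lambda>r. (r, s, t)) has_vector_derivative (1, 0, 0)) (at r within {0..1 - s - t})"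
      by (auto intro!: derivative_eq_intros simp: has_vector_derivative_def zero_prod_def)
    have im: "(\<lambda>r. (r, s, t)) ` {0..1 - s - t} \<subseteq> tetra" using x by (auto simp: tetra_def)
    show "((\<lambda>r. a23 (r, s, t)) has_vector_derivative wdir tetra a23 (1, 0, 0) (r, s, t)) (at r within {0..1 - s - t})"
      using csmooth_along[where l = "\<lambda>r. (r, s, t)", OF solid_tetra cs(3) d im] x by simp
  qed
  have 2: "integral tetra (wdir tetra a13 (0, 1, 0)) = integral triangle (\<lambda>(r, t). a13 (r, 1 - r - t, t) - a13 (r, 0, t))"
  proof (rule tetra_ftc2[OF cc(2) cd(2)])
    fix r s t :: real assume x: "(r, s, t) \<in> tetra"
    have d: "((\<lambda>s. (r, s, t)) has_vector_derivative (0, 1, 0)) (at s within {0..1 - r - t})"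
      by (auto intro!: derivative_eq_intros simp: has_vector_derivative_def zero_prod_def)
    have im: "(\<lambda>s. (r, s, t)) ` {0..1 - r - t} \<subseteq> tetra" using x by (auto simp: tetra_def)
    show "((\<lambda>s. a13 (r, s, t)) has_vector_derivative wdir tetra a13 (0, 1, 0) (r, s, t)) (at s within {0..1 - r - t})"
      using csmooth_along[where l = "\<lambda>s. (r, s, t)", OF solid_tetra cs(2) d im] x by simp
  qed
  have 3: "integral tetra (wdir tetra a12 (0, 0, 1)) = integral triangle (\<lambda>(r, s). a12 (r, s, 1 - r - s) - a12 (r, s, 0))"
  proof (rule tetra_ftc3[OF cc(1) cd(1)])
    fix r s t :: real assume x: "(r, s, t) \<in> tetra"
    have d: "((\<lambda>t. (r, s, t)) has_vector_derivative (0, 0, 1)) (at t within {0..1 - r - s})"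
      by (auto intro!: derivative_eq_intros simp: has_vector_derivative_def zero_prod_def)
    have im: "(\<lambda>t. (r, s, t)) ` {0..1 - r - s} \<subseteq> tetra" using x by (auto simp: tetra_def)
    show "((\<lambda>t. a12 (r, s, t)) has_vector_derivative wdir tetra a12 (0, 0, 1) (r, s, t)) (at t within {0..1 - r - s})"
      using csmooth_along[where l = "\<lambda>t. (r, s, t)", OF solid_tetra cs(1) d im] x by simp
  qed
  have "0 = integral tetra (\<lambda>x. wdir tetra a23 (1, 0, 0) x - wdir tetra a13 (0, 1, 0) x + wdir tetra a12 (0, 0, 1) x)"
    using closed by (subst integral_cong[where g = "\<lambda>_. 0"]) auto
  also have "\<dots> = integral tetra (wdir tetra a23 (1, 0, 0)) - integral tetra (wdir tetra a13 (0, 1, 0)) + integral tetra (wdir tetra a12 (0, 0, 1))"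
    using iw by (simp add: integral_add integral_diff integrable_diff)
  finally have z: "0 = integral tetra (wdir tetra a23 (1, 0, 0)) - integral tetra (wdir tetra a13 (0, 1, 0)) + integral tetra (wdir tetra a12 (0, 0, 1))" .
  have face: "continuous_on triangle (\<lambda>p. a (l p))"
    if "continuous_on tetra a" "continuous_on triangle l" "l ` triangle \<subseteq> tetra" for a :: "real \<times> real \<times> real \<Rightarrow> complex" and l
    by (rule continuous_on_compose2[OF that])
  have fc: "continuous_on triangle (\<lambda>p. a (1 - fst p - snd p, fst p, snd p))"
    "continuous_on triangle (\<lambda>p. a (0, fst p, snd p))"
    "continuous_on triangle (\<lambda>p. a (fst p, 0, snd p))"
    "continuous_on triangle (\<lambda>p. a (fst p, snd p, 0))"
    "continuous_on triangle (\<lambda>p. a (fst p, 1 - fst p - snd p, snd p))"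
    "continuous_on triangle (\<lambda>p. a (fst p, snd p, 1 - fst p - snd p))"
    if "continuous_on tetra a" for a :: "real \<times> real \<times> real \<Rightarrow> complex"
    by (rule face[OF that]; force intro!: continuous_intros simp: tetra_def triangle_def)+
  note fi = fc[THEN compact_integral(2)[OF compact_triangle]]
  \<comment> \<open>Integration along the second or third coordinate parametrizes the slanted face
    differently; reflection, and for \<open>a12\<close> also a swap, lead to
    \<open>(1 - s - t, s, t)\<close>.\<close>
  have s13: "integral triangle (\<lambda>p. a13 (fst p, 1 - fst p - snd p, snd p)) = integral triangle (\<lambda>p. a13 (1 - fst p - snd p, fst p, snd p))"
    using integral_triangle_reflect[OF fc(5)[OF cc(2)]] by (simp add: case_prod_unfold)
  have e: "1 - snd p - fst p = 1 - fst p - snd p" for p :: "real \<times> real" by simp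
  have s12: "integral triangle (\<lambda>p. a12 (fst p, snd p, 1 - fst p - snd p)) = integral triangle (\<lambda>p. a12 (1 - fst p - snd p, fst p, snd p))"
    using integral_triangle_reflect[OF fc(6)[OF cc(1)]] integral_triangle_swap[OF fc(1)[OF cc(1)]]
    by (simp add: case_prod_unfold e)
  have "integral triangle (\<lambda>(s, t). a12 (1 - s - t, s, t) - a13 (1 - s - t, s, t) + a23 (1 - s - t, s, t))
    - integral triangle (\<lambda>(s, t). a23 (0, s, t)) + integral triangle (\<lambda>(s, t). a13 (s, 0, t))
    - integral triangle (\<lambda>(s, t). a12 (s, t, 0))
    = integral tetra (wdir tetra a23 (1, 0, 0)) - integral tetra (wdir tetra a13 (0, 1, 0)) + integral tetra (wdir tetra a12 (0, 0, 1))"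
    unfolding 1 2 3 case_prod_unfold fst_conv snd_conv prod.collapse
    using fi(1)[OF cc(1)] fi(1)[OF cc(2)] fi(1)[OF cc(3)] fi(2)[OF cc(3)] fi(3)[OF cc(2)] fi(4)[OF cc(1)]
      fi(5)[OF cc(2)] fi(6)[OF cc(1)] s12 s13
    by (simp add: integral_add integral_diff integrable_diff)
  then show ?thesis using z by simp
qed

section \<open>Linear extension of simplex functionals to chains\<close>

definition fint :: "('s \<Rightarrow> complex) \<Rightarrow> ('s \<Rightarrow>\<^sub>0 int) \<Rightarrow> complex" where
  "fint f c = (\<Sum>\<sigma>\<in>Poly_Mapping.keys c. of_int (Poly_Mapping.lookup c \<sigma>) * f \<sigma>)"

lemma fint_superset:
  assumes "finite A" "Poly_Mapping.keys c \<subseteq> A"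
  shows "fint f c = (\<Sum>\<sigma>\<in>A. of_int (Poly_Mapping.lookup c \<sigma>) * f \<sigma>)"
  unfolding fint_def by (rule sum.mono_neutral_left[OF assms]) (auto simp: in_keys_iff)

lemma fint_zero [simp]: "fint f 0 = 0" by (simp add: fint_def)

lemma fint_add: "fint f (c + d) = fint f c + fint f d"
proof -
  let ?A = "Poly_Mapping.keys c \<union> Poly_Mapping.keys d"
  have "fint f (c + d) = (\<Sum>\<sigma>\<in>?A. of_int (Poly_Mapping.lookup (c + d) \<sigma>) * f \<sigma>)"
    by (rule fint_superset) (use Poly_Mapping.keys_add[of c d] in auto)
  then show ?thesis
    using fint_superset[of ?A c f] fint_superset[of ?A d f]
    by (simp add: lookup_add distrib_right sum.distrib)
qed

lemma fint_frag_cmul: "fint f (frag_cmul k c) = of_int k * fint f c"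
proof -
  have "fint f (frag_cmul k c) = (\<Sum>\<sigma>\<in>Poly_Mapping.keys c. of_int (Poly_Mapping.lookup (frag_cmul k c) \<sigma>) * f \<sigma>)"
    by (rule fint_superset) (auto simp: keys_cmul)
  then show ?thesis by (simp add: fint_def sum_distrib_left mult.assoc)
qed

lemma fint_frag_of [simp]: "fint f (frag_of \<sigma>) = f \<sigma>"
  by (simp add: fint_def)

lemma fint_sum: "fint f (\<Sum>i\<in>I. c i) = (\<Sum>i\<in>I. fint f (c i))"
  by (induction I rule: infinite_finite_induct) (auto simp: fint_add)

lemma fint_frag_extend: "fint f (frag_extend b c) = fint (\<lambda>\<sigma>. fint f (b \<sigma>)) c"
  by (simp add: frag_extend_def fint_sum fint_frag_cmul fint_def[of "\<lambda>\<sigma>. fint f (b \<sigma>)"])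

lemma fint_cong: "(\<And>\<sigma>. \<sigma> \<in> Poly_Mapping.keys c \<Longrightarrow> f \<sigma> = g \<sigma>) \<Longrightarrow> fint f c = fint g c"
  unfolding fint_def by (intro sum.cong) auto

lemma fint_chain_boundary:
  assumes "p > 0"
  shows "fint f (chain_boundary p c) = fint (\<lambda>\<sigma>. \<Sum>k\<le>p. (-1) ^ k * f (singular_face p k \<sigma>)) c"
  using assms by (simp add: chain_boundary_def fint_frag_extend fint_sum fint_frag_cmul)

definition cint :: "('k \<Rightarrow> 's \<Rightarrow> complex) \<Rightarrow> ('k \<Rightarrow>\<^sub>0 ('s \<Rightarrow>\<^sub>0 int)) \<Rightarrow> complex" where
  "cint f S = (\<Sum>K\<in>Poly_Mapping.keys S. fint (f K) (Poly_Mapping.lookup S K))"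

lemma cint_superset:
  assumes "finite A" "Poly_Mapping.keys S \<subseteq> A"
  shows "cint f S = (\<Sum>K\<in>A. fint (f K) (Poly_Mapping.lookup S K))"
  unfolding cint_def by (rule sum.mono_neutral_left[OF assms]) (auto simp: in_keys_iff)

lemma cint_add: "cint f (S + T) = cint f S + cint f T"
proof -
  let ?A = "Poly_Mapping.keys S \<union> Poly_Mapping.keys T"
  have "cint f (S + T) = (\<Sum>K\<in>?A. fint (f K) (Poly_Mapping.lookup (S + T) K))"
    by (rule cint_superset) (use Poly_Mapping.keys_add[of S T] in auto)
  then show ?thesis
    using cint_superset[of ?A S f] cint_superset[of ?A T f]
    by (simp add: lookup_add fint_add sum.distrib)
qed

lemma cint_zero [simp]: "cint f 0 = 0" by (simp add: cint_def)

lemma cint_sum: "cint f (\<Sum>i\<in>I. S i) = (\<Sum>i\<in>I. cint f (S i))"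
  by (induction I rule: infinite_finite_induct) (auto simp: cint_add)

lemma cint_single: "cint f (Poly_Mapping.single K c) = fint (f K) c"
  by (cases "c = 0") (auto simp: cint_def)

text \<open>Adjunction between chains and cochains: \<open>\<partial>''\<close> on chains is the
  alternating sum over deleted indices on cochains, which is the Cech coboundary up to a change of
  coordinate in the last term.\<close>

lemma cint_bd_cech:
  "cint f (bd_cech S) = cint (\<lambda>K \<sigma>. \<Sum>j<length K. (-1) ^ j * f (del_nth j K) \<sigma>) S"
proof -
  have "cint f (bd_cech S) = (\<Sum>K\<in>Poly_Mapping.keys S. \<Sum>j<length K. (-1) ^ j * fint (f (del_nth j K)) (Poly_Mapping.lookup S K))"
    by (simp add: bd_cech_def cint_sum cint_single fint_frag_cmul)
  also have "\<dots> = cint (\<lambda>K \<sigma>. \<Sum>j<length K. (-1) ^ j * f (del_nth j K) \<sigma>) S"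
    unfolding cint_def fint_def sum_distrib_left
    by (intro sum.cong refl) (subst sum.swap, simp add: ac_simps)
  finally show ?thesis .
qed

lemma cint_bd_sing:
  assumes "p > 0"
  shows "cint f (bd_sing p S) = cint (\<lambda>K \<sigma>. \<Sum>k\<le>p. (-1) ^ k * f K (singular_face p k \<sigma>)) S"
proof -
  have z: "chain_boundary p 0 = 0" by simp
  have "cint f (bd_sing p S) = (\<Sum>K\<in>Poly_Mapping.keys S. fint (f K) (Poly_Mapping.lookup (bd_sing p S) K))"
    by (rule cint_superset) (auto simp: bd_sing_def in_keys_iff map.rep_eq when_def)
  also have "\<dots> = (\<Sum>K\<in>Poly_Mapping.keys S. fint (f K) (chain_boundary p (Poly_Mapping.lookup S K)))"
    by (intro sum.cong refl) (auto simp: bd_sing_def in_keys_iff map.rep_eq when_def)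
  finally show ?thesis using assms by (simp add: fint_chain_boundary cint_def)
qed

lemma cint_cong:
  "(\<And>K \<sigma>. K \<in> Poly_Mapping.keys S \<Longrightarrow> \<sigma> \<in> Poly_Mapping.keys (Poly_Mapping.lookup S K) \<Longrightarrow> f K \<sigma> = g K \<sigma>) \<Longrightarrow>
    cint f S = cint g S"
  unfolding cint_def by (intro sum.cong fint_cong) auto

lemma cint_linear:
  "cint (\<lambda>K \<sigma>. f K \<sigma> + g K \<sigma>) S = cint f S + cint g S"
  "cint (\<lambda>K \<sigma>. c * f K \<sigma>) S = c * cint f S"
  by (simp_all add: cint_def fint_def sum.distrib distrib_left sum_distrib_left ac_simps)

lemma chain_int_cint: "chain_int I \<phi> S = cint (\<lambda>K. I (last K) (\<phi> K)) S"
  by (simp add: chain_int_def cint_def fint_def)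

definition bary3 :: "real \<Rightarrow> real \<Rightarrow> real \<Rightarrow> nat \<Rightarrow> real" where
  "bary3 r s t n = (if n = 0 then 1 - r - s - t else if n = 1 then r else if n = 2 then s else if n = 3 then t else 0)"

lemma bary_simplex: "(s, t) \<in> triangle \<Longrightarrow> bary s t \<in> standard_simplex 2"
  by (auto simp: bary_def standard_simplex_def triangle_def numeral_2_eq_2)

lemma bary_simplex1: "s \<in> {0..1} \<Longrightarrow> bary s 0 \<in> standard_simplex 1"
  by (auto simp: bary_def standard_simplex_def)

lemma bary_simplex0: "bary 0 0 \<in> standard_simplex 0"
  by (auto simp: bary_def standard_simplex_def)

lemma bary3_simplex: "(r, s, t) \<in> tetra \<Longrightarrow> bary3 r s t \<in> standard_simplex 3"
  by (auto simp: bary3_def standard_simplex_def tetra_def numeral_3_eq_3 numeral_2_eq_2)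

lemma face_bary:
  assumes "(s, t) \<in> triangle"
  shows "singular_face 3 0 \<sigma> (bary s t) = \<sigma> (bary3 (1 - s - t) s t)"
    "singular_face 3 1 \<sigma> (bary s t) = \<sigma> (bary3 0 s t)"
    "singular_face 3 2 \<sigma> (bary s t) = \<sigma> (bary3 s 0 t)"
    "singular_face 3 3 \<sigma> (bary s t) = \<sigma> (bary3 s t 0)"
proof -
  have "simplical_face 0 (bary s t) = bary3 (1 - s - t) s t"
    "simplical_face 1 (bary s t) = bary3 0 s t"
    "simplical_face 2 (bary s t) = bary3 s 0 t"
    "simplical_face 3 (bary s t) = bary3 s t 0"
    by (rule ext, auto simp: simplical_face_def bary_def bary3_def)+
  then show "singular_face 3 0 \<sigma> (bary s t) = \<sigma> (bary3 (1 - s - t) s t)"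
    "singular_face 3 1 \<sigma> (bary s t) = \<sigma> (bary3 0 s t)"
    "singular_face 3 2 \<sigma> (bary s t) = \<sigma> (bary3 s 0 t)"
    "singular_face 3 3 \<sigma> (bary s t) = \<sigma> (bary3 s t 0)"
    using bary_simplex[OF assms] by (simp_all add: singular_face_def numeral_2_eq_2)
qed

lemma face_bary2:
  assumes "s \<in> {0..1}"
  shows "singular_face 2 0 \<sigma> (bary s 0) = \<sigma> (bary (1 - s) s)"
    "singular_face 2 1 \<sigma> (bary s 0) = \<sigma> (bary 0 s)"
    "singular_face 2 2 \<sigma> (bary s 0) = \<sigma> (bary s 0)"
proof -
  have "simplical_face 0 (bary s 0) = bary (1 - s) s"
    "simplical_face 1 (bary s 0) = bary 0 s"
    "simplical_face 2 (bary s 0) = bary s 0"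
    by (rule ext, auto simp: simplical_face_def bary_def)+
  then show "singular_face 2 0 \<sigma> (bary s 0) = \<sigma> (bary (1 - s) s)"
    "singular_face 2 1 \<sigma> (bary s 0) = \<sigma> (bary 0 s)"
    "singular_face 2 2 \<sigma> (bary s 0) = \<sigma> (bary s 0)"
    using bary_simplex1[OF assms] by (simp_all add: singular_face_def)
qed

lemma face_bary1:
  "singular_face 1 0 \<sigma> (bary 0 0) = \<sigma> (bary 1 0)" "singular_face 1 1 \<sigma> (bary 0 0) = \<sigma> (bary 0 0)"
proof -
  have "simplical_face 0 (bary 0 0) = bary 1 0" "simplical_face 1 (bary 0 0) = bary 0 0"
    by (rule ext, auto simp: simplical_face_def bary_def)+
  then show "singular_face 1 0 \<sigma> (bary 0 0) = \<sigma> (bary 1 0)" "singular_face 1 1 \<sigma> (bary 0 0) = \<sigma> (bary 0 0)"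
    using bary_simplex0 by (simp_all add: singular_face_def)
qed

section \<open>Global 2-forms along smooth simplices in the surface\<close>

context rsurface
begin

text \<open>The analogue of \<open>csmooth\<close> for maps into the surface. Each chart around a
  value provides its own local extension, so the image need not fit into one chart.\<close>

definition xsmooth :: "'v::euclidean_space set \<Rightarrow> ('v \<Rightarrow> 'a) \<Rightarrow> bool" where
  "xsmooth T w \<longleftrightarrow> (\<forall>x\<in>T. w x \<in> topspace (surf X) \<and> (\<forall>i\<in>idx X. w x \<in> patch X i \<longrightarrow>
     (\<exists>W G. open W \<and> x \<in> W \<and> smooth_on W G \<and>
        (\<forall>y\<in>T \<inter> W. w y \<in> patch X i \<and> coord X i (w y) = G y))))"

lemma xsmooth_local:
  assumes "xsmooth T w" "x \<in> T" "i \<in> idx X" "w x \<in> patch X i"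
  shows "\<exists>W G. open W \<and> x \<in> W \<and> smooth_on W G \<and> (\<forall>y\<in>T \<inter> W. w y \<in> patch X i \<and> coord X i (w y) = G y)"
  using bspec[OF assms(1)[unfolded xsmooth_def] assms(2)] assms(3,4) by simp

lemma xsmooth_simplex:
  fixes par :: "'v::euclidean_space \<Rightarrow> nat \<Rightarrow> real"
  assumes \<sigma>: "smooth_simplex X p \<sigma>" and par: "\<And>x. x \<in> T \<Longrightarrow> par x \<in> standard_simplex p"
    and sm: "smooth_on UNIV (\<lambda>x. (par x 1, par x 2, par x 3))"
  shows "xsmooth T (\<lambda>x. \<sigma> (par x))"
  unfolding xsmooth_def
proof (intro ballI conjI impI)
  fix x assume x: "x \<in> T"
  have "continuous_map (subtopology (powertop_real UNIV) (standard_simplex p)) (surf X) \<sigma>"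
    using \<sigma> by (simp add: smooth_simplex_def singular_simplex_def)
  from continuous_map_image_subset_topspace[OF this]
  show "\<sigma> (par x) \<in> topspace (surf X)" using par[OF x] by (auto simp: topspace_standard_simplex)
  fix i assume i: "i \<in> idx X" "\<sigma> (par x) \<in> patch X i"
  let ?q = "\<lambda>x. (par x 1, par x 2, par x 3)"
  have "\<exists>W (G :: real \<times> real \<times> real \<Rightarrow> complex).
           open W \<and> ?q x \<in> W \<and> smooth_on W G \<and>
           (\<forall>y\<in>standard_simplex p. (y 1, y 2, y 3) \<in> W \<longrightarrow>
              \<sigma> y \<in> patch X i \<and> coord X i (\<sigma> y) = G (y 1, y 2, y 3))"
    using \<sigma> par[OF x] i unfolding smooth_simplex_def by simp
  then obtain W and G :: "real \<times> real \<times> real \<Rightarrow> complex" where "open W \<and> ?q x \<in> W \<and> smooth_on W G \<and>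
           (\<forall>y\<in>standard_simplex p. (y 1, y 2, y 3) \<in> W \<longrightarrow>
              \<sigma> y \<in> patch X i \<and> coord X i (\<sigma> y) = G (y 1, y 2, y 3))" by (elim exE)
  then have W: "open W" "?q x \<in> W" "smooth_on W G"
    and eq: "\<And>y. y \<in> standard_simplex p \<Longrightarrow> (y 1, y 2, y 3) \<in> W \<Longrightarrow> \<sigma> y \<in> patch X i \<and> coord X i (\<sigma> y) = G (y 1, y 2, y 3)"
    by simp_all
  have o: "open (?q -` W)"
    using continuous_open_preimage[OF smooth_on_continuous[OF sm] open_UNIV W(1)] by simp
  have "smooth_on (?q -` W) (\<lambda>x. G (?q x))"
    by (rule smooth_on_compose[OF o W(3) smooth_on_subset[OF sm]]) auto
  then show "\<exists>W G. open W \<and> x \<in> W \<and> smooth_on W G \<and>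
      (\<forall>y\<in>T \<inter> W. \<sigma> (par y) \<in> patch X i \<and> coord X i (\<sigma> (par y)) = G y)"
    using o W(2) eq par by (intro exI[of _ "?q -` W"] exI[of _ "\<lambda>x. G (?q x)"]) simp
qed

lemma xsmooth_compose:
  fixes l :: "'u::euclidean_space \<Rightarrow> 'v::euclidean_space"
  assumes w: "xsmooth T w" and l: "smooth_on UNIV l" "\<And>x. x \<in> T' \<Longrightarrow> l x \<in> T"
  shows "xsmooth T' (\<lambda>x. w (l x))"
  unfolding xsmooth_def
proof (intro ballI conjI impI)
  fix x assume x: "x \<in> T'"
  show "w (l x) \<in> topspace (surf X)" using w l(2)[OF x] by (simp add: xsmooth_def)
  fix i assume i: "i \<in> idx X" "w (l x) \<in> patch X i"
  obtain W G where "open W \<and> l x \<in> W \<and> smooth_on W G \<and> (\<forall>y\<in>T \<inter> W. w y \<in> patch X i \<and> coord X i (w y) = G y)"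
    using xsmooth_local[OF w l(2)[OF x] i] by (elim exE)
  then have W: "open W" "l x \<in> W" "smooth_on W G" "\<And>y. y \<in> T \<inter> W \<Longrightarrow> w y \<in> patch X i \<and> coord X i (w y) = G y"
    by simp_all
  have o: "open (l -` W)"
    using continuous_open_preimage[OF smooth_on_continuous[OF l(1)] open_UNIV W(1)] by simp
  have "smooth_on (l -` W) (\<lambda>x. G (l x))"
    by (rule smooth_on_compose[OF o W(3) smooth_on_subset[OF l(1)]]) auto
  then show "\<exists>W G. open W \<and> x \<in> W \<and> smooth_on W G \<and>
      (\<forall>y\<in>T' \<inter> W. w (l y) \<in> patch X i \<and> coord X i (w (l y)) = G y)"
    using o W(2,4) l(2) by (intro exI[of _ "l -` W"] exI[of _ "\<lambda>x. G (l x)"]) simp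
qed

lemma xsmooth_cong: "xsmooth T w \<Longrightarrow> (\<And>x. x \<in> T \<Longrightarrow> w x = w' x) \<Longrightarrow> xsmooth T w'"
  unfolding xsmooth_def by simp

lemma xsmooth_chart:
  assumes "xsmooth T w" "i \<in> idx X" "\<And>x. x \<in> T \<Longrightarrow> w x \<in> patch X i"
  shows "csmooth T (\<lambda>x. coord X i (w x))"
  unfolding csmooth_def
proof
  fix x assume x: "x \<in> T"
  obtain W G where "open W \<and> x \<in> W \<and> smooth_on W G \<and> (\<forall>y\<in>T \<inter> W. w y \<in> patch X i \<and> coord X i (w y) = G y)"
    using xsmooth_local[OF assms(1) x assms(2) assms(3)[OF x]] by (elim exE)
  then show "\<exists>W G. open W \<and> x \<in> W \<and> smooth_on W G \<and> (\<forall>y\<in>T \<inter> W. coord X i (w y) = G y)"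
    by (intro exI[of _ W] exI[of _ G]) simp
qed

lemma xsmooth_has_derivative:
  assumes T: "solid T" and w: "xsmooth T w" and x: "x \<in> T" "i \<in> idx X" "w x \<in> patch X i"
  shows "((\<lambda>x. coord X i (w x)) has_derivative frechet_derivative (\<lambda>x. coord X i (w x)) (at x within T)) (at x within T)"
proof -
  obtain W G where "open W \<and> x \<in> W \<and> smooth_on W G \<and> (\<forall>y\<in>T \<inter> W. w y \<in> patch X i \<and> coord X i (w y) = G y)"
    using xsmooth_local[OF w x] by (elim exE)
  then show ?thesis using wdir_local[OF T, of W G "\<lambda>x. coord X i (w x)" x] x(1) by simp
qed

lemma global_2form_change:
  assumes "global_2form X \<alpha>" "i \<in> idx X" "j \<in> idx X" "z \<in> dom_of X [j]" "coord_inv X j z \<in> patch X i"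
  shows "\<alpha> [j] z = \<alpha> [i] (trans_fun X i j z) * (deriv (trans_fun X i j) z * cnj (deriv (trans_fun X i j) z))"
proof -
  have "z \<in> dom_of X [i, j]" "[i, j] \<in> tuples X 1" using assms by (auto simp: dom_of2 tuples_def)
  then have "cech pull2 X \<alpha> [i, j] z = 0" using assms(1) by (auto simp: global_2form_def)
  moreover have "pd (trans_fun X i j) z = deriv (trans_fun X i j) z" "pdb (trans_fun X i j) z = 0"
    using has_wirt_unique[OF has_wirt_field[OF trans_deriv[OF assms(2-5)]]] by auto
  ultimately show ?thesis by (simp add: cech_def Let_def del_nth_def pull2_def)
qed

lemma global_2form_smooth: "global_2form X \<alpha> \<Longrightarrow> i \<in> idx X \<Longrightarrow> smooth_on (dom_of X [i]) (\<alpha> [i])"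
  by (auto simp: global_2form_def smooth_cochain_def tuples_def)

lemma chart_derivative_change:
  assumes T: "solid T" and w: "xsmooth T w" and x: "x \<in> T" and ij: "i \<in> idx X" "j \<in> idx X"
    and p: "w x \<in> patch X i" "w x \<in> patch X j"
  shows "wdir T (\<lambda>x. coord X i (w x)) b x =
    deriv (trans_fun X i j) (coord X j (w x)) * wdir T (\<lambda>x. coord X j (w x)) b x"
proof -
  obtain W G where "open W \<and> x \<in> W \<and> smooth_on W G \<and> (\<forall>y\<in>T \<inter> W. w y \<in> patch X j \<and> coord X j (w y) = G y)"
    using xsmooth_local[OF w x ij(2) p(2)] by (elim exE)
  then have W: "open W" "x \<in> W" "\<And>y. y \<in> T \<inter> W \<Longrightarrow> w y \<in> patch X j" by simp_all
  let ?A = "frechet_derivative (\<lambda>x. coord X j (w x)) (at x within T)"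
  have dj: "((\<lambda>x. coord X j (w x)) has_derivative ?A) (at x within T)"
    by (rule xsmooth_has_derivative[OF T w x ij(2) p(2)])
  have "(trans_fun X i j has_field_derivative deriv (trans_fun X i j) (coord X j (w x))) (at (coord X j (w x)))"
    using trans_deriv[OF ij, of "coord X j (w x)"] ij p by simp
  then have "(trans_fun X i j has_derivative (*) (deriv (trans_fun X i j) (coord X j (w x)))) (at (coord X j (w x)))"
    by (simp add: has_field_derivative_def)
  from has_derivative_compose[OF dj this]
  have d: "((\<lambda>x. trans_fun X i j (coord X j (w x))) has_derivative
     (\<lambda>h. deriv (trans_fun X i j) (coord X j (w x)) * ?A h)) (at x within T)" .
  obtain d where dpos: "d > 0" "ball x d \<subseteq> W" using W(1,2) open_contains_ball by blast
  have "((\<lambda>x. coord X i (w x)) has_derivative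
     (\<lambda>h. deriv (trans_fun X i j) (coord X j (w x)) * ?A h)) (at x within T)"
  proof (rule has_derivative_transform_within[OF d dpos(1) x])
    fix y assume "y \<in> T" "dist y x < d"
    then have "y \<in> T \<inter> W" using dpos(2) by (auto simp: dist_commute subset_iff)
    then show "trans_fun X i j (coord X j (w y)) = coord X i (w y)"
      using W(3) ij by (simp add: trans_fun_def)
  qed
  from wdir_eq[OF T x this] show ?thesis .
qed

lemma area_form_change:
  assumes T: "solid T" and w: "xsmooth T w" and x: "x \<in> T" and ij: "i \<in> idx X" "j \<in> idx X"
    and p: "w x \<in> patch X i" "w x \<in> patch X j" and \<alpha>: "global_2form X \<alpha>"
  shows "area_form (\<alpha> [i]) T (\<lambda>x. coord X i (w x)) b c x = area_form (\<alpha> [j]) T (\<lambda>x. coord X j (w x)) b c x"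
proof -
  have "\<alpha> [j] (coord X j (w x)) = \<alpha> [i] (coord X i (w x)) *
     (deriv (trans_fun X i j) (coord X j (w x)) * cnj (deriv (trans_fun X i j) (coord X j (w x))))"
    using global_2form_change[OF \<alpha> ij, of "coord X j (w x)"] ij p by (simp add: trans_fun_def)
  then show ?thesis
    unfolding area_form_def chart_derivative_change[OF T w x ij p] by (simp add: algebra_simps)
qed

text \<open>The chart is chosen point by point, because the simplices of the homology condition may
  leave every chart; the transformation law of a global form makes the choice immaterial.\<close>

definition gdens :: "('i list \<Rightarrow> form2) \<Rightarrow> 'v::euclidean_space set \<Rightarrow> ('v \<Rightarrow> 'a) \<Rightarrow> 'v \<Rightarrow> 'v \<Rightarrow> 'v \<Rightarrow> complex" where
  "gdens \<alpha> T w b c x = (let i = SOME i. i \<in> idx X \<and> w x \<in> patch X i in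
     area_form (\<alpha> [i]) T (\<lambda>x. coord X i (w x)) b c x)"

lemma gdens_eq:
  assumes T: "solid T" and w: "xsmooth T w" and x: "x \<in> T" and i: "i \<in> idx X" "w x \<in> patch X i"
    and \<alpha>: "global_2form X \<alpha>"
  shows "gdens \<alpha> T w b c x = area_form (\<alpha> [i]) T (\<lambda>x. coord X i (w x)) b c x"
proof -
  let ?j = "SOME i. i \<in> idx X \<and> w x \<in> patch X i"
  have "?j \<in> idx X \<and> w x \<in> patch X ?j" by (rule someI[where x = i]) (use i in simp)
  then show ?thesis unfolding gdens_def Let_def using area_form_change[OF T w x _ i(1) _ i(2) \<alpha>] by blast
qed

lemma gdens_local:
  assumes T: "solid T" and w: "xsmooth T w" and x: "x \<in> T" and \<alpha>: "global_2form X \<alpha>"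
  shows "\<exists>i W G. i \<in> idx X \<and> open W \<and> x \<in> W \<and> smooth_on W G \<and> G ` W \<subseteq> dom_of X [i] \<and>
    (\<forall>y\<in>T \<inter> W. w y \<in> patch X i \<and> coord X i (w y) = G y) \<and>
    (\<forall>b c. \<forall>y\<in>T \<inter> W. gdens \<alpha> T w b c y =
      \<alpha> [i] (G y) * (dird G b y * cnj (dird G c y) - dird G c y * cnj (dird G b y)))"
proof -
  obtain i where i: "i \<in> idx X" "w x \<in> patch X i"
    using topspace_covered[of "w x"] w x by (auto simp: xsmooth_def)
  obtain W G where "open W \<and> x \<in> W \<and> smooth_on W G \<and> (\<forall>y\<in>T \<inter> W. w y \<in> patch X i \<and> coord X i (w y) = G y)"
    using xsmooth_local[OF w x i] by (elim exE)
  then have W: "open W" "x \<in> W" "smooth_on W G" "\<And>y. y \<in> T \<inter> W \<Longrightarrow> w y \<in> patch X i \<and> coord X i (w y) = G y"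
    by simp_all
  let ?W = "W \<inter> G -` dom_of X [i]"
  have o: "open ?W"
    using continuous_open_preimage[OF smooth_on_continuous[OF W(3)] W(1) open_dom_single[OF i(1)]] .
  have "gdens \<alpha> T w b c y = \<alpha> [i] (G y) * (dird G b y * cnj (dird G c y) - dird G c y * cnj (dird G b y))"
    if "y \<in> T \<inter> ?W" for b c y
  proof -
    have y: "y \<in> T \<inter> W" using that by blast
    have "wdir T (\<lambda>x. coord X i (w x)) e y = dird G e y" for e
      using wdir_local(2)[OF T W(1,3), of "\<lambda>x. coord X i (w x)" y] W(4) y by simp
    then show ?thesis
      using gdens_eq[OF T w _ i(1) _ \<alpha>, of y] W(4)[OF y] y by (simp add: area_form_def)
  qed
  moreover have "x \<in> ?W" using W(2) W(4)[of x] i(2) x coord_dom[of "w x" i] by simp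
  moreover have "smooth_on ?W G" using smooth_on_subset[OF W(3)] by blast
  ultimately show ?thesis
    using i(1) o W(4) by (intro exI[of _ i] exI[of _ ?W] exI[of _ G]) auto
qed

lemma csmooth_gdens:
  assumes T: "solid T" and w: "xsmooth T w" and \<alpha>: "global_2form X \<alpha>"
  shows "csmooth T (gdens \<alpha> T w b c)"
  unfolding csmooth_def
proof
  fix x assume x: "x \<in> T"
  obtain i W G where "i \<in> idx X \<and> open W \<and> x \<in> W \<and> smooth_on W G \<and> G ` W \<subseteq> dom_of X [i] \<and>
    (\<forall>y\<in>T \<inter> W. w y \<in> patch X i \<and> coord X i (w y) = G y) \<and>
    (\<forall>b c. \<forall>y\<in>T \<inter> W. gdens \<alpha> T w b c y =
      \<alpha> [i] (G y) * (dird G b y * cnj (dird G c y) - dird G c y * cnj (dird G b y)))"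
    using gdens_local[OF T w x \<alpha>] by (elim exE)
  then have W: "i \<in> idx X" "open W" "x \<in> W" "smooth_on W G" "G ` W \<subseteq> dom_of X [i]"
    "\<And>y. y \<in> T \<inter> W \<Longrightarrow> gdens \<alpha> T w b c y =
      \<alpha> [i] (G y) * (dird G b y * cnj (dird G c y) - dird G c y * cnj (dird G b y))" by simp_all
  have "smooth_on W (\<lambda>y. \<alpha> [i] (G y) * (dird G b y * cnj (dird G c y) - dird G c y * cnj (dird G b y)))"
    by (intro smooth_on_mult smooth_on_diff smooth_on_cnj smooth_on_dird W
        smooth_on_compose[OF W(2) global_2form_smooth[OF \<alpha> W(1)] W(4)]) (use W(5) in auto)
  then show "\<exists>W g. open W \<and> x \<in> W \<and> smooth_on W g \<and> (\<forall>y\<in>T \<inter> W. gdens \<alpha> T w b c y = g y)"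
    using W by (intro exI[of _ W] exI[of _ "\<lambda>y. \<alpha> [i] (G y) * (dird G b y * cnj (dird G c y) - dird G c y * cnj (dird G b y))"]) simp
qed

lemma gdens_closed:
  assumes T: "solid T" and w: "xsmooth T w" and \<alpha>: "global_2form X \<alpha>" and x: "x \<in> T"
  shows "wdir T (gdens \<alpha> T w b c) a x - wdir T (gdens \<alpha> T w a c) b x + wdir T (gdens \<alpha> T w a b) c x = 0"
proof -
  obtain i W G where "i \<in> idx X \<and> open W \<and> x \<in> W \<and> smooth_on W G \<and> G ` W \<subseteq> dom_of X [i] \<and>
    (\<forall>y\<in>T \<inter> W. w y \<in> patch X i \<and> coord X i (w y) = G y) \<and>
    (\<forall>b c. \<forall>y\<in>T \<inter> W. gdens \<alpha> T w b c y =
      \<alpha> [i] (G y) * (dird G b y * cnj (dird G c y) - dird G c y * cnj (dird G b y)))"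
    using gdens_local[OF T w x \<alpha>] by (elim exE)
  then have W: "i \<in> idx X" "open W" "x \<in> T \<inter> W" "smooth_on W G" "G x \<in> dom_of X [i]"
    "\<And>b c y. y \<in> T \<inter> W \<Longrightarrow> gdens \<alpha> T w b c y =
      \<alpha> [i] (G y) * (dird G b y * cnj (dird G c y) - dird G c y * cnj (dird G b y))" using x by auto
  show ?thesis
    by (rule closed_area_form[OF T W(2) open_dom_single[OF W(1)] W(4) global_2form_smooth[OF \<alpha> W(1)] W(3,5)])
       (rule W(6))
qed

text \<open>Functoriality of the pullback: the form on a face of a simplex is the form on the
  simplex evaluated on the tangent vectors of the face.\<close>

lemma gdens_compose:
  fixes l :: "'u::euclidean_space \<Rightarrow> 'v::euclidean_space"
  assumes T: "solid T" "solid T'" and w: "xsmooth T w" and \<alpha>: "global_2form X \<alpha>"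
    and l: "smooth_on UNIV l" "\<And>x. x \<in> T' \<Longrightarrow> l x \<in> T" "(l has_derivative l') (at x within T')"
    and x: "x \<in> T'" and w': "\<And>x. x \<in> T' \<Longrightarrow> w' x = w (l x)"
  shows "gdens \<alpha> T' w' b c x = gdens \<alpha> T w (l' b) (l' c) (l x)"
proof -
  obtain i where i: "i \<in> idx X" "w (l x) \<in> patch X i"
    using topspace_covered[of "w (l x)"] w l(2)[OF x] by (auto simp: xsmooth_def)
  have xw': "xsmooth T' w'"
    using xsmooth_cong[OF xsmooth_compose[OF w l(1,2)]] w' by metis
  let ?u = "\<lambda>x. coord X i (w x)"
  have "(?u has_derivative frechet_derivative ?u (at (l x) within T)) (at (l x) within T)"
    by (rule xsmooth_has_derivative[OF T(1) w l(2)[OF x] i])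
  then have "(?u has_derivative frechet_derivative ?u (at (l x) within T)) (at (l x) within l ` T')"
    by (rule has_derivative_subset) (use l(2) in auto)
  from diff_chain_within[OF l(3) this]
  have "((\<lambda>x. ?u (l x)) has_derivative (\<lambda>h. wdir T ?u (l' h) (l x))) (at x within T')"
    by (simp add: o_def)
  then have "((\<lambda>x. coord X i (w' x)) has_derivative (\<lambda>h. wdir T ?u (l' h) (l x))) (at x within T')"
    by (rule has_derivative_transform[OF x, rotated]) (simp add: w')
  then have d: "wdir T' (\<lambda>x. coord X i (w' x)) h x = wdir T ?u (l' h) (l x)" for h
    using wdir_eq[OF T(2) x] by blast
  show ?thesis
    using gdens_eq[OF T(2) xw' x i(1) _ \<alpha>] gdens_eq[OF T(1) w l(2)[OF x] i \<alpha>] i w'[OF x]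
    by (simp add: area_form_def d)
qed

text \<open>Alternating bilinearity, for the vectors \<open>b - a\<close> and \<open>c - a\<close>
  that span the slanted face.\<close>

lemma gdens_diff:
  assumes T: "solid T" and w: "xsmooth T w" and x: "x \<in> T" and \<alpha>: "global_2form X \<alpha>"
  shows "gdens \<alpha> T w (b - a) (c - a) x = gdens \<alpha> T w a b x - gdens \<alpha> T w a c x + gdens \<alpha> T w b c x"
proof -
  obtain i where i: "i \<in> idx X" "w x \<in> patch X i"
    using topspace_covered[of "w x"] w x by (auto simp: xsmooth_def)
  have lin: "linear (frechet_derivative (\<lambda>x. coord X i (w x)) (at x within T))"
    using has_derivative_linear[OF xsmooth_has_derivative[OF T w x i]] .
  show ?thesis
    unfolding gdens_eq[OF T w x i \<alpha>] area_form_def linear_diff[OF lin] by (simp add: algebra_simps)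
qed

text \<open>Makes sense for simplices contained in no single chart, unlike
  \<open>simplex_int2\<close>.\<close>

definition int2 :: "('i list \<Rightarrow> form2) \<Rightarrow> ((nat \<Rightarrow> real) \<Rightarrow> 'a) \<Rightarrow> complex" where
  "int2 \<alpha> \<sigma> = integral triangle (gdens \<alpha> triangle (\<lambda>p. \<sigma> (bary (fst p) (snd p))) (1, 0) (0, 1))"

lemma xsmooth_bary:
  assumes "smooth_simplex X 2 \<sigma>" shows "xsmooth triangle (\<lambda>p. \<sigma> (bary (fst p) (snd p)))"
proof (rule xsmooth_simplex[OF assms])
  show "bary (fst x) (snd x) \<in> standard_simplex 2" if "x \<in> triangle" for x
    using that by (simp add: bary_simplex)
  show "smooth_on UNIV (\<lambda>p. (bary (fst p) (snd p) 1, bary (fst p) (snd p) 2, bary (fst p) (snd p) 3))"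
    unfolding bary_def
    by (auto intro!: smooth_on_Pair smooth_on_const smooth_on_fst smooth_on_snd smooth_on_ident)
qed

lemma xsmooth_bary3:
  assumes "smooth_simplex X 3 \<sigma>"
  shows "xsmooth tetra (\<lambda>p. \<sigma> (bary3 (fst p) (fst (snd p)) (snd (snd p))))"
proof (rule xsmooth_simplex[OF assms])
  show "bary3 (fst x) (fst (snd x)) (snd (snd x)) \<in> standard_simplex 3" if "x \<in> tetra" for x
    using that by (simp add: bary3_simplex)
  show "smooth_on UNIV (\<lambda>p. (bary3 (fst p) (fst (snd p)) (snd (snd p)) 1, bary3 (fst p) (fst (snd p)) (snd (snd p)) 2,
      bary3 (fst p) (fst (snd p)) (snd (snd p)) 3))"
    unfolding bary3_def
    by (auto intro!: smooth_on_Pair smooth_on_const smooth_on_fst smooth_on_snd smooth_on_ident)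
qed

lemma xsmooth_bary1:
  assumes "smooth_simplex X 1 \<sigma>" shows "xsmooth {0..1} (\<lambda>s. \<sigma> (bary s 0))"
proof (rule xsmooth_simplex[OF assms])
  show "smooth_on UNIV (\<lambda>s. (bary s 0 1, bary s 0 2, bary s 0 3))"
    unfolding bary_def by (auto intro!: smooth_on_Pair smooth_on_const smooth_on_ident)
qed (rule bary_simplex1)

lemma stokes_3simplex:
  assumes \<sigma>: "smooth_simplex X 3 \<sigma>" and \<alpha>: "global_2form X \<alpha>"
  shows "(\<Sum>k\<le>3. (-1) ^ k * int2 \<alpha> (singular_face 3 k \<sigma>)) = 0"
proof -
  let ?w = "\<lambda>p. \<sigma> (bary3 (fst p) (fst (snd p)) (snd (snd p)))"
  note w = xsmooth_bary3[OF \<sigma>]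
  let ?a = "gdens \<alpha> tetra ?w"
  have fc: "int2 \<alpha> (singular_face 3 k \<sigma>) = integral triangle (\<lambda>p. ?a (l' (1, 0)) (l' (0, 1)) (l p))"
    if l: "smooth_on UNIV l" "\<And>x. x \<in> triangle \<Longrightarrow> l x \<in> tetra"
      "\<And>x. (l has_derivative l') (at x within triangle)"
      and f: "\<And>p. p \<in> triangle \<Longrightarrow> singular_face 3 k \<sigma> (bary (fst p) (snd p)) = ?w (l p)" for l l' k
    unfolding int2_def
    by (intro integral_cong gdens_compose[OF solid_tetra solid_triangle w \<alpha> l(1,2,3) _ f]) auto
  have f0: "int2 \<alpha> (singular_face 3 0 \<sigma>) = integral triangle (\<lambda>(s, t).
      ?a (1,0,0) (0,1,0) (1 - s - t, s, t) - ?a (1,0,0) (0,0,1) (1 - s - t, s, t) + ?a (0,1,0) (0,0,1) (1 - s - t, s, t))"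
  proof -
    \<comment> \<open>The face opposite to the vertex 0 of the simplex; its tangent vectors are
      \<open>(-1, 1, 0)\<close> and \<open>(-1, 0, 1)\<close>.\<close>
    let ?l = "\<lambda>p::real \<times> real. (1 - fst p - snd p, fst p, snd p)"
    let ?l' = "\<lambda>p::real \<times> real. (- fst p - snd p, fst p, snd p)"
    have lt: "?l x \<in> tetra" if "x \<in> triangle" for x using that by (auto simp: tetra_def triangle_def)
    have "int2 \<alpha> (singular_face 3 0 \<sigma>) = integral triangle (\<lambda>p. ?a (?l' (1, 0)) (?l' (0, 1)) (?l p))"
      by (rule fc) (auto intro!: smooth_on_Pair smooth_on_diff smooth_on_const smooth_on_fst smooth_on_snd smooth_on_ident
          derivative_eq_intros simp: face_bary tetra_def triangle_def)
    also have "\<dots> = integral triangle (\<lambda>p. ?a (1,0,0) (0,1,0) (?l p) - ?a (1,0,0) (0,0,1) (?l p) + ?a (0,1,0) (0,0,1) (?l p))"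
    proof (rule integral_cong)
      fix p :: "real \<times> real" assume "p \<in> triangle"
      from gdens_diff[OF solid_tetra w lt[OF this] \<alpha>, of "(0,1,0)" "(1,0,0)" "(0,0,1)"]
      show "?a (?l' (1, 0)) (?l' (0, 1)) (?l p) =
        ?a (1,0,0) (0,1,0) (?l p) - ?a (1,0,0) (0,0,1) (?l p) + ?a (0,1,0) (0,0,1) (?l p)" by simp
    qed
    finally show ?thesis by (simp add: case_prod_unfold)
  qed
  have f1: "int2 \<alpha> (singular_face 3 1 \<sigma>) = integral triangle (\<lambda>(s, t). ?a (0,1,0) (0,0,1) (0, s, t))"
  proof -
    let ?l = "\<lambda>p::real \<times> real. (0::real, fst p, snd p)"
    have "int2 \<alpha> (singular_face 3 1 \<sigma>) = integral triangle (\<lambda>p. ?a (?l (1, 0)) (?l (0, 1)) (?l p))"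
      by (rule fc) (auto intro!: smooth_on_Pair smooth_on_const smooth_on_fst smooth_on_snd smooth_on_ident
          derivative_eq_intros simp: face_bary[unfolded One_nat_def] tetra_def triangle_def)
    then show ?thesis by (simp add: case_prod_unfold)
  qed
  have f2: "int2 \<alpha> (singular_face 3 2 \<sigma>) = integral triangle (\<lambda>(s, t). ?a (1,0,0) (0,0,1) (s, 0, t))"
  proof -
    let ?l = "\<lambda>p::real \<times> real. (fst p, 0::real, snd p)"
    have "int2 \<alpha> (singular_face 3 2 \<sigma>) = integral triangle (\<lambda>p. ?a (?l (1, 0)) (?l (0, 1)) (?l p))"
      by (rule fc) (auto intro!: smooth_on_Pair smooth_on_const smooth_on_fst smooth_on_snd smooth_on_ident
          derivative_eq_intros simp: face_bary tetra_def triangle_def)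
    then show ?thesis by (simp add: case_prod_unfold)
  qed
  have f3: "int2 \<alpha> (singular_face 3 3 \<sigma>) = integral triangle (\<lambda>(s, t). ?a (1,0,0) (0,1,0) (s, t, 0))"
  proof -
    let ?l = "\<lambda>p::real \<times> real. (fst p, snd p, 0::real)"
    have "int2 \<alpha> (singular_face 3 3 \<sigma>) = integral triangle (\<lambda>p. ?a (?l (1, 0)) (?l (0, 1)) (?l p))"
      by (rule fc) (auto intro!: smooth_on_Pair smooth_on_const smooth_on_fst smooth_on_snd smooth_on_ident
          derivative_eq_intros simp: face_bary tetra_def triangle_def)
    then show ?thesis by (simp add: case_prod_unfold)
  qed
  have "(\<Sum>k\<le>3. (-1) ^ k * int2 \<alpha> (singular_face 3 k \<sigma>)) = int2 \<alpha> (singular_face 3 0 \<sigma>)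
      - int2 \<alpha> (singular_face 3 1 \<sigma>) + int2 \<alpha> (singular_face 3 2 \<sigma>) - int2 \<alpha> (singular_face 3 3 \<sigma>)"
    by (simp add: numeral_3_eq_3 numeral_2_eq_2)
  also have "\<dots> = 0"
    unfolding f0 f1 f2 f3
    by (rule stokes_tetra) (intro csmooth_gdens solid_tetra w \<alpha> gdens_closed; assumption)+
  finally show ?thesis .
qed

lemma stokes_3chain:
  assumes "smooth_chain X 3 B" "global_2form X \<alpha>"
  shows "fint (int2 \<alpha>) (chain_boundary 3 B) = 0"
proof -
  have "fint (int2 \<alpha>) (chain_boundary 3 B) = fint (\<lambda>\<sigma>. 0) B"
    using assms stokes_3simplex by (subst fint_chain_boundary) (auto simp: smooth_chain_def intro!: fint_cong)
  then show ?thesis by (simp add: fint_def)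
qed

lemma simplex_int2_eq: "simplex_int2 X i \<omega> \<sigma> =
    integral triangle (area_form \<omega> triangle (\<lambda>p. coord X i (\<sigma> (bary (fst p) (snd p)))) (1, 0) (0, 1))"
  unfolding simplex_int2_def Let_def area_form_def[abs_def] case_prod_unfold by simp

lemma int2_chart:
  assumes "smooth_simplex X 2 \<sigma>" "i \<in> idx X" "\<And>y. y \<in> standard_simplex 2 \<Longrightarrow> \<sigma> y \<in> patch X i" "global_2form X \<alpha>"
  shows "simplex_int2 X i (\<alpha> [i]) \<sigma> = int2 \<alpha> \<sigma>"
  unfolding simplex_int2_eq int2_def
  by (intro integral_cong gdens_eq[OF solid_triangle xsmooth_bary[OF assms(1)], symmetric] assms)
     (auto intro!: assms(3) bary_simplex)

lemma simplex_int1_eq: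
  assumes "csmooth {0..1} (\<lambda>s. coord X i (\<sigma> (bary s 0)))"
  shows "simplex_int1 X i \<theta> \<sigma> = integral {0..1} (edge_form \<theta> {0..1} (\<lambda>s. coord X i (\<sigma> (bary s 0))) 1)"
  unfolding simplex_int1_def Let_def
proof (rule integral_cong)
  fix s :: real assume s: "s \<in> {0..1}"
  let ?u = "\<lambda>s. coord X i (\<sigma> (bary s 0))"
  have "(?u has_derivative frechet_derivative ?u (at s within {0..1})) (at s within {0..1})"
    by (rule csmooth_has_derivative[OF solid_unit assms s])
  from has_vector_derivative_along[where l = "\<lambda>s. s" and b = 1 and I = "{0..1}", OF this]
  have "(?u has_vector_derivative wdir {0..1} ?u 1 s) (at s within {0..1})"
    by (simp add: has_vector_derivative_def)
  then have "vector_derivative ?u (at s within {0..1}) = wdir {0..1} ?u 1 s"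
    using s by (intro vector_derivative_within_closed_interval) auto
  then show "fst (\<theta> (?u s)) * vector_derivative ?u (at s within {0..1}) + snd (\<theta> (?u s)) * cnj (vector_derivative ?u (at s within {0..1}))
     = edge_form \<theta> {0..1} ?u 1 s" by (simp add: edge_form_def)
qed

lemma edge_form_compose:
  assumes "csmooth triangle u" "(l has_vector_derivative b) (at s within {0..1})" "l ` {0..1} \<subseteq> triangle" "s \<in> {0..1}"
    "\<And>s. s \<in> {0..1} \<Longrightarrow> v s = u (l s)"
  shows "edge_form \<eta> {0..1} v 1 s = edge_form \<eta> triangle u b (l s)"
proof -
  have "((\<lambda>s. u (l s)) has_vector_derivative wdir triangle u b (l s)) (at s within {0..1})"
    by (rule csmooth_along[OF solid_triangle assms(1,2,3)]) (use assms(3,4) in auto)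
  then have "((\<lambda>s. u (l s)) has_derivative (\<lambda>h. h *\<^sub>R wdir triangle u b (l s))) (at s within {0..1})"
    by (simp add: has_vector_derivative_def)
  then have "(v has_derivative (\<lambda>h. h *\<^sub>R wdir triangle u b (l s))) (at s within {0..1})"
    by (rule has_derivative_transform[OF assms(4), rotated]) (rule assms(5))
  from wdir_eq[OF solid_unit assms(4) this, of 1] show ?thesis
    using assms(4,5) by (simp add: edge_form_def)
qed

lemma csmooth_line:
  fixes l :: "'w::euclidean_space \<Rightarrow> 'v::euclidean_space" and u :: "'v \<Rightarrow> complex"
  assumes "csmooth T u" "smooth_on UNIV l" "\<And>x. x \<in> T' \<Longrightarrow> l x \<in> T" "\<And>x. x \<in> T' \<Longrightarrow> v x = u (l x)"
  shows "csmooth T' v"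
  unfolding csmooth_def
proof
  fix x assume x: "x \<in> T'"
  obtain W g where "open W \<and> l x \<in> W \<and> smooth_on W g \<and> (\<forall>y\<in>T \<inter> W. u y = g y)"
    using csmooth_local[OF assms(1) assms(3)[OF x]] by (elim exE)
  then have W: "open W" "l x \<in> W" "smooth_on W g" "\<And>y. y \<in> T \<inter> W \<Longrightarrow> u y = g y" by simp_all
  have o: "open (l -` W)"
    using continuous_open_preimage[OF smooth_on_continuous[OF assms(2)] open_UNIV W(1)] by simp
  have "smooth_on (l -` W) (\<lambda>x. g (l x))"
    by (rule smooth_on_compose[OF o W(3) smooth_on_subset[OF assms(2)]]) auto
  then show "\<exists>W g. open W \<and> x \<in> W \<and> smooth_on W g \<and> (\<forall>y\<in>T' \<inter> W. v y = g y)"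
    using o W assms(3,4) by (intro exI[of _ "l -` W"] exI[of _ "\<lambda>x. g (l x)"]) simp
qed

lemma stokes_2simplex:
  assumes \<sigma>: "smooth_simplex X 2 \<sigma>" and i: "i \<in> idx X" and p: "\<And>y. y \<in> standard_simplex 2 \<Longrightarrow> \<sigma> y \<in> patch X i"
    and \<eta>: "smooth_on (dom_of X [i]) \<eta>"
  shows "simplex_int2 X i (d1 \<eta>) \<sigma> = (\<Sum>k\<le>2. (-1) ^ k * simplex_int1 X i \<eta> (singular_face 2 k \<sigma>))"
proof -
  let ?u = "\<lambda>p. coord X i (\<sigma> (bary (fst p) (snd p)))"
  have in_p: "\<sigma> (bary (fst x) (snd x)) \<in> patch X i" if "x \<in> triangle" for x
    using p bary_simplex[of "fst x" "snd x"] that by simp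
  have u: "csmooth triangle ?u" using xsmooth_chart[OF xsmooth_bary[OF \<sigma>] i in_p] .
  have uV: "?u x \<in> dom_of X [i]" if "x \<in> triangle" for x using in_p[OF that] by simp
  have edge: "simplex_int1 X i \<eta> (singular_face 2 k \<sigma>) = integral {0..1} (\<lambda>s. edge_form \<eta> triangle ?u b (l s))"
    if l: "smooth_on UNIV l" "l ` {0..1} \<subseteq> triangle" "\<And>s. (l has_vector_derivative b) (at s within {0..1})"
      "\<And>s. s \<in> {0..1} \<Longrightarrow> singular_face 2 k \<sigma> (bary s 0) = \<sigma> (bary (fst (l s)) (snd (l s)))" for k l b
  proof -
    have "csmooth {0..1} (\<lambda>s. coord X i (singular_face 2 k \<sigma> (bary s 0)))"
      by (rule csmooth_line[OF u l(1)]) (use l in auto)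
    from simplex_int1_eq[OF this] have "simplex_int1 X i \<eta> (singular_face 2 k \<sigma>)
       = integral {0..1} (edge_form \<eta> {0..1} (\<lambda>s. coord X i (singular_face 2 k \<sigma> (bary s 0))) 1)" .
    also have "\<dots> = integral {0..1} (\<lambda>s. edge_form \<eta> triangle ?u b (l s))"
      by (rule integral_cong, rule edge_form_compose[OF u l(3,2)]) (use l(4) in auto)
    finally show ?thesis .
  qed
  \<comment> \<open>The edge opposite to the vertex 0 runs from \<open>(1, 0)\<close> to
    \<open>(0, 1)\<close>, hence the direction \<open>(-1, 1)\<close>.\<close>
  have e0: "simplex_int1 X i \<eta> (singular_face 2 0 \<sigma>) = integral {0..1} (\<lambda>s. edge_form \<eta> triangle ?u (-1, 1) (1 - s, s))"
    by (rule edge) (auto intro!: smooth_on_Pair smooth_on_diff smooth_on_const smooth_on_ident derivative_eq_intros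
        simp: triangle_def has_vector_derivative_def face_bary2 fun_eq_iff)
  have e1: "simplex_int1 X i \<eta> (singular_face 2 1 \<sigma>) = integral {0..1} (\<lambda>s. edge_form \<eta> triangle ?u (0, 1) (0, s))"
    by (rule edge) (auto intro!: smooth_on_Pair smooth_on_const smooth_on_ident derivative_eq_intros
        simp: triangle_def has_vector_derivative_def face_bary2[unfolded One_nat_def] fun_eq_iff)
  have e2: "simplex_int1 X i \<eta> (singular_face 2 2 \<sigma>) = integral {0..1} (\<lambda>s. edge_form \<eta> triangle ?u (1, 0) (s, 0))"
    by (rule edge) (auto intro!: smooth_on_Pair smooth_on_const smooth_on_ident derivative_eq_intros
        simp: triangle_def has_vector_derivative_def face_bary2 fun_eq_iff)
  have "edge_form \<eta> triangle ?u (-1, 1) (1 - s, s) = edge_form \<eta> triangle ?u (0, 1) (1 - s, s) - edge_form \<eta> triangle ?u (1, 0) (1 - s, s)"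
    if "s \<in> {0..1}" for s
  proof -
    have m: "(1 - s, s) \<in> triangle" using that by (auto simp: triangle_def)
    have lin: "linear (frechet_derivative ?u (at (1 - s, s) within triangle))"
      using has_derivative_linear[OF csmooth_has_derivative[OF solid_triangle u m]] .
    have "(-1 :: real, 1 :: real) = (0, 1) - (1, 0)" by simp
    then have we: "wdir triangle ?u (-1, 1) (1 - s, s) = wdir triangle ?u (0, 1) (1 - s, s) - wdir triangle ?u (1, 0) (1 - s, s)"
      using linear_diff[OF lin] by metis
    show ?thesis unfolding edge_form_def we by (simp add: algebra_simps)
  qed
  then have e0': "simplex_int1 X i \<eta> (singular_face 2 0 \<sigma>) =
     integral {0..1} (\<lambda>s. edge_form \<eta> triangle ?u (0, 1) (1 - s, s) - edge_form \<eta> triangle ?u (1, 0) (1 - s, s))"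
    unfolding e0 by (rule integral_cong)
  have "simplex_int2 X i (d1 \<eta>) \<sigma> = simplex_int1 X i \<eta> (singular_face 2 0 \<sigma>)
      - simplex_int1 X i \<eta> (singular_face 2 1 \<sigma>) + simplex_int1 X i \<eta> (singular_face 2 2 \<sigma>)"
    unfolding simplex_int2_eq e0' e1 e2
    by (rule stokes_triangle[OF u open_dom_single[OF i] uV \<eta>])
  then show ?thesis by (simp add: numeral_2_eq_2)
qed

lemma stokes_1simplex:
  assumes \<sigma>: "smooth_simplex X 1 \<sigma>" and i: "i \<in> idx X" and p: "\<And>y. y \<in> standard_simplex 1 \<Longrightarrow> \<sigma> y \<in> patch X i"
    and V: "open V" "\<And>y. y \<in> standard_simplex 1 \<Longrightarrow> coord X i (\<sigma> y) \<in> V" and \<phi>: "smooth_on V \<phi>"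
  shows "simplex_int1 X i (d0 \<phi>) \<sigma> = (\<Sum>k\<le>1. (-1) ^ k * simplex_int0 X i \<phi> (singular_face 1 k \<sigma>))"
proof -
  let ?u = "\<lambda>s. coord X i (\<sigma> (bary s 0))"
  have u: "csmooth {0..1} ?u"
    by (rule xsmooth_chart[OF xsmooth_bary1[OF \<sigma>] i]) (use p bary_simplex1 in auto)
  have uV: "?u s \<in> V" if "s \<in> {0..1}" for s using V(2) bary_simplex1[OF that] by simp
  have cs: "csmooth {0..1} (\<lambda>s. \<phi> (?u s))" by (rule csmooth_compose[OF u V(1) \<phi> uV])
  have "((\<lambda>s. edge_form (d0 \<phi>) {0..1} ?u 1 s) has_integral (\<phi> (?u 1) - \<phi> (?u 0))) {0..1}"
  proof (rule fundamental_theorem_of_calculus)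
    fix s :: real assume s: "s \<in> {0..1}"
    have "(?u has_derivative frechet_derivative ?u (at s within {0..1})) (at s within {0..1})"
      by (rule csmooth_has_derivative[OF solid_unit u s])
    from has_derivative_compose[OF this smooth_on_has_wirt[OF \<phi> uV[OF s], unfolded has_wirt_def]]
    have "((\<lambda>s. \<phi> (?u s)) has_derivative (\<lambda>h. pd \<phi> (?u s) * wdir {0..1} ?u h s + pdb \<phi> (?u s) * cnj (wdir {0..1} ?u h s))) (at s within {0..1})" .
    from has_vector_derivative_along[where l = "\<lambda>s. s" and b = 1 and I = "{0..1}", OF this]
    show "((\<lambda>s. \<phi> (?u s)) has_vector_derivative edge_form (d0 \<phi>) {0..1} ?u 1 s) (at s within {0..1})"
      by (simp add: has_vector_derivative_def edge_form_def d0_def)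
  qed simp
  then have "simplex_int1 X i (d0 \<phi>) \<sigma> = \<phi> (?u 1) - \<phi> (?u 0)"
    using simplex_int1_eq[OF u] integral_unique by metis
  then show ?thesis by (simp add: simplex_int0_def face_bary1[unfolded One_nat_def])
qed

text \<open>Chart independence of line integrals; it turns the pulled-back term of a Cech coboundary
  into an integral in the other chart.\<close>

lemma simplex_int1_pull:
  assumes \<sigma>: "smooth_simplex X 1 \<sigma>" and ij: "i \<in> idx X" "j \<in> idx X"
    and p: "\<And>y. y \<in> standard_simplex 1 \<Longrightarrow> \<sigma> y \<in> patch X i" "\<And>y. y \<in> standard_simplex 1 \<Longrightarrow> \<sigma> y \<in> patch X j"
  shows "simplex_int1 X i \<eta> \<sigma> = simplex_int1 X j (pull1 (trans_fun X i j) \<eta>) \<sigma>"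
proof -
  note w = xsmooth_bary1[OF \<sigma>]
  have u: "csmooth {0..1} (\<lambda>s. coord X i (\<sigma> (bary s 0)))" "csmooth {0..1} (\<lambda>s. coord X j (\<sigma> (bary s 0)))"
    by (rule xsmooth_chart[OF w]; use ij p bary_simplex1 in auto)+
  show ?thesis
    unfolding simplex_int1_eq[OF u(1)] simplex_int1_eq[OF u(2)]
  proof (rule integral_cong)
    fix s :: real assume s: "s \<in> {0..1}"
    note ps = p(1)[OF bary_simplex1[OF s]] p(2)[OF bary_simplex1[OF s]]
    let ?z = "coord X j (\<sigma> (bary s 0))"
    have t: "pd (trans_fun X i j) ?z = deriv (trans_fun X i j) ?z" "pdb (trans_fun X i j) ?z = 0"
      using has_wirt_unique[OF has_wirt_field[OF trans_deriv[OF ij, of ?z]]] ps ij by auto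
    show "edge_form \<eta> {0..1} (\<lambda>s. coord X i (\<sigma> (bary s 0))) 1 s
      = edge_form (pull1 (trans_fun X i j) \<eta>) {0..1} (\<lambda>s. coord X j (\<sigma> (bary s 0))) 1 s"
      unfolding edge_form_def chart_derivative_change[OF solid_unit w s ij ps]
      using ij ps by (simp add: pull1_def t trans_fun_def algebra_simps)
  qed
qed

end

section \<open>Variation of the cocycle\<close>

lemma has_vector_derivative_divide':
  fixes a b :: "real \<Rightarrow> complex"
  assumes "(a has_vector_derivative a') (at t)" "(b has_vector_derivative b') (at t)" "b t \<noteq> 0"
  shows "((\<lambda>t. a t / b t) has_vector_derivative (a' - a t / b t * b') / b t) (at t)"
proof -
  have "((\<lambda>t. a t / b t) has_derivative (\<lambda>h. ((h *\<^sub>R a') * b t - a t * (h *\<^sub>R b')) / (b t * b t))) (at t)"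
    by (rule has_derivative_divide'[OF assms(1,2)[unfolded has_vector_derivative_def] assms(3)])
  moreover have "((h *\<^sub>R a') * b t - a t * (h *\<^sub>R b')) / (b t * b t) = h *\<^sub>R ((a' - a t / b t * b') / b t)" for h
    using assms(3) by (simp add: field_simps scaleR_conv_of_real)
  ultimately show ?thesis by (simp add: has_vector_derivative_def)
qed

lemma has_vector_derivative_eventually:
  assumes "(f has_vector_derivative d) (at t)" "\<forall>\<^sub>F s in nhds t. f s = g s"
  shows "(g has_vector_derivative d) (at t)"
proof -
  have "f t = g t" using eventually_nhds_x_imp_x[OF assms(2)] .
  moreover have "\<forall>\<^sub>F s in nhds t. s \<in> UNIV \<longrightarrow> f s = g s" using assms(2) by simp
  ultimately show ?thesis using assms(1) has_vector_derivative_cong_ev by blast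
qed

lemma dt_eqI:
  assumes "smooth_on W H" "(t, z) \<in> W" "((\<lambda>t. H (t, z)) has_vector_derivative d) (at t)"
  shows "dt H (t, z) = d"
  using vector_derivative_unique_at[OF slice_has_vector_derivative[OF assms(1,2)] assms(3)] .

section \<open>Logarithms of the derivatives of the transition functions\<close>

context rsurface
begin

context
  assumes log: "log_branches X"
begin

lemma logtr_props:
  assumes "i \<in> idx X" "j \<in> idx X"
  shows "continuous_on (dom_of X [i, j]) (logtr X [i, j])"
    "\<And>z. z \<in> dom_of X [i, j] \<Longrightarrow> exp (logtr X [i, j] z) = deriv (trans_fun X i j) z"
  using log assms by (auto simp: log_branches_def log_branch_def)

lemma logtr_holo: "i \<in> idx X \<Longrightarrow> j \<in> idx X \<Longrightarrow> logtr X [i, j] holomorphic_on dom_of X [i, j]"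
  by (rule holomorphic_on_log(1)[OF open_dom2 logtr_props deriv_trans_holo])

lemma logtr_deriv:
  assumes "i \<in> idx X" "j \<in> idx X" "z \<in> dom_of X [i, j]"
  shows "deriv (logtr X [i, j]) z = deriv (deriv (trans_fun X i j)) z / deriv (trans_fun X i j) z"
  by (rule holomorphic_on_log(2)[OF open_dom2 logtr_props deriv_trans_holo]) (use assms in auto)

lemma logtr_field:
  assumes "i \<in> idx X" "j \<in> idx X" "z \<in> dom_of X [i, j]"
  shows "(logtr X [i, j] has_field_derivative deriv (logtr X [i, j]) z) (at z)"
  using holomorphic_derivI[OF logtr_holo[OF assms(1,2)] open_dom2[OF assms(1,2)] assms(3)] .

lemma cc_eq:
  "cc X [i, j, k] y = logtr X [j, k] y - logtr X [i, k] y + logtr X [i, j] (trans_fun X j k y)"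
  by (simp add: cc_def cech_def Let_def del_nth_def pull0_def numeral_2_eq_2)

text \<open>The exponential of \<open>c\<^sub>i\<^sub>j\<^sub>k\<close> is 1, so its derivative vanishes.\<close>

lemma cc_field:
  assumes "i \<in> idx X" "j \<in> idx X" "k \<in> idx X" "y \<in> dom_of X [i, j, k]"
  shows "(cc X [i, j, k] has_field_derivative 0) (at y)"
proof -
  have d: "y \<in> dom_of X [k]" "coord_inv X k y \<in> patch X i" "coord_inv X k y \<in> patch X j"
    if "y \<in> dom_of X [i, j, k]" for y
    using dom_of3[OF assms(1-3)] that by auto
  note d = d[OF assms(4)]
  note t = trans_mem[OF assms(2,3) d(1,3)]
  have "((\<lambda>y. logtr X [j, k] y - logtr X [i, k] y + logtr X [i, j] (trans_fun X j k y)) has_field_derivative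
    deriv (logtr X [j, k]) y - deriv (logtr X [i, k]) y
     + deriv (logtr X [i, j]) (trans_fun X j k y) * deriv (trans_fun X j k) y) (at y)"
    by (intro DERIV_add DERIV_diff logtr_field DERIV_chain2[OF logtr_field] trans_deriv assms)
       (use d t assms in \<open>auto simp: dom_of2\<close>)
  then obtain c where c: "(cc X [i, j, k] has_field_derivative c) (at y)"
    unfolding cc_eq[abs_def] by blast
  have e: "exp (cc X [i, j, k] y) = 1" if y: "y \<in> dom_of X [i, j, k]" for y
  proof -
    have d: "y \<in> dom_of X [k]" "coord_inv X k y \<in> patch X i" "coord_inv X k y \<in> patch X j"
      using dom_of3[OF assms(1-3)] y by auto
    note t = trans_mem[OF assms(2,3) d(1,3)]
    have "exp (cc X [i, j, k] y) = deriv (trans_fun X j k) y / deriv (trans_fun X i k) y * deriv (trans_fun X i j) (trans_fun X j k y)"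
      using logtr_props(2) d t assms by (simp add: cc_eq exp_add exp_diff dom_of2)
    then show ?thesis
      using trans_deriv_comp[OF assms(1-3) d] trans_deriv_nz[OF assms(1,3) d(1,2)] by (simp add: field_simps)
  qed
  have "((\<lambda>y. exp (cc X [i, j, k] y)) has_field_derivative exp (cc X [i, j, k] y) * c) (at y)"
    by (rule DERIV_chain2[OF DERIV_exp c])
  moreover have "((\<lambda>y. exp (cc X [i, j, k] y)) has_field_derivative 0) (at y)"
    by (rule has_field_derivative_transform_within_open[OF _ open_dom3[OF assms(1-3)] assms(4)])
       (use e in \<open>auto intro: DERIV_const\<close>)
  ultimately have "exp (cc X [i, j, k] y) * c = 0" using DERIV_unique by blast
  then show ?thesis using c by simp
qed

end

end

locale setting =
  sx: rsurface X + sy: rsurface Y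
  for X :: "('a, 'i) surface" and Y :: "('b, 'i) surface" +
  fixes f :: "'a \<Rightarrow> 'b" and L h :: "'i \<Rightarrow> complex \<Rightarrow> complex"
  assumes idx_eq: "idx Y = idx X" and diffeo: "oriented_diffeo X Y f"
    and patch_img: "\<forall>i\<in>idx X. patch Y i = f ` patch X i"
    and logX: "log_branches X" and logY: "log_branches Y"
    and logL: "\<forall>i\<in>idx X. log_branch (dom_of X [i]) (pd (local_rep X Y f i)) (L i)"
    and tameX: "tame_trivialization X" and tameY: "tame_trivialization Y"
    and proj: "projective_connection X h"
begin

abbreviation "fl \<equiv> local_rep X Y f"

lemma f_patch: "i \<in> idx X \<Longrightarrow> x \<in> patch X i \<Longrightarrow> f x \<in> patch Y i"
  using patch_img by blast

lemma smooth_fl: assumes "i \<in> idx X" shows "smooth_on (dom_of X [i]) (fl i)"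
proof -
  have "smooth_on {\<zeta> \<in> dom_of X [i]. f (coord_inv X i \<zeta>) \<in> patch Y i} (\<lambda>\<zeta>. coord Y i (f (coord_inv X i \<zeta>)))"
    using diffeo assms idx_eq unfolding oriented_diffeo_def smooth_map_def by auto
  moreover have "{\<zeta> \<in> dom_of X [i]. f (coord_inv X i \<zeta>) \<in> patch Y i} = dom_of X [i]"
    using f_patch[OF assms] by auto
  ultimately show ?thesis unfolding local_rep_def[abs_def] by simp
qed

lemma pd_fl_nz: assumes "i \<in> idx X" "z \<in> dom_of X [i]" shows "pd (fl i) z \<noteq> 0"
proof -
  have "cmod (pdb (fl i) z) < cmod (pd (fl i) z)"
    using diffeo assms idx_eq f_patch[OF assms(1)] unfolding oriented_diffeo_def local_rep_def[abs_def] by auto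
  then show ?thesis by auto
qed

lemma smooth_h: "i \<in> idx X \<Longrightarrow> smooth_on (dom_of X [i]) (h i)"
  using proj by (simp add: projective_connection_def)

lemma fl_mem: "i \<in> idx X \<Longrightarrow> z \<in> dom_of X [i] \<Longrightarrow> fl i z \<in> dom_of Y [i]"
  using f_patch[of i "coord_inv X i z"] by (simp add: local_rep_def)

lemma coord_inv_fl: "i \<in> idx X \<Longrightarrow> z \<in> dom_of X [i] \<Longrightarrow> coord_inv Y i (fl i z) = f (coord_inv X i z)"
  using f_patch[of i "coord_inv X i z"] idx_eq by (simp add: local_rep_def)

lemma fl_dom2: "i \<in> idx X \<Longrightarrow> j \<in> idx X \<Longrightarrow> z \<in> dom_of X [i, j] \<Longrightarrow> fl j z \<in> dom_of Y [i, j]"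
  using fl_mem[of j z] coord_inv_fl[of j z] f_patch idx_eq by (simp add: sx.dom_of2 sy.dom_of2)

end

text \<open>The compact slice at time 0 has a neighbourhood of uniform width in \<open>W\<close>;
  formulas valid on \<open>W\<close> therefore hold along a whole simplex for small
  \<open>t\<close>.\<close>

lemma eventually_compact_slice:
  fixes u :: "'e::topological_space \<Rightarrow> complex"
  assumes "open W" "compact T" "continuous_on T u" "\<And>x. x \<in> T \<Longrightarrow> (0, u x) \<in> W"
  shows "\<forall>\<^sub>F t in nhds (0::real). \<forall>x\<in>T. (t, u x) \<in> W"
proof -
  define K where "K = Pair (0::real) ` u ` T"
  have K: "compact K" unfolding K_def
    by (intro compact_continuous_image assms continuous_intros)
  obtain e where e: "e > 0" "(\<Union>x\<in>K. ball x e) \<subseteq> W"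
    using compact_subset_open_imp_ball_epsilon_subset[OF K assms(1)] assms(4) by (auto simp: K_def)
  have "(t, u x) \<in> W" if "dist t 0 < e" "x \<in> T" for t x
  proof -
    have "(t, u x) \<in> ball (0, u x) e" using that by (simp add: dist_Pair_Pair dist_commute)
    then have "(t, u x) \<in> (\<Union>x\<in>K. ball x e)"
      using that(2) by (intro UN_I[of "(0, u x)"]) (simp_all add: K_def)
    then show ?thesis using e(2) by blast
  qed
  then show ?thesis unfolding eventually_nhds_metric using e(1) by blast
qed

section \<open>The variation in one chart\<close>

locale variation = setting X Y f L h
  for X :: "('a, 'i) surface" and Y :: "('b, 'i) surface" and f :: "'a \<Rightarrow> 'b" and L h :: "'i \<Rightarrow> complex \<Rightarrow> complex" +
  fixes F :: "real \<Rightarrow> 'a \<Rightarrow> 'b" and e :: real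
  assumes F0: "x \<in> topspace (surf X) \<Longrightarrow> F 0 x = f x" and e_pos: "e > 0"
    and F_diffeo: "\<bar>t\<bar> < e \<Longrightarrow> oriented_diffeo X Y (F t)"
    and F_cont: "continuous_map (prod_topology (top_of_set {-e<..<e}) (surf X)) (surf Y) (\<lambda>(t, x). F t x)"
    and F_smooth: "i \<in> idx X \<Longrightarrow> j \<in> idx Y \<Longrightarrow> smooth_on
           {(t, \<zeta>). \<bar>t\<bar> < e \<and> \<zeta> \<in> dom_of X [i] \<and> F t (coord_inv X i \<zeta>) \<in> patch Y j}
           (\<lambda>(t, \<zeta>). coord Y j (F t (coord_inv X i \<zeta>)))"
begin

definition G :: "'i \<Rightarrow> real \<times> complex \<Rightarrow> complex" where
  "G i = (\<lambda>(t, \<zeta>). coord Y i (F t (coord_inv X i \<zeta>)))"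

text \<open>Open by joint continuity, and it contains the whole slice \<open>t = 0\<close> because
  \<open>patch Y i\<close> is the image of \<open>patch X i\<close>; time derivatives at 0 thus
  exist at every point of the chart.\<close>

definition W :: "'i \<Rightarrow> (real \<times> complex) set" where
  "W i = {(t, \<zeta>). \<bar>t\<bar> < e \<and> \<zeta> \<in> dom_of X [i] \<and> F t (coord_inv X i \<zeta>) \<in> patch Y i}"

abbreviation "ul \<equiv> delta_rep X Y F"

lemma open_F_preimage:
  assumes i: "i \<in> idx X" and U: "openin (surf Y) U"
  shows "open {(t, \<zeta>). \<bar>t\<bar> < e \<and> \<zeta> \<in> dom_of X [i] \<and> F t (coord_inv X i \<zeta>) \<in> U}"
proof -
  have "\<bar>t\<bar> < e \<longleftrightarrow> t \<in> {-e<..<e}" for t by auto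
  then show ?thesis using sx.open_family_preimage[OF F_cont open_greaterThanLessThan i U] by simp
qed

lemma open_W: "i \<in> idx X \<Longrightarrow> open (W i)"
  unfolding W_def using open_F_preimage sy.patch_open idx_eq by simp

lemma smooth_G: "i \<in> idx X \<Longrightarrow> smooth_on (W i) (G i)"
  unfolding W_def G_def using F_smooth idx_eq by simp

lemma F0_coord: "i \<in> idx X \<Longrightarrow> z \<in> dom_of X [i] \<Longrightarrow> F 0 (coord_inv X i z) = f (coord_inv X i z)"
  using F0 sx.coord_inv_topspace by blast

lemma zero_W: "i \<in> idx X \<Longrightarrow> z \<in> dom_of X [i] \<Longrightarrow> (0, z) \<in> W i"
  using e_pos f_patch F0_coord by (simp add: W_def)

lemma snd_W: "q \<in> W i \<Longrightarrow> snd q \<in> dom_of X [i]" by (auto simp: W_def)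

lemma local_rep_G: "local_rep X Y (F t) i = (\<lambda>\<zeta>. G i (t, \<zeta>))"
  by (simp add: local_rep_def[abs_def] G_def)

lemma fl_G: "i \<in> idx X \<Longrightarrow> z \<in> dom_of X [i] \<Longrightarrow> fl i z = G i (0, z)"
  using F0_coord by (simp add: local_rep_def G_def)

lemma ul_G: "i \<in> idx X \<Longrightarrow> z \<in> dom_of X [i] \<Longrightarrow> ul i z = dt (G i) (0, z)"
  unfolding delta_rep_def local_rep_G
  by (rule vector_derivative_at[OF slice_has_vector_derivative[OF smooth_G zero_W]])

lemma zero_slice:
  assumes i: "i \<in> idx X" and H: "smooth_on (W i) H" and eq: "\<And>z. z \<in> dom_of X [i] \<Longrightarrow> H (0, z) = g z"
  shows "smooth_on (dom_of X [i]) g" and "z \<in> dom_of X [i] \<Longrightarrow> pd g z = dz H (0, z)"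
    and "z \<in> dom_of X [i] \<Longrightarrow> pdb g z = dzb H (0, z)"
proof -
  have s: "smooth_on (dom_of X [i]) (\<lambda>z. H (0, z))"
    using smooth_on_subset[OF smooth_slice[OF open_W[OF i] H, of 0], of "dom_of X [i]"] zero_W[OF i] by auto
  show "smooth_on (dom_of X [i]) g" by (rule smooth_on_cong[OF sx.open_dom_single[OF i] eq s])
  show "z \<in> dom_of X [i] \<Longrightarrow> pd g z = dz H (0, z)" "z \<in> dom_of X [i] \<Longrightarrow> pdb g z = dzb H (0, z)"
    using pd_cong[OF sx.open_dom_single[OF i] eq s] slice_pd[OF H zero_W[OF i]] by auto
qed

lemma smooth_ul: "i \<in> idx X \<Longrightarrow> smooth_on (dom_of X [i]) (ul i)"
  by (rule zero_slice(1)[OF _ smooth_on_dt[OF open_W smooth_G] ul_G[symmetric]])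

lemma deform: "i \<in> idx X \<Longrightarrow> deformation (dom_of X [i]) (fl i) (ul i) (h i)"
  by unfold_locales (auto simp: sx.open_dom_single smooth_fl smooth_ul smooth_h pd_fl_nz)

lemma dz_G_nz:
  assumes "i \<in> idx X" "(t, z) \<in> W i" shows "dz (G i) (t, z) \<noteq> 0"
proof -
  have "cmod (pdb (\<lambda>\<zeta>. G i (t, \<zeta>)) z) < cmod (pd (\<lambda>\<zeta>. G i (t, \<zeta>)) z)"
    using F_diffeo[of t] assms idx_eq unfolding oriented_diffeo_def W_def G_def by simp
  then show ?thesis using slice_pd[OF smooth_G[OF assms(1)] assms(2)] by auto
qed

context
  fixes i assumes i: "i \<in> idx X"
begin

interpretation deformation "dom_of X [i]" "fl i" "ul i" "h i" by (rule deform[OF i])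

text \<open>\<open>Mu\<close>, \<open>Nu\<close> and \<open>Om\<close> continue
  \<open>\<mu>\<close>, \<open>N\<close> and the coefficient of \<open>\<omega>\<close> to nonzero
  times.\<close>

definition Mu :: "real \<times> complex \<Rightarrow> complex" where "Mu q = dzb (G i) q / dz (G i) q"

definition Nu :: "real \<times> complex \<Rightarrow> complex" where "Nu q = dz (dz (G i)) q / dz (G i) q"

definition Om :: "real \<times> complex \<Rightarrow> complex" where
  "Om q = Nu q * dz Mu q + 2 * Mu q * h i (snd q)"

lemmas oW = open_W[OF i]
lemmas sG = smooth_G[OF i]
lemmas sGz = smooth_on_dz[OF oW sG]
lemmas sGb = smooth_on_dzb[OF oW sG]
lemmas sGzz = smooth_on_dz[OF oW sGz]

lemma nz: "q \<in> W i \<Longrightarrow> dz (G i) q \<noteq> 0" using dz_G_nz[OF i] by (cases q) auto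

lemma smooth_Mu: "smooth_on (W i) Mu"
  unfolding Mu_def[abs_def] by (rule smooth_on_divide[OF oW sGb sGz nz])

lemma smooth_Nu: "smooth_on (W i) Nu"
  unfolding Nu_def[abs_def] by (rule smooth_on_divide[OF oW sGzz sGz nz])

lemma smooth_h_snd: "smooth_on (W i) (\<lambda>q. h i (snd q))"
  by (rule smooth_on_compose[OF oW smooth_h]) (auto intro!: smooth_on_snd oW smooth_on_ident snd_W)

lemma smooth_Om: "smooth_on (W i) Om"
  unfolding Om_def[abs_def]
  by (intro smooth_on_add smooth_on_mult smooth_on_const smooth_on_dz oW smooth_Mu smooth_Nu smooth_h_snd)

lemma beltrami_slice: "(t, z) \<in> W i \<Longrightarrow> beltrami (\<lambda>\<zeta>. G i (t, \<zeta>)) z = Mu (t, z)"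
  using slice_pd[OF sG] by (simp add: beltrami_def Mu_def)

lemma pd_beltrami_slice:
  assumes "(t, z) \<in> W i" shows "pd (beltrami (\<lambda>\<zeta>. G i (t, \<zeta>))) z = dz Mu (t, z)"
proof -
  have s: "smooth_on {\<zeta>. (t, \<zeta>) \<in> W i} (\<lambda>\<zeta>. Mu (t, \<zeta>))" by (rule smooth_slice[OF oW smooth_Mu])
  have "pd (beltrami (\<lambda>\<zeta>. G i (t, \<zeta>))) z = pd (\<lambda>\<zeta>. Mu (t, \<zeta>)) z"
    by (rule pd_cong(1)[OF open_slice[OF oW] _ s]) (use assms beltrami_slice in auto)
  then show ?thesis using slice_pd(1)[OF smooth_Mu assms] by simp
qed

lemma lag_omega_Om: "(t, z) \<in> W i \<Longrightarrow> lag_omega X Y h (F t) [i] z = Om (t, z)"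
  using slice_pd(1)[OF sG] slice_pd_fun(1)[OF oW sG]
  by (simp add: lag_omega_def Let_def local_rep_G Om_def Nu_def beltrami_slice pd_beltrami_slice)

lemma zero_dz:
  assumes "z \<in> dom_of X [i]"
  shows "dz (G i) (0, z) = B z" "dzb (G i) (0, z) = pdb (fl i) z" "dz (dz (G i)) (0, z) = pd B z"
    "dt (dz (G i)) (0, z) = pd (ul i) z" "dt (dzb (G i)) (0, z) = pdb (ul i) z"
    "dt (dz (dz (G i))) (0, z) = pd (pd (ul i)) z"
proof -
  note z0 = zero_W[OF i assms]
  have B0: "dz (G i) (0, z) = B z" "dzb (G i) (0, z) = pdb (fl i) z" if "z \<in> dom_of X [i]" for z
    using zero_slice(2,3)[OF i sG fl_G[OF i, symmetric] that] by auto
  show "dz (G i) (0, z) = B z" "dzb (G i) (0, z) = pdb (fl i) z" using B0[OF assms] by auto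
  show "dz (dz (G i)) (0, z) = pd B z" using zero_slice(2)[OF i sGz B0(1) assms] by simp
  have st: "smooth_on (W i) (dt (G i))" by (rule smooth_on_dt[OF oW sG])
  have U0: "dz (dt (G i)) (0, z) = pd (ul i) z" "dzb (dt (G i)) (0, z) = pdb (ul i) z" if "z \<in> dom_of X [i]" for z
    using zero_slice(2,3)[OF i st ul_G[OF i, symmetric] that] by auto
  have t0: "dt (dz (G i)) q = dz (dt (G i)) q" if "q \<in> W i" for q using dt_dz(1)[OF oW sG that] .
  show "dt (dz (G i)) (0, z) = pd (ul i) z" using t0[OF z0] U0[OF assms] by simp
  show "dt (dzb (G i)) (0, z) = pdb (ul i) z" using dt_dz(2)[OF oW sG z0] U0[OF assms] by simp
  have "dt (dz (dz (G i))) (0, z) = dz (dt (dz (G i))) (0, z)" using dt_dz(1)[OF oW sGz z0] .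
  also have "\<dots> = pd (pd (ul i)) z"
    using zero_slice(2)[OF i smooth_on_dt[OF oW sGz] _ assms, of "pd (ul i)"] t0 U0(1) zero_W[OF i] by simp
  finally show "dt (dz (dz (G i))) (0, z) = pd (pd (ul i)) z" .
qed

text \<open>Product rule for \<open>u = v * B\<close>, with the Beltrami equation used for the
  derivatives of \<open>B\<close>.\<close>

lemma w_ul:
  assumes "z \<in> dom_of X [i]"
  shows "pd (ul i) z = p z * B z" "pdb (ul i) z = (pdb v z + v z * (pd \<mu> z + \<mu> z * N z)) * B z"
    "pd (pd (ul i)) z = (pd p z + p z * N z) * B z"
proof -
  have w: "has_wirt (ul i) (p z * B z) ((pdb v z + v z * (pd \<mu> z + \<mu> z * N z)) * B z) z" if z: "z \<in> dom_of X [i]" for z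
  proof -
    have "has_wirt (\<lambda>z. v z * B z) (p z * B z) ((pdb v z + v z * (pd \<mu> z + \<mu> z * N z)) * B z) z"
      by (rule has_wirt_eq[OF has_wirt_mult[OF w_v[OF z] w_B[OF z]]]) (auto simp: var_log_def algebra_simps)
    then show ?thesis by (rule has_wirt_cong[OF _ sx.open_dom_single[OF i] z]) (simp add: u_eq)
  qed
  show "pd (ul i) z = p z * B z" "pdb (ul i) z = (pdb v z + v z * (pd \<mu> z + \<mu> z * N z)) * B z"
    using has_wirt_unique[OF w[OF assms]] by auto
  have "has_wirt (\<lambda>z. p z * B z) ((pd p z + p z * N z) * B z) (pdb p z * B z + p z * (B z * (pd \<mu> z + \<mu> z * N z))) z"
    by (rule has_wirt_eq[OF has_wirt_mult[OF w_p[OF assms] w_B[OF assms]]]) (auto simp: algebra_simps)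
  then have "has_wirt (pd (ul i)) ((pd p z + p z * N z) * B z) (pdb p z * B z + p z * (B z * (pd \<mu> z + \<mu> z * N z))) z"
    by (rule has_wirt_cong[OF _ sx.open_dom_single[OF i] assms]) (use has_wirt_unique(1)[OF w] in auto)
  then show "pd (pd (ul i)) z = (pd p z + p z * N z) * B z" by (rule has_wirt_unique)
qed

lemma Mu_zero: "z \<in> dom_of X [i] \<Longrightarrow> Mu (0, z) = \<mu> z"
  by (simp add: Mu_def zero_dz beltrami_def)

lemma Nu_zero: "z \<in> dom_of X [i] \<Longrightarrow> Nu (0, z) = N z"
  by (simp add: Nu_def zero_dz prelog_def)

text \<open>In the quotient rule for \<open>\<mu> = pdb f / pd f\<close> the two terms
  \<open>v * \<mu> * N\<close> cancel, which leaves the operator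
  \<open>pdb - \<mu> * pd + pd \<mu>\<close> applied to \<open>v\<close>.\<close>

lemma dt_Mu: assumes "z \<in> dom_of X [i]" shows "dt Mu (0, z) = m z"
proof -
  note z0 = zero_W[OF i assms]
  have "dt Mu (0, z) = (dt (dzb (G i)) (0, z) - dzb (G i) (0, z) / dz (G i) (0, z) * dt (dz (G i)) (0, z)) / dz (G i) (0, z)"
    by (rule dt_eqI[OF smooth_Mu z0], unfold Mu_def)
       (rule has_vector_derivative_divide'[OF slice_has_vector_derivative[OF sGb z0] slice_has_vector_derivative[OF sGz z0] nz[OF z0]])
  then show ?thesis
    unfolding zero_dz[OF assms] w_ul[OF assms] pdb_f[OF assms] var_mu_def var_log_def
    using pd_nz[OF assms] by (simp only:) (simp add: field_simps)
qed

text \<open>Reflects that \<open>N\<close> is the derivative of \<open>log \<partial>f\<close>,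
  whose variation is \<open>p\<close>; working with the quotient keeps branches out of the
  computation.\<close>

lemma dt_Nu: assumes "z \<in> dom_of X [i]" shows "dt Nu (0, z) = pd p z"
proof -
  note z0 = zero_W[OF i assms]
  have "dt Nu (0, z) = (dt (dz (dz (G i))) (0, z) - dz (dz (G i)) (0, z) / dz (G i) (0, z) * dt (dz (G i)) (0, z)) / dz (G i) (0, z)"
    by (rule dt_eqI[OF smooth_Nu z0], unfold Nu_def)
       (rule has_vector_derivative_divide'[OF slice_has_vector_derivative[OF sGzz z0] slice_has_vector_derivative[OF sGz z0] nz[OF z0]])
  then show ?thesis
    unfolding zero_dz[OF assms] w_ul[OF assms] pd_B[OF assms]
    using pd_nz[OF assms] by (simp add: field_simps)
qed

lemma dt_Om:
  assumes "z \<in> dom_of X [i]"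
  shows "dt Om (0, z) = el_form (fl i) (ul i) (h i) z + d1 (prim (fl i) (ul i) (h i)) z"
proof -
  note z0 = zero_W[OF i assms]
  have dM: "dt (dz Mu) (0, z) = pd m z"
    using dt_dz(1)[OF oW smooth_Mu z0] zero_slice(2)[OF i smooth_on_dt[OF oW smooth_Mu] dt_Mu assms] by simp
  have M1: "dz Mu (0, z) = pd \<mu> z" using zero_slice(2)[OF i smooth_Mu Mu_zero assms] by simp
  note s = slice_has_vector_derivative[OF _ z0]
  have "((\<lambda>t. Nu (t, z) * dz Mu (t, z) + 2 * Mu (t, z) * h i z) has_vector_derivative
    (Nu (0, z) * dt (dz Mu) (0, z) + dt Nu (0, z) * dz Mu (0, z) + 2 * dt Mu (0, z) * h i z)) (at 0)"
    by (intro has_vector_derivative_add has_vector_derivative_mult has_vector_derivative_mult_right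
        has_vector_derivative_mult_left s smooth_Nu smooth_Mu smooth_on_dz[OF oW smooth_Mu])
  then have "dt Om (0, z) = Nu (0, z) * dt (dz Mu) (0, z) + dt Nu (0, z) * dz Mu (0, z) + 2 * dt Mu (0, z) * h i z"
    by (intro dt_eqI[OF smooth_Om z0]) (simp add: Om_def)
  also have "\<dots> = pd p z * pd \<mu> z + N z * pd m z + 2 * h i z * m z"
    unfolding dM M1 dt_Mu[OF assms] dt_Nu[OF assms] Nu_zero[OF assms] by (simp add: algebra_simps)
  finally show ?thesis using d1_prim[OF assms] by simp
qed

text \<open>Pairs at which the principal logarithm in \<open>continue_log\<close> is smooth; the
  ratio is 1 at time 0, so no point of that slice is lost.\<close>

definition WL :: "(real \<times> complex) set" where
  "WL = {q \<in> W i. dz (G i) q / B (snd q) \<notin> \<real>\<^sub>\<le>\<^sub>0}"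

definition LG :: "real \<times> complex \<Rightarrow> complex" where
  "LG q = L i (snd q) + Ln (dz (G i) q / B (snd q))"

lemma smooth_ratio: "smooth_on (W i) (\<lambda>q. dz (G i) q / B (snd q))"
proof (rule smooth_on_divide[OF oW sGz])
  show "smooth_on (W i) (\<lambda>q. B (snd q))"
    by (rule smooth_on_compose[OF oW smooth_B]) (auto intro!: smooth_on_snd oW smooth_on_ident snd_W)
qed (auto intro!: pd_nz snd_W)

lemma open_WL: "open WL"
proof -
  have "WL = W i \<inter> (\<lambda>q. dz (G i) q / B (snd q)) -` (- \<real>\<^sub>\<le>\<^sub>0)" by (auto simp: WL_def)
  then show ?thesis
    using continuous_open_preimage[OF smooth_on_continuous[OF smooth_ratio] oW, of "- \<real>\<^sub>\<le>\<^sub>0"]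
    by (simp only: open_Compl closed_nonpos_Reals_complex)
qed

lemma WL_W: "q \<in> WL \<Longrightarrow> q \<in> W i" by (simp add: WL_def)

lemma zero_WL: "z \<in> dom_of X [i] \<Longrightarrow> (0, z) \<in> WL"
  using zero_W[OF i] pd_nz by (simp add: WL_def zero_dz)

lemma logL': "continuous_on (dom_of X [i]) (L i)" "z \<in> dom_of X [i] \<Longrightarrow> exp (L i z) = B z"
  using logL i by (auto simp: log_branch_def)

lemma smooth_L: "smooth_on (dom_of X [i]) (L i)"
  by (rule smooth_on_log[OF sx.open_dom_single[OF i] logL' smooth_B])

lemma smooth_LG: "smooth_on WL LG"
  unfolding LG_def[abs_def]
proof (rule smooth_on_add[OF open_WL])
  show "smooth_on WL (\<lambda>q. L i (snd q))"
    by (rule smooth_on_compose[OF open_WL smooth_L])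
       (auto intro!: smooth_on_snd open_WL smooth_on_ident snd_W WL_W)
  show "smooth_on WL (\<lambda>q. Ln (dz (G i) q / B (snd q)))"
  proof (rule smooth_on_compose[OF open_WL, where T = "- \<real>\<^sub>\<le>\<^sub>0" and g = Ln])
    show "smooth_on (- \<real>\<^sub>\<le>\<^sub>0) Ln" by (rule smooth_on_holomorphic) (auto intro!: holomorphic_intros open_Compl)
    show "smooth_on WL (\<lambda>q. dz (G i) q / B (snd q))"
      by (rule smooth_on_subset[OF smooth_ratio]) (auto dest: WL_W)
  qed (auto simp: WL_def)
qed

lemma continue_log_LG: "(t, z) \<in> W i \<Longrightarrow> continue_log X Y f L (F t) i z = LG (t, z)"
  using slice_pd(1)[OF sG] by (simp add: continue_log_def local_rep_G LG_def)

lemma d0_continue_log: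
  assumes "(t, z) \<in> WL"
  shows "d0 (continue_log X Y f L (F t) i) z = (dz LG (t, z), dzb LG (t, z))"
proof -
  have s: "smooth_on {\<zeta>. (t, \<zeta>) \<in> WL} (\<lambda>\<zeta>. LG (t, \<zeta>))" by (rule smooth_slice[OF open_WL smooth_LG])
  have eq: "\<And>y. y \<in> {\<zeta>. (t, \<zeta>) \<in> WL} \<Longrightarrow> LG (t, y) = continue_log X Y f L (F t) i y"
    using continue_log_LG WL_W by simp
  have zin: "z \<in> {\<zeta>. (t, \<zeta>) \<in> WL}" using assms by simp
  note c = pd_cong[OF open_slice[OF open_WL] eq s zin]
  show ?thesis using c slice_pd[OF smooth_LG assms] by (simp add: d0_def)
qed

lemma LG_zero: "z \<in> dom_of X [i] \<Longrightarrow> LG (0, z) = L i z"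
  using pd_nz by (simp add: LG_def zero_dz)

lemma dt_LG: assumes "z \<in> dom_of X [i]" shows "dt LG (0, z) = p z"
proof -
  note z0 = zero_W[OF i assms]
  have r: "((\<lambda>t. dz (G i) (t, z) / B z) has_vector_derivative dt (dz (G i)) (0, z) / B z) (at 0)"
    by (rule has_vector_derivative_divide[OF slice_has_vector_derivative[OF sGz z0]])
  have r1: "dz (G i) (0, z) / B z = 1" using pd_nz[OF assms] by (simp add: zero_dz assms)
  have "(Ln has_field_derivative 1) (at (dz (G i) (0, z) / B z))"
    using has_field_derivative_Ln[of 1] unfolding r1 by simp
  from field_vector_diff_chain_at[OF r this]
  have "((\<lambda>t. Ln (dz (G i) (t, z) / B z)) has_vector_derivative dt (dz (G i)) (0, z) / B z) (at 0)"
    by (simp add: o_def)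
  from has_vector_derivative_add[OF has_vector_derivative_const[of "L i z"] this]
  have "dt LG (0, z) = dt (dz (G i)) (0, z) / B z"
    by (intro dt_eqI[OF smooth_LG zero_WL[OF assms]]) (simp add: LG_def)
  then show ?thesis using pd_nz[OF assms] by (simp add: zero_dz assms w_ul)
qed

lemma zero_sliceL:
  assumes H: "smooth_on WL H" and eq: "\<And>z. z \<in> dom_of X [i] \<Longrightarrow> H (0, z) = g z" and z: "z \<in> dom_of X [i]"
  shows "dz H (0, z) = pd g z" "dzb H (0, z) = pdb g z"
proof -
  have s: "smooth_on (dom_of X [i]) (\<lambda>z. H (0, z))"
    using smooth_on_subset[OF smooth_slice[OF open_WL H, of 0], of "dom_of X [i]"] zero_WL by auto
  show "dz H (0, z) = pd g z" "dzb H (0, z) = pdb g z"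
    using pd_cong[OF sx.open_dom_single[OF i] eq s z] slice_pd[OF H zero_WL[OF z]] by auto
qed

lemma LG_derivs:
  assumes "z \<in> dom_of X [i]"
  shows "dz LG (0, z) = N z" "dzb LG (0, z) = pd \<mu> z + \<mu> z * N z"
    "dt (dz LG) (0, z) = pd p z" "dt (dzb LG) (0, z) = pdb p z"
proof -
  have w: "has_wirt (L i) (N z * B z / B z) (B z * (pd \<mu> z + \<mu> z * N z) / B z) z"
    by (rule has_wirt_log[OF sx.open_dom_single[OF i] logL' assms w_B[OF assms]])
  show "dz LG (0, z) = N z" "dzb LG (0, z) = pd \<mu> z + \<mu> z * N z"
    using zero_sliceL[OF smooth_LG LG_zero assms] has_wirt_unique[OF w] pd_nz[OF assms] by auto
  show "dt (dz LG) (0, z) = pd p z" "dt (dzb LG) (0, z) = pdb p z"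
    using zero_sliceL[OF smooth_on_dt[OF open_WL smooth_LG] dt_LG assms]
      dt_dz[OF open_WL smooth_LG zero_WL[OF assms]] by auto
qed

end

section \<open>Overlaps of two charts and the primitive cochain\<close>

lemma G_zero_dom: "i \<in> idx X \<Longrightarrow> z \<in> dom_of X [i] \<Longrightarrow> G i (0, z) = fl i z" by (simp add: fl_G)

text \<open>The representatives with indices \<open>i\<close> and \<open>j\<close> can be compared
  only while the point lies in both source patches and its moving image in both target
  patches.\<close>

definition W2 :: "'i \<Rightarrow> 'i \<Rightarrow> (real \<times> complex) set" where
  "W2 i j = {(t, \<zeta>). \<bar>t\<bar> < e \<and> \<zeta> \<in> dom_of X [j] \<and> F t (coord_inv X j \<zeta>) \<in> patch Y i \<inter> patch Y j}
     \<inter> UNIV \<times> dom_of X [i, j]"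

lemma open_W2: assumes "i \<in> idx X" "j \<in> idx X" shows "open (W2 i j)"
  unfolding W2_def
  using open_F_preimage[OF assms(2), of "patch Y i \<inter> patch Y j"] sy.patch_open idx_eq assms
  by (intro open_Int open_Times sx.open_dom2) auto

lemma zero_W2: "i \<in> idx X \<Longrightarrow> j \<in> idx X \<Longrightarrow> z \<in> dom_of X [i, j] \<Longrightarrow> (0, z) \<in> W2 i j"
  using e_pos f_patch F0_coord by (auto simp: W2_def sx.dom_of2)

lemma G_dom2: assumes "i \<in> idx X" "j \<in> idx X" "(t, z) \<in> W2 i j" shows "G j (t, z) \<in> dom_of Y [i, j]"
  using assms idx_eq by (auto simp: W2_def G_def sy.dom_of2)

lemma trans_local:
  assumes "i \<in> idx X" "j \<in> idx X" "(t, z) \<in> W2 i j"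
  shows "G i (t, trans_fun X i j z) = trans_fun Y i j (G j (t, z))"
  using assms idx_eq sx.trans_mem(2)[of i j z] by (auto simp: W2_def G_def trans_fun_def sx.dom_of2)

text \<open>The law for \<open>u\<close> comes from differentiating
  \<open>G i (t, z_ij z) = w_ij (G j (t, z))\<close> at \<open>t = 0\<close>; it has no
  inhomogeneous term because \<open>w_ij\<close> does not depend on \<open>t\<close>.\<close>

lemma transit:
  assumes ij: "i \<in> idx X" "j \<in> idx X"
  shows "transition (dom_of X [i]) (fl i) (ul i) (h i) (dom_of X [j]) (fl j) (ul j) (h j)
    (trans_fun X i j) (trans_fun Y i j) (dom_of X [i, j]) (dom_of Y [i, j])"
proof -
  interpret di: deformation "dom_of X [i]" "fl i" "ul i" "h i" by (rule deform[OF ij(1)])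
  interpret dj: deformation "dom_of X [j]" "fl j" "ul j" "h j" by (rule deform[OF ij(2)])
  have ijY: "i \<in> idx Y" "j \<in> idx Y" using ij idx_eq by auto
  show ?thesis
  proof unfold_locales
    fix z assume z: "z \<in> dom_of X [i, j]"
    then have zj: "z \<in> dom_of X [j]" "coord_inv X j z \<in> patch X i" using sx.dom_of2[OF ij] by auto
    note m = sx.trans_mem[OF ij zj]
    show "trans_fun X i j z \<in> dom_of X [i]" by (rule m(1))
    show "deriv (trans_fun X i j) z \<noteq> 0" by (rule sx.trans_deriv_nz[OF ij zj])
    show "fl j z \<in> dom_of Y [i, j]" by (rule fl_dom2[OF ij z])
    note z0 = zero_W2[OF ij z]
    show "fl i (trans_fun X i j z) = trans_fun Y i j (fl j z)"
      using trans_local[OF ij z0] fl_G[OF ij(1) m(1)] fl_G[OF ij(2) zj(1)] by simp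
    show "h j z - h i (trans_fun X i j z) * (deriv (trans_fun X i j) z)\<^sup>2 = schwarzian (trans_fun X i j) z"
      using proj ij z by (auto simp: projective_connection_def)
    have d1: "((\<lambda>t. G j (t, z)) has_vector_derivative dt (G j) (0, z)) (at 0)"
      by (rule slice_has_vector_derivative[OF smooth_G[OF ij(2)] zero_W[OF ij(2) zj(1)]])
    have "G j (0, z) \<in> dom_of Y [i, j]" using G_dom2[OF ij z0] .
    then have "(trans_fun Y i j has_field_derivative deriv (trans_fun Y i j) (G j (0, z))) (at (G j (0, z)))"
      using sy.trans_deriv[OF ijY] sy.dom_of2[OF ijY] by blast
    from field_vector_diff_chain_at[OF d1 this]
    have "((\<lambda>t. trans_fun Y i j (G j (t, z))) has_vector_derivative dt (G j) (0, z) * deriv (trans_fun Y i j) (G j (0, z))) (at 0)"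
      by (simp add: o_def)
    moreover have "\<forall>\<^sub>F t in nhds 0. trans_fun Y i j (G j (t, z)) = G i (t, trans_fun X i j z)"
      using eventually_slice[OF open_W2[OF ij] z0] by eventually_elim (simp add: trans_local[OF ij])
    ultimately have "((\<lambda>t. G i (t, trans_fun X i j z)) has_vector_derivative dt (G j) (0, z) * deriv (trans_fun Y i j) (G j (0, z))) (at 0)"
      by (rule has_vector_derivative_eventually)
    then have "dt (G i) (0, trans_fun X i j z) = dt (G j) (0, z) * deriv (trans_fun Y i j) (G j (0, z))"
      by (rule dt_eqI[OF smooth_G[OF ij(1)] zero_W[OF ij(1) m(1)]])
    then show "ul i (trans_fun X i j z) = deriv (trans_fun Y i j) (fl j z) * ul j z"
      using ul_G[OF ij(1) m(1)] ul_G[OF ij(2) zj(1)] fl_G[OF ij(2) zj(1)] by simp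
  next
    show "trans_fun Y i j holomorphic_on dom_of Y [i, j]" by (rule sy.trans_holo[OF ijY])
    show "deriv (trans_fun Y i j) y \<noteq> 0" if "y \<in> dom_of Y [i, j]" for y
      using sy.trans_deriv_nz[OF ijY] that sy.dom_of2[OF ijY] by blast
  qed (use sx.dom_of2[OF ij] ij ijY in \<open>auto simp: sx.open_dom2 sy.open_dom2 sx.trans_holo\<close>)
qed

lemma form_a_el: "form_a X Y h f F K = el_form (fl (K ! 0)) (ul (K ! 0)) (h (K ! 0))"
  by (rule ext) (simp add: form_a_def Let_def el_form_def vfield_def)

lemma global_form_a: "global_2form X (form_a X Y h f F)"
  unfolding global_2form_def
proof (intro conjI ballI)
  show "smooth_cochain X 0 (form_a X Y h f F)"
    unfolding smooth_cochain_def
  proof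
    fix K assume "K \<in> tuples X 0"
    then obtain i where K: "K = [i]" "i \<in> idx X" by (auto simp: tuples_def length_Suc_conv)
    then show "smooth_on (dom_of X K) (form_a X Y h f F K)"
      using deformation.smooth_el[OF deform] by (simp add: form_a_el)
  qed
  fix K z assume K: "K \<in> tuples X 1" and z: "z \<in> dom_of X K"
  then obtain i j where ij: "K = [i, j]" "i \<in> idx X" "j \<in> idx X" by (auto simp: tuples_def length_Suc_conv)
  then have zj: "z \<in> dom_of X [j]" "coord_inv X j z \<in> patch X i" "z \<in> dom_of X [i, j]" using z sx.dom_of2 by auto
  interpret transition "dom_of X [i]" "fl i" "ul i" "h i" "dom_of X [j]" "fl j" "ul j" "h j"
    "trans_fun X i j" "trans_fun Y i j" "dom_of X [i, j]" "dom_of Y [i, j]" by (rule transit[OF ij(2,3)])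
  have "pd (trans_fun X i j) z = deriv (trans_fun X i j) z" "pdb (trans_fun X i j) z = 0"
    using has_wirt_unique[OF w_phi[OF zj(3)]] by auto
  then show "cech pull2 X (form_a X Y h f F) K z = 0"
    using el_eq[OF zj(3)] by (simp add: ij cech_def Let_def del_nth_def pull2_def form_a_el)
qed

definition xi20 :: "'i list \<Rightarrow> form1" where
  "xi20 K = prim (fl (K ! 0)) (ul (K ! 0)) (h (K ! 0))"

text \<open>Varying the pullback of the target \<open>\<tau>\<close> gives the exact form
  \<open>d (\<tau> * \<delta>f)\<close>, since a holomorphic 1-form on a surface is closed. Likewise
  \<open>(log w' + log z') d p\<close>, with \<open>p\<close> the variation of
  \<open>log \<partial>f\<close>, is exact up to a term in which \<open>p\<close> is
  undifferentiated. Both enter \<open>\<theta>\<close> with a minus sign.\<close>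

definition xi11 :: "'i list \<Rightarrow> form0" where
  "xi11 K z = (let i = K ! 0; j = K ! 1 in
     - ((logtr Y [i, j] (fl j z) + logtr X [i, j] z) * var_log (fl j) (ul j) z + tau Y [i, j] (fl j z) * ul j z))"

end

lemma has_vector_derivative_holo:
  fixes g :: "real \<Rightarrow> complex"
  assumes "(g has_vector_derivative u) (at t)" "(\<phi> has_field_derivative d) (at (g t))"
  shows "((\<lambda>t. \<phi> (g t)) has_vector_derivative u * d) (at t)"
  using field_vector_diff_chain_at[OF assms] by (simp add: o_def)

context setting
begin

lemma tau_holo:
  assumes "i \<in> idx X" "j \<in> idx X"
  shows "tau Y [i, j] holomorphic_on dom_of Y [i, j]" "tau X [i, j] holomorphic_on dom_of X [i, j]"
  using tameX tameY assms idx_eq by (auto simp: tame_trivialization_def tuples_def)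

lemma phi_holo:
  assumes "i \<in> idx X" "j \<in> idx X" "k \<in> idx X"
  shows "phi Y [i, j, k] holomorphic_on dom_of Y [i, j, k]"
  using tameY assms idx_eq by (auto simp: tame_trivialization_def tuples_def)

lemma idxY: "i \<in> idx X \<Longrightarrow> i \<in> idx Y" using idx_eq by simp

text \<open>The dz-component on the target only: the trivialization on the source is held fixed and
  is constant in \<open>t\<close>.\<close>

lemma tame_relation:
  assumes ijk: "i \<in> idx X" "j \<in> idx X" "k \<in> idx X" and y: "y \<in> dom_of Y [i, j, k]"
  shows "- logtr Y [i, j] (trans_fun Y j k y) * deriv (logtr Y [j, k]) y
    = tau Y [j, k] y - tau Y [i, k] y + tau Y [i, j] (trans_fun Y j k y) * deriv (trans_fun Y j k) y
      + deriv (phi Y [i, j, k]) y"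
proof -
  note ijkY = ijk[THEN idxY]
  have d: "y \<in> dom_of Y [k]" "coord_inv Y k y \<in> patch Y i" "coord_inv Y k y \<in> patch Y j"
    using y sy.dom_of3[OF ijkY] by auto
  then have yjk: "y \<in> dom_of Y [j, k]" using sy.dom_of2 ijkY by simp
  have "cscale (- logtr Y [i, j] (trans_fun Y j k y)) (d0 (logtr Y [j, k]) y)
        = cech pull1 Y (tau_form Y) [i, j, k] y + d0 (phi Y [i, j, k]) y"
    using tameY ijkY y unfolding tame_trivialization_def by blast
  moreover have "pd (logtr Y [j, k]) y = deriv (logtr Y [j, k]) y"
    using has_wirt_unique(1)[OF has_wirt_field[OF sy.logtr_field[OF logY ijkY(2,3) yjk]]] .
  moreover have "pd (phi Y [i, j, k]) y = deriv (phi Y [i, j, k]) y"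
    using has_wirt_unique(1)[OF has_wirt_holomorphic[OF phi_holo[OF ijk] sy.open_dom3[OF ijkY] y]] .
  moreover have "pd (trans_fun Y j k) y = deriv (trans_fun Y j k) y"
    using has_wirt_unique(1)[OF has_wirt_field[OF sy.trans_deriv[OF ijkY(2,3) d(1,3)]]] .
  ultimately show ?thesis
    by (simp add: cscale_def d0_def cech_def Let_def del_nth_def tau_form_def pull1_def prod_eq_iff numeral_2_eq_2)
qed

end

section \<open>Variation of \<open>\<theta>\<close>, \<open>\<Theta>\<close> and
  \<open>m\<close>\<close>

context variation
begin

definition Wt :: "'i \<Rightarrow> 'i \<Rightarrow> (real \<times> complex) set" where
  "Wt i j = W2 i j \<inter> WL j"

text \<open>\<open>Th1\<close> and \<open>Th2\<close> are the components of \<open>\<theta>\<close>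
  along dz and dzbar, continued to nonzero times.\<close>

definition Th1 :: "'i \<Rightarrow> 'i \<Rightarrow> real \<times> complex \<Rightarrow> complex" where
  "Th1 i j q = - ((logtr Y [i, j] (G j q) + logtr X [i, j] (snd q)) * dz (LG j) q)
     + logtr Y [i, j] (G j q) * deriv (logtr X [i, j]) (snd q) - tau Y [i, j] (G j q) * dz (G j) q + tau X [i, j] (snd q)"

definition Th2 :: "'i \<Rightarrow> 'i \<Rightarrow> real \<times> complex \<Rightarrow> complex" where
  "Th2 i j q = 2 * Mu j q * deriv (logtr X [i, j]) (snd q)
     - (logtr Y [i, j] (G j q) + logtr X [i, j] (snd q)) * dzb (LG j) q - tau Y [i, j] (G j q) * dzb (G j) q"

context
  fixes i j assumes ij: "i \<in> idx X" "j \<in> idx X"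
begin

lemmas ijY = ij[THEN idxY]

interpretation transition "dom_of X [i]" "fl i" "ul i" "h i" "dom_of X [j]" "fl j" "ul j" "h j"
    "trans_fun X i j" "trans_fun Y i j" "dom_of X [i, j]" "dom_of Y [i, j]" by (rule transit[OF ij])

lemma open_Wt: "open (Wt i j)"
  unfolding Wt_def by (intro open_Int open_W2 open_WL ij)

lemma zero_Wt: "z \<in> dom_of X [i, j] \<Longrightarrow> (0, z) \<in> Wt i j"
  using zero_W2[OF ij] zero_WL[OF ij(2)] sub by (auto simp: Wt_def)

lemma Wt_W: "q \<in> Wt i j \<Longrightarrow> q \<in> W j" using WL_W[OF ij(2)] by (auto simp: Wt_def)

lemma smooth_comp_G:
  assumes "\<phi> holomorphic_on dom_of Y [i, j]" shows "smooth_on (Wt i j) (\<lambda>q. \<phi> (G j q))"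
  by (rule smooth_on_compose[OF open_Wt smooth_on_holomorphic[OF open_E assms] smooth_on_subset[OF smooth_G[OF ij(2)]]])
     (use G_dom2[OF ij] Wt_W in \<open>auto simp: Wt_def\<close>)

lemma snd_Wt: "q \<in> Wt i j \<Longrightarrow> snd q \<in> dom_of X [i, j]"
  by (auto simp: Wt_def W2_def)

lemma smooth_comp_snd:
  assumes "\<phi> holomorphic_on dom_of X [i, j]" shows "smooth_on (Wt i j) (\<lambda>q. \<phi> (snd q))"
  by (rule smooth_on_compose[OF open_Wt smooth_on_holomorphic[OF open_D' assms]])
     (auto intro!: smooth_on_snd open_Wt smooth_on_ident snd_Wt)

lemmas lY_holo = sy.logtr_holo[OF logY ijY]
lemmas lX_holo = sx.logtr_holo[OF logX ij]
lemmas lX1_holo = holomorphic_deriv[OF lX_holo open_D']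

lemma smooth_LG': "smooth_on (Wt i j) (LG j)"
  by (rule smooth_on_subset[OF smooth_LG[OF ij(2)]]) (simp add: Wt_def)

lemma smooth_G': "smooth_on (Wt i j) (G j)"
  by (rule smooth_on_subset[OF smooth_G[OF ij(2)]]) (use Wt_W in auto)

lemma smooth_Th1: "smooth_on (Wt i j) (Th1 i j)"
  unfolding Th1_def[abs_def]
  by (intro smooth_on_add smooth_on_diff smooth_on_minus smooth_on_mult open_Wt smooth_comp_G smooth_comp_snd
      smooth_on_dz smooth_LG' smooth_G' lY_holo lX_holo lX1_holo tau_holo ij)

lemma smooth_Th2: "smooth_on (Wt i j) (Th2 i j)"
  unfolding Th2_def[abs_def]
  by (intro smooth_on_add smooth_on_diff smooth_on_mult smooth_on_const open_Wt smooth_comp_G smooth_comp_snd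
      smooth_on_dzb smooth_LG' smooth_G' lY_holo lX_holo lX1_holo tau_holo ij
      smooth_on_subset[OF smooth_Mu[OF ij(2)]]) (use Wt_W in auto)

lemma lam_logtr: "z \<in> dom_of X [i, j] \<Longrightarrow> deriv (logtr X [i, j]) z = lam z"
  unfolding lam_def by (rule sx.logtr_deriv[OF logX ij])

lemma rho_logtr: "y \<in> dom_of Y [i, j] \<Longrightarrow> deriv (logtr Y [i, j]) y = rho y"
  unfolding rho_def by (rule sy.logtr_deriv[OF logY ijY])

lemma lag_theta_Th:
  assumes "(t, z) \<in> Wt i j"
  shows "lag_theta X Y (F t) (continue_log X Y f L (F t)) [i, j] z = (Th1 i j (t, z), Th2 i j (t, z))"
proof -
  have z: "z \<in> dom_of X [i, j]" using assms by (auto simp: Wt_def W2_def)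
  have WL: "(t, z) \<in> WL j" using assms by (simp add: Wt_def)
  have lX: "d0 (logtr X [i, j]) z = (deriv (logtr X [i, j]) z, 0)"
    using has_wirt_unique[OF has_wirt_holomorphic[OF lX_holo open_D' z]] by (simp add: d0_def)
  show ?thesis
    unfolding lag_theta_def Let_def local_rep_G
    using beltrami_slice[OF ij(2) Wt_W[OF assms]] d0_continue_log[OF ij(2) WL]
      slice_pd[OF smooth_G[OF ij(2)] Wt_W[OF assms]] sx.logtr_deriv[OF logX ij z]
    by (simp add: lX cscale_def pull1_def tau_form_def Th1_def Th2_def)
qed

lemma hvd_G: "z \<in> dom_of X [i, j] \<Longrightarrow> ((\<lambda>t. G j (t, z)) has_vector_derivative ul j z) (at 0)"
  using slice_has_vector_derivative[OF smooth_G[OF ij(2)] zero_W[OF ij(2)]] ul_G[OF ij(2)] sub by fastforce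

lemma hvd_comp_G:
  assumes z: "z \<in> dom_of X [i, j]" and \<phi>: "\<phi> holomorphic_on dom_of Y [i, j]"
  shows "((\<lambda>t. \<phi> (G j (t, z))) has_vector_derivative ul j z * deriv \<phi> (fl j z)) (at 0)"
proof -
  have "(\<phi> has_field_derivative deriv \<phi> (G j (0, z))) (at (G j (0, z)))"
    by (rule holomorphic_derivI[OF \<phi> open_E G_dom2[OF ij zero_W2[OF ij z]]])
  from has_vector_derivative_holo[OF hvd_G[OF z] this] show ?thesis
    using fl_G[OF ij(2)] z sub by auto
qed

lemma w_comp_f:
  assumes z: "z \<in> dom_of X [i, j]" and \<phi>: "\<phi> holomorphic_on dom_of Y [i, j]"
  shows "has_wirt (\<lambda>z. \<phi> (fl j z)) (deriv \<phi> (fl j z) * j.B z) (deriv \<phi> (fl j z) * (j.\<mu> z * j.B z)) z"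
  using has_wirt_compose_holomorphic[OF \<phi> open_E f_E[OF z] j.w_f[OF inDj[OF z]]] j.pdb_f[OF inDj[OF z]] by simp

lemma w_xi11:
  assumes z: "z \<in> dom_of X [i, j]"
  shows "has_wirt (xi11 [i, j])
    (- ((R z + lam z) * j.p z + (logtr Y [i, j] (fl j z) + logtr X [i, j] z) * pd j.p z
       + (deriv (tau Y [i, j]) (fl j z) * j.B z * ul j z + tau Y [i, j] (fl j z) * pd (ul j) z)))
    (- (j.\<mu> z * R z * j.p z + (logtr Y [i, j] (fl j z) + logtr X [i, j] z) * pdb j.p z
       + (deriv (tau Y [i, j]) (fl j z) * (j.\<mu> z * j.B z) * ul j z + tau Y [i, j] (fl j z) * pdb (ul j) z))) z"
proof -
  note zj = inDj[OF z]
  have w: "has_wirt (\<lambda>z. - ((logtr Y [i, j] (fl j z) + logtr X [i, j] z) * var_log (fl j) (ul j) z + tau Y [i, j] (fl j z) * ul j z))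
    (- ((deriv (logtr Y [i, j]) (fl j z) * j.B z + deriv (logtr X [i, j]) z) * j.p z
       + (logtr Y [i, j] (fl j z) + logtr X [i, j] z) * pd j.p z
       + (deriv (tau Y [i, j]) (fl j z) * j.B z * ul j z + tau Y [i, j] (fl j z) * pd (ul j) z)))
    (- ((deriv (logtr Y [i, j]) (fl j z) * (j.\<mu> z * j.B z) + 0) * j.p z
       + (logtr Y [i, j] (fl j z) + logtr X [i, j] z) * pdb j.p z
       + (deriv (tau Y [i, j]) (fl j z) * (j.\<mu> z * j.B z) * ul j z + tau Y [i, j] (fl j z) * pdb (ul j) z))) z"
    by (rule has_wirt_minus[OF has_wirt_add[OF has_wirt_mult[OF has_wirt_add[OF w_comp_f[OF z lY_holo]
        has_wirt_holomorphic[OF lX_holo open_D' z]] j.w_p[OF zj]] has_wirt_mult[OF w_comp_f[OF z tau_holo(1)[OF ij]] j.w_u[OF zj]]]])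
  have "xi11 [i, j] = (\<lambda>z. - ((logtr Y [i, j] (fl j z) + logtr X [i, j] z) * var_log (fl j) (ul j) z + tau Y [i, j] (fl j z) * ul j z))"
    by (rule ext) (simp add: xi11_def Let_def)
  then show ?thesis
    using w unfolding lam_logtr[OF z] rho_logtr[OF f_E[OF z]]
    by (simp add: R_def mult_ac)
qed

lemma smooth_xi11: "smooth_on (dom_of X [i, j]) (xi11 [i, j])"
proof -
  note fj = smooth_on_subset[OF smooth_fl[OF ij(2)] sub]
  have c: "smooth_on (dom_of X [i, j]) (\<lambda>z. \<phi> (fl j z))" if "\<phi> holomorphic_on dom_of Y [i, j]" for \<phi>
    by (rule smooth_on_compose[OF open_D' smooth_on_holomorphic[OF open_E that] fj f_E])
  show ?thesis
    unfolding xi11_def[abs_def] Let_def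
    by simp (intro smooth_on_minus smooth_on_add smooth_on_diff smooth_on_mult open_D' c lY_holo tau_holo ij
        smooth_on_holomorphic[OF open_D' lX_holo] smooth_on_subset[OF j.smooth_p sub] smooth_on_subset[OF smooth_ul[OF ij(2)] sub])
qed

text \<open>Subtracting the differential of \<open>xi11\<close> removes the derivatives of
  \<open>p\<close> and every term with \<open>\<tau>\<close>. With \<open>u = v * B\<close> the rest
  of the dz-part is \<open>R * (p - v * N) + lam * (R * v + p)\<close>, and
  \<open>p - v * N = pd v\<close> gives the expression of \<open>cech_prim\<close>. The dzbar-part
  leaves \<open>2 * m * lam + R * (\<mu> * p - v * pd \<mu> - v * \<mu> * N)\<close>, which agrees
  for the same reason.\<close>

lemma dt_Th:
  assumes z: "z \<in> dom_of X [i, j]"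
  shows "dt (Th1 i j) (0, z) = fst (d0 (xi11 [i, j]) z + cech pull1 X xi20 [i, j] z)"
    "dt (Th2 i j) (0, z) = snd (d0 (xi11 [i, j]) z + cech pull1 X xi20 [i, j] z)"
proof -
  note zj = inDj[OF z]
  note z0 = zero_Wt[OF z]
  have h1: "((\<lambda>t. H (t, z)) has_vector_derivative dt H (0, z)) (at 0)" if "smooth_on (Wt i j) H" for H
    by (rule slice_has_vector_derivative[OF that z0])
  note sL = smooth_on_dz[OF open_Wt smooth_LG'] smooth_on_dzb[OF open_Wt smooth_LG']
  note sGG = smooth_on_dz[OF open_Wt smooth_G'] smooth_on_dzb[OF open_Wt smooth_G']
  note LGd = LG_derivs[OF ij(2) zj]
  note Gd = zero_dz[OF ij(2) zj]
  have G0: "G j (0, z) = fl j z" using G_zero_dom[OF ij(2) zj] .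
  let ?r = "rho (fl j z)" and ?l = "logtr Y [i, j] (fl j z) + logtr X [i, j] z"
  have lYd: "((\<lambda>t. logtr Y [i, j] (G j (t, z))) has_vector_derivative ul j z * ?r) (at 0)"
    using hvd_comp_G[OF z lY_holo] rho_logtr[OF f_E[OF z]] by simp
  note tYd = hvd_comp_G[OF z tau_holo(1)[OF ij]]
  have "((\<lambda>t. - ((logtr Y [i, j] (G j (t, z)) + logtr X [i, j] z) * dz (LG j) (t, z))
     + logtr Y [i, j] (G j (t, z)) * lam z - tau Y [i, j] (G j (t, z)) * dz (G j) (t, z) + tau X [i, j] z)
     has_vector_derivative
     - ((logtr Y [i, j] (G j (0, z)) + logtr X [i, j] z) * dt (dz (LG j)) (0, z) + (ul j z * ?r + 0) * dz (LG j) (0, z))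
     + ul j z * ?r * lam z - (tau Y [i, j] (G j (0, z)) * dt (dz (G j)) (0, z) + ul j z * deriv (tau Y [i, j]) (fl j z) * dz (G j) (0, z)) + 0) (at 0)"
    by (intro has_vector_derivative_add has_vector_derivative_diff has_vector_derivative_minus has_vector_derivative_mult
        has_vector_derivative_mult_left has_vector_derivative_const lYd tYd h1 sL sGG)
  then have 1: "dt (Th1 i j) (0, z) = - (?l * pd j.p z + ul j z * ?r * j.N z)
     + ul j z * ?r * lam z - (tau Y [i, j] (fl j z) * pd (ul j) z + ul j z * deriv (tau Y [i, j]) (fl j z) * j.B z)"
    by (intro dt_eqI[OF smooth_Th1 z0]) (simp add: Th1_def lam_logtr[OF z] G0 LGd Gd)
  have "((\<lambda>t. 2 * Mu j (t, z) * lam z - (logtr Y [i, j] (G j (t, z)) + logtr X [i, j] z) * dzb (LG j) (t, z)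
     - tau Y [i, j] (G j (t, z)) * dzb (G j) (t, z))
     has_vector_derivative 2 * dt (Mu j) (0, z) * lam z
     - ((logtr Y [i, j] (G j (0, z)) + logtr X [i, j] z) * dt (dzb (LG j)) (0, z) + (ul j z * ?r + 0) * dzb (LG j) (0, z))
     - (tau Y [i, j] (G j (0, z)) * dt (dzb (G j)) (0, z) + ul j z * deriv (tau Y [i, j]) (fl j z) * dzb (G j) (0, z))) (at 0)"
    by (intro has_vector_derivative_add has_vector_derivative_diff has_vector_derivative_mult has_vector_derivative_mult_right
        has_vector_derivative_mult_left has_vector_derivative_const lYd tYd h1 sL sGG
        slice_has_vector_derivative[OF smooth_Mu[OF ij(2)] zero_W[OF ij(2) zj]])
  then have 2: "dt (Th2 i j) (0, z) = 2 * j.m z * lam z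
     - (?l * pdb j.p z + ul j z * ?r * (pd j.\<mu> z + j.\<mu> z * j.N z))
     - (tau Y [i, j] (fl j z) * pdb (ul j) z + ul j z * deriv (tau Y [i, j]) (fl j z) * (j.\<mu> z * j.B z))"
    by (intro dt_eqI[OF smooth_Th2 z0]) (simp add: Th2_def lam_logtr[OF z] G0 LGd Gd dt_Mu[OF ij(2) zj] j.pdb_f[OF zj])
  have P: "pd (trans_fun X i j) z = deriv (trans_fun X i j) z" "pdb (trans_fun X i j) z = 0"
    using has_wirt_unique[OF w_phi[OF z]] by auto
  have c: "cech pull1 X xi20 [i, j] z = prim (fl j) (ul j) (h j) z
     - (fst (prim (fl i) (ul i) (h i) (trans_fun X i j z)) * deriv (trans_fun X i j) z,
        snd (prim (fl i) (ul i) (h i) (trans_fun X i j z)) * cnj (deriv (trans_fun X i j) z))"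
    by (simp add: cech_def Let_def del_nth_def pull1_def P xi20_def)
  note xi = has_wirt_unique[OF w_xi11[OF z]]
  show "dt (Th1 i j) (0, z) = fst (d0 (xi11 [i, j]) z + cech pull1 X xi20 [i, j] z)"
    unfolding c fst_add fst_diff fst_conv cech_prim[OF z] d0_def xi 1
    unfolding R_def j.u_eq[OF zj] var_log_def by (simp add: algebra_simps)
  show "dt (Th2 i j) (0, z) = snd (d0 (xi11 [i, j]) z + cech pull1 X xi20 [i, j] z)"
    unfolding c snd_add snd_diff snd_conv cech_prim[OF z] d0_def xi 2
    unfolding R_def j.u_eq[OF zj] var_log_def by (simp add: algebra_simps)
qed

lemma lag_theta_derivative:
  assumes z: "z \<in> dom_of X [i, j]"
  shows "((\<lambda>t. lag_theta X Y (F t) (continue_log X Y f L (F t)) [i, j] z) has_vector_derivative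
    d0 (xi11 [i, j]) z + cech pull1 X xi20 [i, j] z) (at 0)"
proof -
  note s = slice_has_vector_derivative[OF smooth_Th1 zero_Wt[OF z]] slice_has_vector_derivative[OF smooth_Th2 zero_Wt[OF z]]
  have "((\<lambda>t. (Th1 i j (t, z), Th2 i j (t, z))) has_vector_derivative
     (dt (Th1 i j) (0, z), dt (Th2 i j) (0, z))) (at 0)"
    using has_derivative_Pair[OF s[unfolded has_vector_derivative_def]] by (simp add: has_vector_derivative_def)
  then have "((\<lambda>t. (Th1 i j (t, z), Th2 i j (t, z))) has_vector_derivative
     d0 (xi11 [i, j]) z + cech pull1 X xi20 [i, j] z) (at 0)"
    unfolding dt_Th[OF z] prod.collapse .
  then show ?thesis
    by (rule has_vector_derivative_eventually)
       (use eventually_slice[OF open_Wt zero_Wt[OF z]] in \<open>auto elim!: eventually_mono simp: lag_theta_Th\<close>)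
qed

lemma xi11_pull: "z \<in> dom_of X [i, j] \<Longrightarrow> ul i (trans_fun X i j z) = deriv (trans_fun Y i j) (fl j z) * ul j z"
  "z \<in> dom_of X [i, j] \<Longrightarrow> var_log (fl i) (ul i) (trans_fun X i j z) = j.p z + deriv (logtr Y [i, j]) (fl j z) * ul j z"
  "z \<in> dom_of X [i, j] \<Longrightarrow> fl i (trans_fun X i j z) = trans_fun Y i j (fl j z)"
  using u_tr f_eq p_eq rho_logtr[OF f_E] j.u_eq[OF inDj] by (simp_all add: R_def mult_ac)

end

lemma lag_omega_derivative:
  assumes "i \<in> idx X" "z \<in> dom_of X [i]"
  shows "((\<lambda>t. lag_omega X Y h (F t) [i] z) has_vector_derivative
    form_a X Y h f F [i] z + d1 (xi20 [i]) z) (at 0)"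
proof -
  have "((\<lambda>t. Om i (t, z)) has_vector_derivative form_a X Y h f F [i] z + d1 (xi20 [i]) z) (at 0)"
    using slice_has_vector_derivative[OF smooth_Om[OF assms(1)] zero_W[OF assms]]
    unfolding dt_Om[OF assms] by (simp add: form_a_el xi20_def)
  then show ?thesis
    by (rule has_vector_derivative_eventually,
        intro eventually_mono[OF eventually_slice[OF open_W[OF assms(1)] zero_W[OF assms]]])
       (simp add: lag_omega_Om[OF assms(1)])
qed

text \<open>The \<open>c_ijk\<close> are locally constant, so only the target \<open>\<phi>\<close>,
  \<open>log \<partial>f\<close> and \<open>log w'\<close> vary. The tame relation trades the
  derivative of \<open>\<phi>\<close> for the coboundary of \<open>\<tau>\<close> and a product of
  logarithms. The coboundary of the \<open>p\<close>-terms of \<open>xi11\<close> gives the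
  constants \<open>c_ijk\<close> times \<open>p\<close>, plus the derivative of
  \<open>log w'_jk\<close> produced by the transformation law of \<open>p\<close>.\<close>

lemma lag_Theta_derivative:
  assumes ijk: "i \<in> idx X" "j \<in> idx X" "k \<in> idx X" and z: "z \<in> dom_of X [i, j, k]"
  shows "((\<lambda>t. lag_Theta X Y (F t) (continue_log X Y f L (F t)) [i, j, k] z) has_vector_derivative
    cech pull0 X xi11 [i, j, k] z) (at 0)"
proof -
  note ijkY = ijk[THEN idxY]
  have zk: "z \<in> dom_of X [k]" "coord_inv X k z \<in> patch X i" "coord_inv X k z \<in> patch X j"
    using z sx.dom_of3[OF ijk] by auto
  have zjk: "z \<in> dom_of X [j, k]" "z \<in> dom_of X [i, k]" using zk sx.dom_of2 ijk by auto
  have tij: "trans_fun X j k z \<in> dom_of X [i, j]"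
    using sx.trans_mem[OF ijk(2,3) zk(1,3)] zk sx.dom_of2 ijk by auto
  let ?y = "fl k z" and ?u = "ul k z" and ?p = "var_log (fl k) (ul k) z"
  have y: "?y \<in> dom_of Y [i, j, k]"
    using fl_mem[OF ijk(3) zk(1)] coord_inv_fl[OF ijk(3) zk(1)] f_patch zk(2,3) ijk sy.dom_of3[OF ijkY] by simp
  have yjk: "?y \<in> dom_of Y [j, k]" using y sy.dom_of2[OF ijkY(2,3)] sy.dom_of3[OF ijkY] by simp
  have G0: "G k (0, z) = ?y" using G_zero_dom[OF ijk(3) zk(1)] .
  have hG: "((\<lambda>t. G k (t, z)) has_vector_derivative ?u) (at 0)" by (rule hvd_G[OF ijk(2,3) zjk(1)])
  have h: "((\<lambda>t. \<phi> (G k (t, z))) has_vector_derivative ?u * d) (at 0)" if "(\<phi> has_field_derivative d) (at ?y)" for \<phi> d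
    by (rule has_vector_derivative_holo[OF hG]) (use that G0 in simp)
  have hphi: "((\<lambda>t. phi Y [i, j, k] (G k (t, z))) has_vector_derivative ?u * deriv (phi Y [i, j, k]) ?y) (at 0)"
    by (rule h[OF holomorphic_derivI[OF phi_holo[OF ijk] sy.open_dom3[OF ijkY] y]])
  have hcc: "((\<lambda>t. cc Y [i, j, k] (G k (t, z))) has_vector_derivative ?u * 0) (at 0)"
    by (rule h[OF sy.cc_field[OF logY ijkY y]])
  have hl: "((\<lambda>t. logtr Y [j, k] (G k (t, z))) has_vector_derivative ?u * deriv (logtr Y [j, k]) ?y) (at 0)"
    by (rule h[OF sy.logtr_field[OF logY ijkY(2,3) yjk]])
  have hL: "((\<lambda>t. LG k (t, z)) has_vector_derivative ?p) (at 0)"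
    using slice_has_vector_derivative[OF smooth_LG[OF ijk(3)] zero_WL[OF ijk(3) zk(1)]] dt_LG[OF ijk(3) zk(1)] by simp
  have "((\<lambda>t. phi Y [i, j, k] (G k (t, z)) - phi X [i, j, k] z
     - (cc Y [i, j, k] (G k (t, z)) + cc X [i, j, k] z) * LG k (t, z)
     - logtr X [i, j] (trans_fun X j k z) * logtr Y [j, k] (G k (t, z))
     + cc Y [i, j, k] (G k (t, z)) * logtr X [i, k] z) has_vector_derivative
     ?u * deriv (phi Y [i, j, k]) ?y - 0
     - ((cc Y [i, j, k] (G k (0, z)) + cc X [i, j, k] z) * ?p + (?u * 0 + 0) * LG k (0, z))
     - logtr X [i, j] (trans_fun X j k z) * (?u * deriv (logtr Y [j, k]) ?y) + ?u * 0 * logtr X [i, k] z) (at 0)"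
    by (intro has_vector_derivative_add has_vector_derivative_diff has_vector_derivative_mult has_vector_derivative_mult_right
        has_vector_derivative_mult_left has_vector_derivative_const hphi hcc hl hL)
  then have d: "((\<lambda>t. lag_Theta X Y (F t) (continue_log X Y f L (F t)) [i, j, k] z) has_vector_derivative
     ?u * deriv (phi Y [i, j, k]) ?y - (cc Y [i, j, k] ?y + cc X [i, j, k] z) * ?p
     - logtr X [i, j] (trans_fun X j k z) * (?u * deriv (logtr Y [j, k]) ?y)) (at 0)"
  proof (intro has_vector_derivative_eventually[of _ _ 0 "\<lambda>t. lag_Theta X Y (F t) (continue_log X Y f L (F t)) [i, j, k] z"])
    show "\<forall>\<^sub>F t in nhds 0. phi Y [i, j, k] (G k (t, z)) - phi X [i, j, k] z
     - (cc Y [i, j, k] (G k (t, z)) + cc X [i, j, k] z) * LG k (t, z)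
     - logtr X [i, j] (trans_fun X j k z) * logtr Y [j, k] (G k (t, z))
     + cc Y [i, j, k] (G k (t, z)) * logtr X [i, k] z
      = lag_Theta X Y (F t) (continue_log X Y f L (F t)) [i, j, k] z"
      using eventually_slice[OF open_W[OF ijk(3)] zero_W[OF ijk(3) zk(1)]]
      by eventually_elim (simp add: lag_Theta_def Let_def local_rep_G continue_log_LG[OF ijk(3)] numeral_2_eq_2)
  qed (simp add: G0)
  have c: "cech pull0 X xi11 [i, j, k] z = xi11 [j, k] z - xi11 [i, k] z + xi11 [i, j] (trans_fun X j k z)"
    by (simp add: cech_def Let_def del_nth_def pull0_def numeral_2_eq_2)
  note q = xi11_pull[OF ijk(2,3) zjk(1)]
  note ta = tame_relation[OF ijk y]
  have e: "?u * deriv (phi Y [i, j, k]) ?y = ?u * (- logtr Y [i, j] (trans_fun Y j k ?y) * deriv (logtr Y [j, k]) ?y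
     - tau Y [j, k] ?y + tau Y [i, k] ?y - tau Y [i, j] (trans_fun Y j k ?y) * deriv (trans_fun Y j k) ?y)"
    unfolding ta by (simp add: algebra_simps)
  have "?u * deriv (phi Y [i, j, k]) ?y - (cc Y [i, j, k] ?y + cc X [i, j, k] z) * ?p
     - logtr X [i, j] (trans_fun X j k z) * (?u * deriv (logtr Y [j, k]) ?y) = cech pull0 X xi11 [i, j, k] z"
    unfolding c e by (simp add: xi11_def Let_def q sy.cc_eq[OF logY] sx.cc_eq[OF logX]) (simp add: algebra_simps)
  then show ?thesis using d by simp
qed

text \<open>\<open>m\<close> is the coboundary of \<open>\<Theta>\<close>, whose variation is itself
  a coboundary, so the square of the Cech differential appears.\<close>

lemma lag_m_derivative:
  assumes ijkl: "i \<in> idx X" "j \<in> idx X" "k \<in> idx X" "l \<in> idx X" and z: "z \<in> dom_of X [i, j, k, l]"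
  shows "((\<lambda>t. lag_m X Y (F t) (continue_log X Y f L (F t)) [i, j, k, l] z) has_vector_derivative 0) (at 0)"
proof -
  have zl: "z \<in> dom_of X [l]" "coord_inv X l z \<in> patch X i" "coord_inv X l z \<in> patch X j" "coord_inv X l z \<in> patch X k"
    using z sx.dom_of4[OF ijkl] by auto
  let ?w = "trans_fun X k l z"
  note m = sx.trans_mem[OF ijkl(3,4) zl(1,4)]
  have d: "z \<in> dom_of X [j, k, l]" "z \<in> dom_of X [i, k, l]" "z \<in> dom_of X [i, j, l]" "?w \<in> dom_of X [i, j, k]"
    using zl m sx.dom_of3 ijkl by auto
  have "((\<lambda>t. let T = lag_Theta X Y (F t) (continue_log X Y f L (F t)) in
      T [j, k, l] z - T [i, k, l] z + T [i, j, l] z - T [i, j, k] ?w) has_vector_derivative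
      cech pull0 X xi11 [j, k, l] z - cech pull0 X xi11 [i, k, l] z + cech pull0 X xi11 [i, j, l] z
        - cech pull0 X xi11 [i, j, k] ?w) (at 0)"
    unfolding Let_def
    by (intro has_vector_derivative_add has_vector_derivative_diff lag_Theta_derivative ijkl d)
  moreover have "cech pull0 X xi11 [j, k, l] z - cech pull0 X xi11 [i, k, l] z + cech pull0 X xi11 [i, j, l] z
        - cech pull0 X xi11 [i, j, k] ?w = 0"
    using sx.trans_comp[OF ijkl(2,3,4) zl(1,4)]
    by (simp add: cech_def Let_def del_nth_def pull0_def numeral_2_eq_2)
  ultimately show ?thesis
    by (simp add: lag_m_def cech_def Let_def del_nth_def pull0_def numeral_2_eq_2 numeral_3_eq_3 algebra_simps)
qed

section \<open>The primitive as a Deligne cochain\<close>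

definition xi :: "'i cochain2" where
  "xi = \<lparr>c20 = (\<lambda>K z. cscale (2 * of_real pi * \<i>) (xi20 K z)),
     c11 = (\<lambda>K z. 2 * of_real pi * \<i> * xi11 K z), c02 = (\<lambda>K z. 0)\<rparr>"

lemma smooth_xi20: "i \<in> idx X \<Longrightarrow> smooth_on (dom_of X [i]) (xi20 [i])"
  using deformation.smooth_prim[OF deform] by (simp add: xi20_def)

lemma cscale_scale: "bounded_linear (cscale c)"
  unfolding cscale_def[abs_def]
  by (intro bounded_linear_Pair bounded_linear_compose[OF bounded_linear_mult_right] bounded_linear_fst bounded_linear_snd)

lemma deligne_xi: "deligne_cochain2 X xi"
  unfolding deligne_cochain2_def
proof (intro conjI ballI)
  show "smooth_cochain X 0 (c20 xi)"
    unfolding smooth_cochain_def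
  proof
    fix K assume "K \<in> tuples X 0"
    then obtain i where "K = [i]" "i \<in> idx X" by (auto simp: tuples_def length_Suc_conv)
    then show "smooth_on (dom_of X K) (c20 xi K)"
      using smooth_on_bounded_linear[OF cscale_scale sx.open_dom_single smooth_xi20] by (simp add: xi_def)
  qed
  show "smooth_cochain X 1 (c11 xi)"
    unfolding smooth_cochain_def
  proof
    fix K assume "K \<in> tuples X 1"
    then obtain i j where "K = [i, j]" "i \<in> idx X" "j \<in> idx X" by (auto simp: tuples_def length_Suc_conv)
    then show "smooth_on (dom_of X K) (c11 xi K)"
      using smooth_on_mult[OF sx.open_dom2 smooth_on_const smooth_xi11] by (simp add: xi_def)
  qed
qed (auto simp: xi_def Zp_def intro: exI[of _ "0::int"])

text \<open>The signs fit because \<open>D\<close> carries plus on the Cech coboundary of 1-forms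
  and minus on that of functions, while \<open>\<Theta>\<close> enters the cocycle
  negatively.\<close>

lemma cochain_derivative:
  "has_cochain_derivative X (\<lambda>t. lag_Omega X Y h (F t) (continue_log X Y f L (F t)))
     (add_top (\<lambda>K z. 2 * of_real pi * \<i> * form_a X Y h f F K z) (total_D X xi))"
  unfolding has_cochain_derivative_def
proof (intro conjI ballI)
  let ?c = "2 * of_real pi * \<i> :: complex"
  fix K z assume K: "K \<in> tuples X 0" and z: "z \<in> dom_of X K"
  then obtain i where i: "K = [i]" "i \<in> idx X" by (auto simp: tuples_def length_Suc_conv)
  have z: "z \<in> dom_of X [i]" using z i by simp
  note s = smooth_xi20[OF i(2)]
  have "has_wirt (\<lambda>y. ?c * snd (xi20 [i] y)) (0 * snd (xi20 [i] z) + ?c * pd (\<lambda>y. snd (xi20 [i] y)) z)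
     (0 * snd (xi20 [i] z) + ?c * pdb (\<lambda>y. snd (xi20 [i] y)) z) z"
    "has_wirt (\<lambda>y. ?c * fst (xi20 [i] y)) (0 * fst (xi20 [i] z) + ?c * pd (\<lambda>y. fst (xi20 [i] y)) z)
     (0 * fst (xi20 [i] z) + ?c * pdb (\<lambda>y. fst (xi20 [i] y)) z) z"
    by (intro has_wirt_mult has_wirt_const smooth_on_has_wirt[OF _ z] smooth_on_snd smooth_on_fst sx.open_dom_single i s)+
  then have "d1 (c20 xi [i]) z = ?c * d1 (xi20 [i]) z"
    unfolding d1_def by (simp add: xi_def cscale_def has_wirt_unique right_diff_distrib)
  then show "((\<lambda>t. c30 (lag_Omega X Y h (F t) (continue_log X Y f L (F t))) K z) has_vector_derivative
     c30 (add_top (\<lambda>K z. ?c * form_a X Y h f F K z) (total_D X xi)) K z) (at 0)"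
    using has_vector_derivative_mult_right[OF lag_omega_derivative[OF i(2) z], of ?c]
    by (simp add: lag_Omega_def add_top_def total_D_def i distrib_left)
next
  define c :: complex where "c = 2 * of_real pi * \<i>"
  fix K z assume K: "K \<in> tuples X 1" and z: "z \<in> dom_of X K"
  then obtain i j where ij: "K = [i, j]" "i \<in> idx X" "j \<in> idx X" by (auto simp: tuples_def length_Suc_conv)
  have z: "z \<in> dom_of X [i, j]" using z ij by simp
  have w: "has_wirt (\<lambda>z. c * xi11 [i, j] z) (0 * xi11 [i, j] z + c * pd (xi11 [i, j]) z) (0 * xi11 [i, j] z + c * pdb (xi11 [i, j]) z) z"
    by (intro has_wirt_mult has_wirt_const smooth_on_has_wirt[OF smooth_xi11 z] ij)
  have c: "c21 (total_D X xi) [i, j] z = cscale c (d0 (xi11 [i, j]) z + cech pull1 X xi20 [i, j] z)"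
    unfolding total_D_def xi_def c_def[symmetric]
    by (simp add: d0_def has_wirt_unique[OF w] cech_def Let_def del_nth_def pull1_def cscale_def algebra_simps)
  have "((\<lambda>t. cscale c (lag_theta X Y (F t) (continue_log X Y f L (F t)) [i, j] z)) has_vector_derivative
     cscale c (d0 (xi11 [i, j]) z + cech pull1 X xi20 [i, j] z)) (at 0)"
    using bounded_linear.has_vector_derivative[OF cscale_scale lag_theta_derivative[OF ij(2,3) z]] .
  then show "((\<lambda>t. c21 (lag_Omega X Y h (F t) (continue_log X Y f L (F t))) K z) has_vector_derivative
     c21 (add_top (\<lambda>K z. 2 * of_real pi * \<i> * form_a X Y h f F K z) (total_D X xi)) K z) (at 0)"
    unfolding c_def[symmetric] using c by (simp add: lag_Omega_def add_top_def ij c_def)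
next
  let ?c = "2 * of_real pi * \<i> :: complex"
  fix K z assume K: "K \<in> tuples X 2" and z: "z \<in> dom_of X K"
  then obtain i j k where ijk: "K = [i, j, k]" "i \<in> idx X" "j \<in> idx X" "k \<in> idx X"
    by (auto simp: tuples_def length_Suc_conv numeral_2_eq_2)
  have z: "z \<in> dom_of X [i, j, k]" using z ijk by simp
  have c: "c12 (total_D X xi) [i, j, k] z = - (?c * cech pull0 X xi11 [i, j, k] z)"
    by (simp add: total_D_def xi_def cech_def Let_def del_nth_def pull0_def algebra_simps)
  have "((\<lambda>t. - (?c * lag_Theta X Y (F t) (continue_log X Y f L (F t)) [i, j, k] z)) has_vector_derivative
     - (?c * cech pull0 X xi11 [i, j, k] z)) (at 0)"
    by (intro has_vector_derivative_minus has_vector_derivative_mult_right lag_Theta_derivative ijk z)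
  then show "((\<lambda>t. c12 (lag_Omega X Y h (F t) (continue_log X Y f L (F t))) K z) has_vector_derivative
     c12 (add_top (\<lambda>K z. ?c * form_a X Y h f F K z) (total_D X xi)) K z) (at 0)"
    using c by (simp add: lag_Omega_def add_top_def ijk)
next
  let ?c = "2 * of_real pi * \<i> :: complex"
  fix K z assume K: "K \<in> tuples X 3" and z: "z \<in> dom_of X K"
  then obtain i j k l where ijkl: "K = [i, j, k, l]" "i \<in> idx X" "j \<in> idx X" "k \<in> idx X" "l \<in> idx X"
    by (auto simp: tuples_def length_Suc_conv numeral_3_eq_3)
  have z: "z \<in> dom_of X [i, j, k, l]" using z ijkl by simp
  have "((\<lambda>t. - (?c * lag_m X Y (F t) (continue_log X Y f L (F t)) [i, j, k, l] z)) has_vector_derivative - (?c * 0)) (at 0)"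
    by (intro has_vector_derivative_minus has_vector_derivative_mult_right lag_m_derivative ijkl z)
  then show "((\<lambda>t. c03 (lag_Omega X Y h (F t) (continue_log X Y f L (F t))) K z) has_vector_derivative
     c03 (add_top (\<lambda>K z. ?c * form_a X Y h f F K z) (total_D X xi)) K z) (at 0)"
    by (simp add: lag_Omega_def add_top_def total_D_def xi_def ijkl cech_def pull0_def Let_def)
qed

end

section \<open>Variation of the action\<close>

lemma cint_has_vector_derivative:
  assumes "\<And>K \<sigma>. K \<in> Poly_Mapping.keys S \<Longrightarrow> \<sigma> \<in> Poly_Mapping.keys (Poly_Mapping.lookup S K) \<Longrightarrow>
    ((\<lambda>t. g t K \<sigma>) has_vector_derivative g' K \<sigma>) (at x)"
  shows "((\<lambda>t. cint (g t) S) has_vector_derivative cint g' S) (at x)"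
  unfolding cint_def fint_def
  by (intro has_vector_derivative_sum has_vector_derivative_mult_right assms)

lemma singular_simplex_mem:
  assumes "singular_simplex p (subtopology T U) \<sigma>" "y \<in> standard_simplex p"
  shows "\<sigma> y \<in> U"
proof -
  have "continuous_map (subtopology (powertop_real UNIV) (standard_simplex p)) (subtopology T U) \<sigma>"
    using assms(1) by (simp add: singular_simplex_def)
  from continuous_map_image_subset_topspace[OF this] show ?thesis
    using assms(2) by (auto simp: topspace_standard_simplex)
qed

lemma cover_simplex:
  assumes "cover_chain X q p S" "K \<in> Poly_Mapping.keys S" "\<sigma> \<in> Poly_Mapping.keys (Poly_Mapping.lookup S K)"
  shows "K \<in> tuples X q" "smooth_simplex X p \<sigma>"
    "\<And>y i. y \<in> standard_simplex p \<Longrightarrow> i \<in> set K \<Longrightarrow> \<sigma> y \<in> patch X i"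
proof -
  show "K \<in> tuples X q" "smooth_simplex X p \<sigma>" using assms by (auto simp: cover_chain_def smooth_chain_def)
  have "singular_simplex p (subtopology (surf X) (overlap X K)) \<sigma>"
    using assms unfolding cover_chain_def singular_chain_def by blast
  from singular_simplex_mem[OF this] show "\<And>y i. y \<in> standard_simplex p \<Longrightarrow> i \<in> set K \<Longrightarrow> \<sigma> y \<in> patch X i"
    by (auto simp: overlap_def)
qed

context rsurface
begin

lemma simplex_int2_add:
  assumes \<sigma>: "smooth_simplex X 2 \<sigma>" and i: "i \<in> idx X" and p: "\<And>y. y \<in> standard_simplex 2 \<Longrightarrow> \<sigma> y \<in> patch X i"
    and \<omega>: "continuous_on (dom_of X [i]) \<omega>" "continuous_on (dom_of X [i]) \<omega>'"
  shows "simplex_int2 X i (\<lambda>z. \<omega> z + \<omega>' z) \<sigma> = simplex_int2 X i \<omega> \<sigma> + simplex_int2 X i \<omega>' \<sigma>"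
proof -
  let ?u = "\<lambda>p. coord X i (\<sigma> (bary (fst p) (snd p)))"
  have in_p: "\<sigma> (bary (fst x) (snd x)) \<in> patch X i" if "x \<in> triangle" for x
    using p bary_simplex[of "fst x" "snd x"] that by simp
  have u: "csmooth triangle ?u" using xsmooth_chart[OF xsmooth_bary[OF \<sigma>] i in_p] .
  have "area_form w triangle ?u (1, 0) (0, 1) integrable_on triangle" if "continuous_on (dom_of X [i]) w" for w
    unfolding area_form_def[abs_def]
    by (intro compact_integral(2)[OF compact_triangle] continuous_intros continuous_on_compose2[OF that]
        csmooth_continuous u csmooth_wdir solid_triangle) (use in_p in auto)
  note this[OF \<omega>(1)] this[OF \<omega>(2)]
  then show ?thesis
    unfolding simplex_int2_eq by (subst integral_add[symmetric]) (auto simp: area_form_def distrib_right intro!: integral_cong)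
qed

lemma simplex_int1_add:
  assumes \<sigma>: "smooth_simplex X 1 \<sigma>" and i: "i \<in> idx X" and p: "\<And>y. y \<in> standard_simplex 1 \<Longrightarrow> \<sigma> y \<in> patch X i"
    and V: "\<And>y. y \<in> standard_simplex 1 \<Longrightarrow> coord X i (\<sigma> y) \<in> V"
    and \<theta>: "continuous_on V \<theta>" "continuous_on V \<theta>'"
  shows "simplex_int1 X i (\<lambda>z. \<theta> z + \<theta>' z) \<sigma> = simplex_int1 X i \<theta> \<sigma> + simplex_int1 X i \<theta>' \<sigma>"
    "simplex_int1 X i (\<lambda>z. \<theta> z - \<theta>' z) \<sigma> = simplex_int1 X i \<theta> \<sigma> - simplex_int1 X i \<theta>' \<sigma>"
proof -
  let ?u = "\<lambda>s. coord X i (\<sigma> (bary s 0))"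
  have u: "csmooth {0..1} ?u"
    by (rule xsmooth_chart[OF xsmooth_bary1[OF \<sigma>] i]) (use p bary_simplex1 in auto)
  have i: "edge_form w {0..1} ?u 1 integrable_on {0..1}" if "continuous_on V w" for w
    unfolding edge_form_def[abs_def]
    by (intro compact_integral(2)[OF compact_Icc] continuous_intros continuous_on_compose2[OF that]
        csmooth_continuous u csmooth_wdir solid_unit) (use V bary_simplex1 in auto)
  note i[OF \<theta>(1)] i[OF \<theta>(2)]
  then show "simplex_int1 X i (\<lambda>z. \<theta> z + \<theta>' z) \<sigma> = simplex_int1 X i \<theta> \<sigma> + simplex_int1 X i \<theta>' \<sigma>"
    "simplex_int1 X i (\<lambda>z. \<theta> z - \<theta>' z) \<sigma> = simplex_int1 X i \<theta> \<sigma> - simplex_int1 X i \<theta>' \<sigma>"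
    unfolding simplex_int1_eq[OF u]
    by (subst integral_add[symmetric] integral_diff[symmetric]; auto simp: edge_form_def algebra_simps intro!: integral_cong)+
qed

lemma smooth_pull1:
  assumes ij: "i \<in> idx X" "j \<in> idx X" and \<eta>: "smooth_on (dom_of X [i]) \<eta>"
  shows "smooth_on (dom_of X [i, j]) (pull1 (trans_fun X i j) \<eta>)"
proof -
  note o = open_dom2[OF ij] and t = trans_smooth[OF ij]
  have c: "smooth_on (dom_of X [i, j]) (\<lambda>z. \<eta> (trans_fun X i j z))"
    by (rule smooth_on_compose[OF o \<eta> t]) (use trans_mem ij dom_of2 in auto)
  show ?thesis
    unfolding pull1_def[abs_def]
    by (intro smooth_on_Pair smooth_on_add smooth_on_mult smooth_on_cnj smooth_on_fst smooth_on_snd smooth_on_pd smooth_on_pdb o t c)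
qed

end

context variation
begin

text \<open>The integrand equals the smooth function \<open>Om\<close> only where \<open>F t\<close>
  stays in the patch. By compactness this is the whole simplex for small \<open>t\<close>, which
  suffices for a derivative at 0.\<close>

lemma simplex2_derivative:
  assumes \<sigma>: "smooth_simplex X 2 \<sigma>" and i: "i \<in> idx X" and p: "\<And>y. y \<in> standard_simplex 2 \<Longrightarrow> \<sigma> y \<in> patch X i"
  shows "((\<lambda>t. simplex_int2 X i (lag_omega X Y h (F t) [i]) \<sigma>) has_vector_derivative
    simplex_int2 X i (\<lambda>z. form_a X Y h f F [i] z + d1 (xi20 [i]) z) \<sigma>) (at 0)"
proof -
  let ?u = "\<lambda>p. coord X i (\<sigma> (bary (fst p) (snd p)))"
  have in_p: "\<sigma> (bary (fst x) (snd x)) \<in> patch X i" if "x \<in> triangle" for x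
    using p bary_simplex[of "fst x" "snd x"] that by simp
  have u: "csmooth triangle ?u" using sx.xsmooth_chart[OF sx.xsmooth_bary[OF \<sigma>] i in_p] .
  have ud: "?u x \<in> dom_of X [i]" if "x \<in> triangle" for x using in_p[OF that] by simp
  let ?k = "\<lambda>x. wdir triangle ?u (1, 0) x * cnj (wdir triangle ?u (0, 1) x) - wdir triangle ?u (0, 1) x * cnj (wdir triangle ?u (1, 0) x)"
  have k: "continuous_on triangle ?k"
    by (intro continuous_intros csmooth_continuous u csmooth_wdir solid_triangle)
  note c = csmooth_continuous[OF u]
  have z: "(0, ?u x) \<in> W i" if "x \<in> triangle" for x using zero_W[OF i ud[OF that]] .
  have d: "((\<lambda>t. integral triangle (\<lambda>x. Om i (t, ?u x) * ?k x)) has_vector_derivative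
      integral triangle (\<lambda>x. dt (Om i) (0, ?u x) * ?k x)) (at 0)"
    by (rule has_vector_derivative_integral[OF open_W[OF i] smooth_Om[OF i] compact_triangle c k z])
  have ev: "\<forall>\<^sub>F t in nhds 0. \<forall>x\<in>triangle. (t, ?u x) \<in> W i"
    by (rule eventually_compact_slice[OF open_W[OF i] compact_triangle c]) (rule z)
  have e: "\<forall>\<^sub>F t in nhds 0. integral triangle (\<lambda>x. Om i (t, ?u x) * ?k x) = simplex_int2 X i (lag_omega X Y h (F t) [i]) \<sigma>"
    using ev by eventually_elim (auto simp: sx.simplex_int2_eq area_form_def lag_omega_Om[OF i] intro!: integral_cong)
  have "integral triangle (\<lambda>x. dt (Om i) (0, ?u x) * ?k x) = simplex_int2 X i (\<lambda>z. form_a X Y h f F [i] z + d1 (xi20 [i]) z) \<sigma>"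
    unfolding sx.simplex_int2_eq
    by (intro integral_cong) (simp add: area_form_def dt_Om[OF i ud] form_a_el xi20_def)
  then show ?thesis using has_vector_derivative_eventually[OF d e] by simp
qed

lemma simplex1_derivative:
  assumes \<sigma>: "smooth_simplex X 1 \<sigma>" and ij: "i \<in> idx X" "j \<in> idx X"
    and p: "\<And>y. y \<in> standard_simplex 1 \<Longrightarrow> \<sigma> y \<in> patch X i" "\<And>y. y \<in> standard_simplex 1 \<Longrightarrow> \<sigma> y \<in> patch X j"
  shows "((\<lambda>t. simplex_int1 X j (lag_theta X Y (F t) (continue_log X Y f L (F t)) [i, j]) \<sigma>) has_vector_derivative
    simplex_int1 X j (\<lambda>z. d0 (xi11 [i, j]) z + cech pull1 X xi20 [i, j] z) \<sigma>) (at 0)"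
proof -
  let ?u = "\<lambda>s. coord X j (\<sigma> (bary s 0))"
  have u: "csmooth {0..1} ?u"
    by (rule sx.xsmooth_chart[OF sx.xsmooth_bary1[OF \<sigma>] ij(2)]) (use p bary_simplex1 in auto)
  have ud: "?u x \<in> dom_of X [i, j]" if "x \<in> {0..1}" for x
    using p bary_simplex1[OF that] sx.dom_of2[OF ij] ij by simp
  let ?D = "wdir {0..1} ?u 1"
  have k: "continuous_on {0..1} ?D" "continuous_on {0..1} (\<lambda>s. cnj (?D s))"
    by (intro continuous_intros csmooth_continuous u csmooth_wdir solid_unit)+
  note c = csmooth_continuous[OF u]
  note o = open_Wt[OF ij] and s = smooth_Th1[OF ij] smooth_Th2[OF ij]
  have z: "(0, ?u x) \<in> Wt i j" if "x \<in> {0..1}" for x using zero_Wt[OF ij ud[OF that]] .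
  have int: "(\<lambda>s. H (t, ?u s) * k s) integrable_on {0..1}"
    if "smooth_on (Wt i j) H" "continuous_on {0..1} k" "\<forall>x\<in>{0..1}. (t, ?u x) \<in> Wt i j" for H :: "real \<times> complex \<Rightarrow> complex" and k :: "real \<Rightarrow> complex" and t
  proof (rule compact_integral(2)[OF compact_Icc], rule continuous_on_mult[OF _ that(2)])
    have "continuous_on {0..1} (\<lambda>s. (t, ?u s))" by (intro continuous_intros c)
    then show "continuous_on {0..1} (\<lambda>s. H (t, ?u s))"
      by (rule continuous_on_compose2[OF smooth_on_continuous[OF that(1)]]) (use that(3) in auto)
  qed
  have d: "((\<lambda>t. integral {0..1} (\<lambda>s. Th1 i j (t, ?u s) * ?D s) + integral {0..1} (\<lambda>s. Th2 i j (t, ?u s) * cnj (?D s)))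
     has_vector_derivative integral {0..1} (\<lambda>s. dt (Th1 i j) (0, ?u s) * ?D s) + integral {0..1} (\<lambda>s. dt (Th2 i j) (0, ?u s) * cnj (?D s))) (at 0)"
    by (intro has_vector_derivative_add has_vector_derivative_integral[OF o s(1) compact_Icc c k(1) z]
        has_vector_derivative_integral[OF o s(2) compact_Icc c k(2) z])
  have ev: "\<forall>\<^sub>F t in nhds 0. \<forall>x\<in>{0..1}. (t, ?u x) \<in> Wt i j"
    by (rule eventually_compact_slice[OF o compact_Icc c]) (rule z)
  have e: "\<forall>\<^sub>F t in nhds 0. integral {0..1} (\<lambda>s. Th1 i j (t, ?u s) * ?D s) + integral {0..1} (\<lambda>s. Th2 i j (t, ?u s) * cnj (?D s))
     = simplex_int1 X j (lag_theta X Y (F t) (continue_log X Y f L (F t)) [i, j]) \<sigma>"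
    using ev
  proof eventually_elim
    fix t assume t: "\<forall>x\<in>{0..1}. (t, ?u x) \<in> Wt i j"
    then show "integral {0..1} (\<lambda>s. Th1 i j (t, ?u s) * ?D s) + integral {0..1} (\<lambda>s. Th2 i j (t, ?u s) * cnj (?D s))
     = simplex_int1 X j (lag_theta X Y (F t) (continue_log X Y f L (F t)) [i, j]) \<sigma>"
      unfolding sx.simplex_int1_eq[OF u]
      using int[OF s(1) k(1) t] int[OF s(2) k(2) t]
      by (subst integral_add[symmetric]) (auto simp: edge_form_def lag_theta_Th[OF ij] intro!: integral_cong)
  qed
  have t0: "\<forall>x\<in>{0..1}. (0, ?u x) \<in> Wt i j" using z by blast
  have "integral {0..1} (\<lambda>s. dt (Th1 i j) (0, ?u s) * ?D s) + integral {0..1} (\<lambda>s. dt (Th2 i j) (0, ?u s) * cnj (?D s))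
     = simplex_int1 X j (\<lambda>z. d0 (xi11 [i, j]) z + cech pull1 X xi20 [i, j] z) \<sigma>"
    unfolding sx.simplex_int1_eq[OF u]
    using int[OF smooth_on_dt[OF o s(1)] k(1) t0] int[OF smooth_on_dt[OF o s(2)] k(2) t0]
    by (subst integral_add[symmetric]) (auto simp: edge_form_def dt_Th[OF ij ud] intro!: integral_cong)
  then show ?thesis using has_vector_derivative_eventually[OF d e] by simp
qed

lemma simplex0_derivative:
  assumes ijk: "i \<in> idx X" "j \<in> idx X" "k \<in> idx X"
    and p: "\<And>y l. y \<in> standard_simplex 0 \<Longrightarrow> l \<in> {i, j, k} \<Longrightarrow> \<sigma> y \<in> patch X l"
  shows "((\<lambda>t. simplex_int0 X k (lag_Theta X Y (F t) (continue_log X Y f L (F t)) [i, j, k]) \<sigma>) has_vector_derivative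
    simplex_int0 X k (cech pull0 X xi11 [i, j, k]) \<sigma>) (at 0)"
  unfolding simplex_int0_def
  by (rule lag_Theta_derivative[OF ijk]) (use p[OF bary_simplex0] ijk in \<open>simp add: sx.dom_of3\<close>)

end

section \<open>Cancellation along the chains\<close>

locale action_variation = variation X Y f L h F e
  for X :: "('a, 'i::linorder) surface" and Y :: "('b, 'i) surface" and f :: "'a \<Rightarrow> 'b" and L h :: "'i \<Rightarrow> complex \<Rightarrow> complex"
    and F :: "real \<Rightarrow> 'a \<Rightarrow> 'b" and e :: real +
  fixes S0 S1 S2 :: "'i list \<Rightarrow>\<^sub>0 'a chain"
  assumes chains: "fundamental_chains X S0 S1 S2"
begin

lemma cover: "cover_chain X 0 2 S0" "cover_chain X 1 1 S1" "cover_chain X 2 0 S2"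
  and boundary: "bd_sing 2 S0 = bd_cech S1" "bd_sing 1 S1 = bd_cech S2"
  using chains by (auto simp: fundamental_chains_def)

lemma S0_simplex:
  assumes "K \<in> Poly_Mapping.keys S0" "\<sigma> \<in> Poly_Mapping.keys (Poly_Mapping.lookup S0 K)"
  obtains i where "K = [i]" "i \<in> idx X" "smooth_simplex X 2 \<sigma>" "\<And>y. y \<in> standard_simplex 2 \<Longrightarrow> \<sigma> y \<in> patch X i"
proof -
  note c = cover_simplex[OF cover(1) assms]
  obtain i where "K = [i]" "i \<in> idx X" using c(1) by (auto simp: tuples_def length_Suc_conv)
  then show ?thesis using that c(2,3) by simp
qed

lemma S1_simplex:
  assumes "K \<in> Poly_Mapping.keys S1" "\<sigma> \<in> Poly_Mapping.keys (Poly_Mapping.lookup S1 K)"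
  obtains i j where "K = [i, j]" "i \<in> idx X" "j \<in> idx X" "smooth_simplex X 1 \<sigma>"
    "\<And>y. y \<in> standard_simplex 1 \<Longrightarrow> \<sigma> y \<in> patch X i" "\<And>y. y \<in> standard_simplex 1 \<Longrightarrow> \<sigma> y \<in> patch X j"
proof -
  note c = cover_simplex[OF cover(2) assms]
  obtain i j where "K = [i, j]" "i \<in> idx X" "j \<in> idx X" using c(1) by (auto simp: tuples_def length_Suc_conv)
  then show ?thesis using that c(2,3) by simp
qed

lemma S2_simplex:
  assumes "K \<in> Poly_Mapping.keys S2" "\<sigma> \<in> Poly_Mapping.keys (Poly_Mapping.lookup S2 K)"
  obtains i j k where "K = [i, j, k]" "i \<in> idx X" "j \<in> idx X" "k \<in> idx X"
    "\<And>y l. y \<in> standard_simplex 0 \<Longrightarrow> l \<in> {i, j, k} \<Longrightarrow> \<sigma> y \<in> patch X l"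
proof -
  note c = cover_simplex[OF cover(3) assms]
  obtain i j k where "K = [i, j, k]" "i \<in> idx X" "j \<in> idx X" "k \<in> idx X"
    using c(1) by (auto simp: tuples_def length_Suc_conv numeral_2_eq_2)
  then show ?thesis using that c(3) by simp
qed

abbreviation "J1 \<equiv> \<lambda>K. simplex_int1 X (last K) (xi20 K)"
abbreviation "J0 \<equiv> \<lambda>K. simplex_int0 X (last K) (xi11 K)"

text \<open>With \<open>term1\<close> and \<open>term0\<close>: the 1-form part of the primitive is
  integrated over \<open>\<partial>'\<Sigma>_0\<close> and \<open>\<partial>''\<Sigma>_1\<close>,
  its function part over \<open>\<partial>'\<Sigma>_1\<close> and
  \<open>\<partial>''\<Sigma>_2\<close>. The alternating signs of the action make each pair
  cancel.\<close>

lemma term2: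
  "cint (\<lambda>K. simplex_int2 X (last K) (\<lambda>z. form_a X Y h f F K z + d1 (xi20 K) z)) S0
   = fint (sx.int2 (form_a X Y h f F)) (\<Sum>K\<in>Poly_Mapping.keys S0. Poly_Mapping.lookup S0 K) + cint J1 (bd_sing 2 S0)"
proof -
  have "cint (\<lambda>K. simplex_int2 X (last K) (\<lambda>z. form_a X Y h f F K z + d1 (xi20 K) z)) S0
    = cint (\<lambda>K \<sigma>. sx.int2 (form_a X Y h f F) \<sigma> + (\<Sum>k\<le>2. (-1) ^ k * J1 K (singular_face 2 k \<sigma>))) S0"
  proof (rule cint_cong)
    fix K \<sigma> assume "K \<in> Poly_Mapping.keys S0" "\<sigma> \<in> Poly_Mapping.keys (Poly_Mapping.lookup S0 K)"
    then obtain i where i: "K = [i]" "i \<in> idx X" "smooth_simplex X 2 \<sigma>" "\<And>y. y \<in> standard_simplex 2 \<Longrightarrow> \<sigma> y \<in> patch X i"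
      by (rule S0_simplex) blast
    note sm = smooth_xi20[OF i(2)]
    have "smooth_on (dom_of X [i]) (d1 (xi20 [i]))"
      unfolding d1_def[abs_def]
      by (intro smooth_on_diff smooth_on_pd smooth_on_pdb smooth_on_fst smooth_on_snd sm sx.open_dom_single i)
    moreover have "smooth_on (dom_of X [i]) (form_a X Y h f F [i])"
      by (rule sx.global_2form_smooth[OF global_form_a i(2)])
    ultimately show "simplex_int2 X (last K) (\<lambda>z. form_a X Y h f F K z + d1 (xi20 K) z) \<sigma>
      = sx.int2 (form_a X Y h f F) \<sigma> + (\<Sum>k\<le>2. (-1) ^ k * J1 K (singular_face 2 k \<sigma>))"
      using sx.simplex_int2_add[OF i(3,2,4)] sx.int2_chart[OF i(3,2,4) global_form_a] sx.stokes_2simplex[OF i(3,2,4) sm]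
      by (simp add: i(1) smooth_on_continuous)
  qed
  also have "\<dots> = cint (\<lambda>K. sx.int2 (form_a X Y h f F)) S0 + cint J1 (bd_sing 2 S0)"
    by (simp add: cint_linear(1) cint_bd_sing)
  finally show ?thesis by (simp add: fint_sum cint_def)
qed

lemma term1:
  "cint (\<lambda>K. simplex_int1 X (last K) (\<lambda>z. d0 (xi11 K) z + cech pull1 X xi20 K z)) S1
   = cint J0 (bd_sing 1 S1) + cint J1 (bd_cech S1)"
proof -
  have "cint (\<lambda>K. simplex_int1 X (last K) (\<lambda>z. d0 (xi11 K) z + cech pull1 X xi20 K z)) S1
    = cint (\<lambda>K \<sigma>. (\<Sum>k\<le>1. (-1) ^ k * J0 K (singular_face 1 k \<sigma>)) + (\<Sum>j<length K. (-1) ^ j * J1 (del_nth j K) \<sigma>)) S1"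
  proof (rule cint_cong)
    fix K \<sigma> assume "K \<in> Poly_Mapping.keys S1" "\<sigma> \<in> Poly_Mapping.keys (Poly_Mapping.lookup S1 K)"
    then obtain i j where ij: "K = [i, j]" "i \<in> idx X" "j \<in> idx X" "smooth_simplex X 1 \<sigma>"
      "\<And>y. y \<in> standard_simplex 1 \<Longrightarrow> \<sigma> y \<in> patch X i" "\<And>y. y \<in> standard_simplex 1 \<Longrightarrow> \<sigma> y \<in> patch X j"
      by (rule S1_simplex) blast
    let ?V = "dom_of X [i, j]" and ?t = "trans_fun X i j"
    note o = sx.open_dom2[OF ij(2,3)]
    have V: "coord X j (\<sigma> y) \<in> ?V" if "y \<in> standard_simplex 1" for y
      using ij that by (simp add: sx.dom_of2)
    have sub: "?V \<subseteq> dom_of X [j]" using sx.dom_of2 ij by blast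
    have c1: "continuous_on ?V (d0 (xi11 [i, j]))"
      unfolding d0_def[abs_def]
      by (intro smooth_on_continuous smooth_on_Pair smooth_on_pd smooth_on_pdb o smooth_xi11 ij)
    have c2: "continuous_on ?V (xi20 [j])" "continuous_on ?V (pull1 ?t (xi20 [i]))"
      by (intro smooth_on_continuous smooth_on_subset[OF smooth_xi20 sub] sx.smooth_pull1 smooth_xi20 ij)+
    have ce: "cech pull1 X xi20 [i, j] = (\<lambda>z. xi20 [j] z - pull1 ?t (xi20 [i]) z)"
      by (rule ext) (simp add: cech_def Let_def del_nth_def)
    have c3: "continuous_on ?V (cech pull1 X xi20 [i, j])"
      unfolding ce by (intro continuous_intros c2)
    have "simplex_int1 X j (\<lambda>z. d0 (xi11 [i, j]) z + cech pull1 X xi20 [i, j] z) \<sigma>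
      = simplex_int1 X j (d0 (xi11 [i, j])) \<sigma> + simplex_int1 X j (cech pull1 X xi20 [i, j]) \<sigma>"
      by (rule sx.simplex_int1_add(1)[OF ij(4,3) _ _ c1 c3]) (use ij V in auto)
    moreover have "simplex_int1 X j (cech pull1 X xi20 [i, j]) \<sigma> = simplex_int1 X j (xi20 [j]) \<sigma> - simplex_int1 X i (xi20 [i]) \<sigma>"
    proof -
      \<comment> \<open>The term with the second index deleted has to be integrated in the
        coordinate \<open>i\<close>, the last index of \<open>[i]\<close>, whereas
        \<open>cech\<close> supplies it pulled back to the coordinate \<open>j\<close>.\<close>
      have "simplex_int1 X j (pull1 ?t (xi20 [i])) \<sigma> = simplex_int1 X i (xi20 [i]) \<sigma>"
        using sx.simplex_int1_pull[OF ij(4,2,3,5,6), of "xi20 [i]"] by simp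
      moreover have "simplex_int1 X j (\<lambda>z. xi20 [j] z - pull1 ?t (xi20 [i]) z) \<sigma>
        = simplex_int1 X j (xi20 [j]) \<sigma> - simplex_int1 X j (pull1 ?t (xi20 [i])) \<sigma>"
        by (rule sx.simplex_int1_add(2)[OF ij(4,3) _ _ c2]) (use ij V in auto)
      ultimately show ?thesis unfolding ce by simp
    qed
    moreover have "simplex_int1 X j (d0 (xi11 [i, j])) \<sigma> = (\<Sum>k\<le>1. (-1) ^ k * simplex_int0 X j (xi11 [i, j]) (singular_face 1 k \<sigma>))"
      by (rule sx.stokes_1simplex[OF ij(4,3) _ o _ smooth_xi11[OF ij(2,3)]]) (use ij V in auto)
    ultimately show "simplex_int1 X (last K) (\<lambda>z. d0 (xi11 K) z + cech pull1 X xi20 K z) \<sigma>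
       = (\<Sum>k\<le>1. (-1) ^ k * J0 K (singular_face 1 k \<sigma>)) + (\<Sum>j<length K. (-1) ^ j * J1 (del_nth j K) \<sigma>)"
      by (simp add: ij(1) del_nth_def)
  qed
  then show ?thesis by (simp add: cint_linear(1) cint_bd_sing cint_bd_cech)
qed

lemma term0: "cint (\<lambda>K. simplex_int0 X (last K) (cech pull0 X xi11 K)) S2 = cint J0 (bd_cech S2)"
  unfolding cint_bd_cech
proof (rule cint_cong)
  fix K \<sigma> assume "K \<in> Poly_Mapping.keys S2" "\<sigma> \<in> Poly_Mapping.keys (Poly_Mapping.lookup S2 K)"
  then obtain i j k where ijk: "K = [i, j, k]" "i \<in> idx X" "j \<in> idx X" "k \<in> idx X"
    "\<And>y l. y \<in> standard_simplex 0 \<Longrightarrow> l \<in> {i, j, k} \<Longrightarrow> \<sigma> y \<in> patch X l"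
    by (rule S2_simplex) blast
  have "trans_fun X j k (coord X k (\<sigma> (bary 0 0))) = coord X j (\<sigma> (bary 0 0))"
    using ijk(5)[OF bary_simplex0, of k] ijk(4) by (simp add: trans_fun_def)
  then show "simplex_int0 X (last K) (cech pull0 X xi11 K) \<sigma> = (\<Sum>j<length K. (-1) ^ j * J0 (del_nth j K) \<sigma>)"
    by (simp add: ijk(1) simplex_int0_def cech_def Let_def del_nth_def pull0_def numeral_2_eq_2)
qed

theorem action_derivative:
  "has_derivative_mod_Z3 (\<lambda>t. action X Y h S0 S1 S2 (F t) (continue_log X Y f L (F t)))
    (2 * of_real pi * \<i> * fint (sx.int2 (form_a X Y h f F)) (\<Sum>K\<in>Poly_Mapping.keys S0. Poly_Mapping.lookup S0 K))"
proof -
  let ?L = "\<lambda>t. continue_log X Y f L (F t)"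
  \<comment> \<open>A lift of the action to the complex numbers; differentiating it gives the
    derivative modulo \<open>\<int>(3)\<close>.\<close>
  let ?s = "\<lambda>t. 2 * of_real pi * \<i> * (chain_int (simplex_int2 X) (lag_omega X Y h (F t)) S0
      - chain_int (simplex_int1 X) (lag_theta X Y (F t) (?L t)) S1
      + chain_int (simplex_int0 X) (lag_Theta X Y (F t) (?L t)) S2)"
  have d2: "((\<lambda>t. chain_int (simplex_int2 X) (lag_omega X Y h (F t)) S0) has_vector_derivative
     cint (\<lambda>K. simplex_int2 X (last K) (\<lambda>z. form_a X Y h f F K z + d1 (xi20 K) z)) S0) (at 0)"
    unfolding chain_int_cint
  proof (rule cint_has_vector_derivative)
    fix K \<sigma> assume "K \<in> Poly_Mapping.keys S0" "\<sigma> \<in> Poly_Mapping.keys (Poly_Mapping.lookup S0 K)"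
    then obtain i where i: "K = [i]" "i \<in> idx X" "smooth_simplex X 2 \<sigma>" "\<And>y. y \<in> standard_simplex 2 \<Longrightarrow> \<sigma> y \<in> patch X i"
      by (rule S0_simplex) blast
    show "((\<lambda>t. simplex_int2 X (last K) (lag_omega X Y h (F t) K) \<sigma>) has_vector_derivative
      simplex_int2 X (last K) (\<lambda>z. form_a X Y h f F K z + d1 (xi20 K) z) \<sigma>) (at 0)"
      using simplex2_derivative[OF i(3,2,4)] by (simp add: i(1))
  qed
  have d1: "((\<lambda>t. chain_int (simplex_int1 X) (lag_theta X Y (F t) (?L t)) S1) has_vector_derivative
     cint (\<lambda>K. simplex_int1 X (last K) (\<lambda>z. d0 (xi11 K) z + cech pull1 X xi20 K z)) S1) (at 0)"
    unfolding chain_int_cint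
  proof (rule cint_has_vector_derivative)
    fix K \<sigma> assume "K \<in> Poly_Mapping.keys S1" "\<sigma> \<in> Poly_Mapping.keys (Poly_Mapping.lookup S1 K)"
    then obtain i j where ij: "K = [i, j]" "i \<in> idx X" "j \<in> idx X" "smooth_simplex X 1 \<sigma>"
      "\<And>y. y \<in> standard_simplex 1 \<Longrightarrow> \<sigma> y \<in> patch X i" "\<And>y. y \<in> standard_simplex 1 \<Longrightarrow> \<sigma> y \<in> patch X j"
      by (rule S1_simplex) blast
    show "((\<lambda>t. simplex_int1 X (last K) (lag_theta X Y (F t) (?L t) K) \<sigma>) has_vector_derivative
      simplex_int1 X (last K) (\<lambda>z. d0 (xi11 K) z + cech pull1 X xi20 K z) \<sigma>) (at 0)"
      using simplex1_derivative[OF ij(4,2,3,5,6)] by (simp add: ij(1))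
  qed
  have d0: "((\<lambda>t. chain_int (simplex_int0 X) (lag_Theta X Y (F t) (?L t)) S2) has_vector_derivative
     cint (\<lambda>K. simplex_int0 X (last K) (cech pull0 X xi11 K)) S2) (at 0)"
    unfolding chain_int_cint
  proof (rule cint_has_vector_derivative)
    fix K \<sigma> assume "K \<in> Poly_Mapping.keys S2" "\<sigma> \<in> Poly_Mapping.keys (Poly_Mapping.lookup S2 K)"
    then obtain i j k where ijk: "K = [i, j, k]" "i \<in> idx X" "j \<in> idx X" "k \<in> idx X"
      "\<And>y l. y \<in> standard_simplex 0 \<Longrightarrow> l \<in> {i, j, k} \<Longrightarrow> \<sigma> y \<in> patch X l"
      by (rule S2_simplex) blast
    show "((\<lambda>t. simplex_int0 X (last K) (lag_Theta X Y (F t) (?L t) K) \<sigma>) has_vector_derivative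
      simplex_int0 X (last K) (cech pull0 X xi11 K) \<sigma>) (at 0)"
      using simplex0_derivative[OF ijk(2,3,4), of \<sigma>] ijk(5) by (simp add: ijk(1))
  qed
  have "(?s has_vector_derivative 2 * of_real pi * \<i> *
     (cint (\<lambda>K. simplex_int2 X (last K) (\<lambda>z. form_a X Y h f F K z + d1 (xi20 K) z)) S0
      - cint (\<lambda>K. simplex_int1 X (last K) (\<lambda>z. d0 (xi11 K) z + cech pull1 X xi20 K z)) S1
      + cint (\<lambda>K. simplex_int0 X (last K) (cech pull0 X xi11 K)) S2)) (at 0)"
    by (intro has_vector_derivative_mult_right has_vector_derivative_add has_vector_derivative_diff d2 d1 d0)
  then have "(?s has_vector_derivative 2 * of_real pi * \<i> *
     fint (sx.int2 (form_a X Y h f F)) (\<Sum>K\<in>Poly_Mapping.keys S0. Poly_Mapping.lookup S0 K)) (at 0)"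
    unfolding term2 term1 term0 boundary by simp
  then show ?thesis
    unfolding has_derivative_mod_Z3_def action_def by (intro exI[of _ ?s]) simp
qed

end

section \<open>Partitions of unity and integration over the surface\<close>

text \<open>The flat function \<open>exp (- 1 / s)\<close> together with its multiples by powers of
  \<open>1 / s\<close>. The family indexed by \<open>n\<close> is closed under differentiation up to
  linear combinations, so smoothness follows by induction on the order for all \<open>n\<close> at
  once.\<close>

definition bump_exp :: "nat \<Rightarrow> real \<Rightarrow> real" where
  "bump_exp n s = (if s > 0 then exp (- 1 / s) / s ^ n else 0)"

lemma power_le_fact_exp: "0 \<le> x \<Longrightarrow> x ^ m \<le> fact m * exp (x::real)"
proof -
  assume x: "0 \<le> x"
  have "(\<Sum>n\<in>{m}. x ^ n /\<^sub>R fact n) \<le> suminf (\<lambda>n. x ^ n /\<^sub>R fact n)"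
    by (rule sum_le_suminf[OF summable_exp_generic]) (use x in auto)
  then have "x ^ m / fact m \<le> exp x" by (simp add: exp_def divide_inverse mult.commute)
  then show ?thesis by (simp add: field_simps)
qed

text \<open>The term of degree \<open>n + 2\<close> of the exponential series absorbs the pole of
  order \<open>n\<close> and leaves two powers of \<open>s\<close>, enough for a zero derivative at
  0.\<close>

lemma bump_exp_bound: "\<bar>bump_exp n s\<bar> \<le> fact (n + 2) * s\<^sup>2"
proof (cases "s > 0")
  case True
  have "(1 / s) ^ (n + 2) \<le> fact (n + 2) * exp (1 / s)" by (rule power_le_fact_exp) (use True in simp)
  then have "1 \<le> fact (n + 2) * exp (1 / s) * s ^ (n + 2)" using True by (simp add: power_divide field_simps)
  then have "exp (- (1 / s)) * 1 \<le> exp (- (1 / s)) * (fact (n + 2) * exp (1 / s) * s ^ (n + 2))"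
    by (intro mult_left_mono) auto
  also have "\<dots> = fact (n + 2) * s ^ (n + 2) * (exp (- (1 / s)) * exp (1 / s))" by (simp only: mult_ac)
  also have "exp (- (1 / s)) * exp (1 / s) = 1" by (simp flip: exp_add)
  finally have "exp (- (1 / s)) \<le> fact (n + 2) * s\<^sup>2 * s ^ n"
    by (simp add: power_add mult_ac power2_eq_square)
  then have "exp (- (1 / s)) / s ^ n \<le> fact (n + 2) * s\<^sup>2" using True by (simp add: divide_le_eq)
  then show ?thesis using True unfolding bump_exp_def by (simp del: fact_Suc)
qed (simp add: bump_exp_def)

lemma bump_exp_derivative:
  "(bump_exp n has_real_derivative bump_exp (n + 2) s + (- real n) * bump_exp (n + 1) s) (at s)"
proof -
  consider "s > 0" | "s < 0" | "s = 0" by linarith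
  then show ?thesis
  proof cases
    case 1
    have e: "((\<lambda>s. exp (- 1 / s)) has_real_derivative exp (- 1 / s) * (1 / s\<^sup>2)) (at s)"
      using 1 by (auto intro!: derivative_eq_intros simp: power2_eq_square)
    have "((\<lambda>s. exp (- 1 / s) / s ^ n) has_real_derivative bump_exp (n + 2) s + (- real n) * bump_exp (n + 1) s) (at s)"
    \<comment> \<open>The exponent \<open>n - 1\<close> in the derivative of \<open>s ^ n\<close>
      makes \<open>n = 0\<close> a separate case.\<close>
    proof (cases n)
      case 0
      then show ?thesis using e 1 by (simp add: bump_exp_def power2_eq_square)
    next
      case (Suc m)
      have "((\<lambda>s. s ^ Suc m) has_real_derivative real (Suc m) * s ^ m) (at s)"
        using DERIV_pow[of "Suc m" s UNIV] by simp
      have "s ^ Suc m \<noteq> 0" using 1 by simp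
      note d = DERIV_divide[OF e \<open>((\<lambda>s. s ^ Suc m) has_real_derivative real (Suc m) * s ^ m) (at s)\<close> this]
      have "(exp (- 1 / s) * (1 / s\<^sup>2) * s ^ Suc m - exp (- 1 / s) * (real (Suc m) * s ^ m)) / (s ^ Suc m * s ^ Suc m)
        = bump_exp (n + 2) s + (- real n) * bump_exp (n + 1) s"
        using 1 by (simp add: Suc bump_exp_def field_simps power2_eq_square)
      from DERIV_cong[OF d this] show ?thesis unfolding Suc .
    qed
    then show ?thesis
      by (rule has_field_derivative_transform_within_open[of _ _ _ "{0<..}"]) (use 1 in \<open>auto simp: bump_exp_def\<close>)
  next
    case 2
    have "((\<lambda>s. 0) has_real_derivative bump_exp (n + 2) s + (- real n) * bump_exp (n + 1) s) (at s)"
      using 2 by (simp add: bump_exp_def)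
    then show ?thesis
      by (rule has_field_derivative_transform_within_open[of _ _ _ "{..<0}"]) (use 2 in \<open>auto simp: bump_exp_def\<close>)
  next
    case 3
    have "((\<lambda>h. bump_exp n h / h) \<longlongrightarrow> 0) (at 0)"
    proof (rule Lim_null_comparison)
      show "\<forall>\<^sub>F h in at 0. norm (bump_exp n h / h) \<le> fact (n + 2) * \<bar>h\<bar>"
      proof (rule eventually_at_topological[THEN iffD2], intro exI[of _ UNIV] conjI ballI impI)
        fix h :: real assume "h \<noteq> 0"
        then show "norm (bump_exp n h / h) \<le> fact (n + 2) * \<bar>h\<bar>"
          using bump_exp_bound[of n h] by (simp add: divide_le_eq power2_eq_square mult.assoc del: fact_Suc)
      qed auto
      have "((\<lambda>h. fact (n + 2) * \<bar>h\<bar>) \<longlongrightarrow> fact (n + 2) * \<bar>0::real\<bar>) (at 0)" by (intro tendsto_intros)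
      then show "((\<lambda>h. fact (n + 2) * \<bar>h\<bar>) \<longlongrightarrow> (0::real)) (at 0)" by simp
    qed
    moreover have "bump_exp m 0 = 0" for m by (simp add: bump_exp_def)
    ultimately show ?thesis unfolding 3 DERIV_def by simp
  qed
qed

lemma smooth_on_bump_exp: "smooth_on S (bump_exp n)"
proof -
  have "Ck_on k UNIV (bump_exp n)" for k
  proof (induction k arbitrary: n)
    case 0 then show ?case using bump_exp_derivative DERIV_isCont continuous_at_imp_continuous_on by (metis Ck_on.simps(1))
  next
    case (Suc k)
    have "Ck_on k UNIV (\<lambda>x. (bump_exp (n + 2) x + (- real n) * bump_exp (n + 1) x) * b)" for b
      by (intro Ck_on_bounded_linear[OF bounded_linear_mult_left] Ck_on_add open_UNIV Suc
          Ck_on_bounded_linear[OF bounded_linear_mult_right])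
    then show ?case
      by (intro Ck_on_SucI'[OF open_UNIV bump_exp_derivative[unfolded has_field_derivative_def]])
  qed
  then have "smooth_on UNIV (bump_exp n)" by (simp add: smooth_on_def)
  then show ?thesis using smooth_on_subset by blast
qed

text \<open>The squared distance is used because, unlike the distance, it is smooth at the
  centre.\<close>

definition cbump :: "complex \<Rightarrow> real \<Rightarrow> complex \<Rightarrow> real" where
  "cbump a r z = bump_exp 0 (r\<^sup>2 - (cmod (z - a))\<^sup>2)"

lemma cbump_smooth: "smooth_on S (cbump a r)"
proof -
  have "smooth_on UNIV (\<lambda>z. r\<^sup>2 - ((Re (z - a))\<^sup>2 + (Im (z - a))\<^sup>2))"
    by (intro smooth_intros open_UNIV smooth_on_bounded_linear[OF bounded_linear_Re] smooth_on_bounded_linear[OF bounded_linear_Im])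
  then have "smooth_on UNIV (\<lambda>z. bump_exp 0 (r\<^sup>2 - ((Re (z - a))\<^sup>2 + (Im (z - a))\<^sup>2)))"
    by (rule smooth_on_compose[OF open_UNIV smooth_on_bump_exp[of UNIV]]) auto
  then have "smooth_on UNIV (cbump a r)" unfolding cbump_def[abs_def] cmod_power2 .
  then show ?thesis using smooth_on_subset by blast
qed

lemma cbump_nonneg: "0 \<le> cbump a r z"
  by (simp add: cbump_def bump_exp_def)

lemma cbump_pos_iff: "0 < r \<Longrightarrow> 0 < cbump a r z \<longleftrightarrow> z \<in> ball a r"
proof -
  assume r: "0 < r"
  have "(cmod (z - a))\<^sup>2 < r\<^sup>2 \<longleftrightarrow> cmod (z - a) < r"
    using r power2_less_imp_less[of "cmod (z - a)" r] power_strict_mono[of "cmod (z - a)" r 2] by fastforce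
  then show ?thesis by (simp add: cbump_def bump_exp_def dist_norm norm_minus_commute[of a])
qed

section \<open>Smooth partitions of unity on the surface\<close>

context rsurface
begin

lemma coord_inv_continuous: "i \<in> idx X \<Longrightarrow> continuous_map (top_of_set (dom_of X [i])) (surf X) (coord_inv X i)"
  unfolding continuous_map_def
  using coord_inv_topspace open_chart_preimage open_dom_single by (auto simp: openin_open_eq)

lemma compactin_chart:
  assumes "i \<in> idx X" "compact C" "C \<subseteq> dom_of X [i]"
  shows "compactin (surf X) (coord_inv X i ` C)" "closedin (surf X) (coord_inv X i ` C)"
proof -
  show c: "compactin (surf X) (coord_inv X i ` C)"
    by (rule image_compactin[OF _ coord_inv_continuous]) (use assms in \<open>auto simp: compactin_subtopology\<close>)
  show "closedin (surf X) (coord_inv X i ` C)"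
    by (rule compactin_imp_closedin[OF _ c]) (use rs in \<open>simp add: riemann_surface_def\<close>)
qed

lemma compact_coord:
  assumes "i \<in> idx X" "compactin (surf X) K" "K \<subseteq> patch X i"
  shows "compact (coord X i ` K)" "coord X i ` K \<subseteq> dom_of X [i]"
proof -
  have "compactin (top_of_set (dom_of X [i])) (coord X i ` K)"
    by (rule image_compactin[OF _ homeomorphic_imp_continuous_map[OF chart_homeo[OF assms(1)]]])
       (use assms in \<open>auto simp: compactin_subtopology\<close>)
  then show "compact (coord X i ` K)" "coord X i ` K \<subseteq> dom_of X [i]" by (auto simp: compactin_subtopology)
qed

definition fun_smooth :: "('a \<Rightarrow> real) \<Rightarrow> bool" where
  "fun_smooth g \<longleftrightarrow> (\<forall>j\<in>idx X. smooth_on (dom_of X [j]) (\<lambda>\<zeta>. g (coord_inv X j \<zeta>)))"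

lemma fun_smoothD: "fun_smooth g \<Longrightarrow> j \<in> idx X \<Longrightarrow> smooth_on (dom_of X [j]) (\<lambda>\<zeta>. g (coord_inv X j \<zeta>))"
  by (simp add: fun_smooth_def)

lemma fun_smooth_sum: "(\<And>p. p \<in> P \<Longrightarrow> fun_smooth (g p)) \<Longrightarrow> fun_smooth (\<lambda>y. \<Sum>p\<in>P. g p y)"
  unfolding fun_smooth_def by (auto intro!: smooth_on_sum open_dom_single)

lemma fun_smooth_divide:
  assumes "fun_smooth g" "fun_smooth k" "\<And>y. y \<in> topspace (surf X) \<Longrightarrow> k y \<noteq> 0"
  shows "fun_smooth (\<lambda>y. g y / k y)"
  unfolding fun_smooth_def
proof
  fix j assume j: "j \<in> idx X"
  note o = open_dom_single[OF j]
  have "smooth_on (dom_of X [j]) (\<lambda>\<zeta>. complex_of_real (g (coord_inv X j \<zeta>)) / complex_of_real (k (coord_inv X j \<zeta>)))"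
    by (intro smooth_on_divide smooth_on_of_real o fun_smoothD assms(1,2) j)
       (use assms(3) coord_inv_topspace[OF j] in simp)
  from smooth_on_bounded_linear[OF bounded_linear_Re o this]
  show "smooth_on (dom_of X [j]) (\<lambda>\<zeta>. g (coord_inv X j \<zeta>) / k (coord_inv X j \<zeta>))"
    by (simp flip: of_real_divide)
qed

text \<open>Extension by zero of a function supported in a chart is smooth because compact sets are closed.\<close>

lemma local_bump:
  assumes N: "openin (surf X) N" and x: "x \<in> N"
  shows "\<exists>g K. fun_smooth g \<and> (\<forall>y. 0 \<le> g y) \<and> 0 < g x \<and> openin (surf X) {y \<in> topspace (surf X). 0 < g y} \<and>
    closedin (surf X) K \<and> K \<subseteq> N \<and> (\<forall>y. g y \<noteq> 0 \<longrightarrow> y \<in> K)"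
proof -
  obtain i where i: "i \<in> idx X" "x \<in> patch X i" using topspace_covered[of x] openin_subset[OF N] x by auto
  let ?V = "{z \<in> dom_of X [i]. coord_inv X i z \<in> N}" and ?z = "coord X i x"
  have "open ?V" "?z \<in> ?V" using open_chart_preimage[OF i(1) N] i x by auto
  then obtain r where r: "r > 0" "cball ?z r \<subseteq> ?V" by (meson open_contains_cball)
  define g where "g y = (if y \<in> patch X i then cbump ?z r (coord X i y) else 0)" for y
  let ?K = "coord_inv X i ` cball ?z r"
  have K: "closedin (surf X) ?K" by (rule compactin_chart[OF i(1)]) (use r in auto)
  have pos: "0 < g y \<longleftrightarrow> y \<in> {y \<in> patch X i. coord X i y \<in> ball ?z r}" for y
    using cbump_pos_iff[OF r(1)] by (simp add: g_def)
  have nn: "0 \<le> g y" for y by (simp add: g_def cbump_nonneg)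
  have supp: "y \<in> ?K" if "g y \<noteq> 0" for y
  proof -
    have "0 < g y" using nn[of y] that by linarith
    then have "y \<in> patch X i" "coord X i y \<in> cball ?z r" by (simp_all add: pos)
    then show ?thesis using i(1) by (intro image_eqI[of _ _ "coord X i y"]) auto
  qed
  have "fun_smooth g"
    unfolding fun_smooth_def
  proof (intro ballI smooth_on_local)
    fix j z assume j: "j \<in> idx X" and z: "z \<in> dom_of X [j]"
    show "\<exists>T. open T \<and> z \<in> T \<and> smooth_on T (\<lambda>\<zeta>. g (coord_inv X j \<zeta>))"
    proof (cases "coord_inv X j z \<in> patch X i")
      case True
      have "smooth_on (dom_of X [i, j]) (\<lambda>\<zeta>. cbump ?z r (trans_fun X i j \<zeta>))"
        by (rule smooth_on_compose[OF open_dom2 cbump_smooth[of UNIV] trans_smooth]) (use i j in auto)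
      then have "smooth_on (dom_of X [i, j]) (\<lambda>\<zeta>. g (coord_inv X j \<zeta>))"
        by (rule smooth_on_cong[OF open_dom2, rotated -1]) (use i j dom_of2 in \<open>auto simp: g_def trans_fun_def\<close>)
      then show ?thesis using True z i j dom_of2 open_dom2 by (intro exI[of _ "dom_of X [i, j]"]) simp
    next
      case False
      let ?T = "{\<zeta> \<in> dom_of X [j]. coord_inv X j \<zeta> \<in> topspace (surf X) - ?K}"
      have o: "open ?T" by (rule open_chart_preimage[OF j]) (use K in blast)
      have "smooth_on ?T (\<lambda>\<zeta>. g (coord_inv X j \<zeta>))"
        by (rule smooth_on_cong[OF o _ smooth_on_const[of _ 0]]) (use supp in auto)
      moreover have "?K \<subseteq> patch X i" using r by auto
      ultimately show ?thesis using o z False coord_inv_topspace[OF j z] by (intro exI[of _ ?T]) auto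
    qed
  qed
  moreover have "openin (surf X) {y \<in> topspace (surf X). 0 < g y}"
  proof -
    have "{y \<in> topspace (surf X). 0 < g y} = {y \<in> patch X i. coord X i y \<in> ball ?z r}"
      unfolding pos using patch_subset[OF i(1)] by blast
    then show ?thesis using openin_chart[OF i(1) open_ball] by simp
  qed
  moreover have "0 < g x" using pos i r by simp
  moreover have "?K \<subseteq> N" using r by auto
  ultimately show ?thesis using K nn supp by (intro exI[of _ g] exI[of _ ?K]) simp
qed

text \<open>Compactness selects finitely many bumps, which are normalized by their sum. The
  neighbourhoods \<open>N\<close> are left free: charts give the partition used in
  \<open>surface_integral\<close>, and the neighbourhoods from the local homology condition localize
  the integral over the fundamental cycle.\<close>

lemma smooth_partition:
  assumes c: "compact_space (surf X)" and N: "\<And>x. x \<in> topspace (surf X) \<Longrightarrow> openin (surf X) (N x) \<and> x \<in> N x"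
  shows "\<exists>P \<psi>. finite P \<and> P \<subseteq> topspace (surf X) \<and>
    (\<forall>p\<in>P. fun_smooth (\<psi> p) \<and> (\<forall>y. 0 \<le> \<psi> p y) \<and> (\<exists>K. closedin (surf X) K \<and> K \<subseteq> N p \<and> (\<forall>y. \<psi> p y \<noteq> 0 \<longrightarrow> y \<in> K))) \<and>
    (\<forall>y\<in>topspace (surf X). (\<Sum>p\<in>P. \<psi> p y) = 1)"
proof -
  have "\<forall>x\<in>topspace (surf X). \<exists>g. \<exists>K. fun_smooth g \<and> (\<forall>y. 0 \<le> g y) \<and> 0 < g x \<and> openin (surf X) {y \<in> topspace (surf X). 0 < g y} \<and>
    closedin (surf X) K \<and> K \<subseteq> N x \<and> (\<forall>y. g y \<noteq> 0 \<longrightarrow> y \<in> K)"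
    using local_bump N by simp
  then obtain g where "\<forall>x\<in>topspace (surf X). \<exists>K. fun_smooth (g x) \<and> (\<forall>y. 0 \<le> g x y) \<and> 0 < g x x \<and>
    openin (surf X) {y \<in> topspace (surf X). 0 < g x y} \<and>
    closedin (surf X) K \<and> K \<subseteq> N x \<and> (\<forall>y. g x y \<noteq> 0 \<longrightarrow> y \<in> K)"
    by (rule bchoice[THEN exE])
  then have g: "fun_smooth (g x)" "\<And>y. 0 \<le> g x y" "0 < g x x" "openin (surf X) {y \<in> topspace (surf X). 0 < g x y}"
    "\<exists>K. closedin (surf X) K \<and> K \<subseteq> N x \<and> (\<forall>y. g x y \<noteq> 0 \<longrightarrow> y \<in> K)"
    if "x \<in> topspace (surf X)" for x using that by simp_all
  let ?U = "\<lambda>x. {y \<in> topspace (surf X). 0 < g x y}"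
  have "\<exists>\<F>. finite \<F> \<and> \<F> \<subseteq> ?U ` topspace (surf X) \<and> topspace (surf X) \<subseteq> \<Union>\<F>"
  proof -
    have "\<forall>U\<in>?U ` topspace (surf X). openin (surf X) U" by (simp add: g(4))
    moreover have "topspace (surf X) \<subseteq> \<Union>(?U ` topspace (surf X))" by (auto simp: g(3))
    ultimately show ?thesis using c[unfolded compact_space_def compactin_def] by simp
  qed
  then obtain \<F> where F: "finite \<F>" "\<F> \<subseteq> ?U ` topspace (surf X)" "topspace (surf X) \<subseteq> \<Union>\<F>" by blast
  obtain P where P: "P \<subseteq> topspace (surf X)" "finite P" "\<F> = ?U ` P"
    using finite_subset_image[OF F(1,2)] by blast
  define S where "S y = (\<Sum>p\<in>P. g p y)" for y
  have S: "S y > 0" if y: "y \<in> topspace (surf X)" for y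
  proof -
    obtain p where "p \<in> P" "0 < g p y" using F(3) P(3) y by auto
    moreover have "\<And>p. p \<in> P \<Longrightarrow> 0 \<le> g p y" using g(2) P(1) by blast
    ultimately show ?thesis unfolding S_def by (intro sum_pos2[OF P(2)]) auto
  qed
  \<comment> \<open>The value 0 off the space lets positivity be claimed for every element of the
    type.\<close>
  define \<psi> where "\<psi> p y = (if y \<in> topspace (surf X) then g p y / S y else 0)" for p y
  have sS: "fun_smooth S" unfolding S_def[abs_def] by (rule fun_smooth_sum) (use g(1) P(1) in blast)
  have "fun_smooth (\<psi> p)" if p: "p \<in> P" for p
    unfolding fun_smooth_def
  proof
    fix j assume j: "j \<in> idx X"
    have "fun_smooth (\<lambda>y. g p y / S y)"
      by (rule fun_smooth_divide[OF _ sS]) (use g(1) P(1) p S in force)+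
    from smooth_on_cong[OF open_dom_single[OF j] _ fun_smoothD[OF this j]]
    show "smooth_on (dom_of X [j]) (\<lambda>\<zeta>. \<psi> p (coord_inv X j \<zeta>))"
      using coord_inv_topspace[OF j] by (simp add: \<psi>_def)
  qed
  moreover have "0 \<le> \<psi> p y" if p: "p \<in> P" for p y
  proof -
    have "0 \<le> g p y" using p P(1) g(2) by blast
    then show ?thesis using S[of y] by (simp add: \<psi>_def divide_nonneg_pos)
  qed
  moreover have "\<exists>K. closedin (surf X) K \<and> K \<subseteq> N p \<and> (\<forall>y. \<psi> p y \<noteq> 0 \<longrightarrow> y \<in> K)" if p: "p \<in> P" for p
  proof -
    obtain K where "closedin (surf X) K \<and> K \<subseteq> N p \<and> (\<forall>y. g p y \<noteq> 0 \<longrightarrow> y \<in> K)"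
      using g(5)[of p] p P(1) by blast
    then show ?thesis by (intro exI[of _ K]) (auto simp: \<psi>_def)
  qed
  moreover have "(\<Sum>p\<in>P. \<psi> p y) = 1" if y: "y \<in> topspace (surf X)" for y
    using S[OF y] y by (simp add: \<psi>_def S_def flip: sum_divide_distrib)
  ultimately show ?thesis using P(1,2) by (intro exI[of _ P] exI[of _ \<psi>]) simp
qed

lemma partition_of_unity_exists:
  assumes c: "compact_space (surf X)"
  shows "\<exists>\<rho>. partition_of_unity X \<rho>"
proof -
  have "\<forall>x\<in>topspace (surf X). \<exists>i. i \<in> idx X \<and> x \<in> patch X i" using topspace_covered by blast
  then obtain k where k: "\<forall>x\<in>topspace (surf X). k x \<in> idx X \<and> x \<in> patch X (k x)" by (rule bchoice[THEN exE])
  have nb: "openin (surf X) (patch X (k x)) \<and> x \<in> patch X (k x)" if "x \<in> topspace (surf X)" for x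
    using k patch_open that by blast
  have "\<exists>P \<psi>. finite P \<and> P \<subseteq> topspace (surf X) \<and>
    (\<forall>p\<in>P. fun_smooth (\<psi> p) \<and> (\<forall>y. 0 \<le> \<psi> p y) \<and> (\<exists>K. closedin (surf X) K \<and> K \<subseteq> patch X (k p) \<and> (\<forall>y. \<psi> p y \<noteq> 0 \<longrightarrow> y \<in> K))) \<and>
    (\<forall>y\<in>topspace (surf X). (\<Sum>p\<in>P. \<psi> p y) = 1)" by (rule smooth_partition[OF c]) (rule nb)
  then obtain P \<psi> where "finite P \<and> P \<subseteq> topspace (surf X) \<and>
    (\<forall>p\<in>P. fun_smooth (\<psi> p) \<and> (\<forall>y. 0 \<le> \<psi> p y) \<and> (\<exists>K. closedin (surf X) K \<and> K \<subseteq> patch X (k p) \<and> (\<forall>y. \<psi> p y \<noteq> 0 \<longrightarrow> y \<in> K))) \<and>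
    (\<forall>y\<in>topspace (surf X). (\<Sum>p\<in>P. \<psi> p y) = 1)" by (elim exE)
  then have P: "finite P" "P \<subseteq> topspace (surf X)" "\<And>p. p \<in> P \<Longrightarrow> fun_smooth (\<psi> p)" "\<And>p y. p \<in> P \<Longrightarrow> 0 \<le> \<psi> p y"
    "\<And>p. p \<in> P \<Longrightarrow> \<exists>K. closedin (surf X) K \<and> K \<subseteq> patch X (k p) \<and> (\<forall>y. \<psi> p y \<noteq> 0 \<longrightarrow> y \<in> K)"
    "\<And>y. y \<in> topspace (surf X) \<Longrightarrow> (\<Sum>p\<in>P. \<psi> p y) = 1" by simp_all
  \<comment> \<open>A partition of unity is indexed by charts, so the bumps supported in the chosen
    chart \<open>i\<close> are summed; finitely many bumps leave finitely many nonzero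
    \<open>\<rho> i\<close>.\<close>
  define \<rho> where "\<rho> i y = (\<Sum>p\<in>{p\<in>P. k p = i}. \<psi> p y)" for i y
  let ?I = "{i \<in> idx X. \<exists>x\<in>topspace (surf X). \<rho> i x \<noteq> 0}"
  have z: "\<rho> i y = 0" if "i \<notin> k ` P" for i y
  proof -
    have "{p \<in> P. k p = i} = {}" using that by blast
    then show ?thesis unfolding \<rho>_def by (simp only: sum.empty)
  qed
  have fin: "finite ?I" by (rule finite_subset[of _ "k ` P"]) (use P(1) z in blast)+
  have supp: "surf X closure_of {x \<in> topspace (surf X). \<rho> i x \<noteq> 0} \<subseteq> patch X i" for i
  proof -
    have "\<forall>p\<in>P. \<exists>K. closedin (surf X) K \<and> K \<subseteq> patch X (k p) \<and> (\<forall>y. \<psi> p y \<noteq> 0 \<longrightarrow> y \<in> K)" using P(5) by blast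
    then obtain K where K: "\<forall>p\<in>P. closedin (surf X) (K p) \<and> K p \<subseteq> patch X (k p) \<and> (\<forall>y. \<psi> p y \<noteq> 0 \<longrightarrow> y \<in> K p)"
      by (rule bchoice[THEN exE])
    have "closedin (surf X) (\<Union>p\<in>{p \<in> P. k p = i}. K p)"
      by (rule closedin_Union) (use K P(1) in auto)
    moreover have "{x \<in> topspace (surf X). \<rho> i x \<noteq> 0} \<subseteq> (\<Union>p\<in>{p \<in> P. k p = i}. K p)"
    proof clarify
      fix x assume "\<rho> i x \<noteq> 0"
      then obtain p where "p \<in> {p \<in> P. k p = i}" "\<psi> p x \<noteq> 0" unfolding \<rho>_def by (rule sum.not_neutral_contains_not_neutral)
      then show "x \<in> (\<Union>p\<in>{p \<in> P. k p = i}. K p)" using K by blast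
    qed
    ultimately have "surf X closure_of {x \<in> topspace (surf X). \<rho> i x \<noteq> 0} \<subseteq> (\<Union>p\<in>{p \<in> P. k p = i}. K p)"
      by (rule closure_of_minimal[rotated])
    then show ?thesis using K by blast
  qed
  have nn: "0 \<le> \<rho> i x" for i x unfolding \<rho>_def by (rule sum_nonneg) (use P(4) in blast)
  have sm: "fun_smooth (\<rho> i)" for i unfolding \<rho>_def[abs_def] by (rule fun_smooth_sum) (use P(3) in blast)
  have one: "(\<Sum>i\<in>?I. \<rho> i x) = 1" if x: "x \<in> topspace (surf X)" for x
  proof -
    have "(\<Sum>i\<in>?I. \<rho> i x) = (\<Sum>i\<in>k ` P. \<rho> i x)"
      by (rule sum.mono_neutral_left) (use P(1,2) z k x in \<open>auto\<close>)
    also have "\<dots> = (\<Sum>p\<in>P. \<psi> p x)"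
      unfolding \<rho>_def by (rule sum.image_gen[OF P(1), symmetric])
    finally show ?thesis using P(6)[OF x] by simp
  qed
  have "partition_of_unity X \<rho>"
    unfolding partition_of_unity_def
    by (intro conjI ballI fin nn supp one fun_smoothD[OF sm])
  then show ?thesis by (rule exI[of _ \<rho>])
qed

end

section \<open>Integrals of forms supported in a chart\<close>

lemma integral_support:
  fixes f :: "'v::euclidean_space \<Rightarrow> 'w::euclidean_space"
  assumes "S \<subseteq> T" "\<And>x. x \<in> T \<Longrightarrow> x \<notin> S \<Longrightarrow> f x = 0"
  shows "integral T f = integral S f" "f integrable_on T \<longleftrightarrow> f integrable_on S"
proof -
  have "(\<lambda>x. if x \<in> T then f x else 0) = (\<lambda>x. if x \<in> S then f x else 0)" by (rule ext) (use assms in auto)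
  then show "integral T f = integral S f" "f integrable_on T \<longleftrightarrow> f integrable_on S"
    by (metis integral_restrict_UNIV, metis integrable_restrict_UNIV)
qed

lemma triangle_hull:
  "(\<lambda>p. of_real (1 - fst p - snd p) * a + of_real (fst p) * b + of_real (snd p) * c) ` triangle = convex hull {a, b, c :: complex}"
proof -
  have "\<exists>p\<in>triangle. u *\<^sub>R a + v *\<^sub>R b + w *\<^sub>R c = of_real (1 - fst p - snd p) * a + of_real (fst p) * b + of_real (snd p) * c"
    if "0 \<le> u" "0 \<le> v" "0 \<le> w" "u + v + w = 1" for u v w
  proof -
    have "u = 1 - v - w" using that by simp
    then have "complex_of_real u = 1 - of_real v - of_real w" by simp
    then show ?thesis using that by (intro bexI[of _ "(v, w)"]) (auto simp: triangle_def scaleR_conv_of_real)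
  qed
  moreover have "\<exists>u v w. of_real (1 - fst p - snd p) * a + of_real (fst p) * b + of_real (snd p) * c = u *\<^sub>R a + v *\<^sub>R b + w *\<^sub>R c
      \<and> 0 \<le> u \<and> 0 \<le> v \<and> 0 \<le> w \<and> u + v + w = 1" if "p \<in> triangle" for p
    using that by (intro exI[of _ "1 - fst p - snd p"] exI[of _ "fst p"] exI[of _ "snd p"])
      (auto simp: triangle_def scaleR_conv_of_real)
  ultimately show ?thesis unfolding convex_hull_3 by (auto simp: image_iff)
qed

text \<open>The affine parametrization of the hull, written \<open>z -> a + p z + q cnj z\<close>,
  has determinant \<open>|p|^2 - |q|^2\<close>, which is \<open>Im (cnj (b - a) * (c - a))\<close>.
  Its positivity removes the absolute value and, since \<open>|p|\<close> and \<open>|q|\<close>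
  differ, also gives injectivity.\<close>

lemma affine_triangle_integral:
  assumes J: "Im (cnj (b - a) * (c - a)) > 0" and f: "continuous_on (convex hull {a, b, c}) f"
  shows "integral triangle (\<lambda>p. of_real (Im (cnj (b - a) * (c - a))) *
      f (of_real (1 - fst p - snd p) * a + of_real (fst p) * b + of_real (snd p) * c)) = (integral (convex hull {a, b, c}) f :: complex)"
proof -
  let ?e = "\<lambda>p::real \<times> real. Complex (fst p) (snd p)"
  let ?g = "\<lambda>z. a + of_real (Re z) * (b - a) + of_real (Im z) * (c - a)"
  let ?p = "((b - a) - \<i> * (c - a)) / 2" and ?q = "((b - a) + \<i> * (c - a)) / 2"
  have gp: "?g z = a + (?p * z + ?q * cnj z)" for z by (simp add: complex_eq_iff field_simps)
  have J': "(cmod ?p)\<^sup>2 - (cmod ?q)\<^sup>2 = Im (cnj (b - a) * (c - a))"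
    unfolding cmod_power2 by (simp add: power2_eq_square field_simps)
  have ge: "?g (?e x) = of_real (1 - fst x - snd x) * a + of_real (fst x) * b + of_real (snd x) * c" for x
    by (simp add: algebra_simps)
  let ?T = "?e ` triangle"
  have im: "?g ` ?T = convex hull {a, b, c}" unfolding triangle_hull[symmetric] image_image ge ..
  have le: "linear ?e" by (auto intro!: linearI simp: complex_eq_iff)
  have cT: "compact ?T"
    by (rule compact_continuous_image[OF _ compact_triangle])
       (use linear_continuous_on[of ?e triangle] le in \<open>simp add: linear_linear\<close>)
  have lin: "P * (z - w) = - (Q * cnj (z - w))" if "a + (P * z + Q * cnj z) = a + (P * w + Q * cnj w)" for P Q z w
    using that by (simp add: algebra_simps)
  have inj: "inj ?g"
  proof (rule injI)
    fix z w assume "?g z = ?g w"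
    then have "?p * (z - w) = - (?q * cnj (z - w))" unfolding gp by (rule lin)
    then have "cmod ?p * cmod (z - w) = cmod ?q * cmod (z - w)"
      by (metis complex_mod_cnj norm_minus_cancel norm_mult)
    moreover have "cmod ?p \<noteq> cmod ?q" using J J' by auto
    ultimately show "z = w" by auto
  qed
  have g: "(?g has_derivative (\<lambda>h. ?p * h + ?q * cnj h)) (at z within ?T)" for z
    unfolding gp by (auto intro!: derivative_eq_intros simp: fun_eq_iff mult.commute)
  have cg: "continuous_on ?T ?g" by (intro continuous_intros)
  have "integral (convex hull {a, b, c}) f = integral ?T (\<lambda>z. of_real \<bar>(cmod ?p)\<^sup>2 - (cmod ?q)\<^sup>2\<bar> * f (?g z))"
    using cov_complex[where p = "\<lambda>_. ?p" and q = "\<lambda>_. ?q" and f = f, OF cT g continuous_on_const continuous_on_const inj_on_subset[OF inj subset_UNIV]] f im by simp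
  also have "\<dots> = integral ?T (\<lambda>z. of_real (Im (cnj (b - a) * (c - a))) * f (?g z))"
    unfolding J' using J by simp
  also have "\<dots> = integral triangle (\<lambda>x. of_real (Im (cnj (b - a) * (c - a))) * f (?g (?e x)))"
  proof (rule integral_basis_bij[OF le _ _ compact_triangle refl])
    have "?e ` Basis = Basis" by (auto simp: Basis_prod_def Basis_complex_def complex_eq_iff image_Un)
    moreover have "inj_on ?e Basis" by (auto simp: inj_on_def complex_eq_iff prod_eq_iff)
    ultimately show "bij_betw ?e Basis Basis" by (simp add: bij_betw_def)
    show "?e x \<bullet> ?e b = x \<bullet> b" for x b by (simp add: inner_complex_def inner_prod_def)
    show "x \<in> triangle" if "?e x \<in> ?T" for x using that by (auto simp: complex_eq_iff)
    show "continuous_on ?T (\<lambda>z. of_real (Im (cnj (b - a) * (c - a))) * f (?g z))"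
      by (intro continuous_on_mult continuous_on_const continuous_on_compose2[OF f cg]) (use im in blast)
  qed
  finally show ?thesis unfolding ge by simp
qed

context rsurface
begin

lemma global_2formI:
  assumes "\<And>i. i \<in> idx X \<Longrightarrow> smooth_on (dom_of X [i]) (\<alpha> [i])"
    and "\<And>i j z. i \<in> idx X \<Longrightarrow> j \<in> idx X \<Longrightarrow> z \<in> dom_of X [j] \<Longrightarrow> coord_inv X j z \<in> patch X i \<Longrightarrow>
      \<alpha> [j] z = \<alpha> [i] (trans_fun X i j z) * (deriv (trans_fun X i j) z * cnj (deriv (trans_fun X i j) z))"
  shows "global_2form X \<alpha>"
  unfolding global_2form_def smooth_cochain_def
proof (intro conjI ballI)
  fix K assume "K \<in> tuples X 0"
  then obtain i where "K = [i]" "i \<in> idx X" by (auto simp: tuples_def length_Suc_conv)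
  then show "smooth_on (dom_of X K) (\<alpha> K)" using assms(1) by simp
next
  fix K z assume K: "K \<in> tuples X 1" "z \<in> dom_of X K"
  then obtain i j where ij: "K = [i, j]" "i \<in> idx X" "j \<in> idx X" by (auto simp: tuples_def length_Suc_conv)
  then have z: "z \<in> dom_of X [j]" "coord_inv X j z \<in> patch X i" using K(2) dom_of2 by auto
  have "pd (trans_fun X i j) z = deriv (trans_fun X i j) z" "pdb (trans_fun X i j) z = 0"
    using has_wirt_unique[OF has_wirt_field[OF trans_deriv[OF ij(2,3) z]]] by auto
  then show "cech pull2 X \<alpha> K z = 0"
    using assms(2)[OF ij(2,3) z] by (simp add: ij(1) cech_def Let_def del_nth_def pull2_def)
qed

definition fmult :: "('a \<Rightarrow> real) \<Rightarrow> ('i list \<Rightarrow> form2) \<Rightarrow> 'i list \<Rightarrow> form2" where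
  "fmult g \<alpha> K z = of_real (g (coord_inv X (last K) z)) * \<alpha> K z"

lemma global_2form_fmult:
  assumes g: "fun_smooth g" and \<alpha>: "global_2form X \<alpha>"
  shows "global_2form X (fmult g \<alpha>)"
proof (rule global_2formI)
  show "smooth_on (dom_of X [i]) (fmult g \<alpha> [i])" if "i \<in> idx X" for i
    unfolding fmult_def[abs_def]
    by (intro smooth_on_mult smooth_on_of_real global_2form_smooth[OF \<alpha>] open_dom_single that) (simp add: fun_smoothD g that)
  show "fmult g \<alpha> [j] z = fmult g \<alpha> [i] (trans_fun X i j z) * (deriv (trans_fun X i j) z * cnj (deriv (trans_fun X i j) z))"
    if "i \<in> idx X" "j \<in> idx X" "z \<in> dom_of X [j]" "coord_inv X j z \<in> patch X i" for i j z
    using global_2form_change[OF \<alpha> that] trans_mem(2)[OF that] by (simp add: fmult_def)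
qed

definition supported :: "('i list \<Rightarrow> form2) \<Rightarrow> 'a set \<Rightarrow> bool" where
  "supported \<alpha> K \<longleftrightarrow> (\<forall>i\<in>idx X. \<forall>z\<in>dom_of X [i]. coord_inv X i z \<notin> K \<longrightarrow> \<alpha> [i] z = 0)"

lemma supportedD: "supported \<alpha> K \<Longrightarrow> i \<in> idx X \<Longrightarrow> z \<in> dom_of X [i] \<Longrightarrow> coord_inv X i z \<notin> K \<Longrightarrow> \<alpha> [i] z = 0"
  by (simp add: supported_def)

lemma supported_fmult:
  assumes "\<And>y. y \<in> topspace (surf X) \<Longrightarrow> g y \<noteq> 0 \<Longrightarrow> y \<in> K" shows "supported (fmult g \<alpha>) K"
  unfolding supported_def fmult_def using assms coord_inv_topspace by fastforce

lemma supported_integral: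
  assumes \<alpha>: "global_2form X \<alpha>" and K: "compactin (surf X) K" "supported \<alpha> K" and i: "i \<in> idx X" "K \<subseteq> patch X i"
  shows "integral (dom_of X [i]) (\<alpha> [i]) = integral (coord X i ` K) (\<alpha> [i])" "\<alpha> [i] integrable_on dom_of X [i]"
proof -
  note c = compact_coord[OF i(1) K(1) i(2)]
  have z: "\<alpha> [i] z = 0" if "z \<in> dom_of X [i]" "z \<notin> coord X i ` K" for z
    using that by (intro supportedD[OF K(2) i(1)]) (auto simp: image_iff)
  show "integral (dom_of X [i]) (\<alpha> [i]) = integral (coord X i ` K) (\<alpha> [i])"
    by (rule integral_support(1)[OF c(2) z])
  have "\<alpha> [i] integrable_on coord X i ` K"
    by (rule compact_integral(2)[OF c(1) continuous_on_subset[OF smooth_on_continuous[OF global_2form_smooth[OF \<alpha> i(1)]] c(2)]])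
  then show "\<alpha> [i] integrable_on dom_of X [i]" using integral_support(2)[OF c(2) z] by simp
qed

text \<open>The real Jacobian of a holomorphic transition function is \<open>|\<phi>'|^2\<close>,
  exactly the factor in the transformation law of a global 2-form. Support in a compact subset of
  both patches confines the two integrals to corresponding compact sets.\<close>

lemma chart_integral_change:
  assumes \<alpha>: "global_2form X \<alpha>" and K: "compactin (surf X) K" "supported \<alpha> K"
    and i: "i \<in> idx X" "K \<subseteq> patch X i" and l: "l \<in> idx X" "K \<subseteq> patch X l"
  shows "integral (dom_of X [i]) (\<alpha> [i]) = integral (dom_of X [l]) (\<alpha> [l])"
proof -
  let ?S = "coord X l ` K" and ?g = "trans_fun X i l"
  note cl = compact_coord[OF l(1) K(1) l(2)] and ci = compact_coord[OF i(1) K(1) i(2)]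
  have mem: "z \<in> dom_of X [l]" "coord_inv X l z \<in> K" "coord_inv X l z \<in> patch X i" if "z \<in> ?S" for z
    using that l i by (auto simp: subset_iff)
  have im: "?g ` ?S = coord X i ` K" using l by (auto simp: trans_fun_def image_iff subset_iff)
  have inj: "inj_on ?g ?S"
  proof (rule inj_onI)
    fix z w assume zw: "z \<in> ?S" "w \<in> ?S" "?g z = ?g w"
    then have "coord_inv X l z = coord_inv X l w"
      using trans_mem(2)[OF i(1) l(1) mem(1,3)] by metis
    then show "z = w" using mem(1) zw coord_coord_inv by metis
  qed
  have d: "(?g has_derivative (\<lambda>h. deriv ?g z * h + 0 * cnj h)) (at z within ?S)" if "z \<in> ?S" for z
    using trans_deriv[OF i(1) l(1) mem(1,3)[OF that]] has_derivative_at_withinI by (fastforce simp: has_field_derivative_def)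
  have sub: "?S \<subseteq> dom_of X [i, l]" using mem dom_of2 i l by blast
  have "continuous_on ?S (deriv ?g)"
    using continuous_on_subset[OF holomorphic_on_imp_continuous_on[OF deriv_trans_holo[OF i(1) l(1)]] sub] .
  moreover have "continuous_on (?g ` ?S) (\<alpha> [i])"
    unfolding im by (rule continuous_on_subset[OF smooth_on_continuous[OF global_2form_smooth[OF \<alpha> i(1)]] ci(2)])
  ultimately have "integral (coord X i ` K) (\<alpha> [i]) = integral ?S (\<lambda>z. of_real \<bar>(cmod (deriv ?g z))\<^sup>2 - (cmod 0)\<^sup>2\<bar> * \<alpha> [i] (?g z))"
    using cov_complex[OF cl(1) d _ continuous_on_const inj, of "\<alpha> [i]"] im by simp
  also have "\<dots> = integral ?S (\<alpha> [l])"
  proof (rule integral_cong)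
    fix z assume z: "z \<in> ?S"
    have "of_real ((cmod (deriv ?g z))\<^sup>2) = deriv ?g z * cnj (deriv ?g z)" by (rule complex_norm_square)
    then show "of_real \<bar>(cmod (deriv ?g z))\<^sup>2 - (cmod 0)\<^sup>2\<bar> * \<alpha> [i] (?g z) = \<alpha> [l] z"
      using global_2form_change[OF \<alpha> i(1) l(1) mem(1,3)[OF z]] by (simp add: mult.commute)
  qed
  finally show ?thesis
    using supported_integral(1)[OF \<alpha> K i] supported_integral(1)[OF \<alpha> K l] by simp
qed

lemma xsmooth_coord_inv:
  fixes u :: "'v::euclidean_space \<Rightarrow> complex"
  assumes i: "i \<in> idx X" and u: "smooth_on UNIV u" "\<And>p. p \<in> T \<Longrightarrow> u p \<in> dom_of X [i]"
  shows "xsmooth T (\<lambda>p. coord_inv X i (u p))"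
  unfolding xsmooth_def
proof (intro ballI conjI impI)
  fix x assume x: "x \<in> T"
  show "coord_inv X i (u x) \<in> topspace (surf X)" using coord_inv_topspace i u(2)[OF x] by simp
  fix j assume j: "j \<in> idx X" "coord_inv X i (u x) \<in> patch X j"
  have o: "open (u -` dom_of X [j, i])"
    using continuous_open_preimage[OF smooth_on_continuous[OF u(1)] open_UNIV open_dom2[OF j(1) i]] by simp
  have "smooth_on (u -` dom_of X [j, i]) (\<lambda>p. trans_fun X j i (u p))"
    by (rule smooth_on_compose[OF o trans_smooth[OF j(1) i] smooth_on_subset[OF u(1)]]) auto
  moreover have "x \<in> u -` dom_of X [j, i]" using dom_of2[OF j(1) i] j u(2)[OF x] by simp
  ultimately show "\<exists>W G. open W \<and> x \<in> W \<and> smooth_on W G \<and>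
      (\<forall>y\<in>T \<inter> W. coord_inv X i (u y) \<in> patch X j \<and> coord X j (coord_inv X i (u y)) = G y)"
    using o dom_of2[OF j(1) i]
    by (intro exI[of _ "u -` dom_of X [j, i]"] exI[of _ "\<lambda>p. trans_fun X j i (u p)"]) (simp add: trans_fun_def)
qed

text \<open>The constant is that of \<open>dz \<and> dzbar = -2i dx \<and> dy\<close>: on the edge
  vectors of the triangle the form \<open>dz \<and> dzbar\<close> takes the value \<open>-2i\<close>
  times the determinant \<open>Im (cnj (b - a) * (c - a))\<close>.\<close>

lemma int2_chart_triangle:
  assumes i: "i \<in> idx X" and h: "convex hull {a, b, c} \<subseteq> dom_of X [i]" and J: "Im (cnj (b - a) * (c - a)) > 0"
    and \<alpha>: "global_2form X \<alpha>"
  shows "int2 \<alpha> (chart_triangle X i a b c) = - 2 * \<i> * integral (convex hull {a, b, c}) (\<alpha> [i])"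
proof -
  let ?u = "\<lambda>p::real \<times> real. of_real (1 - fst p - snd p) * a + of_real (fst p) * b + of_real (snd p) * c"
  let ?w = "\<lambda>p. chart_triangle X i a b c (bary (fst p) (snd p))"
  have ud: "?u p \<in> dom_of X [i]" if "p \<in> triangle" for p using triangle_hull[of a b c] h that by blast
  have w: "?w p = coord_inv X i (?u p)" if "p \<in> triangle" for p
    using bary_simplex[of "fst p" "snd p"] that by (simp add: chart_triangle_def bary_def)
  have us: "smooth_on UNIV ?u"
    by (intro smooth_intros open_UNIV)
  have xs: "xsmooth triangle ?w" using xsmooth_cong[OF xsmooth_coord_inv[OF i us ud]] w by simp
  have "gdens \<alpha> triangle ?w (1, 0) (0, 1) x = - 2 * \<i> * (of_real (Im (cnj (b - a) * (c - a))) * \<alpha> [i] (?u x))"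
    if x: "x \<in> triangle" for x
  proof -
    have "(?u has_derivative (\<lambda>h. of_real (- fst h - snd h) * a + of_real (fst h) * b + of_real (snd h) * c)) (at x within triangle)"
      by (auto intro!: derivative_eq_intros)
    then have d: "((\<lambda>x. coord X i (?w x)) has_derivative (\<lambda>h. of_real (- fst h - snd h) * a + of_real (fst h) * b + of_real (snd h) * c)) (at x within triangle)"
      by (rule has_derivative_transform[OF x, rotated]) (simp only: w coord_coord_inv[OF ud])
    have wd: "wdir triangle (\<lambda>x. coord X i (?w x)) h x = of_real (- fst h - snd h) * a + of_real (fst h) * b + of_real (snd h) * c" for h
      by (rule wdir_eq[OF solid_triangle x d])
    have "(b - a) * cnj (c - a) - (c - a) * cnj (b - a) = - 2 * \<i> * of_real (Im (cnj (b - a) * (c - a)))"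
      by (simp add: complex_eq_iff algebra_simps)
    moreover have "gdens \<alpha> triangle ?w (1, 0) (0, 1) x = area_form (\<alpha> [i]) triangle (\<lambda>x. coord X i (?w x)) (1, 0) (0, 1) x"
      by (rule gdens_eq[OF solid_triangle xs x i _ \<alpha>]) (simp only: w x coord_inv_patch[OF ud[OF x]])
    moreover have "coord X i (?w x) = ?u x" by (simp only: w[OF x] coord_coord_inv[OF ud[OF x]])
    ultimately show ?thesis by (simp add: area_form_def wd)
  qed
  then have "int2 \<alpha> (chart_triangle X i a b c) = integral triangle (\<lambda>x. - 2 * \<i> * (of_real (Im (cnj (b - a) * (c - a))) * \<alpha> [i] (?u x)))"
    unfolding int2_def by (intro integral_cong)
  also have "\<dots> = - 2 * \<i> * integral triangle (\<lambda>x. of_real (Im (cnj (b - a) * (c - a))) * \<alpha> [i] (?u x))" by (rule integral_mult_right)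
  also have "\<dots> = - 2 * \<i> * integral (convex hull {a, b, c}) (\<alpha> [i])"
    unfolding affine_triangle_integral[OF J continuous_on_subset[OF smooth_on_continuous[OF global_2form_smooth[OF \<alpha> i]] h]] ..
  finally show ?thesis .
qed

lemma int2_zero:
  assumes \<sigma>: "smooth_simplex X 2 \<sigma>" and \<alpha>: "global_2form X \<alpha>" and K: "supported \<alpha> K"
    and d: "\<And>y. y \<in> standard_simplex 2 \<Longrightarrow> \<sigma> y \<notin> K"
  shows "int2 \<alpha> \<sigma> = 0"
proof -
  let ?w = "\<lambda>p. \<sigma> (bary (fst p) (snd p))"
  note w = xsmooth_bary[OF \<sigma>]
  have "gdens \<alpha> triangle ?w (1, 0) (0, 1) x = 0" if x: "x \<in> triangle" for x
  proof -
    obtain i where i: "i \<in> idx X" "?w x \<in> patch X i"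
      using topspace_covered[of "?w x"] w x by (auto simp: xsmooth_def)
    have "\<alpha> [i] (coord X i (?w x)) = 0"
      using supportedD[OF K i(1), of "coord X i (?w x)"] i d[OF bary_simplex, of "fst x" "snd x"] x by simp
    then show ?thesis using gdens_eq[OF solid_triangle w x i \<alpha>] by (simp add: area_form_def)
  qed
  then have "int2 \<alpha> \<sigma> = integral triangle (\<lambda>x. 0)" unfolding int2_def by (intro integral_cong)
  then show ?thesis by simp
qed

lemma int2_sum:
  assumes \<sigma>: "smooth_simplex X 2 \<sigma>" and \<alpha>: "\<And>p. p \<in> P \<Longrightarrow> global_2form X (\<beta> p)" and P: "finite P"
    and eq: "\<And>i z. i \<in> idx X \<Longrightarrow> z \<in> dom_of X [i] \<Longrightarrow> \<alpha> [i] z = (\<Sum>p\<in>P. \<beta> p [i] z)"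
  shows "int2 \<alpha> \<sigma> = (\<Sum>p\<in>P. int2 (\<beta> p) \<sigma>)"
proof -
  let ?w = "\<lambda>p. \<sigma> (bary (fst p) (snd p))"
  note w = xsmooth_bary[OF \<sigma>]
  have "gdens \<alpha> triangle ?w (1, 0) (0, 1) x = (\<Sum>p\<in>P. gdens (\<beta> p) triangle ?w (1, 0) (0, 1) x)" if x: "x \<in> triangle" for x
  proof -
    let ?i = "SOME i. i \<in> idx X \<and> ?w x \<in> patch X i"
    have "\<exists>i. i \<in> idx X \<and> ?w x \<in> patch X i"
      using topspace_covered[of "?w x"] w x by (auto simp: xsmooth_def)
    from someI_ex[OF this] have "?i \<in> idx X" "?w x \<in> patch X ?i" by auto
    then show ?thesis unfolding gdens_def Let_def area_form_def by (simp add: eq sum_distrib_right)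
  qed
  then have "int2 \<alpha> \<sigma> = integral triangle (\<lambda>x. \<Sum>p\<in>P. gdens (\<beta> p) triangle ?w (1, 0) (0, 1) x)"
    unfolding int2_def by (intro integral_cong)
  also have "\<dots> = (\<Sum>p\<in>P. int2 (\<beta> p) \<sigma>)"
    unfolding int2_def
    by (intro integral_sum P compact_integral(2)[OF compact_triangle] csmooth_continuous csmooth_gdens solid_triangle w \<alpha>)
  finally show ?thesis .
qed

end

section \<open>The surface integral and the fundamental cycle\<close>

locale compact_rsurface = rsurface X for X :: "('a, 'i) surface" +
  assumes compact: "compact_space (surf X)"
begin

text \<open>The very choice made inside \<open>surface_integral\<close>, so that the latter unfolds
  to a sum over this partition.\<close>

definition "pou = (SOME \<rho>. partition_of_unity X \<rho>)"
definition "I = {i \<in> idx X. \<exists>x\<in>topspace (surf X). pou i x \<noteq> 0}"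

lemma pou: "partition_of_unity X pou"
  unfolding pou_def by (rule someI_ex[OF partition_of_unity_exists[OF compact]])

lemma pou_props: "finite I" "I \<subseteq> idx X" "i \<in> idx X \<Longrightarrow> fun_smooth (pou i)"
  "x \<in> topspace (surf X) \<Longrightarrow> (\<Sum>i\<in>I. pou i x) = 1"
  using pou by (auto simp: partition_of_unity_def I_def fun_smooth_def)

lemma pou_support:
  assumes "i \<in> idx X"
  obtains K where "compactin (surf X) K" "K \<subseteq> patch X i" "\<And>\<alpha>. supported (fmult (pou i) \<alpha>) K"
proof -
  let ?K = "surf X closure_of {x \<in> topspace (surf X). pou i x \<noteq> 0}"
  have "compactin (surf X) ?K" using closedin_compact_space[OF compact closedin_closure_of] .
  moreover have "?K \<subseteq> patch X i" using pou assms by (simp add: partition_of_unity_def)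
  moreover have "{x \<in> topspace (surf X). pou i x \<noteq> 0} \<subseteq> ?K" by (rule closure_of_subset) auto
  then have "supported (fmult (pou i) \<alpha>) ?K" for \<alpha> by (intro supported_fmult) auto
  ultimately show ?thesis using that by blast
qed

lemma surface_integral_eq:
  "surface_integral X \<alpha> = (\<Sum>i\<in>I. - 2 * \<i> * integral (dom_of X [i]) (fmult (pou i) \<alpha> [i]))"
  unfolding surface_integral_def Let_def pou_def[symmetric] I_def[symmetric]
  by (intro sum.cong refl) (simp add: fmult_def[abs_def] mult.assoc)

text \<open>Each piece of the partition has compact support in its own patch and in
  \<open>patch X i\<close>, so it may be integrated in the coordinate \<open>i\<close>, where the
  pieces add up to the form.\<close>

lemma surface_integral_chart:
  assumes \<alpha>: "global_2form X \<alpha>" and K: "closedin (surf X) K" "K \<subseteq> patch X i" "supported \<alpha> K" and i: "i \<in> idx X"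
  shows "surface_integral X \<alpha> = - 2 * \<i> * integral (dom_of X [i]) (\<alpha> [i])"
proof -
  have l: "integral (dom_of X [l]) (fmult (pou l) \<alpha> [l]) = integral (dom_of X [i]) (fmult (pou l) \<alpha> [i])"
    "fmult (pou l) \<alpha> [i] integrable_on dom_of X [i]" if "l \<in> I" for l
  proof -
    have l: "l \<in> idx X" using that pou_props(2) by blast
    obtain M where M: "compactin (surf X) M" "M \<subseteq> patch X l" "\<And>\<alpha>. supported (fmult (pou l) \<alpha>) M"
      using pou_support[OF l] by blast
    have c: "compactin (surf X) (M \<inter> K)" by (rule compact_Int_closedin[OF M(1) K(1)])
    have s: "supported (fmult (pou l) \<alpha>) (M \<inter> K)"
      using M(3)[of \<alpha>] K(3) by (auto simp: supported_def fmult_def)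
    note gl = global_2form_fmult[OF pou_props(3)[OF l] \<alpha>]
    show "integral (dom_of X [l]) (fmult (pou l) \<alpha> [l]) = integral (dom_of X [i]) (fmult (pou l) \<alpha> [i])"
      by (rule chart_integral_change[OF gl c s l _ i]) (use M K in auto)
    show "fmult (pou l) \<alpha> [i] integrable_on dom_of X [i]"
      by (rule supported_integral(2)[OF gl c s i]) (use K in auto)
  qed
  have "integral (dom_of X [i]) (\<alpha> [i]) = integral (dom_of X [i]) (\<lambda>z. \<Sum>l\<in>I. fmult (pou l) \<alpha> [i] z)"
    by (rule integral_cong)
       (use pou_props(4)[OF coord_inv_topspace[OF i]] in \<open>simp add: fmult_def flip: sum_distrib_right of_real_sum\<close>)
  also have "\<dots> = (\<Sum>l\<in>I. integral (dom_of X [i]) (fmult (pou l) \<alpha> [i]))"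
    by (intro integral_sum pou_props l)
  finally show ?thesis unfolding surface_integral_eq by (simp add: l(1) sum_distrib_left)
qed

lemma surface_integral_sum:
  assumes \<beta>: "\<And>p. p \<in> P \<Longrightarrow> global_2form X (\<beta> p)" and P: "finite P"
    and eq: "\<And>i z. i \<in> idx X \<Longrightarrow> z \<in> dom_of X [i] \<Longrightarrow> \<alpha> [i] z = (\<Sum>p\<in>P. \<beta> p [i] z)"
  shows "surface_integral X \<alpha> = (\<Sum>p\<in>P. surface_integral X (\<beta> p))"
proof -
  have "integral (dom_of X [i]) (fmult (pou i) \<alpha> [i]) = (\<Sum>p\<in>P. integral (dom_of X [i]) (fmult (pou i) (\<beta> p) [i]))"
    if "i \<in> I" for i
  proof -
    have i: "i \<in> idx X" using that pou_props(2) by blast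
    obtain M where M: "compactin (surf X) M" "M \<subseteq> patch X i" "\<And>\<alpha>. supported (fmult (pou i) \<alpha>) M"
      using pou_support[OF i] by blast
    have int: "fmult (pou i) (\<beta> p) [i] integrable_on dom_of X [i]" if "p \<in> P" for p
      by (rule supported_integral(2)[OF global_2form_fmult[OF pou_props(3)[OF i] \<beta>[OF that]] M(1,3) i M(2)])
    have "integral (dom_of X [i]) (fmult (pou i) \<alpha> [i]) = integral (dom_of X [i]) (\<lambda>z. \<Sum>p\<in>P. fmult (pou i) (\<beta> p) [i] z)"
      by (rule integral_cong) (simp add: fmult_def eq i sum_distrib_left)
    also have "\<dots> = (\<Sum>p\<in>P. integral (dom_of X [i]) (fmult (pou i) (\<beta> p) [i]))"
      by (intro integral_sum P int)
    finally show ?thesis .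
  qed
  then show ?thesis
    unfolding surface_integral_eq by (subst sum.swap) (simp add: sum_distrib_left)
qed

theorem fundamental_integral:
  assumes s: "fundamental_cycle X s" and \<alpha>: "global_2form X \<alpha>"
  shows "fint (int2 \<alpha>) s = surface_integral X \<alpha>"
proof -
  have ex: "\<exists>N. openin (surf X) N \<and> x \<in> N \<and> (\<forall>\<beta> K. global_2form X \<beta> \<longrightarrow> closedin (surf X) K \<longrightarrow> K \<subseteq> N \<longrightarrow> supported \<beta> K \<longrightarrow>
      fint (int2 \<beta>) s = surface_integral X \<beta>)" if x: "x \<in> topspace (surf X)" for x
  proof -
    have "\<exists>i\<in>idx X. \<exists>a b c.
        x \<in> patch X i \<and> convex hull {a, b, c} \<subseteq> dom_of X [i] \<and>
        coord X i x \<in> interior (convex hull {a, b, c}) \<and> Im (cnj (b - a) * (c - a)) > 0 \<and>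
        (\<exists>B E. smooth_chain X 3 B \<and> smooth_chain X 2 E \<and>
           (\<forall>\<sigma>\<in>Poly_Mapping.keys E. x \<notin> \<sigma> ` standard_simplex 2) \<and>
           s - frag_of (chart_triangle X i a b c) = chain_boundary 3 B + E)"
      using s x unfolding fundamental_cycle_def by simp
    then obtain i a b c B E where i: "i \<in> idx X" and h: "x \<in> patch X i" "convex hull {a, b, c} \<subseteq> dom_of X [i]"
        "coord X i x \<in> interior (convex hull {a, b, c})" "Im (cnj (b - a) * (c - a)) > 0"
      and BE: "smooth_chain X 3 B" "smooth_chain X 2 E" "\<And>\<sigma>. \<sigma> \<in> Poly_Mapping.keys E \<Longrightarrow> x \<notin> \<sigma> ` standard_simplex 2"
        "s - frag_of (chart_triangle X i a b c) = chain_boundary 3 B + E" by blast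
    \<comment> \<open>The simplices of \<open>E\<close> are only known to avoid the point
      \<open>x\<close>. They are finitely many with compact images, so a whole neighbourhood of
      \<open>x\<close> avoids them.\<close>
    define Q where "Q = (\<Union>\<sigma>\<in>Poly_Mapping.keys E. \<sigma> ` standard_simplex 2)"
    define N where "N = {y \<in> patch X i. coord X i y \<in> interior (convex hull {a, b, c})} - Q"
    have "closedin (surf X) (\<sigma> ` standard_simplex 2)" if "\<sigma> \<in> Poly_Mapping.keys E" for \<sigma>
    proof (rule compactin_imp_closedin)
      show "Hausdorff_space (surf X)" using rs by (simp add: riemann_surface_def)
      have "continuous_map (subtopology (powertop_real UNIV) (standard_simplex 2)) (surf X) \<sigma>"
        using BE(2) that by (simp add: smooth_chain_def smooth_simplex_def singular_simplex_def)
      then show "compactin (surf X) (\<sigma> ` standard_simplex 2)"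
        by (rule image_compactin[rotated]) (simp add: compactin_subtopology compactin_standard_simplex)
    qed
    then have "closedin (surf X) Q" unfolding Q_def by (intro closedin_Union) auto
    then have "openin (surf X) N" unfolding N_def by (intro openin_diff openin_chart[OF i] open_interior)
    moreover have "x \<in> N" using h BE(3) by (auto simp: N_def Q_def)
    moreover have "fint (int2 \<beta>) s = surface_integral X \<beta>"
      if \<beta>: "global_2form X \<beta>" and K: "closedin (surf X) K" "K \<subseteq> N" "supported \<beta> K" for \<beta> K
    proof -
      have "s = frag_of (chart_triangle X i a b c) + (chain_boundary 3 B + E)" using BE(4) by (simp add: algebra_simps)
      then have "fint (int2 \<beta>) s = int2 \<beta> (chart_triangle X i a b c) + fint (int2 \<beta>) E"
        using stokes_3chain[OF BE(1) \<beta>] by (simp add: fint_add)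
      also have "fint (int2 \<beta>) E = fint (\<lambda>\<sigma>. 0) E"
      proof (rule fint_cong)
        fix \<sigma> assume \<sigma>: "\<sigma> \<in> Poly_Mapping.keys E"
        show "int2 \<beta> \<sigma> = 0"
          by (rule int2_zero[OF _ \<beta> K(3)]) (use \<sigma> BE(2) K(2) in \<open>auto simp: smooth_chain_def N_def Q_def\<close>)
      qed
      also have "fint (\<lambda>\<sigma>. 0) E = 0" by (simp add: fint_def)
      also have "int2 \<beta> (chart_triangle X i a b c) + 0 = - 2 * \<i> * integral (convex hull {a, b, c}) (\<beta> [i])"
        using int2_chart_triangle[OF i h(2,4) \<beta>] by simp
      also have "integral (convex hull {a, b, c}) (\<beta> [i]) = integral (dom_of X [i]) (\<beta> [i])"
      proof (rule integral_support(1)[OF h(2), symmetric])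
        fix z assume z: "z \<in> dom_of X [i]" "z \<notin> convex hull {a, b, c}"
        then have "coord_inv X i z \<notin> N" using interior_subset by (auto simp: N_def)
        then show "\<beta> [i] z = 0" using supportedD[OF K(3) i z(1)] K(2) by blast
      qed
      also have "- 2 * \<i> * integral (dom_of X [i]) (\<beta> [i]) = surface_integral X \<beta>"
        by (rule surface_integral_chart[OF \<beta> K(1) _ K(3) i, symmetric]) (use K(2) N_def in blast)
      finally show ?thesis .
    qed
    ultimately show ?thesis by (intro exI[of _ N]) simp
  qed
  then have "\<forall>x\<in>topspace (surf X). \<exists>N. openin (surf X) N \<and> x \<in> N \<and> (\<forall>\<beta> K. global_2form X \<beta> \<longrightarrow> closedin (surf X) K \<longrightarrow> K \<subseteq> N \<longrightarrow> supported \<beta> K \<longrightarrow>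
      fint (int2 \<beta>) s = surface_integral X \<beta>)" by simp
  then obtain N where N: "\<forall>x\<in>topspace (surf X). openin (surf X) (N x) \<and> x \<in> N x \<and> (\<forall>\<beta> K. global_2form X \<beta> \<longrightarrow> closedin (surf X) K \<longrightarrow> K \<subseteq> N x \<longrightarrow> supported \<beta> K \<longrightarrow>
      fint (int2 \<beta>) s = surface_integral X \<beta>)" by (rule bchoice[THEN exE])
  have "\<exists>P \<psi>. finite P \<and> P \<subseteq> topspace (surf X) \<and>
    (\<forall>p\<in>P. fun_smooth (\<psi> p) \<and> (\<forall>y. 0 \<le> \<psi> p y) \<and> (\<exists>K. closedin (surf X) K \<and> K \<subseteq> N p \<and> (\<forall>y. \<psi> p y \<noteq> 0 \<longrightarrow> y \<in> K))) \<and>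
    (\<forall>y\<in>topspace (surf X). (\<Sum>p\<in>P. \<psi> p y) = 1)" by (rule smooth_partition[OF compact]) (simp add: N)
  then obtain P \<psi> where "finite P \<and> P \<subseteq> topspace (surf X) \<and>
    (\<forall>p\<in>P. fun_smooth (\<psi> p) \<and> (\<forall>y. 0 \<le> \<psi> p y) \<and> (\<exists>K. closedin (surf X) K \<and> K \<subseteq> N p \<and> (\<forall>y. \<psi> p y \<noteq> 0 \<longrightarrow> y \<in> K))) \<and>
    (\<forall>y\<in>topspace (surf X). (\<Sum>p\<in>P. \<psi> p y) = 1)" by (elim exE)
  then have P: "finite P" "P \<subseteq> topspace (surf X)" "\<And>p. p \<in> P \<Longrightarrow> fun_smooth (\<psi> p)"
    "\<And>p. p \<in> P \<Longrightarrow> \<exists>K. closedin (surf X) K \<and> K \<subseteq> N p \<and> (\<forall>y. \<psi> p y \<noteq> 0 \<longrightarrow> y \<in> K)"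
    "\<And>y. y \<in> topspace (surf X) \<Longrightarrow> (\<Sum>p\<in>P. \<psi> p y) = 1" by simp_all
  let ?\<beta> = "\<lambda>p. fmult (\<psi> p) \<alpha>"
  have \<beta>: "global_2form X (?\<beta> p)" if "p \<in> P" for p by (rule global_2form_fmult[OF P(3)[OF that] \<alpha>])
  have eq: "\<alpha> [i] z = (\<Sum>p\<in>P. ?\<beta> p [i] z)" if "i \<in> idx X" "z \<in> dom_of X [i]" for i z
    using P(5)[OF coord_inv_topspace[OF that]] by (simp add: fmult_def flip: sum_distrib_right of_real_sum)
  have loc: "fint (int2 (?\<beta> p)) s = surface_integral X (?\<beta> p)" if p: "p \<in> P" for p
  proof -
    obtain K where K: "closedin (surf X) K" "K \<subseteq> N p" "\<And>y. \<psi> p y \<noteq> 0 \<Longrightarrow> y \<in> K" using P(4)[OF p] by blast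
    have "supported (?\<beta> p) K" by (rule supported_fmult) (rule K(3))
    then show ?thesis using N p P(2) \<beta>[OF p] K(1,2) by blast
  qed
  have "fint (int2 \<alpha>) s = fint (\<lambda>\<sigma>. \<Sum>p\<in>P. int2 (?\<beta> p) \<sigma>) s"
    by (rule fint_cong, rule int2_sum[OF _ \<beta> P(1) eq])
       (use s in \<open>auto simp: fundamental_cycle_def smooth_chain_def\<close>)
  also have "\<dots> = (\<Sum>p\<in>P. fint (int2 (?\<beta> p)) s)"
    unfolding fint_def by (subst sum.swap) (simp add: sum_distrib_left)
  also have "\<dots> = (\<Sum>p\<in>P. surface_integral X (?\<beta> p))" by (intro sum.cong refl loc)
  also have "\<dots> = surface_integral X \<alpha>" by (rule surface_integral_sum[OF \<beta> P(1) eq, symmetric])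
  finally show ?thesis .
qed

end

section \<open>Variations supported in a chart\<close>

text \<open>Multiplicativity of the real determinant under composition, in Wirtinger
  coefficients.\<close>

lemma jacobian_mult:
  fixes P Q p q :: complex
  shows "(cmod (P * p + Q * cnj q))\<^sup>2 - (cmod (P * q + Q * cnj p))\<^sup>2 = ((cmod P)\<^sup>2 - (cmod Q)\<^sup>2) * ((cmod p)\<^sup>2 - (cmod q)\<^sup>2)"
  unfolding cmod_power2 by (simp add: power2_eq_square algebra_simps)

lemma jacobian_pos_compose:
  fixes P Q p q :: complex
  assumes "cmod Q < cmod P" "cmod q < cmod p"
  shows "cmod (P * q + Q * cnj p) < cmod (P * p + Q * cnj q)"
proof (rule power2_less_imp_less)
  have "(cmod Q)\<^sup>2 < (cmod P)\<^sup>2" "(cmod q)\<^sup>2 < (cmod p)\<^sup>2" using assms by (simp_all add: power_strict_mono)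
  then have "0 < ((cmod P)\<^sup>2 - (cmod Q)\<^sup>2) * ((cmod p)\<^sup>2 - (cmod q)\<^sup>2)" by simp
  then show "(cmod (P * q + Q * cnj p))\<^sup>2 < (cmod (P * p + Q * cnj q))\<^sup>2" using jacobian_mult[of P p Q q] by linarith
qed simp

text \<open>The derivative of \<open>k\<close> is the inverse matrix of the derivative of
  \<open>g\<close>, evaluated at \<open>k\<close>. Since its coefficients are smooth functions of
  the point, class \<open>C^n\<close> of \<open>k\<close> yields class \<open>C^(n+1)\<close>,
  starting from continuity.\<close>

lemma smooth_inverse_map:
  fixes g k :: "complex \<Rightarrow> complex"
  assumes g: "smooth_on UNIV g" and k: "continuous_on UNIV k" "\<And>w. g (k w) = w"
    and J: "\<And>w. cmod (pdb g w) < cmod (pd g w)"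
  shows "smooth_on UNIV k"
proof -
  let ?J = "\<lambda>w. pd g w * cnj (pd g w) - pdb g w * cnj (pdb g w)"
  \<comment> \<open>Wirtinger coefficients of the inverse of the real-linear map
    \<open>h -> P h + Q cnj h\<close>.\<close>
  let ?p = "\<lambda>w. cnj (pd g w) / ?J w" and ?q = "\<lambda>w. - pdb g w / ?J w"
  have J0: "?J w \<noteq> 0" for w
  proof -
    have "(cmod (pdb g w))\<^sup>2 < (cmod (pd g w))\<^sup>2" using J by (simp add: power_strict_mono)
    moreover have "?J w = of_real ((cmod (pd g w))\<^sup>2 - (cmod (pdb g w))\<^sup>2)" by (simp only: of_real_diff complex_norm_square)
    ultimately show ?thesis by (simp only: of_real_eq_0_iff)
  qed
  have s: "smooth_on UNIV ?p" "smooth_on UNIV ?q"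
    by (intro smooth_on_divide smooth_on_diff smooth_on_mult smooth_on_minus smooth_on_cnj smooth_on_pd smooth_on_pdb open_UNIV g J0)+
  have d: "(k has_derivative (\<lambda>h. ?p (k w) * h + ?q (k w) * cnj h)) (at w)" for w
  proof (rule has_derivative_inverse_basic[OF _ _ _ _ open_UNIV UNIV_I])
    show "(g has_derivative (\<lambda>h. pd g (k w) * h + pdb g (k w) * cnj h)) (at (k w))"
      using has_wirt_pd[OF smooth_on_differentiable[OF g UNIV_I]] unfolding has_wirt_def .
    show "bounded_linear (\<lambda>h. ?p (k w) * h + ?q (k w) * cnj h)"
      by (intro bounded_linear_add bounded_linear_mult_right bounded_linear_compose[OF bounded_linear_mult_right bounded_linear_cnj])
    have inv: "cnj P / D * (P * h + Q * cnj h) + - Q / D * cnj (P * h + Q * cnj h) = h" if "D = P * cnj P - Q * cnj Q" "D \<noteq> 0" for P Q D h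
    proof -
      have "cnj P / D * (P * h + Q * cnj h) + - Q / D * cnj (P * h + Q * cnj h)
        = (cnj P * (P * h + Q * cnj h) - Q * cnj (P * h + Q * cnj h)) / D" by (simp add: diff_divide_distrib)
      also have "cnj P * (P * h + Q * cnj h) - Q * cnj (P * h + Q * cnj h) = D * h" by (simp add: that(1) algebra_simps)
      finally show ?thesis using that(2) by simp
    qed
    show "(\<lambda>h. ?p (k w) * h + ?q (k w) * cnj h) \<circ> (\<lambda>h. pd g (k w) * h + pdb g (k w) * cnj h) = id"
      by (rule ext, simp only: o_def id_def, rule inv[OF refl J0])
    show "continuous (at w) k" using k(1) by (simp add: continuous_on_eq_continuous_at)
  qed (rule k(2))
  have "Ck_on n UNIV k" for n
  proof (induction n)
    case (Suc n)
    have "Ck_on n UNIV ?p" "Ck_on n UNIV ?q" using s by (simp_all add: smooth_on_def)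
    from this[THEN Ck_on_compose[OF open_UNIV _ Suc UNIV_I]]
    have "Ck_on n UNIV (\<lambda>w. ?p (k w) * b + ?q (k w) * cnj b)" for b
      by (intro Ck_on_add open_UNIV Ck_on_bounded_linear[OF bounded_linear_mult_left])
    then show ?case by (intro Ck_on_SucI'[OF open_UNIV d])
  qed (simp add: k)
  then show ?thesis by (simp add: smooth_on_def)
qed

text \<open>For small \<open>t\<close> the map \<open>t \<beta>\<close> is Lipschitz with constant
  1/2: Banach's fixed point theorem gives surjectivity, the triangle inequality gives injectivity
  and a Lipschitz inverse, and the inverse is then smooth by
  \<open>smooth_inverse_map\<close>.\<close>

lemma flow_exists:
  fixes \<beta> :: "complex \<Rightarrow> complex"
  assumes \<beta>: "smooth_on UNIV \<beta>" and supp: "\<And>w. w \<notin> ball w0 r \<Longrightarrow> \<beta> w = 0"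
  shows "\<exists>\<epsilon>>0. \<forall>t. \<bar>t\<bar> < \<epsilon> \<longrightarrow> (\<forall>w. cmod (pdb (\<lambda>w. w + of_real t * \<beta> w) w) < cmod (pd (\<lambda>w. w + of_real t * \<beta> w) w)) \<and>
    (\<exists>k. smooth_on UNIV k \<and> (\<forall>w. k (w + of_real t * \<beta> w) = w) \<and> (\<forall>w. k w + of_real t * \<beta> (k w) = w))"
proof -
  let ?n = "\<lambda>w. cmod (pd \<beta> w) + cmod (pdb \<beta> w)"
  have wb: "has_wirt \<beta> (pd \<beta> w) (pdb \<beta> w) w" for w
    by (rule has_wirt_pd[OF smooth_on_differentiable[OF \<beta> UNIV_I]])
  \<comment> \<open>Off the closed ball \<open>\<beta>\<close> vanishes on a neighbourhood, so a
    bound for its differential on the compact ball is a global bound.\<close>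
  have z: "?n w = 0" if "w \<notin> cball w0 r" for w
  proof -
    have "0 = \<beta> y" if "y \<in> - cball w0 r" for y using supp[of y] that by simp
    then have "has_wirt \<beta> 0 0 w"
      by (rule has_wirt_cong[OF has_wirt_const[of 0], of "- cball w0 r", rotated -1]) (use that in auto)
    from has_wirt_unique[OF this] show ?thesis by simp
  qed
  have "continuous_on (cball w0 r) ?n"
    by (intro continuous_intros smooth_on_continuous smooth_on_subset[OF smooth_on_pd[OF open_UNIV \<beta>]] smooth_on_subset[OF smooth_on_pdb[OF open_UNIV \<beta>]]) auto
  then have "bounded (?n ` cball w0 r)" using compact_imp_bounded compact_continuous_image compact_cball by blast
  then obtain M where M: "M > 0" "\<And>w. w \<in> cball w0 r \<Longrightarrow> \<bar>?n w\<bar> \<le> M" unfolding bounded_pos by auto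
  have n: "?n w \<le> M" for w using M z[of w] by (cases "w \<in> cball w0 r") force+
  have lip: "cmod (\<beta> w - \<beta> w') \<le> M * cmod (w - w')" for w w'
  proof (rule differentiable_bound[OF convex_UNIV])
    fix w show "(\<beta> has_derivative (\<lambda>h. pd \<beta> w * h + pdb \<beta> w * cnj h)) (at w within UNIV)"
      using wb[of w] by (simp add: has_wirt_def)
    show "onorm (\<lambda>h. pd \<beta> w * h + pdb \<beta> w * cnj h) \<le> M"
    proof (rule onorm_le)
      fix h
      have "cmod (pd \<beta> w * h + pdb \<beta> w * cnj h) \<le> cmod (pd \<beta> w * h) + cmod (pdb \<beta> w * cnj h)" by (rule norm_triangle_ineq)
      also have "\<dots> = ?n w * cmod h" by (simp add: norm_mult distrib_right)
      also have "\<dots> \<le> M * cmod h" by (intro mult_right_mono n) simp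
      finally show "cmod (pd \<beta> w * h + pdb \<beta> w * cnj h) \<le> M * cmod h" .
    qed
  qed auto
  show ?thesis
  \<comment> \<open>\<open>M\<close> bounds the differential of \<open>\<beta>\<close>, so
    \<open>|t| * M < 1/2\<close> gives the contraction factor and keeps the Jacobian
    positive.\<close>
  proof (intro exI[of _ "1 / (2 * M)"] conjI allI impI)
    show "0 < 1 / (2 * M)" using M by simp
    fix t :: real assume t: "\<bar>t\<bar> < 1 / (2 * M)"
    then have tM: "\<bar>t\<bar> * M < 1 / 2" using M(1) by (simp add: field_simps)
    let ?g = "\<lambda>w. w + of_real t * \<beta> w"
    have lt: "cmod (of_real t * \<beta> w - of_real t * \<beta> w') \<le> 1 / 2 * cmod (w - w')" for w w'
    proof -
      have "cmod (of_real t * \<beta> w - of_real t * \<beta> w') = \<bar>t\<bar> * cmod (\<beta> w - \<beta> w')"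
        by (simp flip: right_diff_distrib add: norm_mult)
      also have "\<dots> \<le> \<bar>t\<bar> * (M * cmod (w - w'))" by (intro mult_left_mono lip) simp
      also have "\<dots> = (\<bar>t\<bar> * M) * cmod (w - w')" by simp
      also have "\<dots> \<le> 1 / 2 * cmod (w - w')" by (intro mult_right_mono) (use tM in auto)
      finally show ?thesis .
    qed
    have wg: "has_wirt ?g (1 + of_real t * pd \<beta> w) (of_real t * pdb \<beta> w) w" for w
      using has_wirt_add[OF has_wirt_ident has_wirt_mult[OF has_wirt_const[of "of_real t"] wb[of w]]] by simp
    show J: "cmod (pdb ?g w) < cmod (pd ?g w)" for w
    proof -
      have "\<bar>t\<bar> * ?n w \<le> \<bar>t\<bar> * M" by (intro mult_left_mono n) simp
      then have "cmod (of_real t * pd \<beta> w) + cmod (of_real t * pdb \<beta> w) < 1 / 2"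
        using tM by (simp add: norm_mult distrib_left)
      moreover have "1 - cmod (of_real t * pd \<beta> w) \<le> cmod (1 + of_real t * pd \<beta> w)"
        using norm_diff_ineq[of 1 "of_real t * pd \<beta> w"] by simp
      ultimately show ?thesis unfolding has_wirt_unique[OF wg] by linarith
    qed
    have inj: "1 / 2 * cmod (w - w') \<le> cmod (?g w - ?g w')" for w w'
    proof -
      have "?g w - ?g w' = (w - w') + (of_real t * \<beta> w - of_real t * \<beta> w')" by (simp add: algebra_simps)
      show ?thesis
        unfolding \<open>?g w - ?g w' = _\<close> using norm_diff_ineq[of "w - w'" "of_real t * \<beta> w - of_real t * \<beta> w'"] lt[of w w'] by linarith
    qed
    have "\<exists>w. ?g w = y" for y
    proof -
      have "\<exists>!w. y - of_real t * \<beta> w = w"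
      proof (rule banach_fix_type[of "1 / 2"])
        show "\<forall>w w'. dist (y - of_real t * \<beta> w) (y - of_real t * \<beta> w') \<le> 1 / 2 * dist w w'"
          using lt by (simp add: dist_norm norm_minus_commute)
      qed auto
      then obtain w where "y - of_real t * \<beta> w = w" by blast
      then have "?g w = y" by (metis diff_add_cancel)
      then show ?thesis ..
    qed
    then obtain k where k: "\<And>y. ?g (k y) = y" by metis
    have kg: "k (?g w) = w" for w using inj[of "k (?g w)" w] k[of "?g w"] by simp
    have "dist (k y) (k y') \<le> 2 * dist y y'" for y y' using inj[of "k y" "k y'"] by (simp add: k dist_norm)
    then have "2-lipschitz_on UNIV k" by (intro lipschitz_onI) auto
    then have ck: "continuous_on UNIV k" by (rule lipschitz_on_continuous_on)
    have "smooth_on UNIV k"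
      by (rule smooth_inverse_map[OF _ ck k J]) (intro smooth_intros open_UNIV \<beta>)
    then show "\<exists>k. smooth_on UNIV k \<and> (\<forall>w. k (?g w) = w) \<and> (\<forall>w. k w + of_real t * \<beta> (k w) = w)"
      using kg k by blast
  qed
qed

section \<open>Smooth families of maps between surfaces\<close>

definition smooth_family :: "real set \<Rightarrow> ('a, 'i) surface \<Rightarrow> ('b, 'i) surface \<Rightarrow> (real \<Rightarrow> 'a \<Rightarrow> 'b) \<Rightarrow> bool" where
  "smooth_family I A B H \<longleftrightarrow> continuous_map (prod_topology (top_of_set I) (surf A)) (surf B) (\<lambda>(t, x). H t x) \<and>
     (\<forall>i\<in>idx A. \<forall>j\<in>idx B. smooth_on {(t, \<zeta>). t \<in> I \<and> \<zeta> \<in> dom_of A [i] \<and> H t (coord_inv A i \<zeta>) \<in> patch B j}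
        (\<lambda>(t, \<zeta>). coord B j (H t (coord_inv A i \<zeta>))))"

lemma continuous_map_familyI:
  assumes m: "\<And>t x. t \<in> I \<Longrightarrow> x \<in> topspace T \<Longrightarrow> H t x \<in> topspace T'"
    and o: "\<And>U t x. openin T' U \<Longrightarrow> t \<in> I \<Longrightarrow> x \<in> topspace T \<Longrightarrow> H t x \<in> U \<Longrightarrow>
      \<exists>A B. open A \<and> t \<in> A \<and> openin T B \<and> x \<in> B \<and> (\<forall>t'\<in>A \<inter> I. \<forall>x'\<in>B. H t' x' \<in> U)"
  shows "continuous_map (prod_topology (top_of_set I) T) T' (\<lambda>(t::real, x). H t x)"
  unfolding continuous_map_def
proof (intro conjI allI impI)
  show "(\<lambda>(t, x). H t x) \<in> topspace (prod_topology (top_of_set I) T) \<rightarrow> topspace T'" using m by auto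
  fix U assume U: "openin T' U"
  show "openin (prod_topology (top_of_set I) T) {p \<in> topspace (prod_topology (top_of_set I) T). (\<lambda>(t, x). H t x) p \<in> U}"
    unfolding openin_prod_topology_alt
  proof (intro allI impI)
    fix t x assume tx: "(t, x) \<in> {p \<in> topspace (prod_topology (top_of_set I) T). (\<lambda>(t, x). H t x) p \<in> U}"
    then have tx': "t \<in> I" "x \<in> topspace T" "H t x \<in> U" by auto
    obtain A B where AB: "open A" "t \<in> A" "openin T B" "x \<in> B" "\<And>t' x'. t' \<in> A \<inter> I \<Longrightarrow> x' \<in> B \<Longrightarrow> H t' x' \<in> U"
      using o[OF U tx'] by blast
    have "openin (top_of_set I) (A \<inter> I)" using AB(1) by (metis openin_open_Int inf_commute)
    moreover have "(A \<inter> I) \<times> B \<subseteq> {p \<in> topspace (prod_topology (top_of_set I) T). (\<lambda>(t, x). H t x) p \<in> U}"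
      using AB(5) openin_subset[OF AB(3)] by auto
    ultimately show "\<exists>U' V. openin (top_of_set I) U' \<and> openin T V \<and> t \<in> U' \<and> x \<in> V \<and>
        U' \<times> V \<subseteq> {p \<in> topspace (prod_topology (top_of_set I) T). (\<lambda>(t, x). H t x) p \<in> U}"
      using AB tx'(1) by (intro exI[of _ "A \<inter> I"] exI[of _ B]) simp
  qed
qed

lemma smooth_family_slice:
  fixes A :: "('a, 'i) surface" and B :: "('b, 'i) surface"
  assumes A: "rsurface A" and B: "rsurface B" and I: "open I" "t \<in> I" and H: "smooth_family I A B H"
  shows "smooth_map A B (H t)"
  unfolding smooth_map_def
proof (intro conjI ballI)
  have c: "continuous_map (prod_topology (top_of_set I) (surf A)) (surf B) (\<lambda>(t, x). H t x)" using H by (simp add: smooth_family_def)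
  have "continuous_map (surf A) (prod_topology (top_of_set I) (surf A)) (\<lambda>x. (t, x))"
    using I(2) by (auto simp: continuous_map_pairwise o_def)
  from continuous_map_compose[OF this c] show "continuous_map (surf A) (surf B) (H t)" by (simp add: o_def)
  fix i j assume ij: "i \<in> idx A" "j \<in> idx B"
  let ?W = "{(t, \<zeta>). t \<in> I \<and> \<zeta> \<in> dom_of A [i] \<and> H t (coord_inv A i \<zeta>) \<in> patch B j}"
  have o: "open ?W" by (rule rsurface.open_family_preimage[OF A c I(1) ij(1) rsurface.patch_open[OF B ij(2)]])
  have "smooth_on ?W (\<lambda>(t, \<zeta>). coord B j (H t (coord_inv A i \<zeta>)))" using H ij by (simp add: smooth_family_def)
  from smooth_slice[OF o this, of t]
  show "smooth_on {\<zeta> \<in> dom_of A [i]. H t (coord_inv A i \<zeta>) \<in> patch B j} (\<lambda>\<zeta>. coord B j (H t (coord_inv A i \<zeta>)))"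
    using I(2) by simp
qed

lemma smooth_family_const:
  fixes A :: "('a, 'i) surface" and B :: "('b, 'i) surface"
  assumes A: "rsurface A" and B: "rsurface B" and I: "open I" and k: "smooth_map A B k"
  shows "smooth_family I A B (\<lambda>t. k)"
  unfolding smooth_family_def
proof (intro conjI ballI)
  have c: "continuous_map (surf A) (surf B) k" using k by (simp add: smooth_map_def)
  show ck: "continuous_map (prod_topology (top_of_set I) (surf A)) (surf B) (\<lambda>(t, x). k x)"
    using continuous_map_compose[OF continuous_map_snd c, of "top_of_set I"] by (simp add: o_def case_prod_unfold)
  fix i j assume ij: "i \<in> idx A" "j \<in> idx B"
  have o: "open {(t, \<zeta>). t \<in> I \<and> \<zeta> \<in> dom_of A [i] \<and> k (coord_inv A i \<zeta>) \<in> patch B j}"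
    by (rule rsurface.open_family_preimage[OF A ck I ij(1) rsurface.patch_open[OF B ij(2)]])
  have "smooth_on {\<zeta> \<in> dom_of A [i]. k (coord_inv A i \<zeta>) \<in> patch B j} (\<lambda>\<zeta>. coord B j (k (coord_inv A i \<zeta>)))"
    using k ij by (simp add: smooth_map_def)
  from smooth_on_compose[OF o this smooth_on_snd[OF o smooth_on_ident]]
  show "smooth_on {(t, \<zeta>). t \<in> I \<and> \<zeta> \<in> dom_of A [i] \<and> k (coord_inv A i \<zeta>) \<in> patch B j} (\<lambda>(t, \<zeta>). coord B j (k (coord_inv A i \<zeta>)))"
    by (auto simp: case_prod_unfold)
qed

lemma smooth_map_chart:
  "smooth_map A B f \<Longrightarrow> i \<in> idx A \<Longrightarrow> j \<in> idx B \<Longrightarrow>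
    smooth_on {\<zeta> \<in> dom_of A [i]. f (coord_inv A i \<zeta>) \<in> patch B j} (\<lambda>\<zeta>. coord B j (f (coord_inv A i \<zeta>)))"
  by (simp add: smooth_map_def)

lemma open_map_chart:
  assumes A: "rsurface A" and f: "smooth_map A B f" and i: "i \<in> idx A" and U: "openin (surf B) U"
  shows "open {\<zeta> \<in> dom_of A [i]. f (coord_inv A i \<zeta>) \<in> U}"
proof -
  have "openin (surf A) {x \<in> topspace (surf A). f x \<in> U}"
    by (rule openin_continuous_map_preimage[OF _ U]) (use f in \<open>simp add: smooth_map_def\<close>)
  from rsurface.open_chart_preimage[OF A i this]
  show ?thesis using rsurface.coord_inv_topspace[OF A i] by (simp cong: conj_cong)
qed

text \<open>Near a given point and time the composite factors through one chart of the middle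
  surface, where it is a composition of smooth functions of \<open>(t, z)\<close>.\<close>

lemma smooth_family_compose:
  fixes A :: "('a, 'i) surface" and B :: "('b, 'i) surface" and C :: "('c, 'i) surface"
  assumes A: "rsurface A" and B: "rsurface B" and C: "rsurface C" and I: "open I"
    and H: "smooth_family I B C H" and f: "smooth_map A B f"
  shows "smooth_family I A C (\<lambda>t x. H t (f x))"
  unfolding smooth_family_def
proof (intro conjI ballI)
  have c: "continuous_map (prod_topology (top_of_set I) (surf B)) (surf C) (\<lambda>(t, x). H t x)" using H by (simp add: smooth_family_def)
  have cf: "continuous_map (surf A) (surf B) f" using f by (simp add: smooth_map_def)
  have "continuous_map (prod_topology (top_of_set I) (surf A)) (prod_topology (top_of_set I) (surf B)) (\<lambda>(t, x). (t, f x))"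
    using continuous_map_compose[OF continuous_map_snd cf, of "top_of_set I"] continuous_map_fst[of "top_of_set I" "surf A"]
    by (simp add: continuous_map_pairwise o_def case_prod_unfold)
  from continuous_map_compose[OF this c] show "continuous_map (prod_topology (top_of_set I) (surf A)) (surf C) (\<lambda>(t, x). H t (f x))"
    by (simp add: o_def case_prod_unfold)
  fix i j assume ij: "i \<in> idx A" "j \<in> idx C"
  let ?r = "\<lambda>(t, \<zeta>). coord C j (H t (f (coord_inv A i \<zeta>)))"
  show "smooth_on {(t, \<zeta>). t \<in> I \<and> \<zeta> \<in> dom_of A [i] \<and> H t (f (coord_inv A i \<zeta>)) \<in> patch C j} ?r"
  proof (rule smooth_on_local, clarify)
    fix t \<zeta> assume t: "t \<in> I" and z: "\<zeta> \<in> dom_of A [i]" and p: "H t (f (coord_inv A i \<zeta>)) \<in> patch C j"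
    have "f (coord_inv A i \<zeta>) \<in> topspace (surf B)"
      using continuous_map_image_subset_topspace[OF cf] rsurface.coord_inv_topspace[OF A ij(1) z] by auto
    then obtain l where l: "l \<in> idx B" "f (coord_inv A i \<zeta>) \<in> patch B l" using rsurface.topspace_covered[OF B] by blast
    let ?D = "{\<zeta> \<in> dom_of A [i]. f (coord_inv A i \<zeta>) \<in> patch B l}" and ?a = "\<lambda>\<zeta>. coord B l (f (coord_inv A i \<zeta>))"
    let ?W = "{(t, w). t \<in> I \<and> w \<in> dom_of B [l] \<and> H t (coord_inv B l w) \<in> patch C j}"
    have oD: "open ?D" by (rule open_map_chart[OF A f ij(1) rsurface.patch_open[OF B l(1)]])
    have oW: "open ?W" by (rule rsurface.open_family_preimage[OF B c I l(1) rsurface.patch_open[OF C ij(2)]])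
    have sa: "smooth_on ?D ?a" by (rule smooth_map_chart[OF f ij(1) l(1)])
    have sW: "smooth_on ?W (\<lambda>(t, w). coord C j (H t (coord_inv B l w)))" using H l(1) ij(2) by (simp add: smooth_family_def)
    let ?T = "(UNIV \<times> ?D) \<inter> (\<lambda>p. (fst p, ?a (snd p))) -` ?W"
    have oUD: "open ((UNIV :: real set) \<times> ?D)" by (rule open_Times[OF open_UNIV oD])
    have sp: "smooth_on (UNIV \<times> ?D) (\<lambda>p. (fst p :: real, ?a (snd p)))"
      by (intro smooth_on_Pair oUD smooth_on_fst smooth_on_ident smooth_on_compose[OF oUD sa] smooth_on_snd) auto
    have oT: "open ?T" by (rule continuous_open_preimage[OF smooth_on_continuous[OF sp] oUD oW])
    have "smooth_on ?T (\<lambda>p. (\<lambda>(t, w). coord C j (H t (coord_inv B l w))) (fst p, ?a (snd p)))"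
      by (rule smooth_on_compose[OF oT sW smooth_on_subset[OF sp]]) auto
    then have "smooth_on ?T ?r"
      by (rule smooth_on_cong[OF oT, rotated]) (use rsurface.coord_inv_coord[OF B l(1)] in auto)
    moreover have "(t, \<zeta>) \<in> ?T" using t z p l rsurface.coord_inv_coord[OF B l] rsurface.coord_dom[OF B l(2)] by simp
    ultimately show "\<exists>T. open T \<and> (t, \<zeta>) \<in> T \<and> smooth_on T ?r" using oT by blast
  qed
qed

text \<open>Extends a map of one coordinate domain to the surface by the identity.\<close>

definition transplant :: "('a, 'i) surface \<Rightarrow> 'i \<Rightarrow> (complex \<Rightarrow> complex) \<Rightarrow> 'a \<Rightarrow> 'a" where
  "transplant X i \<phi> y = (if y \<in> patch X i then coord_inv X i (\<phi> (coord X i y)) else y)"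

text \<open>The chart and the complement of the compact, hence closed, image of \<open>C\<close>
  cover the surface; on the latter the map is the identity. Invariance of \<open>C\<close> keeps the
  moved points inside the chart.\<close>

lemma (in rsurface) smooth_family_transplant:
  assumes i: "i \<in> idx X" and I: "open I" and C: "compact C" "C \<subseteq> dom_of X [i]"
    and \<Psi>: "smooth_on (I \<times> UNIV) (\<lambda>p. \<Psi> (fst p) (snd p))"
    and fix': "\<And>t w. t \<in> I \<Longrightarrow> w \<notin> C \<Longrightarrow> \<Psi> t w = w" and maps: "\<And>t w. t \<in> I \<Longrightarrow> w \<in> C \<Longrightarrow> \<Psi> t w \<in> C"
  shows "smooth_family I X X (\<lambda>t. transplant X i (\<Psi> t))"
proof -
  let ?K = "coord_inv X i ` C" and ?H = "\<lambda>t. transplant X i (\<Psi> t)"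
  note K = compactin_chart(2)[OF i C]
  have dom: "\<Psi> t w \<in> dom_of X [i]" if "t \<in> I" "w \<in> dom_of X [i]" for t w
    using that C(2) fix' maps by (cases "w \<in> C") auto
  have off: "?H t y = y" if "t \<in> I" "y \<notin> ?K" for t y
  proof (cases "y \<in> patch X i")
    case True
    then have "coord X i y \<notin> C" using that(2) i by (metis coord_inv_coord image_eqI)
    then show ?thesis using that(1) fix' True i by (simp add: transplant_def)
  qed (simp add: transplant_def)
  have cPsi: "continuous_on (I \<times> UNIV) (\<lambda>p. \<Psi> (fst p) (snd p))" by (rule smooth_on_continuous[OF \<Psi>])
  have oIU: "open (I \<times> (UNIV :: complex set))" using I by (simp add: open_Times)
  show ?thesis
    unfolding smooth_family_def
  proof (intro conjI ballI)
    show "continuous_map (prod_topology (top_of_set I) (surf X)) (surf X) (\<lambda>(t, x). ?H t x)"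
    proof (rule continuous_map_familyI)
      show "?H t x \<in> topspace (surf X)" if "t \<in> I" "x \<in> topspace (surf X)" for t x
        using that dom coord_inv_topspace[OF i] by (simp add: transplant_def)
      fix U t x assume U: "openin (surf X) U" and t: "t \<in> I" and x: "x \<in> topspace (surf X)" and m: "?H t x \<in> U"
      show "\<exists>A B. open A \<and> t \<in> A \<and> openin (surf X) B \<and> x \<in> B \<and> (\<forall>t'\<in>A \<inter> I. \<forall>x'\<in>B. ?H t' x' \<in> U)"
      proof (cases "x \<in> patch X i")
        case True
        let ?V = "{z \<in> dom_of X [i]. coord_inv X i z \<in> U}"
        have o: "open ((I \<times> UNIV) \<inter> (\<lambda>p. \<Psi> (fst p) (snd p)) -` ?V)"
          by (rule continuous_open_preimage[OF cPsi oIU open_chart_preimage[OF i U]])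
        moreover have "(t, coord X i x) \<in> (I \<times> UNIV) \<inter> (\<lambda>p. \<Psi> (fst p) (snd p)) -` ?V"
          using t True m dom by (simp add: transplant_def)
        ultimately obtain A B where AB: "open A" "open B" "(t, coord X i x) \<in> A \<times> B"
          "A \<times> B \<subseteq> (I \<times> UNIV) \<inter> (\<lambda>p. \<Psi> (fst p) (snd p)) -` ?V" by (rule open_prod_elim)
        have "?H t' x' \<in> U" if "t' \<in> A \<inter> I" "x' \<in> {x \<in> patch X i. coord X i x \<in> B}" for t' x'
        proof -
          have "(t', coord X i x') \<in> A \<times> B" using that by simp
          then show ?thesis using AB(4) that by (auto simp: transplant_def)
        qed
        then show ?thesis using AB True openin_chart[OF i AB(2)]
          by (intro exI[of _ A] exI[of _ "{x \<in> patch X i. coord X i x \<in> B}"]) simp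
      next
        case False
        then have xK: "x \<notin> ?K" using C(2) by auto
        have "openin (surf X) (U - ?K)" by (rule openin_diff[OF U K])
        moreover have "x \<in> U - ?K" using m off[OF t xK] xK by simp
        moreover have "\<forall>t'\<in>UNIV \<inter> I. \<forall>x'\<in>U - ?K. ?H t' x' \<in> U" using off by simp
        ultimately show ?thesis using open_UNIV UNIV_I by (intro exI[of _ UNIV] exI[of _ "U - ?K"]) simp
      qed
    qed
    fix k j assume kj: "k \<in> idx X" "j \<in> idx X"
    let ?r = "\<lambda>(t, \<zeta>). coord X j (?H t (coord_inv X k \<zeta>))"
    show "smooth_on {(t, \<zeta>). t \<in> I \<and> \<zeta> \<in> dom_of X [k] \<and> ?H t (coord_inv X k \<zeta>) \<in> patch X j} ?r"
    proof (rule smooth_on_local, clarify)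
      fix t \<zeta> assume t: "t \<in> I" and z: "\<zeta> \<in> dom_of X [k]" and p: "?H t (coord_inv X k \<zeta>) \<in> patch X j"
      show "\<exists>T. open T \<and> (t, \<zeta>) \<in> T \<and> smooth_on T ?r"
      proof (cases "coord_inv X k \<zeta> \<in> patch X i")
        case True
        let ?D = "I \<times> dom_of X [i, k]" and ?b = "\<lambda>p. \<Psi> (fst p) (trans_fun X i k (snd p))"
        have oD: "open ?D" by (rule open_Times[OF I open_dom2[OF i kj(1)]])
        have "smooth_on ?D (\<lambda>p. (fst p, trans_fun X i k (snd p)))"
          by (intro smooth_on_Pair oD smooth_on_fst smooth_on_ident smooth_on_compose[OF oD trans_smooth[OF i kj(1)]] smooth_on_snd) auto
        from smooth_on_compose[OF oD \<Psi> this] have sb: "smooth_on ?D ?b" by auto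
        let ?T = "?D \<inter> ?b -` dom_of X [j, i]"
        have oT: "open ?T" by (rule continuous_open_preimage[OF smooth_on_continuous[OF sb] oD open_dom2[OF kj(2) i]])
        have "smooth_on ?T (\<lambda>p. trans_fun X j i (?b p))"
          by (rule smooth_on_compose[OF oT trans_smooth[OF kj(2) i] smooth_on_subset[OF sb]]) auto
        then have "smooth_on ?T ?r"
          by (rule smooth_on_cong[OF oT, rotated]) (use dom_of2[OF i kj(1)] in \<open>auto simp: transplant_def trans_fun_def\<close>)
        moreover have "(t, \<zeta>) \<in> ?T"
          using True t z p dom dom_of2[OF i kj(1)] dom_of2[OF kj(2) i] by (simp add: transplant_def trans_fun_def)
        ultimately show ?thesis using oT by blast
      next
        case False
        then have zK: "coord_inv X k \<zeta> \<notin> ?K" using C(2) by auto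
        let ?D = "{\<zeta> \<in> dom_of X [k]. coord_inv X k \<zeta> \<in> patch X j - ?K}"
        have oD: "open (I \<times> ?D)" by (rule open_Times[OF I open_chart_preimage[OF kj(1) openin_diff[OF patch_open[OF kj(2)] K]]])
        have "smooth_on (I \<times> ?D) (\<lambda>p. trans_fun X j k (snd p))"
          by (rule smooth_on_compose[OF oD trans_smooth[OF kj(2,1)]]) (use dom_of2[OF kj(2,1)] oD in \<open>auto intro!: smooth_on_snd smooth_on_ident\<close>)
        then have "smooth_on (I \<times> ?D) ?r"
          by (rule smooth_on_cong[OF oD, rotated]) (use off in \<open>auto simp: trans_fun_def\<close>)
        moreover have "(t, \<zeta>) \<in> I \<times> ?D" using t z p zK off[OF t zK] by simp
        ultimately show ?thesis using oD by blast
      qed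
    qed
  qed
qed

lemma (in rsurface) bij_transplant:
  assumes i: "i \<in> idx X" and g: "\<And>w. w \<in> dom_of X [i] \<Longrightarrow> g w \<in> dom_of X [i]" "\<And>w. w \<in> dom_of X [i] \<Longrightarrow> k w \<in> dom_of X [i]"
    and gk: "\<And>w. g (k w) = w" "\<And>w. k (g w) = w"
  shows "bij_betw (transplant X i g) (topspace (surf X)) (topspace (surf X))"
    "\<And>y. transplant X i g (transplant X i k y) = y" "\<And>y. transplant X i k (transplant X i g y) = y"
proof -
  show 1: "transplant X i g (transplant X i k y) = y" "transplant X i k (transplant X i g y) = y" for y
    using i g gk by (simp_all add: transplant_def)
  have "transplant X i l y \<in> topspace (surf X)" if "\<And>w. w \<in> dom_of X [i] \<Longrightarrow> l w \<in> dom_of X [i]" "y \<in> topspace (surf X)" for l y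
    using that coord_inv_topspace[OF i] by (simp add: transplant_def)
  then show "bij_betw (transplant X i g) (topspace (surf X)) (topspace (surf X))"
    using 1 g by (intro bij_betw_byWitness[where f' = "transplant X i k"]) auto
qed

lemma smooth_map_cong:
  assumes A: "rsurface A" and B: "rsurface B" and f: "smooth_map A B f" and eq: "\<And>x. x \<in> topspace (surf A) \<Longrightarrow> f x = g x"
  shows "smooth_map A B g"
  unfolding smooth_map_def
proof (intro conjI ballI)
  show "continuous_map (surf A) (surf B) g" using f eq by (auto simp: smooth_map_def intro: continuous_map_eq)
  fix i j assume ij: "i \<in> idx A" "j \<in> idx B"
  have e: "f (coord_inv A i \<zeta>) = g (coord_inv A i \<zeta>)" if "\<zeta> \<in> dom_of A [i]" for \<zeta>
    using eq rsurface.coord_inv_topspace[OF A ij(1) that] by simp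
  have s: "{\<zeta> \<in> dom_of A [i]. f (coord_inv A i \<zeta>) \<in> patch B j} = {\<zeta> \<in> dom_of A [i]. g (coord_inv A i \<zeta>) \<in> patch B j}" using e by auto
  show "smooth_on {\<zeta> \<in> dom_of A [i]. g (coord_inv A i \<zeta>) \<in> patch B j} (\<lambda>\<zeta>. coord B j (g (coord_inv A i \<zeta>)))"
    by (rule smooth_on_cong[OF open_map_chart[OF A f ij(1) rsurface.patch_open[OF B ij(2)], unfolded s] _
          smooth_map_chart[OF f ij, unfolded s]]) (use e in auto)
qed


section \<open>Derivatives of curves modulo \<open>\<int>(3)\<close>\<close>

lemma Zp_diff: "x \<in> Zp p \<Longrightarrow> y \<in> Zp p \<Longrightarrow> x - y \<in> Zp p"
  unfolding Zp_def by clarify (metis of_int_diff right_diff_distrib)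

text \<open>Nonzero elements have modulus at least \<open>(2 * pi) ^ 3\<close>.\<close>

lemma Zp_3_discrete:
  assumes "x \<in> Zp 3" "cmod x < 1" shows "x = 0"
proof -
  obtain k where k: "x = (2 * of_real pi * \<i>) ^ 3 * of_int k" using assms(1) by (auto simp: Zp_def)
  have "cmod x = (2 * pi) ^ 3 * \<bar>of_int k\<bar>" by (simp add: k norm_mult norm_power)
  moreover have "1 \<le> (2 * pi) ^ 3" using pi_ge_two by (intro one_le_power) simp
  moreover have "1 \<le> \<bar>real_of_int k\<bar>" if "k \<noteq> 0" using that by linarith
  ultimately have "k = 0" using assms(2) mult_mono[of 1 "(2 * pi) ^ 3" 1 "\<bar>real_of_int k\<bar>"] by fastforce
  then show ?thesis using k by simp
qed

lemma has_derivative_mod_Z3_unique: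
  assumes "has_derivative_mod_Z3 A a" "has_derivative_mod_Z3 A b" shows "a = b"
proof -
  obtain s where s: "\<forall>\<^sub>F t in nhds 0. A t = mod_Z3 (s t)" "(s has_vector_derivative a) (at 0)"
    using assms(1) unfolding has_derivative_mod_Z3_def by blast
  obtain r where r: "\<forall>\<^sub>F t in nhds 0. A t = mod_Z3 (r t)" "(r has_vector_derivative b) (at 0)"
    using assms(2) unfolding has_derivative_mod_Z3_def by blast
  let ?d = "\<lambda>t. s t - r t"
  have d: "(?d has_vector_derivative a - b) (at 0)" by (rule has_vector_derivative_diff[OF s(2) r(2)])
  have Z: "\<forall>\<^sub>F t in nhds 0. ?d t \<in> Zp 3"
    using s(1) r(1)
  proof eventually_elim
    fix t assume "A t = mod_Z3 (s t)" "A t = mod_Z3 (r t)"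
    moreover have "0 \<in> Zp 3" by (auto simp: Zp_def intro!: exI[of _ 0])
    then have "s t \<in> mod_Z3 (s t)" by (force simp: mod_Z3_def)
    ultimately have "s t \<in> mod_Z3 (r t)" by metis
    then obtain k where "s t = r t + k" "k \<in> Zp 3" by (auto simp: mod_Z3_def)
    then show "?d t \<in> Zp 3" by simp
  qed
  have "isCont ?d 0" using has_vector_derivative_continuous[OF d] .
  then have "(?d \<longlongrightarrow> ?d 0) (nhds 0)" by (rule tendsto_at_iff_tendsto_nhds[THEN iffD1, OF isContD])
  then have "\<forall>\<^sub>F t in nhds 0. dist (?d t) (?d 0) < 1" by (rule tendstoD) simp
  then have "\<forall>\<^sub>F t in nhds 0. ?d t = ?d 0"
    using Z
  proof eventually_elim
    fix t assume "dist (?d t) (?d 0) < 1" "?d t \<in> Zp 3"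
    then have "?d t - ?d 0 = 0"
      using Zp_3_discrete[OF Zp_diff[OF _ eventually_nhds_x_imp_x[OF Z]]] by (simp only: dist_norm)
    then show "?d t = ?d 0" by simp
  qed
  from has_vector_derivative_eventually[OF d this]
  have "((\<lambda>t. ?d 0) has_vector_derivative a - b) (at 0)" .
  from vector_derivative_unique_at[OF this has_vector_derivative_const] show ?thesis by simp
qed

lemma integral_pos:
  fixes g :: "complex \<Rightarrow> real"
  assumes D: "open D" and g: "continuous_on D g" "g integrable_on D" "\<And>z. z \<in> D \<Longrightarrow> 0 \<le> g z" and z0: "z0 \<in> D" "g z0 \<noteq> 0"
  shows "integral D g \<noteq> 0"
proof
  assume zero: "integral D g = 0"
  obtain a b where ab: "z0 \<in> box a b" "cbox a b \<subseteq> D" by (rule open_contains_cbox[OF D z0(1)])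
  have c: "continuous_on (cbox a b) g" using g(1) ab(2) by (rule continuous_on_subset)
  have i: "g integrable_on cbox a b" by (rule integrable_continuous[OF c])
  have "integral (cbox a b) g \<le> integral D g"
    by (rule integral_subset_le[OF ab(2) i g(2)]) (use g(3) in auto)
  moreover have "0 \<le> integral (cbox a b) g" by (rule integral_nonneg[OF i]) (use g(3) ab(2) in auto)
  ultimately have "(g has_integral 0) (cbox a b)" using zero integrable_integral[OF i] by simp
  then have "g z0 = 0"
    by (rule has_integral_0_cbox_imp_0[OF c, rotated]) (use g(3) ab box_subset_cbox[of a b] in auto)
  then show False using z0(2) by simp
qed

section \<open>Test variations and the Euler-Lagrange equation\<close>

context setting
begin

lemma variation_exists:
  assumes "vertical_variation X Y f F" shows "\<exists>e. variation X Y f L h F e"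
proof -
  have z: "\<forall>x\<in>topspace (surf X). F 0 x = f x" using assms by (simp add: vertical_variation_def)
  obtain e where "e > 0 \<and> (\<forall>t. \<bar>t\<bar> < e \<longrightarrow> oriented_diffeo X Y (F t)) \<and>
        continuous_map (prod_topology (top_of_set {-e<..<e}) (surf X)) (surf Y) (\<lambda>(t, x). F t x) \<and>
        (\<forall>i\<in>idx X. \<forall>j\<in>idx Y. smooth_on
           {(t, \<zeta>). \<bar>t\<bar> < e \<and> \<zeta> \<in> dom_of X [i] \<and> F t (coord_inv X i \<zeta>) \<in> patch Y j}
           (\<lambda>(t, \<zeta>). coord Y j (F t (coord_inv X i \<zeta>))))"
    using assms[unfolded vertical_variation_def, THEN conjunct2] by (elim exE)
  then have "variation X Y f L h F e"
    by (intro variation.intro setting_axioms variation_axioms.intro) (use z in simp_all)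
  then show ?thesis ..
qed

lemma f_bij: "bij_betw f (topspace (surf X)) (topspace (surf Y))" and f_smooth: "smooth_map X Y f"
  and finv_smooth: "smooth_map Y X (inv_into (topspace (surf X)) f)"
  and f_jacobian: "i \<in> idx X \<Longrightarrow> j \<in> idx Y \<Longrightarrow> \<zeta> \<in> dom_of X [i] \<Longrightarrow> f (coord_inv X i \<zeta>) \<in> patch Y j \<Longrightarrow>
    cmod (pdb (\<lambda>\<zeta>. coord Y j (f (coord_inv X i \<zeta>))) \<zeta>) < cmod (pd (\<lambda>\<zeta>. coord Y j (f (coord_inv X i \<zeta>))) \<zeta>)"
  using diffeo unfolding oriented_diffeo_def by auto

text \<open>Moving only the target by a perturbation of its identity inside one chart leaves the
  complex structures and the coordinates fixed. Bijectivity and orientation come from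
  \<open>flow_exists\<close>, smoothness of the inverse from transplanting the inverse
  perturbation.\<close>

lemma transplant_variation:
  fixes \<beta> :: "complex \<Rightarrow> complex"
  assumes l: "l \<in> idx X" and r: "cball w0 r \<subseteq> dom_of Y [l]" and \<beta>: "smooth_on UNIV \<beta>" and supp: "\<And>w. w \<notin> ball w0 r \<Longrightarrow> \<beta> w = 0"
  shows "vertical_variation X Y f (\<lambda>t x. transplant Y l (\<lambda>w. w + of_real t * \<beta> w) (f x))"
proof -
  let ?C = "cball w0 r" and ?g = "\<lambda>t w. w + of_real t * \<beta> w"
  let ?\<Phi> = "\<lambda>t. transplant Y l (?g t)"
  let ?F = "\<lambda>t x. ?\<Phi> t (f x)"
  have ly: "l \<in> idx Y" using l idx_eq by simp
  have X: "rsurface X" and Y: "rsurface Y" by unfold_locales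
  obtain \<epsilon> where \<epsilon>: "\<epsilon> > 0" and J: "\<And>t w. \<bar>t\<bar> < \<epsilon> \<Longrightarrow> cmod (pdb (?g t) w) < cmod (pd (?g t) w)"
    and inv: "\<And>t. \<bar>t\<bar> < \<epsilon> \<Longrightarrow> \<exists>k. smooth_on UNIV k \<and> (\<forall>w. k (?g t w) = w) \<and> (\<forall>w. k w + of_real t * \<beta> (k w) = w)"
    using flow_exists[OF \<beta> supp] by blast
  let ?I = "{-\<epsilon><..<\<epsilon>}"
  have I: "t \<in> ?I \<longleftrightarrow> \<bar>t\<bar> < \<epsilon>" for t by auto
  have oI: "open ?I" by simp
  have z: "\<beta> w = 0" if "w \<notin> ?C" for w using supp that by simp
  have maps: "?g t w \<in> ?C" if t: "t \<in> ?I" and w: "w \<in> ?C" for t w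
  proof (rule ccontr)
    assume n: "?g t w \<notin> ?C"
    obtain k where k: "\<And>w. k (?g t w) = w" using inv[of t] t unfolding I by blast
    \<comment> \<open>A point that has left the ball is fixed; by injectivity its preimage
      \<open>w\<close> equals it, although \<open>w\<close> lies in the ball.\<close>
    have "?g t (?g t w) = ?g t w" using z[OF n] by simp
    then have "k (?g t (?g t w)) = k (?g t w)" by (simp only:)
    then have "?g t w = w" by (simp only: k)
    then show False using n w by metis
  qed
  have gs: "smooth_on UNIV (?g t)" for t by (intro smooth_intros open_UNIV \<beta>)
  have dom: "?g t w \<in> dom_of Y [l]" if "t \<in> ?I" "w \<in> dom_of Y [l]" for t w
    using maps[OF that(1), of w] z[of w] r that(2) by (cases "w \<in> ?C") auto
  have oIU: "open (?I \<times> (UNIV :: complex set))" by (intro open_Times oI open_UNIV)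
  have fam: "smooth_family ?I Y Y ?\<Phi>"
  proof (rule sy.smooth_family_transplant[OF ly oI compact_cball r _ _ maps])
    show "smooth_on (?I \<times> UNIV) (\<lambda>p. snd p + of_real (fst p) * \<beta> (snd p))"
      by (intro smooth_intros oIU smooth_on_compose[OF oIU \<beta>]) auto
  qed (use z in auto)
  have famF: "smooth_family ?I X Y ?F" by (rule smooth_family_compose[OF X Y Y oI fam f_smooth])
  let ?K = "coord_inv Y l ` ?C"
  have K: "closedin (surf Y) ?K" by (rule sy.compactin_chart[OF ly compact_cball r])
  have off: "?\<Phi> t y = y" if "y \<notin> ?K" for t y
  proof (cases "y \<in> patch Y l")
    case True
    then have "coord Y l y \<notin> ?C" using that ly by (metis sy.coord_inv_coord image_eqI)
    then show ?thesis using z True ly by (simp add: transplant_def)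
  qed (simp add: transplant_def)
  have diffeoF: "oriented_diffeo X Y (?F t)" if t: "\<bar>t\<bar> < \<epsilon>" for t
  proof -
    have tI: "t \<in> ?I" using t I by simp
    obtain k where k: "smooth_on UNIV k" "\<And>w. k (?g t w) = w" "\<And>w. ?g t (k w) = w" using inv[OF t] by blast
    have kz: "k w = w" if "w \<notin> ?C" for w using k(2)[of w] z[OF that] by simp
    have kmaps: "k w \<in> ?C" if w: "w \<in> ?C" for w
    proof (rule ccontr)
      assume n: "k w \<notin> ?C"
      then have "?g t (k w) = k w" using z by simp
      then show False using k(3)[of w] n w by metis
    qed
    have kdom: "k w \<in> dom_of Y [l]" if "w \<in> dom_of Y [l]" for w
      using kmaps[of w] kz[of w] r that by (cases "w \<in> ?C") auto
    note bij = sy.bij_transplant[OF ly dom[OF tI] kdom k(3,2)]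
    have bF: "bij_betw (?F t) (topspace (surf X)) (topspace (surf Y))"
      using bij_betw_trans[OF f_bij bij(1)] by (simp add: o_def)
    have "smooth_family ?I Y Y (\<lambda>t. transplant Y l k)"
    proof (rule sy.smooth_family_transplant[OF ly oI compact_cball r])
      show "smooth_on (?I \<times> UNIV) (\<lambda>p. k (snd p))"
        by (rule smooth_on_compose[OF oIU k(1)]) (auto intro!: smooth_on_snd smooth_on_ident oIU)
    qed (use kz kmaps in auto)
    from smooth_family_slice[OF Y Y oI tI this] have sk: "smooth_map Y Y (transplant Y l k)" .
    let ?fi = "inv_into (topspace (surf X)) f"
    have si: "smooth_map Y X (\<lambda>y. ?fi (transplant Y l k y))"
      by (rule smooth_family_slice[OF Y X oI tI smooth_family_compose[OF Y Y X oI smooth_family_const[OF Y X oI finv_smooth] sk]])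
    have "smooth_map Y X (inv_into (topspace (surf X)) (?F t))"
    proof (rule smooth_map_cong[OF Y X si])
      fix y assume y: "y \<in> topspace (surf Y)"
      have ky: "transplant Y l k y \<in> topspace (surf Y)"
        using y kdom sy.coord_inv_topspace[OF ly] by (simp add: transplant_def)
      have "f (?fi (transplant Y l k y)) = transplant Y l k y" "?fi (transplant Y l k y) \<in> topspace (surf X)"
        using bij_betw_inv_into_right[OF f_bij ky] bij_betw_apply[OF bij_betw_inv_into[OF f_bij] ky] by auto
      then show "?fi (transplant Y l k y) = inv_into (topspace (surf X)) (?F t) y"
        using bij(2) inv_into_f_eq[OF bij_betw_imp_inj_on[OF bF], of "?fi (transplant Y l k y)" y] by simp
    qed
    moreover have "smooth_map X Y (?F t)" by (rule smooth_family_slice[OF X Y oI tI famF])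
    moreover have "cmod (pdb (\<lambda>\<zeta>. coord Y j (?F t (coord_inv X i \<zeta>))) \<zeta>) < cmod (pd (\<lambda>\<zeta>. coord Y j (?F t (coord_inv X i \<zeta>))) \<zeta>)"
      if i: "i \<in> idx X" and j: "j \<in> idx Y" and \<zeta>: "\<zeta> \<in> dom_of X [i]" and p: "?F t (coord_inv X i \<zeta>) \<in> patch Y j" for i j \<zeta>
    \<comment> \<open>When the image under \<open>f\<close> lies in \<open>patch Y l\<close>, the
      representative is \<open>f\<close> followed by the perturbation and a holomorphic transition,
      and the positive Jacobians multiply. Otherwise the image lies off the closed set
      \<open>?K\<close>, and near the point the perturbed map is \<open>f\<close> itself.\<close>
    proof (cases "f (coord_inv X i \<zeta>) \<in> patch Y l")
      case True
      let ?D = "{\<zeta> \<in> dom_of X [i]. f (coord_inv X i \<zeta>) \<in> patch Y l}" and ?a = "\<lambda>\<zeta>. coord Y l (f (coord_inv X i \<zeta>))"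
      have oD: "open ?D" by (rule open_map_chart[OF X f_smooth i sy.patch_open[OF ly]])
      have sa: "smooth_on ?D ?a" by (rule smooth_map_chart[OF f_smooth i ly])
      have zD: "\<zeta> \<in> ?D" using \<zeta> True by simp
      have wa: "has_wirt ?a (pd ?a \<zeta>) (pdb ?a \<zeta>) \<zeta>" by (rule has_wirt_pd[OF smooth_on_differentiable[OF sa zD]])
      have wg: "has_wirt (?g t) (pd (?g t) (?a \<zeta>)) (pdb (?g t) (?a \<zeta>)) (?a \<zeta>)"
        by (rule has_wirt_pd[OF smooth_on_differentiable[OF gs UNIV_I]])
      let ?P = "pd (?g t) (?a \<zeta>)" and ?Q = "pdb (?g t) (?a \<zeta>)" and ?p = "pd ?a \<zeta>" and ?q = "pdb ?a \<zeta>"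
      let ?d = "deriv (trans_fun Y j l) (?g t (?a \<zeta>))"
      have gd: "?g t (?a \<zeta>) \<in> dom_of Y [l]" "coord_inv Y l (?g t (?a \<zeta>)) \<in> patch Y j"
        using dom[OF tI] True p by (simp_all add: transplant_def)
      have "has_wirt (\<lambda>\<zeta>. trans_fun Y j l (?g t (?a \<zeta>))) (?d * (?P * ?p + ?Q * cnj ?q)) (?d * (?P * ?q + ?Q * cnj ?p)) \<zeta>"
        by (rule has_wirt_compose_field[OF sy.trans_deriv[OF j ly gd] has_wirt_compose[OF wg wa]])
      then have "has_wirt (\<lambda>\<zeta>. coord Y j (?F t (coord_inv X i \<zeta>))) (?d * (?P * ?p + ?Q * cnj ?q)) (?d * (?P * ?q + ?Q * cnj ?p)) \<zeta>"
        by (rule has_wirt_cong[OF _ oD zD]) (simp add: transplant_def trans_fun_def)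
      note u = has_wirt_unique[OF this]
      show ?thesis
        unfolding u norm_mult
        by (rule mult_strict_left_mono[OF jacobian_pos_compose[OF J[OF t] f_jacobian[OF i ly \<zeta> True]]])
           (use sy.trans_deriv_nz[OF j ly gd] in simp)
    next
      case False
      then have nK: "f (coord_inv X i \<zeta>) \<notin> ?K" using r by auto
      let ?D = "{\<zeta> \<in> dom_of X [i]. f (coord_inv X i \<zeta>) \<in> patch Y j - ?K}" and ?a = "\<lambda>\<zeta>. coord Y j (f (coord_inv X i \<zeta>))"
      have oD: "open ?D" by (rule open_map_chart[OF X f_smooth i openin_diff[OF sy.patch_open[OF j] K]])
      have sa: "smooth_on ?D ?a" by (rule smooth_on_subset[OF smooth_map_chart[OF f_smooth i j]]) auto
      have pj: "f (coord_inv X i \<zeta>) \<in> patch Y j" using p off[OF nK] by simp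
      have zD: "\<zeta> \<in> ?D" using \<zeta> pj nK by simp
      have "pd (\<lambda>\<zeta>. coord Y j (?F t (coord_inv X i \<zeta>))) \<zeta> = pd ?a \<zeta>" "pdb (\<lambda>\<zeta>. coord Y j (?F t (coord_inv X i \<zeta>))) \<zeta> = pdb ?a \<zeta>"
        by (rule pd_cong[OF oD _ sa zD]; simp add: off)+
      then show ?thesis using f_jacobian[OF i j \<zeta> pj] by simp
    qed
    ultimately show ?thesis using bF by (simp add: oriented_diffeo_def)
  qed
  have "?F 0 x = f x" for x using ly by (simp add: transplant_def)
  then show ?thesis
    unfolding vertical_variation_def
    using \<epsilon> diffeoF famF unfolding smooth_family_def I by (intro conjI exI[of _ \<epsilon>]) simp_all
qed

lemma el_variation:
  assumes comp: "compact_space (surf X)" and l: "l \<in> idx X" and z0: "z0 \<in> dom_of X [l]"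
    and ne: "D_op (h l) (beltrami (fl l)) z0 - pdb (h l) z0 \<noteq> 0"
  shows "\<exists>F. vertical_variation X Y f F \<and> surface_integral X (form_a X Y h f F) \<noteq> 0"
proof -
  have X: "rsurface X" and Y: "rsurface Y" by unfold_locales
  interpret cx: compact_rsurface X by unfold_locales (rule comp)
  have ly: "l \<in> idx Y" using l idx_eq by simp
  note oD = sx.open_dom_single[OF l]
  let ?D = "dom_of X [l]"
  \<comment> \<open>Taking \<open>u = \<partial>f\<close> makes the vector field equal to 1, so this
    is the Euler-Lagrange expression times 2, and its smoothness is an instance of
    \<open>smooth_el\<close>.\<close>
  define E where "E = el_form (fl l) (pd (fl l)) (h l)"
  have def1: "deformation ?D (fl l) (pd (fl l)) (h l)"
    using l by unfold_locales (auto simp: oD smooth_fl smooth_on_pd smooth_h pd_fl_nz)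
  have sE: "smooth_on ?D E" unfolding E_def by (rule deformation.smooth_el[OF def1])
  have E: "E z = - 2 * (pdb (h l) z - D_op (h l) (beltrami (fl l)) z)" if "z \<in> ?D" for z
    using pd_fl_nz[OF l that] by (simp add: E_def el_form_def vfield_def)
  \<comment> \<open>For the variation \<open>\<delta>f = \<beta> \<circ> f\<close> the vector field
    is \<open>(\<beta> \<circ> f) / \<partial>f\<close>, so the integrand becomes \<open>R\<close>
    times \<open>\<beta> \<circ> f\<close>.\<close>
  define R where "R z = E z / pd (fl l) z" for z
  have cR: "continuous_on ?D R"
    unfolding R_def[abs_def]
    by (rule smooth_on_continuous[OF smooth_on_divide[OF oD sE smooth_on_pd[OF oD smooth_fl[OF l]] pd_fl_nz[OF l]]])
  have R0: "R z0 \<noteq> 0" using E[OF z0] ne pd_fl_nz[OF l z0] by (simp add: R_def)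
  \<comment> \<open>Makes \<open>c * R\<close> equal to \<open>|R|^2\<close> at \<open>z0\<close>,
    hence of positive real part on the neighbourhood \<open>V\<close>.\<close>
  define c where "c = cnj (R z0)"
  have cRz0: "Re (c * R z0) > 0"
  proof -
    have "c * R z0 = of_real ((cmod (R z0))\<^sup>2)" unfolding c_def complex_norm_square by (rule mult.commute)
    then show ?thesis using R0 by simp
  qed
  define V where "V = ?D \<inter> (\<lambda>z. Re (c * R z)) -` {0<..}"
  have oV: "open V" unfolding V_def
    by (rule continuous_open_preimage[OF _ oD open_greaterThan]) (intro continuous_intros cR)
  let ?fi = "inv_into (topspace (surf X)) f"
  have fif: "?fi (f x) = x" if "x \<in> topspace (surf X)" for x using bij_betw_inv_into_left[OF f_bij that] .
  let ?U = "{x \<in> patch X l. coord X l x \<in> V}"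
  \<comment> \<open>The bump is a function of the target coordinate, so \<open>V\<close> is
    transported to the target by the inverse of \<open>f\<close>; a ball inside this set confines
    the integrand to \<open>V\<close>.\<close>
  let ?O = "{w \<in> dom_of Y [l]. ?fi (coord_inv Y l w) \<in> ?U}"
  have oO: "open ?O" by (rule open_map_chart[OF Y finv_smooth ly sx.openin_chart[OF l oV]])
  have fl_O: "fl l z \<in> ?O \<longleftrightarrow> z \<in> V" if "z \<in> ?D" for z
    using that fl_mem[OF l that] coord_inv_fl[OF l that] fif[OF sx.coord_inv_topspace[OF l that]] by simp
  have "fl l z0 \<in> ?O" using fl_O[OF z0] z0 cRz0 by (simp add: V_def)
  then obtain r where r: "r > 0" "cball (fl l z0) r \<subseteq> ?O" using oO open_contains_cball by blast
  let ?w0 = "fl l z0" and ?C = "cball (fl l z0) r"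
  have rC: "?C \<subseteq> dom_of Y [l]" using r(2) by auto
  define \<beta> where "\<beta> w = c * of_real (cbump ?w0 r w)" for w
  have s\<beta>: "smooth_on UNIV \<beta>" unfolding \<beta>_def[abs_def] by (intro smooth_intros open_UNIV cbump_smooth)
  have b0: "cbump ?w0 r w = 0" if "w \<notin> ball ?w0 r" for w
    using cbump_pos_iff[OF r(1), of ?w0 w] cbump_nonneg[of ?w0 r w] that by linarith
  have supp: "\<beta> w = 0" if "w \<notin> ball ?w0 r" for w using b0[OF that] by (simp add: \<beta>_def)
  define F where "F t x = transplant Y l (\<lambda>w. w + of_real t * \<beta> w) (f x)" for t x
  have vv: "vertical_variation X Y f F"
    using transplant_variation[OF l rC s\<beta> supp] unfolding F_def[abs_def] by simp
  then obtain e where e: "variation X Y f L h F e" using variation_exists by blast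
  interpret v: variation X Y f L h F e by (rule e)
  let ?K = "{x \<in> topspace (surf X). f x \<in> coord_inv Y l ` ?C}"
  have K: "closedin (surf X) ?K"
    by (rule closedin_continuous_map_preimage[OF _ sy.compactin_chart(2)[OF ly compact_cball rC]])
       (use f_smooth in \<open>simp add: smooth_map_def\<close>)
  have Kp: "?K \<subseteq> patch X l"
  proof
    fix x assume x: "x \<in> ?K"
    then have "f x \<in> patch Y l" using rC by auto
    then obtain x' where x': "x' \<in> patch X l" "f x = f x'" using patch_img l by auto
    then have "x = x'" using bij_betw_imp_inj_on[OF f_bij] x sx.patch_subset[OF l] by (auto dest: inj_onD)
    then show "x \<in> patch X l" using x' by simp
  qed
  have ul_off: "delta_rep X Y F i z = 0" if i: "i \<in> idx X" "z \<in> dom_of X [i]" "coord_inv X i z \<notin> ?K" for i z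
  proof -
    have "f (coord_inv X i z) \<notin> coord_inv Y l ` ?C" using that sx.coord_inv_topspace[OF i(1,2)] by simp
    then have "F t (coord_inv X i z) = f (coord_inv X i z)" for t
    proof (cases "f (coord_inv X i z) \<in> patch Y l")
      case True
      then have "coord Y l (f (coord_inv X i z)) \<notin> ?C"
        using \<open>f (coord_inv X i z) \<notin> coord_inv Y l ` ?C\<close> ly by (metis sy.coord_inv_coord image_eqI)
      then have "\<beta> (coord Y l (f (coord_inv X i z))) = 0" by (intro supp) simp
      then show ?thesis using True ly by (simp add: F_def transplant_def)
    qed (simp add: F_def transplant_def)
    then show ?thesis by (simp add: delta_rep_def local_rep_def)
  qed
  have sup: "supported (form_a X Y h f F) ?K" if "supported = rsurface.supported X" for supported
    unfolding that sx.supported_def by (simp add: form_a_def ul_off)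
  have ul: "delta_rep X Y F l z = \<beta> (fl l z)" if z: "z \<in> ?D" for z
  proof -
    have d: "((\<lambda>t. fl l z + of_real t * \<beta> (fl l z)) has_vector_derivative \<beta> (fl l z)) (at 0)"
      by (auto intro!: derivative_eq_intros simp: has_vector_derivative_def scaleR_conv_of_real)
    have "((\<lambda>t::real. fl l z + of_real t * \<beta> (fl l z)) \<longlongrightarrow> fl l z + of_real 0 * \<beta> (fl l z)) (nhds 0)"
      by (intro tendsto_intros filterlim_ident)
    then have "\<forall>\<^sub>F t in nhds 0. fl l z + of_real t * \<beta> (fl l z) \<in> dom_of Y [l]"
      by (rule topological_tendstoD[OF _ sy.open_dom_single[OF ly]]) (simp add: fl_mem[OF l z])
    then have "\<forall>\<^sub>F t in nhds 0. fl l z + of_real t * \<beta> (fl l z) = local_rep X Y (F t) l z"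
    proof eventually_elim
      fix t assume "fl l z + of_real t * \<beta> (fl l z) \<in> dom_of Y [l]"
      then show "fl l z + of_real t * \<beta> (fl l z) = local_rep X Y (F t) l z"
        using f_patch[OF l sx.coord_inv_patch[OF z]] by (simp add: local_rep_def F_def transplant_def)
    qed
    from vector_derivative_at[OF has_vector_derivative_eventually[OF d this]] show ?thesis unfolding delta_rep_def .
  qed
  let ?\<alpha> = "form_a X Y h f F"
  have \<alpha>: "?\<alpha> [l] z = of_real (cbump ?w0 r (fl l z)) * (c * R z)" if "z \<in> ?D" for z
    using E[OF that] by (simp add: form_a_def Let_def R_def ul[OF that] \<beta>_def mult_ac)
  let ?g = "\<lambda>z. Re (?\<alpha> [l] z)"
  have re: "Re (of_real s * x) = s * Re x" for s x by simp
  have cK: "compactin (surf X) ?K" by (rule closedin_compact_space[OF comp K])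
  have int: "?\<alpha> [l] integrable_on ?D" by (rule sx.supported_integral(2)[OF v.global_form_a cK sup[OF refl] l Kp])
  have "integral ?D ?g = Re (integral ?D (?\<alpha> [l]))"
    using integral_linear[OF int bounded_linear_Re] by (simp add: o_def)
  moreover have "integral ?D ?g \<noteq> 0"
  proof (rule integral_pos[OF oD _ _ _ z0])
    show "continuous_on ?D ?g"
      by (intro continuous_intros smooth_on_continuous[OF sx.global_2form_smooth[OF v.global_form_a l]])
    show "?g integrable_on ?D" using integrable_linear[OF int bounded_linear_Re] by (simp add: o_def)
    show "0 \<le> ?g z" if z: "z \<in> ?D" for z
    proof (cases "fl l z \<in> ball ?w0 r")
      case True
      then have "fl l z \<in> ?C" using ball_subset_cball by blast
      then have "z \<in> V" by (rule fl_O[OF z, THEN iffD1, OF subsetD[OF r(2)]])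
      then show ?thesis using cbump_nonneg[of ?w0 r "fl l z"] unfolding \<alpha>[OF z] re by (simp add: V_def del: times_complex.sel)
    next
      case False
      then show ?thesis unfolding \<alpha>[OF z] by (simp add: b0)
    qed
    show "?g z0 \<noteq> 0"
      using cRz0 cbump_pos_iff[OF r(1), of ?w0 ?w0] r(1) unfolding \<alpha>[OF z0] re by (simp del: times_complex.sel)
  qed
  ultimately have "surface_integral X ?\<alpha> \<noteq> 0"
    using cx.surface_integral_chart[OF v.global_form_a K Kp sup[OF refl] l] by auto
  then show ?thesis using vv by blast
qed

end

theorem theorem4p1p1:
  fixes X :: "('a, 'i::linorder) surface"
    and Y :: "('b, 'i) surface"
    and f :: "'a \<Rightarrow> 'b"
    and L h :: "'i \<Rightarrow> complex \<Rightarrow> complex"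
    and S0 S1 S2 :: "'i list \<Rightarrow>\<^sub>0 'a chain"
    and g :: nat
  assumes "riemann_surface X" and "compact_space (surf X)" and "has_genus X g" and "g > 1"
    and "good_cover X"
    and "riemann_surface Y" and "idx Y = idx X"
    and "oriented_diffeo X Y f" and "\<forall>i\<in>idx X. patch Y i = f ` patch X i"
    and "log_branches X" and "log_branches Y"
    and "\<forall>i\<in>idx X. log_branch (dom_of X [i]) (pd (local_rep X Y f i)) (L i)"
    and "tame_trivialization X" and "tame_trivialization Y"
    and "projective_connection X h"
    and "fundamental_chains X S0 S1 S2"
  shows
    "(\<forall>F. vertical_variation X Y f F \<longrightarrow>
        global_2form X (form_a X Y h f F) \<and>
        (\<exists>\<xi>. deligne_cochain2 X \<xi> \<and>
           has_cochain_derivative X (\<lambda>t. lag_Omega X Y h (F t) (continue_log X Y f L (F t)))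
             (add_top (\<lambda>K z. 2 * of_real pi * \<i> * form_a X Y h f F K z) (total_D X \<xi>))) \<and>
        has_derivative_mod_Z3
          (\<lambda>t. action X Y h S0 S1 S2 (F t) (continue_log X Y f L (F t)))
          (2 * of_real pi * \<i> * surface_integral X (form_a X Y h f F)))
     \<and>
     ((\<forall>F. vertical_variation X Y f F \<longrightarrow>
         has_derivative_mod_Z3 (\<lambda>t. action X Y h S0 S1 S2 (F t) (continue_log X Y f L (F t))) 0)
      \<longleftrightarrow> (\<forall>i\<in>idx X. \<forall>z\<in>dom_of X [i].
            D_op (h i) (beltrami (local_rep X Y f i)) z - pdb (h i) z = 0))"
proof -
  interpret st: setting X Y f L h by unfold_locales (use assms in simp_all)
  interpret cx: compact_rsurface X by unfold_locales (rule assms(2))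
  have first: "global_2form X (form_a X Y h f F) \<and>
        (\<exists>\<xi>. deligne_cochain2 X \<xi> \<and>
           has_cochain_derivative X (\<lambda>t. lag_Omega X Y h (F t) (continue_log X Y f L (F t)))
             (add_top (\<lambda>K z. 2 * of_real pi * \<i> * form_a X Y h f F K z) (total_D X \<xi>))) \<and>
        has_derivative_mod_Z3
          (\<lambda>t. action X Y h S0 S1 S2 (F t) (continue_log X Y f L (F t)))
          (2 * of_real pi * \<i> * surface_integral X (form_a X Y h f F))"
    if F: "vertical_variation X Y f F" for F
  proof -
    obtain e where e: "variation X Y f L h F e" using st.variation_exists[OF F] by blast
    interpret v: variation X Y f L h F e by (rule e)
    interpret av: action_variation X Y f L h F e S0 S1 S2 by unfold_locales (rule assms(16))
    have "fundamental_cycle X (\<Sum>K\<in>Poly_Mapping.keys S0. Poly_Mapping.lookup S0 K)"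
      using assms(16) by (simp add: fundamental_chains_def)
    from av.action_derivative[unfolded cx.fundamental_integral[OF this v.global_form_a]]
    show ?thesis using v.global_form_a v.deligne_xi v.cochain_derivative by blast
  qed
  \<comment> \<open>A form that vanishes in every chart is the empty sum of global 2-forms, so its
    integral is the empty sum.\<close>
  have zero: "surface_integral X (form_a X Y h f F) = 0"
    if "\<forall>i\<in>idx X. \<forall>z\<in>dom_of X [i]. D_op (h i) (beltrami (local_rep X Y f i)) z - pdb (h i) z = 0" for F
    using cx.surface_integral_sum[of "{}" "\<lambda>_. form_a X Y h f F" "form_a X Y h f F"] that
    by (simp add: form_a_def)
  show ?thesis
  proof (intro conjI allI impI iffI ballI)
    fix F assume "vertical_variation X Y f F"
    from first[OF this] show "global_2form X (form_a X Y h f F)"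
      "\<exists>\<xi>. deligne_cochain2 X \<xi> \<and>
           has_cochain_derivative X (\<lambda>t. lag_Omega X Y h (F t) (continue_log X Y f L (F t)))
             (add_top (\<lambda>K z. 2 * of_real pi * \<i> * form_a X Y h f F K z) (total_D X \<xi>))"
      "has_derivative_mod_Z3 (\<lambda>t. action X Y h S0 S1 S2 (F t) (continue_log X Y f L (F t)))
          (2 * of_real pi * \<i> * surface_integral X (form_a X Y h f F))" by auto
  next
    fix i z
    assume crit: "\<forall>F. vertical_variation X Y f F \<longrightarrow>
         has_derivative_mod_Z3 (\<lambda>t. action X Y h S0 S1 S2 (F t) (continue_log X Y f L (F t))) 0"
      and iz: "i \<in> idx X" "z \<in> dom_of X [i]"
    show "D_op (h i) (beltrami (local_rep X Y f i)) z - pdb (h i) z = 0"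
    proof (rule ccontr)
      assume "D_op (h i) (beltrami (local_rep X Y f i)) z - pdb (h i) z \<noteq> 0"
      from st.el_variation[OF assms(2) iz this] obtain F where
        F: "vertical_variation X Y f F" "surface_integral X (form_a X Y h f F) \<noteq> 0" by blast
      \<comment> \<open>Criticality and the first variation formula give two derivatives of the same
        curve, which must coincide.\<close>
      have "2 * of_real pi * \<i> * surface_integral X (form_a X Y h f F) = 0"
        by (rule has_derivative_mod_Z3_unique[of "\<lambda>t. action X Y h S0 S1 S2 (F t) (continue_log X Y f L (F t))"])
           (use first[OF F(1)] crit F(1) in blast)+
      then show False using F(2) by simp
    qed
  next
    fix F
    assume el: "\<forall>i\<in>idx X. \<forall>z\<in>dom_of X [i]. D_op (h i) (beltrami (local_rep X Y f i)) z - pdb (h i) z = 0"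
      and F: "vertical_variation X Y f F"
    from first[OF F] show "has_derivative_mod_Z3 (\<lambda>t. action X Y h S0 S1 S2 (F t) (continue_log X Y f L (F t))) 0"
      unfolding zero[OF el] by simp
  qed
qed

end
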